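(* (i) Let $d\ge1$, $-2<s<d-2$, and let $\mathsf{g}$ be the Riesz/log potential $\mathsf{g}(x)=\frac1s|x|^{-s}$ if $s\neq0$, $\mathsf{g}(x)=-\log|x|$ if $s=0$. Then for all $2<a<d-s$ and $M>0$, there exist a $C^\infty$ vector field $v:\mathbb{R}^d\to\mathbb{R}^d$ and zero-mean Schwartz functions $f$ and $g$ such that $$\frac{\displaystyle\left|\int_{(\mathbb{R}^d)^2}(v(x)-v(y))\cdot\nabla\mathsf{g}(x-y)f(x)g(y)\,dx\,dy\right|}{\displaystyle\Big(\|\nabla v\|_{L^\infty}+\||\nabla|^{\frac a2}v\|_{L^{\frac{2d}{a-2}}}\Big)\|f\|_{\dot H^{\frac{s-d}{2}}}\|g\|_{\dot H^{\frac{s-d}{2}}}}\ge M .$$ (ii) Suppose that $\mathsf{g}$ is admissible and $\hat{\mathsf{g}}$ has super-polynomial decay. Then for any $n,M,t>0$, there exist a $C^\infty$ vector field $v$ and zero-mean Schwartz functions $f$ and $g$ such that $$\frac{\displaystyle\left|\int_{(\mathbb{R}^d)^2}(v(x)-v(y))\cdot\nabla\mathsf{g}(x-y)f(x)g(y)\,dx\,dy\right|}{\|\langle\nabla\rangle^nv\|_{L^1}\|f\|_{\mathsf{g}_t}\|g\|_{\mathsf{g}_t}}\ge M .$$ (iii) Suppose that $\mathsf{g}$ is admissible and for some $c,m>0$, $|\hat{\mathsf{g}}(\xi)|\lesssim e^{-c|\xi|^m}$. Let $t>0$. Then for any $b<\frac{ct^m}{2}$ and $M>0$, there exist a $C^\infty$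 vector field $v$ and zero-mean Schwartz functions $f,g$ such that $$\frac{\displaystyle\left|\int_{(\mathbb{R}^d)^2}(v(x)-v(y))\cdot\nabla\mathsf{g}(x-y)f(x)g(y)\,dx\,dy\right|}{\|e^{b|\nabla|^m}v\|_{L^1}\|f\|_{\mathsf{g}_t}\|g\|_{\mathsf{g}_t}}\ge M .$$
   Context: A potential $\mathsf{g}:\mathbb{R}^d\setminus\{0\}\to\mathbb{R}$ is admissible if $\mathsf{g}\in C^\infty(\mathbb{R}^d\setminus\{0\})$, $\mathsf{g}$ is radially symmetric, $\mathsf{g}$ is conditionally positive definite (i.e. $\int_{(\mathbb{R}^d)^2}\mathsf{g}(x-y)\,d\rho(x)d\rho(y)\ge0$ for every signed Borel measure $\rho$ of zero mass), and $\hat{\mathsf{g}}$ is nonincreasing as a function of $|\xi|$. Super-polynomial decay of $\hat{\mathsf{g}}$ means that for every $n\ge0$, $|\hat{\mathsf{g}}(\xi)|\lesssim_n|\xi|^{-n}$. The Fourier transform is $\hat f(\xi)=\int f(x)e^{-2\pi i\xi\cdot x}dx$. In (i), $|\nabla|$ has symbol $|2\pi\xi|$ and $\|f\|_{\dot H^a}=\||\nabla|^af\|_{L^2}$. In (ii), $\langle\nabla\rangle$ has symbol $(1+|2\pi\xi|^2)^{1/2}$. In (iii), $e^{b|\nabla|^m}v=\mathcal{F}^{-1}(e^{b|\xi|^m}\hat v(\xi))$. For $t>0$, $\mathsf{g}_t(x)=\mathsf{g}(x/t)$ and $\|f\|_{\mathsf{g}_t}^2=\int_{(\mathbb{R}^d)^2}\mathsf{g}((x-y)/t)f(x)f(y)\,dx\,dy$.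 Zero mean means integral zero.
   Formalization: In (ii) and (iii) the potential g is additionally assumed not to be constant on R^d∖{0}; for a constant g (e.g. g = 0) the numerator and the norms of f and g in the denominator vanish for all zero-mean functions, so the ratio is 0/0 and the claim fails. *)

theory Defs
  imports "HOL-Analysis.Analysis" "HOL-Probability.Essential_Supremum"
begin

section \<open>Smooth functions, Schwartz functions, test functions\<close>

primrec iter_partial ::
  "'a list \<Rightarrow> ('a::euclidean_space \<Rightarrow> 'b::real_normed_vector) \<Rightarrow> 'a \<Rightarrow> 'b" where
  "iter_partial [] f = f"
| "iter_partial (e # es) f = (\<lambda>x. frechet_derivative (iter_partial es f) (at x) e)"

text \<open>Meant for open \<open>S\<close>: every iterated partial derivative exists and is (totally) differentiable
  at every point of \<open>S\<close>.\<close>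

definition C_infinity_on ::
  "'a set \<Rightarrow> ('a::euclidean_space \<Rightarrow> 'b::real_normed_vector) \<Rightarrow> bool" where
  "C_infinity_on S f \<longleftrightarrow>
     (\<forall>es. set es \<subseteq> Basis \<longrightarrow> (\<forall>x\<in>S. iter_partial es f differentiable (at x)))"

definition schwartz :: "('a::euclidean_space \<Rightarrow> real) \<Rightarrow> bool" where
  "schwartz f \<longleftrightarrow> C_infinity_on UNIV f \<and>
     (\<forall>k es. set es \<subseteq> Basis \<longrightarrow> bounded (range (\<lambda>x. norm x ^ k * iter_partial es f x)))"

definition zero_mean_schwartz :: "('a::euclidean_space \<Rightarrow> real) \<Rightarrow> bool" where
  "zero_mean_schwartz f \<longleftrightarrow> schwartz f \<and> integral\<^sup>L lborel f = 0"

definition test_function :: "'a set \<Rightarrow> ('a::euclidean_space \<Rightarrow> real) \<Rightarrow> bool" where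
  "test_function U \<psi> \<longleftrightarrow> C_infinity_on UNIV \<psi> \<and>
     (\<exists>K. compact K \<and> K \<subseteq> U \<and> (\<forall>x. x \<notin> K \<longrightarrow> \<psi> x = 0))"

definition gradient :: "('a::euclidean_space \<Rightarrow> real) \<Rightarrow> 'a \<Rightarrow> 'a" where
  "gradient f x = (THE D. GDERIV f x :> D)"


section \<open>Lebesgue norms\<close>

definition in_Lp :: "real \<Rightarrow> ('a::euclidean_space \<Rightarrow> 'b::real_normed_vector) \<Rightarrow> bool" where
  "in_Lp p f \<longleftrightarrow> f \<in> borel_measurable lborel \<and> integrable lborel (\<lambda>x. norm (f x) powr p)"

definition Lp_norm :: "real \<Rightarrow> ('a::euclidean_space \<Rightarrow> 'b::real_normed_vector) \<Rightarrow> real" where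
  "Lp_norm p f = (\<integral>x. norm (f x) powr p \<partial>lborel) powr (1 / p)"

text \<open>The \<open>L\<^sup>\<infinity>\<close> size of \<open>\<nabla>v\<close>, measured in the operator norm of the Jacobian.\<close>

definition grad_esssup :: "('a::euclidean_space \<Rightarrow> 'a) \<Rightarrow> ereal" where
  "grad_esssup v = esssup lborel (\<lambda>x. ereal (onorm (frechet_derivative v (at x))))"


section \<open>Fourier transform and Fourier multipliers\<close>

definition fourier :: "('a::euclidean_space \<Rightarrow> complex) \<Rightarrow> 'a \<Rightarrow> complex" where
  "fourier f \<xi> = (\<integral>x. exp (- (2 * of_real pi * \<i> * of_real (\<xi> \<bullet> x))) * f x \<partial>lborel)"

definition inv_fourier :: "('a::euclidean_space \<Rightarrow> complex) \<Rightarrow> 'a \<Rightarrow> complex" where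
  "inv_fourier F x = (\<integral>\<xi>. exp (2 * of_real pi * \<i> * of_real (\<xi> \<bullet> x)) * F \<xi> \<partial>lborel)"

text \<open>Symbols of \<open>|\<nabla>|\<^sup>a\<close>, \<open>\<langle>\<nabla>\<rangle>\<^sup>n\<close> and \<open>exp (b |\<nabla>|\<^sup>m)\<close>; the last one carries no factor \<open>2\<pi>\<close>.\<close>

definition riesz_symbol :: "real \<Rightarrow> 'a::euclidean_space \<Rightarrow> real" where
  "riesz_symbol a \<xi> = norm ((2 * pi) *\<^sub>R \<xi>) powr a"

definition bessel_symbol :: "real \<Rightarrow> 'a::euclidean_space \<Rightarrow> real" where
  "bessel_symbol n \<xi> = ((1 + (norm ((2 * pi) *\<^sub>R \<xi>))\<^sup>2) powr (1 / 2)) powr n"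

definition exp_symbol :: "real \<Rightarrow> real \<Rightarrow> 'a::euclidean_space \<Rightarrow> real" where
  "exp_symbol b m \<xi> = exp (b * norm \<xi> powr m)"

text \<open>The homogeneous Sobolev norm \<open>\<parallel>|\<nabla>|\<^sup>a f\<parallel>\<close> in \<open>L\<^sup>2\<close>. For a zero-mean Schwartz function \<open>f\<close> and
  \<open>a > - 1 - d\<close> the function \<open>|2\<pi>\<xi>|\<^sup>a f\<^sup>^(\<xi>)\<close> is integrable, so the inversion integral is an
  absolutely convergent one.\<close>

definition hom_sobolev_norm :: "real \<Rightarrow> ('a::euclidean_space \<Rightarrow> real) \<Rightarrow> real" where
  "hom_sobolev_norm a f =
     Lp_norm 2 (inv_fourier (\<lambda>\<xi>. of_real (riesz_symbol a \<xi>) * fourier (\<lambda>x. of_real (f x)) \<xi>))"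

text \<open>\<open>w = \<sigma>(\<nabla>) v\<close> for vector fields that need not be integrable, i.e. \<open>w\<^sup>^ = \<sigma> v\<^sup>^\<close> in the sense of
  distributions. With \<open>\<langle>u\<^sup>^, \<psi>\<rangle> = \<langle>u, \<psi>\<^sup>^\<rangle>\<close> this says \<open>\<langle>w, \<psi>\<^sup>^\<rangle> = \<langle>v, (\<sigma>\<psi>)\<^sup>^\<rangle>\<close>. The test functions \<open>\<psi>\<close> live
  on the frequency side and have compact support, because \<open>\<sigma>\<close> may grow exponentially. Their support
  may contain the origin, so \<open>v\<close> determines \<open>w\<close> almost everywhere.\<close>

definition fourier_multiplier ::
  "('a::euclidean_space \<Rightarrow> real) \<Rightarrow> ('a \<Rightarrow> 'a) \<Rightarrow> ('a \<Rightarrow> 'a) \<Rightarrow> bool" where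
  "fourier_multiplier \<sigma> v w \<longleftrightarrow>
     (\<forall>\<psi>. test_function UNIV \<psi> \<longrightarrow> (\<forall>e\<in>Basis.
        integrable lborel (\<lambda>x. of_real (w x \<bullet> e) * fourier (\<lambda>\<xi>. of_real (\<psi> \<xi>)) x) \<and>
        integrable lborel (\<lambda>x. of_real (v x \<bullet> e) * fourier (\<lambda>\<xi>. of_real (\<sigma> \<xi> * \<psi> \<xi>)) x) \<and>
        (\<integral>x. of_real (w x \<bullet> e) * fourier (\<lambda>\<xi>. of_real (\<psi> \<xi>)) x \<partial>lborel) =
        (\<integral>x. of_real (v x \<bullet> e) * fourier (\<lambda>\<xi>. of_real (\<sigma> \<xi> * \<psi> \<xi>)) x \<partial>lborel)))"


section \<open>Potentials\<close>

text \<open>A potential lives on the punctured space; the value of the HOL function at \<open>0\<close> is never used.\<close>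

definition riesz_potential :: "real \<Rightarrow> 'a::euclidean_space \<Rightarrow> real" where
  "riesz_potential s x = (if s = 0 then - ln (norm x) else 1 / s * norm x powr (- s))"

definition radially_symmetric :: "('a::euclidean_space \<Rightarrow> real) \<Rightarrow> bool" where
  "radially_symmetric g \<longleftrightarrow> (\<forall>x y. x \<noteq> 0 \<and> y \<noteq> 0 \<and> norm x = norm y \<longrightarrow> g x = g y)"

text \<open>A signed Borel measure \<open>\<rho>\<close> of zero mass is a difference \<open>\<mu> - \<nu>\<close> of finite Borel measures of equal
  mass. The condition ranges over those for which the double integral is defined (absolutely
  convergent). On the diagonal \<open>g\<close> is given its limit at \<open>0\<close>; if \<open>g\<close> has no finite limit there,
  the diagonal has to be a null set, i.e. \<open>\<mu>\<close> and \<open>\<nu>\<close> must have no atoms.\<close>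

definition interaction ::
  "('a::euclidean_space \<Rightarrow> real) \<Rightarrow> 'a measure \<Rightarrow> 'a measure \<Rightarrow> real" where
  "interaction g \<mu> \<nu> = (\<integral>(x, y). g (x - y) \<partial>(\<mu> \<Otimes>\<^sub>M \<nu>))"

definition interaction_defined ::
  "('a::euclidean_space \<Rightarrow> real) \<Rightarrow> 'a measure \<Rightarrow> 'a measure \<Rightarrow> bool" where
  "interaction_defined g \<mu> \<nu> \<longleftrightarrow> integrable (\<mu> \<Otimes>\<^sub>M \<nu>) (\<lambda>(x, y). g (x - y))"

definition cond_positive_definite :: "('a::euclidean_space \<Rightarrow> real) \<Rightarrow> bool" where
  "cond_positive_definite g \<longleftrightarrow> (let g0 = g(0 := Lim (at 0) g) in
     \<forall>\<mu> \<nu>. finite_measure \<mu> \<and> sets \<mu> = sets borel \<and> finite_measure \<nu> \<and> sets \<nu> = sets borel \<and>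
       measure \<mu> UNIV = measure \<nu> UNIV \<and>
       ((\<exists>l. (g \<longlongrightarrow> l) (at 0)) \<or> (\<forall>x. measure \<mu> {x} = 0 \<and> measure \<nu> {x} = 0)) \<and>
       interaction_defined g0 \<mu> \<mu> \<and> interaction_defined g0 \<mu> \<nu> \<and>
       interaction_defined g0 \<nu> \<mu> \<and> interaction_defined g0 \<nu> \<nu>
       \<longrightarrow> 0 \<le> interaction g0 \<mu> \<mu> - interaction g0 \<mu> \<nu> - interaction g0 \<nu> \<mu> + interaction g0 \<nu> \<nu>)"

text \<open>\<open>g\<close> is a tempered distribution whose Fourier transform is given by the function \<open>G\<close> away from the
  origin. Nothing is required at the origin: the transforms of \<open>-log|x|\<close> and of \<open>-|x|\<^sup>r\<close> with
  \<open>0 < r < 2\<close> are not locally integrable functions there. In particular \<open>G\<close> determines \<open>g\<close> only up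
  to a polynomial.\<close>

definition has_fourier_transform ::
  "('a::euclidean_space \<Rightarrow> real) \<Rightarrow> ('a \<Rightarrow> real) \<Rightarrow> bool" where
  "has_fourier_transform g G \<longleftrightarrow>
     (\<exists>N::nat. integrable lborel (\<lambda>x. g x / (1 + norm x) ^ N)) \<and>
     (\<forall>\<psi>. test_function (UNIV - {0}) \<psi> \<longrightarrow>
        integrable lborel (\<lambda>\<xi>. G \<xi> * \<psi> \<xi>) \<and>
        (\<integral>x. of_real (g x) * fourier (\<lambda>\<xi>. of_real (\<psi> \<xi>)) x \<partial>lborel) =
          complex_of_real (\<integral>\<xi>. G \<xi> * \<psi> \<xi> \<partial>lborel))"

definition admissible :: "('a::euclidean_space \<Rightarrow> real) \<Rightarrow> ('a \<Rightarrow> real) \<Rightarrow> bool" where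
  "admissible g G \<longleftrightarrow>
     C_infinity_on (UNIV - {0}) g \<and> radially_symmetric g \<and> cond_positive_definite g \<and>
     has_fourier_transform g G \<and>
     (\<forall>\<xi> \<eta>. \<xi> \<noteq> 0 \<and> norm \<xi> \<le> norm \<eta> \<longrightarrow> G \<eta> \<le> G \<xi>)"

definition super_polynomial_decay :: "('a::euclidean_space \<Rightarrow> real) \<Rightarrow> bool" where
  "super_polynomial_decay G \<longleftrightarrow>
     (\<forall>n\<ge>0. \<exists>C. \<forall>\<xi>. \<xi> \<noteq> 0 \<longrightarrow> \<bar>G \<xi>\<bar> \<le> C * norm \<xi> powr (- n))"

definition exponential_decay :: "real \<Rightarrow> real \<Rightarrow> ('a::euclidean_space \<Rightarrow> real) \<Rightarrow> bool" where
  "exponential_decay c m G \<longleftrightarrow>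
     (\<exists>C. \<forall>\<xi>. \<xi> \<noteq> 0 \<longrightarrow> \<bar>G \<xi>\<bar> \<le> C * exp (- (c * norm \<xi> powr m)))"

text \<open>For constant \<open>g\<close> both sides of the commutator estimate vanish identically.\<close>

definition nonconstant_potential :: "('a::euclidean_space \<Rightarrow> real) \<Rightarrow> bool" where
  "nonconstant_potential g \<longleftrightarrow> (\<exists>x y. x \<noteq> 0 \<and> y \<noteq> 0 \<and> g x \<noteq> g y)"

definition dilate :: "real \<Rightarrow> ('a::euclidean_space \<Rightarrow> real) \<Rightarrow> 'a \<Rightarrow> real" where
  "dilate t g x = g (x /\<^sub>R t)"

definition potential_norm :: "('a::euclidean_space \<Rightarrow> real) \<Rightarrow> ('a \<Rightarrow> real) \<Rightarrow> real" where
  "potential_norm g f = sqrt (\<integral>(x, y). g (x - y) * f x * f y \<partial>(lborel \<Otimes>\<^sub>M lborel))"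

definition commutator_form ::
  "('a::euclidean_space \<Rightarrow> real) \<Rightarrow> ('a \<Rightarrow> 'a) \<Rightarrow> ('a \<Rightarrow> real) \<Rightarrow> ('a \<Rightarrow> real) \<Rightarrow> real" where
  "commutator_form g v f h =
     (\<integral>(x, y). ((v x - v y) \<bullet> gradient g (x - y)) * f x * h y \<partial>(lborel \<Otimes>\<^sub>M lborel))"

end

theory Submission
  imports Defs "HOL-Probability.Characteristic_Functions" "HOL-Probability.Sinc_Integral" "HOL-Real_Asymp.Real_Asymp"
begin

text \<open>The vector field is a wave packet \<open>v = V e\<close> whose transform is concentrated near \<open>\<plusminus>n e\<close>, the first
  function \<open>f\<close> is concentrated at the same frequency and the second function \<open>h\<close> is fixed. As
  \<open>n \<rightarrow> \<infinity>\<close> the term \<open>v(y)\<close> of the commutator disappears by the Riemann--Lebesgue lemma, while in the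
  term \<open>v(x)\<close> the product of the two oscillating factors has a nonzero mean, so the form divided by the
  amplitude of \<open>v\<close> converges to a multiple of \<open>\<integral>\<integral> F(x) (e \<bullet> \<nabla>g)(x - y) h(y) dx dy\<close> with an unmodulated
  profile \<open>F\<close>. If \<open>F\<close> is concentrated near \<open>0\<close>, a dipole \<open>h\<close> at \<open>\<plusminus>p\<close> makes this nonzero because \<open>\<nabla>g\<close> is odd.
  At frequency \<open>n\<close> the norm of \<open>f\<close> is so small that the product of the norms of \<open>v\<close> and \<open>f\<close> is negligible against the amplitude of \<open>v\<close>.\<close>

subsection \<open>Calculus of smooth functions\<close>

text \<open>The packet of \<open>v\<close> at frequency n has width n to the power -\<kappa>. It
  must shrink so that \<open>v\<close> tends locally to a pure cosine and the symbol is almost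
  constant on the packet; but then the multiplier image \<open>w\<close> spreads in space and its
  L^p norm grows like n to the power \<kappa> d / p. So \<kappa> must exceed the growth exponent of
  the logarithmic derivative of the symbol, and this power of n must be affordable. For rapidly
  decaying transforms every power is; there b < c t^m / 2 compares exp (b n^m), the size of the
  symbol, with the square root of the transform at t n. In the Riesz case powers compete: the small
  norm of \<open>f\<close> against the symbol gives the exponent (s - d + a) / 2, negative because a
  < d - s, and \<kappa> is so small that spreading consumes only half of it. The gradient of
  \<open>v\<close> costs n^(1 - a/2), harmless because a > 2. A second obstacle: a quotient with
  denominator 0 is 0 in HOL, so every norm in a denominator must be shown to be positive. Hence
  positivity accompanies each upper bound, and functions of zero energy are perturbed.\<close>

abbreviation pd :: "'a \<Rightarrow> ('a::euclidean_space \<Rightarrow> 'b::real_normed_vector) \<Rightarrow> 'a \<Rightarrow> 'b" where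
  "pd e f \<equiv> (\<lambda>x. frechet_derivative f (at x) e)"

lemma pd_eqI: "(f has_derivative f') (at x) \<Longrightarrow> pd e f x = f' e"
  using frechet_derivative_at by metis

text \<open>\<open>frechet_derivative\<close> is a choice from the set of all derivatives, so
  functions with the same set share the chosen value, even at points where no derivative
  exists.\<close>

lemma pd_cong_open:
  assumes "open S" "x \<in> S" "\<And>y. y \<in> S \<Longrightarrow> f y = g y"
  shows "pd e f x = pd e g x"
proof -
  have "(f has_derivative D) (at x) \<longleftrightarrow> (g has_derivative D) (at x)" for D
    using has_derivative_transform_within_open[OF _ assms(1,2), of f D UNIV g]
      has_derivative_transform_within_open[OF _ assms(1,2), of g D UNIV f] assms(3) by auto
  then show ?thesis unfolding frechet_derivative_def by simp
qed

lemma differentiable_cong_open: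
  assumes "open S" "x \<in> S" "\<And>y. y \<in> S \<Longrightarrow> f y = g y"
  shows "f differentiable (at x) \<longleftrightarrow> g differentiable (at x)"
  using has_derivative_transform_within_open[OF _ assms(1,2), of f _ UNIV g]
    has_derivative_transform_within_open[OF _ assms(1,2), of g _ UNIV f] assms(3)
  unfolding differentiable_def by auto

lemma iter_partial_snoc: "iter_partial (es @ [e]) f = iter_partial es (pd e f)"
  by (induction es) auto

text \<open>In \<open>iter_partial\<close> the head of the list is the last derivative taken.
  Peeling the list from the back removes the first derivative, which gives the recursive form that
  \<open>Ck_on\<close> mirrors.\<close>

lemma C_infinity_on_unfold:
  "C_infinity_on S f \<longleftrightarrow>
     (\<forall>x\<in>S. f differentiable (at x)) \<and> (\<forall>e\<in>Basis. C_infinity_on S (pd e f))"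
proof (intro iffI conjI ballI)
  assume f: "C_infinity_on S f"
  fix x assume "x \<in> S" then show "f differentiable (at x)"
    using f[unfolded C_infinity_on_def, rule_format, of "[]"] by simp
next
  fix e :: 'a
  assume f: "C_infinity_on S f" and e: "e \<in> Basis"
  show "C_infinity_on S (pd e f)"
    unfolding C_infinity_on_def
    using f[unfolded C_infinity_on_def, rule_format, of "_ @ [e]"] e
    by (simp add: iter_partial_snoc)
next
  assume *: "(\<forall>x\<in>S. f differentiable (at x)) \<and> (\<forall>e\<in>Basis. C_infinity_on S (pd e f))"
  show "C_infinity_on S f"
    unfolding C_infinity_on_def
  proof (intro allI impI)
    fix es :: "'a list" assume es: "set es \<subseteq> Basis"
    show "\<forall>x\<in>S. iter_partial es f differentiable at x"
    proof (cases es rule: rev_cases)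
      case (snoc es' e)
      then show ?thesis using * es by (auto simp: iter_partial_snoc C_infinity_on_def)
    qed (use * in auto)
  qed
qed

lemma C_infinity_onD: "C_infinity_on S f \<Longrightarrow> x \<in> S \<Longrightarrow> f differentiable (at x)"
  and C_infinity_on_pd: "C_infinity_on S f \<Longrightarrow> e \<in> Basis \<Longrightarrow> C_infinity_on S (pd e f)"
  using C_infinity_on_unfold by blast+

lemma C_infinity_on_continuous: "C_infinity_on S f \<Longrightarrow> continuous_on S f"
  by (meson C_infinity_onD continuous_at_imp_continuous_on differentiable_imp_continuous_within)

lemma C_infinity_on_Un: "C_infinity_on S f \<Longrightarrow> C_infinity_on T f \<Longrightarrow> C_infinity_on (S \<union> T) f"
  by (auto simp: C_infinity_on_def)

lemma C_infinity_on_subset: "C_infinity_on S f \<Longrightarrow> T \<subseteq> S \<Longrightarrow> C_infinity_on T f"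
  by (auto simp: C_infinity_on_def)

text \<open>Smoothness cut off at a finite order, to have something to induct on: the derivative of
  a product or a composition is a sum of terms of the same shape, with one order less to
  check.\<close>

primrec Ck_on :: "nat \<Rightarrow> 'a set \<Rightarrow> ('a::euclidean_space \<Rightarrow> 'b::real_normed_vector) \<Rightarrow> bool" where
  "Ck_on 0 S f = True"
| "Ck_on (Suc n) S f = ((\<forall>x\<in>S. f differentiable (at x)) \<and> (\<forall>e\<in>Basis. Ck_on n S (pd e f)))"

lemma C_infinity_on_iff_Ck_on: "C_infinity_on S f \<longleftrightarrow> (\<forall>n. Ck_on n S f)"
proof
  assume "C_infinity_on S f"
  then have "Ck_on n S f" for n
    by (induction n arbitrary: f) (auto dest: C_infinity_onD C_infinity_on_pd)
  then show "\<forall>n. Ck_on n S f" by blast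
next
  assume *: "\<forall>n. Ck_on n S f"
  have "Ck_on (Suc (length es)) S f \<Longrightarrow> set es \<subseteq> Basis \<Longrightarrow>
      \<forall>x\<in>S. iter_partial es f differentiable (at x)" for es
    by (induction es arbitrary: f rule: rev_induct) (auto simp: iter_partial_snoc)
  with * show "C_infinity_on S f" unfolding C_infinity_on_def by blast
qed

lemma Ck_on_cong:
  assumes "open S" "\<And>y. y \<in> S \<Longrightarrow> f y = g y"
  shows "Ck_on n S f \<longleftrightarrow> Ck_on n S g"
  using assms(2)
proof (induction n arbitrary: f g)
  case (Suc n)
  have "Ck_on n S (pd e f) \<longleftrightarrow> Ck_on n S (pd e g)" for e
    by (rule Suc.IH) (rule pd_cong_open[OF assms(1)], use Suc.prems in auto)
  moreover have "f differentiable (at x) \<longleftrightarrow> g differentiable (at x)" if "x \<in> S" for x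
    by (rule differentiable_cong_open[OF assms(1) that Suc.prems])
  ultimately show ?case by simp
qed simp

lemma C_infinity_on_cong:
  assumes "open S" "\<And>y. y \<in> S \<Longrightarrow> f y = g y"
  shows "C_infinity_on S f \<longleftrightarrow> C_infinity_on S g"
  unfolding C_infinity_on_iff_Ck_on using Ck_on_cong[OF assms] by simp

lemma Ck_on_SucD: "Ck_on (Suc n) S f \<Longrightarrow> Ck_on n S f"
  by (induction n arbitrary: f) auto

lemma Ck_on_const: "Ck_on n S (\<lambda>x. c)"
proof (induction n arbitrary: c)
  case (Suc n)
  have "pd e (\<lambda>x. c) = (\<lambda>x. 0)" for e :: 'a by auto
  then show ?case using Suc by simp
qed simp

lemma Ck_on_add:
  assumes "open S" "Ck_on n S f" "Ck_on n S g"
  shows "Ck_on n S (\<lambda>x. f x + g x)"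
  using assms(2,3)
proof (induction n arbitrary: f g)
  case (Suc n)
  have "Ck_on n S (pd e (\<lambda>x. f x + g x))" if e: "e \<in> Basis" for e
  proof (subst Ck_on_cong[OF assms(1)])
    show "pd e (\<lambda>x. f x + g x) x = pd e f x + pd e g x" if "x \<in> S" for x
      using Suc.prems that
      by (intro pd_eqI[where f' = "\<lambda>h. frechet_derivative f (at x) h + frechet_derivative g (at x) h"])
        (auto simp: frechet_derivative_works intro: has_derivative_add)
    show "Ck_on n S (\<lambda>x. pd e f x + pd e g x)"
      using Suc e by auto
  qed
  then show ?case using Suc.prems by auto
qed simp

lemma Ck_on_mult:
  fixes f g :: "'a::euclidean_space \<Rightarrow> real"
  assumes "open S" "Ck_on n S f" "Ck_on n S g"
  shows "Ck_on n S (\<lambda>x. f x * g x)"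
  using assms(2,3)
proof (induction n arbitrary: f g)
  case (Suc n)
  have "Ck_on n S (pd e (\<lambda>x. f x * g x))" if e: "e \<in> Basis" for e
  proof (subst Ck_on_cong[OF assms(1)])
    show "pd e (\<lambda>x. f x * g x) x = f x * pd e g x + pd e f x * g x" if "x \<in> S" for x
      using Suc.prems that
      by (intro pd_eqI[where f' = "\<lambda>h. f x * frechet_derivative g (at x) h
            + frechet_derivative f (at x) h * g x"])
        (auto simp: frechet_derivative_works intro: has_derivative_mult)
    show "Ck_on n S (\<lambda>x. f x * pd e g x + pd e f x * g x)"
      using Suc.prems e Ck_on_SucD[OF Suc.prems(1)] Ck_on_SucD[OF Suc.prems(2)]
      by (intro Ck_on_add Suc.IH assms(1)) auto
  qed
  then show ?case using Suc.prems by auto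
qed simp

lemma Ck_on_bounded_linear:
  assumes "open S" "bounded_linear L" "Ck_on n S f"
  shows "Ck_on n S (\<lambda>x. L (f x))"
  using assms(3)
proof (induction n arbitrary: f)
  case (Suc n)
  have der: "((\<lambda>x. L (f x)) has_derivative (\<lambda>h. L (frechet_derivative f (at x) h))) (at x)"
    if "x \<in> S" for x
    using Suc.prems that
    by (intro bounded_linear.has_derivative[OF assms(2)]) (auto simp: frechet_derivative_works)
  have "Ck_on n S (pd e (\<lambda>x. L (f x)))" if e: "e \<in> Basis" for e
  proof (subst Ck_on_cong[OF assms(1)])
    show "pd e (\<lambda>x. L (f x)) x = L (pd e f x)" if "x \<in> S" for x
      using pd_eqI[OF der[OF that]] by simp
    show "Ck_on n S (\<lambda>x. L (pd e f x))"
      using Suc e by auto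
  qed
  then show ?case using Suc.prems der by (auto simp: differentiable_def)
qed simp

text \<open>The outer function comes with the whole sequence of its derivatives. Differentiating
  \<open>\<phi> k (f x)\<close> produces \<open>\<phi> (Suc k) (f x)\<close> times a partial of
  \<open>f\<close>, so an induction over n that generalises k closes.\<close>

lemma Ck_on_compose_real:
  fixes f :: "'a::euclidean_space \<Rightarrow> real" and \<phi> :: "nat \<Rightarrow> real \<Rightarrow> real"
  assumes "open S" and \<phi>: "\<And>k y. y \<in> T \<Longrightarrow> (\<phi> k has_real_derivative \<phi> (Suc k) y) (at y)"
    and fT: "f ` S \<subseteq> T" and "Ck_on n S f"
  shows "Ck_on n S (\<lambda>x. \<phi> k (f x))"
  using assms(4)
proof (induction n arbitrary: k)
  case (Suc n)
  have der: "((\<lambda>x. \<phi> k (f x)) has_derivative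
      (\<lambda>h. \<phi> (Suc k) (f x) * frechet_derivative f (at x) h)) (at x)"
    if "x \<in> S" for x
  proof -
    have "(f has_derivative frechet_derivative f (at x)) (at x)"
      using Suc.prems that by (auto simp: frechet_derivative_works)
    moreover have "(\<phi> k has_derivative (\<lambda>h. \<phi> (Suc k) (f x) * h)) (at (f x))"
      using \<phi>[of "f x" k] fT that by (auto simp: has_field_derivative_def)
    ultimately show ?thesis
      by (rule has_derivative_compose)
  qed
  have "Ck_on n S (pd e (\<lambda>x. \<phi> k (f x)))" if e: "e \<in> Basis" for e
  proof (subst Ck_on_cong[OF assms(1)])
    show "pd e (\<lambda>x. \<phi> k (f x)) x = \<phi> (Suc k) (f x) * pd e f x" if "x \<in> S" for x
      using pd_eqI[OF der[OF that]] by simp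
    show "Ck_on n S (\<lambda>x. \<phi> (Suc k) (f x) * pd e f x)"
      using Suc.prems e Ck_on_SucD[OF Suc.prems(1)] by (intro Ck_on_mult assms(1) Suc.IH) auto
  qed
  then show ?case using Suc.prems der by (auto simp: differentiable_def)
qed simp

lemma C_infinity_on_const [simp]: "C_infinity_on S (\<lambda>x. c)"
  by (simp add: C_infinity_on_iff_Ck_on Ck_on_const)

lemma C_infinity_on_add:
  "open S \<Longrightarrow> C_infinity_on S f \<Longrightarrow> C_infinity_on S g \<Longrightarrow> C_infinity_on S (\<lambda>x. f x + g x)"
  unfolding C_infinity_on_iff_Ck_on by (intro allI Ck_on_add) auto

lemma C_infinity_on_mult:
  fixes f g :: "'a::euclidean_space \<Rightarrow> real"
  shows "open S \<Longrightarrow> C_infinity_on S f \<Longrightarrow> C_infinity_on S g \<Longrightarrow> C_infinity_on S (\<lambda>x. f x * g x)"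
  unfolding C_infinity_on_iff_Ck_on by (intro allI Ck_on_mult) auto

lemma C_infinity_on_bounded_linear:
  "open S \<Longrightarrow> bounded_linear L \<Longrightarrow> C_infinity_on S f \<Longrightarrow> C_infinity_on S (\<lambda>x. L (f x))"
  unfolding C_infinity_on_iff_Ck_on by (rule allI, rule Ck_on_bounded_linear) auto

lemma C_infinity_on_compose_real:
  fixes f :: "'a::euclidean_space \<Rightarrow> real" and \<phi> :: "nat \<Rightarrow> real \<Rightarrow> real"
  assumes "open S" "\<And>k y. y \<in> T \<Longrightarrow> (\<phi> k has_real_derivative \<phi> (Suc k) y) (at y)"
    "f ` S \<subseteq> T" "C_infinity_on S f"
  shows "C_infinity_on S (\<lambda>x. \<phi> k (f x))"
proof -
  have "Ck_on n S (\<lambda>x. \<phi> k (f x))" for n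
    by (rule Ck_on_compose_real[where \<phi> = \<phi> and T = T])
      (use assms in \<open>auto simp: C_infinity_on_iff_Ck_on\<close>)
  then show ?thesis by (simp add: C_infinity_on_iff_Ck_on)
qed

lemma C_infinity_on_diff:
  assumes "open S" "C_infinity_on S f" "C_infinity_on S g"
  shows "C_infinity_on S (\<lambda>x. f x - g x)"
proof -
  have "C_infinity_on S (\<lambda>x. - g x)"
    by (rule C_infinity_on_bounded_linear[OF assms(1) bounded_linear_minus[OF bounded_linear_ident] assms(3)])
  from C_infinity_on_add[OF assms(1,2) this] show ?thesis by simp
qed

lemma C_infinity_on_sum:
  assumes "open S" "\<And>i. i \<in> I \<Longrightarrow> C_infinity_on S (f i)"
  shows "C_infinity_on S (\<lambda>x. \<Sum>i\<in>I. f i x)"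
proof (cases "finite I")
  case True
  then show ?thesis
    using assms(2) by (induction I rule: finite_induct) (auto intro!: C_infinity_on_add assms(1))
qed simp

lemma C_infinity_on_linear:
  assumes "bounded_linear L"
  shows "C_infinity_on S L"
proof -
  have "pd e L = (\<lambda>x. L e)" for e
    using pd_eqI[OF bounded_linear_imp_has_derivative[OF assms]] by blast
  moreover have "L differentiable (at x)" for x
    using bounded_linear_imp_has_derivative[OF assms] differentiable_def by blast
  ultimately show ?thesis by (subst C_infinity_on_unfold) simp
qed

lemma C_infinity_on_inner_left: "C_infinity_on S (\<lambda>x. x \<bullet> e)"
  by (rule C_infinity_on_linear) (rule bounded_linear_inner_left)

lemma C_infinity_on_norm_sq: "C_infinity_on S (\<lambda>x::'a::euclidean_space. (norm (x - c))\<^sup>2)"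
proof -
  have "(norm (x - c))\<^sup>2 = (\<Sum>b\<in>Basis. (x \<bullet> b - c \<bullet> b) * (x \<bullet> b - c \<bullet> b))" for x :: 'a
    unfolding power2_norm_eq_inner by (subst euclidean_inner) (simp add: inner_diff_left)
  moreover have "C_infinity_on UNIV (\<lambda>x::'a. \<Sum>b\<in>Basis. (x \<bullet> b - c \<bullet> b) * (x \<bullet> b - c \<bullet> b))"
    by (intro C_infinity_on_sum C_infinity_on_mult C_infinity_on_diff C_infinity_on_inner_left) auto
  ultimately show ?thesis using C_infinity_on_subset[OF _ subset_UNIV] by simp
qed

lemma C_infinity_on_exp:
  fixes f :: "'a::euclidean_space \<Rightarrow> real"
  assumes "open S" "C_infinity_on S f"
  shows "C_infinity_on S (\<lambda>x. exp (f x))"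
  by (rule C_infinity_on_compose_real[where T = UNIV and \<phi> = "\<lambda>_. exp"]) (auto intro: assms DERIV_exp)

lemma C_infinity_on_sin_cos:
  fixes f :: "'a::euclidean_space \<Rightarrow> real"
  assumes "open S" "C_infinity_on S f"
  shows "C_infinity_on S (\<lambda>x. sin (f x))" "C_infinity_on S (\<lambda>x. cos (f x))"
proof -
  \<comment> \<open>A phase shift by a quarter period differentiates the sine, so one sequence
    serves both sine (k = 0) and cosine (k = 1).\<close>
  define \<phi> :: "nat \<Rightarrow> real \<Rightarrow> real" where "\<phi> k y = sin (y + of_nat k * (pi/2))" for k y
  have *: "C_infinity_on S (\<lambda>x. \<phi> k (f x))" for k
  proof (rule C_infinity_on_compose_real[where T = UNIV and \<phi> = \<phi>])
    fix k y
    have "cos (y + of_nat k * (pi/2)) = sin (y + of_nat k * (pi/2) + pi/2)"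
      by (simp add: sin_add)
    also have "y + of_nat k * (pi/2) + pi/2 = y + of_nat (Suc k) * (pi/2)"
      by (simp add: field_simps)
    finally have "cos (y + of_nat k * (pi/2)) = sin (y + of_nat (Suc k) * (pi/2))" .
    then show "(\<phi> k has_real_derivative \<phi> (Suc k) y) (at y)"
      unfolding \<phi>_def by (auto intro!: derivative_eq_intros simp del: of_nat_Suc)
  qed (use assms in auto)
  show "C_infinity_on S (\<lambda>x. sin (f x))" using *[of 0] by (simp add: \<phi>_def)
  show "C_infinity_on S (\<lambda>x. cos (f x))" using *[of 1] by (simp add: \<phi>_def sin_add)
qed

lemma C_infinity_on_powr:
  fixes f :: "'a::euclidean_space \<Rightarrow> real"
  assumes "open S" "C_infinity_on S f" "\<And>x. x \<in> S \<Longrightarrow> f x > 0"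
  shows "C_infinity_on S (\<lambda>x. f x powr p)"
proof -
  define \<phi> :: "nat \<Rightarrow> real \<Rightarrow> real" where "\<phi> k y = (\<Prod>i<k. p - real i) * y powr (p - real k)" for k y
  have "C_infinity_on S (\<lambda>x. \<phi> 0 (f x))"
  proof (rule C_infinity_on_compose_real[where T = "{0<..}" and \<phi> = \<phi>])
    fix k and y :: real assume "y \<in> {0<..}"
    then show "(\<phi> k has_real_derivative \<phi> (Suc k) y) (at y)"
      unfolding \<phi>_def by (auto intro!: derivative_eq_intros simp: algebra_simps)
  qed (use assms in auto)
  then show ?thesis by (simp add: \<phi>_def)
qed

lemma C_infinity_on_inverse:
  fixes f :: "'a::euclidean_space \<Rightarrow> real"
  assumes "open S" "C_infinity_on S f" "\<And>x. x \<in> S \<Longrightarrow> f x > 0"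
  shows "C_infinity_on S (\<lambda>x. inverse (f x))"
  using C_infinity_on_powr[OF assms, of "-1"] C_infinity_on_cong[OF assms(1), of "\<lambda>x. f x powr -1" "\<lambda>x. inverse (f x)"]
    assms(3) by (force simp: powr_minus)


subsection \<open>Bump functions\<close>

text \<open>With u = 1/t, the t-derivative of P(u) exp(-u) is u^2 (P - P')(u) exp(-u). The
  polynomials in the successive derivatives of exp(-1/t) obey this recursion.\<close>

primrec flat_poly :: "nat \<Rightarrow> real poly" where
  "flat_poly 0 = 1"
| "flat_poly (Suc k) = [:0, 0, 1:] * (flat_poly k - pderiv (flat_poly k))"

definition flat :: "nat \<Rightarrow> real \<Rightarrow> real" where
  "flat k t = (if t > 0 then poly (flat_poly k) (1 / t) * exp (- (1 / t)) else 0)"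

lemma poly_times_exp_minus_tendsto_0: "((\<lambda>u. poly p u * exp (- u)) \<longlongrightarrow> (0::real)) at_top"
proof -
  have "((\<lambda>u. \<Sum>i\<le>degree p. coeff p i * (u ^ i / exp u)) \<longlongrightarrow> (\<Sum>i\<le>degree p. coeff p i * 0)) at_top"
    by (intro tendsto_sum tendsto_mult tendsto_const tendsto_power_div_exp_0)
  then show ?thesis
    by (simp add: poly_altdef sum_distrib_right sum_divide_distrib exp_minus field_simps)
qed

lemma flat_DERIV: "(flat k has_real_derivative flat (Suc k) t) (at t)"
proof -
  consider "t > 0" | "t < 0" | "t = 0" by linarith
  then show ?thesis
  proof cases
    case 1
    have "((\<lambda>t. poly (flat_poly k) (1 / t) * exp (- (1 / t))) has_real_derivative flat (Suc k) t) (at t)"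
      using 1 by (auto intro!: derivative_eq_intros DERIV_compose_FDERIV[OF poly_DERIV]
          simp: flat_def field_simps power2_eq_square)
    moreover have "\<forall>\<^sub>F y in nhds t. flat k y = poly (flat_poly k) (1 / y) * exp (- (1 / y))"
      using eventually_nhds_in_open[of "{0<..}" t] 1 by (auto elim!: eventually_mono simp: flat_def)
    ultimately show ?thesis by (subst DERIV_cong_ev[OF refl _ refl]) auto
  next
    case 2
    have "\<forall>\<^sub>F y in nhds t. flat k y = 0"
      using eventually_nhds_in_open[of "{..<0}" t] 2 by (auto elim!: eventually_mono simp: flat_def)
    then show ?thesis using 2 by (subst DERIV_cong_ev[OF refl _ refl]) (auto simp: flat_def)
  next
    case 3
    \<comment> \<open>The factor \<open>[:0,1:]\<close> is the 1/t of the difference quotient at 0,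
      absorbed into the polynomial.\<close>
    have "((\<lambda>t. poly ([:0,1:] * flat_poly k) (inverse t) * exp (- (inverse t))) \<longlongrightarrow> 0) (at_right (0::real))"
      by (rule filterlim_compose[OF poly_times_exp_minus_tendsto_0 filterlim_inverse_at_top_right])
    then have r: "((\<lambda>t. flat k t / t) \<longlongrightarrow> 0) (at_right 0)"
      by (rule Lim_transform_eventually)
        (auto simp: eventually_at_right_field flat_def field_simps intro!: exI[of _ 1])
    have l: "((\<lambda>t. flat k t / t) \<longlongrightarrow> 0) (at_left 0)"
      by (rule tendsto_eventually) (auto simp: eventually_at_left_field flat_def intro!: exI[of _ "-1"])
    have "((\<lambda>t. flat k t / t) \<longlongrightarrow> 0) (at 0)"
      using l r by (simp add: filterlim_at_split)
    then show ?thesis using 3 by (simp add: DERIV_def flat_def)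
  qed
qed

text \<open>The argument will be a squared relative distance, so the thresholds 1/4 and 1 stand for
  half the radius and the full radius.\<close>

definition step_down :: "real \<Rightarrow> real" where
  "step_down t = flat 0 (1 - t) / (flat 0 (1 - t) + flat 0 (t - 1/4))"

lemma flat_0_nonneg: "flat 0 t \<ge> 0" and flat_0_pos: "t > 0 \<Longrightarrow> flat 0 t > 0"
  and flat_nonpos: "t \<le> 0 \<Longrightarrow> flat k t = 0"
  by (auto simp: flat_def)

lemma step_down_denom_pos: "flat 0 (1 - t) + flat 0 (t - 1/4) > 0"
proof (cases "t < 1")
  case True
  then show ?thesis using flat_0_pos[of "1 - t"] flat_0_nonneg[of "t - 1/4"] by linarith
next
  case False
  then show ?thesis using flat_0_pos[of "t - 1/4"] flat_0_nonneg[of "1 - t"] by linarith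
qed

lemma step_down_nonneg: "0 \<le> step_down t" and step_down_le_1: "step_down t \<le> 1"
  and step_down_eq_1: "t \<le> 1/4 \<Longrightarrow> step_down t = 1" and step_down_eq_0: "t \<ge> 1 \<Longrightarrow> step_down t = 0"
  using step_down_denom_pos[of t] flat_0_nonneg[of "1 - t"] flat_0_nonneg[of "t - 1/4"]
  by (auto simp: step_down_def flat_nonpos divide_simps)

lemma C_infinity_on_step_down:
  fixes f :: "'a::euclidean_space \<Rightarrow> real"
  assumes "open S" "C_infinity_on S f"
  shows "C_infinity_on S (\<lambda>x. step_down (f x))"
proof -
  have *: "C_infinity_on S (\<lambda>x. flat 0 (h x))" if "C_infinity_on S h" for h :: "'a \<Rightarrow> real"
    by (rule C_infinity_on_compose_real[where T = UNIV and \<phi> = flat])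
      (use that assms(1) flat_DERIV in auto)
  have "C_infinity_on S (\<lambda>x. flat 0 (1 - f x))" "C_infinity_on S (\<lambda>x. flat 0 (f x - 1/4))"
    by (intro * C_infinity_on_diff assms C_infinity_on_const)+
  moreover have "step_down t = flat 0 (1 - t) * inverse (flat 0 (1 - t) + flat 0 (t - 1/4))" for t
    unfolding step_down_def by (rule divide_inverse)
  ultimately show ?thesis
    by (simp only:) (rule C_infinity_on_mult, rule assms(1), assumption,
      rule C_infinity_on_inverse, rule assms(1), rule C_infinity_on_add, rule assms(1),
      assumption, assumption, rule step_down_denom_pos)
qed

text \<open>The squared distance, unlike the distance, is smooth at the centre.\<close>

definition bump :: "'a::euclidean_space \<Rightarrow> real \<Rightarrow> 'a \<Rightarrow> real" where
  "bump c r \<xi> = step_down ((norm (\<xi> - c))\<^sup>2 * (1 / r\<^sup>2))"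

lemma C_infinity_on_bump: "C_infinity_on UNIV (bump c r)"
  unfolding bump_def
  by (intro C_infinity_on_step_down C_infinity_on_mult C_infinity_on_norm_sq) auto

lemma bump_nonneg: "0 \<le> bump c r \<xi>" and bump_le_1: "bump c r \<xi> \<le> 1"
  by (auto simp: bump_def step_down_nonneg step_down_le_1)

lemma bump_eq_0: "r > 0 \<Longrightarrow> norm (\<xi> - c) \<ge> r \<Longrightarrow> bump c r \<xi> = 0"
  unfolding bump_def by (rule step_down_eq_0) (simp add: field_simps power_mono)

lemma bump_eq_1:
  assumes "r > 0" "norm (\<xi> - c) \<le> r / 2" shows "bump c r \<xi> = 1"
proof -
  have "(norm (\<xi> - c))\<^sup>2 \<le> (r/2)\<^sup>2" using assms by (intro power_mono) auto
  then show ?thesis unfolding bump_def using assms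
    by (intro step_down_eq_1) (simp add: field_simps power2_eq_square)
qed

lemma bump_scale: "r > 0 \<Longrightarrow> s > 0 \<Longrightarrow> bump (s *\<^sub>R c) (s * r) (s *\<^sub>R \<xi>) = bump c r \<xi>"
  by (simp add: bump_def scaleR_diff_right[symmetric] power_mult_distrib)

lemma bump_uminus: "bump (- c) r (- \<xi>) = bump c r \<xi>"
  by (simp add: bump_def norm_minus_commute)


subsection \<open>Lebesgue integration on Euclidean space\<close>

lemma lborel_affine_integrable:
  fixes f :: "'a::euclidean_space \<Rightarrow> 'b::{banach, second_countable_topology}"
  assumes "integrable lborel f" "c \<noteq> 0"
  shows "integrable lborel (\<lambda>x. f (t + c *\<^sub>R x))"
proof -
  have f[measurable]: "f \<in> borel_measurable borel" using assms(1) by auto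
  have "integrable (density (distr lborel borel (\<lambda>x. t + c *\<^sub>R x)) (\<lambda>_. ennreal (\<bar>c\<bar>^DIM('a)))) f"
    using assms lborel_affine[OF assms(2), of t] by simp
  then have "integrable lborel (\<lambda>x. \<bar>c\<bar>^DIM('a) *\<^sub>R f (t + c *\<^sub>R x))"
    by (subst (asm) integrable_density; simp add: integrable_distr_eq)
  from integrable_scaleR_right[OF this, of "1 / \<bar>c\<bar>^DIM('a)"] show ?thesis using assms(2) by simp
qed

lemma lborel_affine_integral:
  fixes f :: "'a::euclidean_space \<Rightarrow> 'b::{banach, second_countable_topology}"
  assumes [measurable]: "f \<in> borel_measurable borel" and "c \<noteq> 0"
  shows "(\<integral>x. f x \<partial>lborel) = \<bar>c\<bar>^DIM('a) *\<^sub>R (\<integral>x. f (t + c *\<^sub>R x) \<partial>lborel)"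
proof -
  have "(\<integral>x. f x \<partial>lborel) = (\<integral>x. f x \<partial>density (distr lborel borel (\<lambda>x. t + c *\<^sub>R x)) (\<lambda>_. ennreal (\<bar>c\<bar>^DIM('a))))"
    using lborel_affine[OF assms(2), of t] by simp
  also have "\<dots> = \<bar>c\<bar>^DIM('a) *\<^sub>R (\<integral>x. f (t + c *\<^sub>R x) \<partial>lborel)"
    by (subst integral_density; simp add: integral_distr)
  finally show ?thesis .
qed

lemma integrable_translate:
  fixes f :: "'a::euclidean_space \<Rightarrow> 'b::{banach, second_countable_topology}"
  shows "integrable lborel f \<Longrightarrow> integrable lborel (\<lambda>x. f (x + t))"
  using lborel_affine_integrable[of f 1 t] by (simp add: add.commute)

lemma integral_translate:
  fixes f :: "'a::euclidean_space \<Rightarrow> 'b::{banach, second_countable_topology}"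
  shows "f \<in> borel_measurable borel \<Longrightarrow> (\<integral>x. f (x + t) \<partial>lborel) = (\<integral>x. f x \<partial>lborel)"
  using lborel_affine_integral[of f 1 t] by (simp add: add.commute)

lemma integral_reflect:
  fixes f :: "'a::euclidean_space \<Rightarrow> 'b::{banach, second_countable_topology}"
  shows "f \<in> borel_measurable borel \<Longrightarrow> (\<integral>x. f (- x) \<partial>lborel) = (\<integral>x. f x \<partial>lborel)"
  using lborel_affine_integral[of f "-1" 0] by simp

lemma nn_integral_translate:
  fixes f :: "'a::euclidean_space \<Rightarrow> ennreal"
  assumes [measurable]: "f \<in> borel_measurable borel"
  shows "(\<integral>\<^sup>+x. f (x + t) \<partial>lborel) = (\<integral>\<^sup>+x. f x \<partial>lborel)"
proof -
  have "(\<integral>\<^sup>+x. f x \<partial>lborel) = (\<integral>\<^sup>+x. f x \<partial>density (distr lborel borel (\<lambda>x. t + 1 *\<^sub>R x)) (\<lambda>_. ennreal (\<bar>1\<bar>^DIM('a))))"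
    using lborel_affine[of 1 t] by simp
  also have "\<dots> = (\<integral>\<^sup>+x. f (x + t) \<partial>lborel)"
    by (subst nn_integral_density; simp add: nn_integral_distr add.commute)
  finally show ?thesis by simp
qed

text \<open>The substitution x = z + y turns a double integral with kernel u(x - y) into a single
  integral of u against a correlation. It preserves the measure because for fixed y it is a
  translation.\<close>

lemma distr_shear:
  "distr (lborel \<Otimes>\<^sub>M lborel) (borel \<Otimes>\<^sub>M borel) (\<lambda>(z, y). (z + y, y)) =
     (lborel \<Otimes>\<^sub>M lborel :: ('a::euclidean_space \<times> 'a) measure)"
proof (rule measure_eqI)
  fix A :: "('a \<times> 'a) set"
  assume "A \<in> sets (distr (lborel \<Otimes>\<^sub>M lborel) (borel \<Otimes>\<^sub>M borel) (\<lambda>(z, y). (z + y, y)))"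
  then have A[measurable]: "A \<in> sets (borel \<Otimes>\<^sub>M borel)" by simp
  have "emeasure (distr (lborel \<Otimes>\<^sub>M lborel) (borel \<Otimes>\<^sub>M borel) (\<lambda>(z, y). (z + y, y))) A =
      (\<integral>\<^sup>+p. indicator A p \<partial>distr (lborel \<Otimes>\<^sub>M lborel) (borel \<Otimes>\<^sub>M borel) (\<lambda>(z::'a, y). (z + y, y)))"
    by simp
  also have "\<dots> = (\<integral>\<^sup>+p. indicator A (fst p + snd p, snd p) \<partial>(lborel \<Otimes>\<^sub>M lborel))"
    by (subst nn_integral_distr) (auto simp: case_prod_beta)
  also have "\<dots> = (\<integral>\<^sup>+y. \<integral>\<^sup>+z. indicator A (z + y, y) \<partial>lborel \<partial>lborel)"
    by (subst lborel_pair.nn_integral_snd[symmetric]) (auto simp: case_prod_beta)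
  also have "\<dots> = (\<integral>\<^sup>+y. \<integral>\<^sup>+z. indicator A (z, y) \<partial>lborel \<partial>lborel)"
  proof (rule nn_integral_cong)
    fix y :: 'a
    show "(\<integral>\<^sup>+z. indicator A (z + y, y) \<partial>lborel) = (\<integral>\<^sup>+z. indicator A (z, y) \<partial>lborel)"
      by (rule nn_integral_translate[of "\<lambda>z. indicator A (z, y)"]) measurable
  qed
  also have "\<dots> = (\<integral>\<^sup>+p. indicator A p \<partial>(lborel \<Otimes>\<^sub>M lborel))"
    by (subst lborel_pair.nn_integral_snd[symmetric]) (auto simp: case_prod_beta)
  finally show "emeasure (distr (lborel \<Otimes>\<^sub>M lborel) (borel \<Otimes>\<^sub>M borel) (\<lambda>(z, y). (z + y, y))) A =
      emeasure (lborel \<Otimes>\<^sub>M lborel) A" by simp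
qed simp

lemma measurable_shear:
  "(\<lambda>(z, y). (z + y, y)) \<in> (lborel \<Otimes>\<^sub>M lborel) \<rightarrow>\<^sub>M (borel \<Otimes>\<^sub>M (borel :: 'a::euclidean_space measure))"
  by measurable

lemma integrable_shear_iff:
  fixes F :: "'a::euclidean_space \<times> 'a \<Rightarrow> 'b::{banach, second_countable_topology}"
  assumes [measurable]: "F \<in> borel_measurable (borel \<Otimes>\<^sub>M borel)"
  shows "integrable (lborel \<Otimes>\<^sub>M lborel) (\<lambda>(z, y). F (z + y, y)) \<longleftrightarrow> integrable (lborel \<Otimes>\<^sub>M lborel) F"
  using integrable_distr_eq[OF measurable_shear, of F] by (simp add: distr_shear[unfolded case_prod_beta'] case_prod_beta')

lemma integral_shear:
  fixes F :: "'a::euclidean_space \<times> 'a \<Rightarrow> 'b::{banach, second_countable_topology}"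
  assumes [measurable]: "F \<in> borel_measurable (borel \<Otimes>\<^sub>M borel)"
  shows "(\<integral>(z, y). F (z + y, y) \<partial>(lborel \<Otimes>\<^sub>M lborel)) = (\<integral>p. F p \<partial>(lborel \<Otimes>\<^sub>M lborel))"
  using integral_distr[OF measurable_shear, of F] by (simp add: distr_shear[unfolded case_prod_beta'] case_prod_beta')

lemma integrable_prod_mult:
  fixes f g :: "'a::euclidean_space \<Rightarrow> 'b::{real_normed_field, banach, second_countable_topology}"
  assumes "integrable lborel f" "integrable lborel g"
  shows "integrable (lborel \<Otimes>\<^sub>M lborel) (\<lambda>(x, y). f x * g y)"
proof (rule lborel_pair.Fubini_integrable)
  have [measurable]: "f \<in> borel_measurable borel" "g \<in> borel_measurable borel" using assms by auto
  show "(\<lambda>(x, y). f x * g y) \<in> borel_measurable (lborel \<Otimes>\<^sub>M lborel)" by measurable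
  show "integrable lborel (\<lambda>x. \<integral>y. norm (case (x, y) of (x, y) \<Rightarrow> f x * g y) \<partial>lborel)"
    using assms by (simp add: norm_mult)
  show "AE x in lborel. integrable lborel (\<lambda>y. case (x, y) of (x, y) \<Rightarrow> f x * g y)"
    using assms by simp
qed

lemma one_plus_norm_ge_1 [simp]: "1 \<le> 1 + norm x" by simp

lemma one_plus_norm_add_le: "1 + norm (x + y) \<le> (1 + norm x) * (1 + norm y)"
  using norm_triangle_ineq[of x y] mult_nonneg_nonneg[OF norm_ge_zero[of x] norm_ge_zero[of y]]
  unfolding distrib_right distrib_left by linarith

lemma one_plus_norm_diff_le: "1 + norm (x - y) \<le> (1 + norm x) * (1 + norm y)"
  using one_plus_norm_add_le[of x "- y"] by simp

lemma one_plus_norm_pow_pos [simp]: "0 < (1 + norm x) ^ K"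
  by (intro zero_less_power) (simp add: add_pos_nonneg)

text \<open>Each coordinate is at most the norm, so (1 + |x|)^(2d) dominates the product of the
  factors (1 + |x_b|)^2, and the integral is at most a power of a one-dimensional one.\<close>

lemma integrable_weight_DIM:
  "integrable lborel (\<lambda>x::'a::euclidean_space. 1 / (1 + norm x) ^ (2 * DIM('a)))"
proof (rule integrableI_bounded)
  have fin: "(\<integral>\<^sup>+t. ennreal (1 / (1 + \<bar>t\<bar>)\<^sup>2) \<partial>(lborel :: real measure)) < \<infinity>"
  proof -
    have "integrable lborel (\<lambda>t::real. inverse (1 + t\<^sup>2))"
      using integrable_inverse_1_plus_square by (simp add: set_integrable_def)
    then have "integrable lborel (\<lambda>t::real. 1 / (1 + \<bar>t\<bar>)\<^sup>2)"
    proof (rule Bochner_Integration.integrable_bound, simp, intro AE_I2)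
      fix t :: real
      have "1 + t\<^sup>2 \<le> (1 + \<bar>t\<bar>)\<^sup>2" by (simp add: power2_sum)
      moreover have "0 < 1 + t\<^sup>2" by (simp add: add_pos_nonneg)
      ultimately show "norm (1 / (1 + \<bar>t\<bar>)\<^sup>2) \<le> norm (inverse (1 + t\<^sup>2))"
        by (simp add: inverse_eq_divide frac_le)
    qed
    then show ?thesis by (simp add: integrable_iff_bounded)
  qed
  have "(\<integral>\<^sup>+x. ennreal (norm (1 / (1 + norm x) ^ (2 * DIM('a)))) \<partial>(lborel::'a measure)) \<le>
      (\<integral>\<^sup>+x. (\<Prod>b\<in>Basis. ennreal (1 / (1 + \<bar>x \<bullet> b\<bar>)\<^sup>2)) \<partial>(lborel::'a measure))"
  proof (rule nn_integral_mono)
    fix x :: 'a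
    have "(\<Prod>b\<in>(Basis::'a set). (1 + \<bar>x \<bullet> b\<bar>)\<^sup>2) \<le> (\<Prod>b\<in>(Basis::'a set). (1 + norm x)\<^sup>2)"
      by (intro prod_mono conjI power_mono) (auto simp: Basis_le_norm)
    also have "\<dots> = (1 + norm x) ^ (2 * DIM('a))" by (simp add: power_mult)
    finally have "1 / (1 + norm x) ^ (2 * DIM('a)) \<le> 1 / (\<Prod>b\<in>(Basis::'a set). (1 + \<bar>x \<bullet> b\<bar>)\<^sup>2)"
      by (intro divide_left_mono mult_pos_pos prod_pos) (auto intro!: zero_less_power add_pos_nonneg)
    also have "\<dots> = (\<Prod>b\<in>(Basis::'a set). 1 / (1 + \<bar>x \<bullet> b\<bar>)\<^sup>2)" by (simp add: prod_dividef)
    finally show "ennreal (norm (1 / (1 + norm x) ^ (2 * DIM('a)))) \<le> (\<Prod>b\<in>(Basis::'a set). ennreal (1 / (1 + \<bar>x \<bullet> b\<bar>)\<^sup>2))"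
      by (subst prod_ennreal) (auto intro!: ennreal_leI simp: less_imp_le)
  qed
  also have "\<dots> = (\<Prod>b\<in>(Basis::'a set). (\<integral>\<^sup>+t. ennreal (1 / (1 + \<bar>t\<bar>)\<^sup>2) \<partial>(lborel :: real measure)))"
    by (rule nn_integral_lborel_prod) auto
  also have "\<dots> < \<infinity>"
    using fin by (simp add: ennreal_prod_eq_top power_less_top_ennreal)
  finally show "(\<integral>\<^sup>+x. ennreal (norm (1 / (1 + norm x) ^ (2 * DIM('a)))) \<partial>(lborel::'a measure)) < \<infinity>" .
qed simp

lemma integrable_weight:
  assumes "2 * DIM('a) \<le> K"
  shows "integrable lborel (\<lambda>x::'a::euclidean_space. 1 / (1 + norm x) ^ K)"
  by (rule Bochner_Integration.integrable_bound[OF integrable_weight_DIM])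
    (use assms in \<open>auto intro!: divide_left_mono power_increasing\<close>)

text \<open>Distributing the exponent over the d coordinates bounds |x|^(-p) by the product of the
  |x_b|^(-p/d). This reduces the claim to one dimension, where p/d < 1 makes the singularity
  integrable.\<close>

lemma integrable_norm_powr_cball:
  assumes "0 \<le> p" "p < real DIM('a)"
  shows "integrable lborel (\<lambda>x::'a::euclidean_space. indicator (cball 0 1) x * norm x powr (- p))"
proof (rule integrableI_bounded)
  define q where "q = p / real DIM('a)"
  have q: "0 \<le> q" "q < 1" using assms by (auto simp: q_def)
  have qp: "real DIM('a) * q = p" by (simp add: q_def)
  define k where "k t = indicator {-1..1} t * \<bar>t\<bar> powr (- q)" for t :: real
  have fin: "(\<integral>\<^sup>+t. ennreal (k t) \<partial>lborel) < \<infinity>"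
  proof -
    have "(\<lambda>t. t powr (- q)) integrable_on {0..1}"
      by (rule integrable_on_powr_from_0) (use q in auto)
    then have "(\<lambda>t. t powr (- q)) absolutely_integrable_on {0..1}"
      by (rule nonnegative_absolutely_integrable_1) auto
    then have "integrable lebesgue (\<lambda>t. indicator {0..1} t *\<^sub>R (t powr (- q)))"
      by (simp add: set_integrable_def)
    then have 1: "integrable lborel (\<lambda>t. indicator {0..1} t * (t powr (- q)))"
      by (subst (asm) integrable_completion) auto
    have 2: "integrable lborel (\<lambda>t. indicator {0..1} (-t) * ((-t) powr (- q)))"
      using lborel_integrable_real_affine[OF 1, of "-1" 0] by simp
    have "integrable lborel k"
    proof (rule Bochner_Integration.integrable_bound[OF Bochner_Integration.integrable_add[OF 1 2]])
      show "k \<in> borel_measurable lborel" unfolding k_def by measurable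
      have "norm (k t) \<le> norm (indicator {0..1} t * t powr - q + indicator {0..1} (- t) * (- t) powr - q)" for t
        by (cases "t \<ge> 0") (auto simp: k_def indicator_def)
      then show "AE t in lborel. norm (k t) \<le>
          norm (indicator {0..1} t * t powr - q + indicator {0..1} (- t) * (- t) powr - q)" by simp
    qed
    then have "(\<integral>\<^sup>+t. ennreal (norm (k t)) \<partial>lborel) < \<infinity>"
      unfolding integrable_iff_bounded by blast
    moreover have "norm (k t) = k t" for t by (simp add: k_def)
    ultimately show ?thesis by simp
  qed
  have "(\<integral>\<^sup>+x. ennreal (norm (indicator (cball 0 1) x * norm x powr (- p))) \<partial>(lborel::'a measure)) \<le>
      (\<integral>\<^sup>+x. (\<Prod>b\<in>Basis. ennreal (k (x \<bullet> b))) \<partial>(lborel::'a measure))"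
  proof (rule nn_integral_mono_AE)
    \<comment> \<open>Points with a vanishing coordinate are discarded, because
      \<open>0 powr (- q)\<close> is 0 and the product would be too small there.\<close>
    have "AE x in (lborel::'a measure). \<forall>b\<in>Basis. x \<bullet> b \<noteq> 0"
    proof (rule AE_finite_allI)
      fix b :: 'a assume b: "b \<in> Basis"
      have "negligible {x::'a. b \<bullet> x = 0}" by (rule negligible_hyperplane) (use b in auto)
      then have "AE x in lebesgue. x \<notin> {x::'a. b \<bullet> x = 0}"
        using AE_not_in negligible_iff_null_sets by blast
      then show "AE x in (lborel::'a measure). x \<bullet> b \<noteq> 0"
        by (simp add: AE_completion_iff inner_commute)
    qed simp
    then show "AE x in (lborel::'a measure). ennreal (norm (indicator (cball 0 1) x * norm x powr (- p))) \<le>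
        (\<Prod>b\<in>Basis. ennreal (k (x \<bullet> b)))"
    proof eventually_elim
      case (elim x)
      show ?case
      proof (cases "norm x \<le> 1")
        case True
        then have x1: "\<bar>x \<bullet> b\<bar> \<le> 1" if "b \<in> Basis" for b using Basis_le_norm[OF that, of x] by simp
        have "x \<noteq> 0" using elim SOME_Basis by (metis inner_zero_left)
        then have "(norm x powr (- q)) ^ DIM('a) = norm x powr (- q * real DIM('a))"
          by (simp add: powr_powr powr_realpow[symmetric])
        also have "- q * real DIM('a) = - p" using qp by (simp add: mult.commute)
        finally have "norm x powr (- p) = (\<Prod>b\<in>(Basis::'a set). norm x powr (- q))"
          by simp
        also have "\<dots> \<le> (\<Prod>b\<in>(Basis::'a set). \<bar>x \<bullet> b\<bar> powr (- q))"
          by (intro prod_mono conjI powr_mono2') (use elim q in \<open>auto simp: Basis_le_norm\<close>)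
        also have "\<dots> = (\<Prod>b\<in>(Basis::'a set). k (x \<bullet> b))"
          using x1 by (intro prod.cong) (auto simp: k_def indicator_def abs_le_iff)
        finally show ?thesis
          using True by (subst prod_ennreal) (auto simp: k_def intro!: ennreal_leI)
      qed simp
    qed
  qed
  also have "\<dots> = (\<Prod>b\<in>(Basis::'a set). (\<integral>\<^sup>+t. ennreal (k t) \<partial>lborel))"
    by (rule nn_integral_lborel_prod) (auto simp: k_def)
  also have "\<dots> < \<infinity>"
    using fin by (simp add: ennreal_prod_eq_top power_less_top_ennreal)
  finally show "(\<integral>\<^sup>+x. ennreal (norm (indicator (cball 0 1) x * norm x powr (- p))) \<partial>(lborel::'a measure)) < \<infinity>" .
  have "(\<lambda>x::'a. norm x powr (- p)) \<in> borel_measurable borel"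
    by (intro powr_real_measurable borel_measurable_norm borel_measurable_const)
  moreover have "(\<lambda>x::'a. indicator (cball 0 1) x :: real) \<in> borel_measurable borel"
    by (rule borel_measurable_indicator) simp
  ultimately show "(\<lambda>x::'a. indicator (cball 0 1) x * norm x powr (- p)) \<in> borel_measurable lborel"
    unfolding measurable_lborel2 by (intro borel_measurable_times)
qed


subsection \<open>Rapidly decreasing functions and tempered weights\<close>

lemma one_plus_norm_pos [simp]: "0 < 1 + norm x" "1 + norm x \<noteq> 0"
  using norm_ge_zero[of x] by linarith+

text \<open>Schwartz decay without smoothness, so that it survives the passage to positive and
  negative parts.\<close>

definition rapid :: "('a::euclidean_space \<Rightarrow> 'b::real_normed_vector) \<Rightarrow> bool" where
  "rapid f \<longleftrightarrow> f \<in> borel_measurable borel \<and> (\<forall>K. \<exists>C. \<forall>x. norm (f x) * (1 + norm x) ^ K \<le> C)"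

text \<open>Growth is bounded in a weighted mean and not pointwise, which admits integrable
  singularities such as those of the gradients of Riesz potentials.\<close>

definition tempered :: "('a::euclidean_space \<Rightarrow> real) \<Rightarrow> bool" where
  "tempered u \<longleftrightarrow> (\<exists>N. integrable lborel (\<lambda>x. u x / (1 + norm x) ^ N))"

lemma tempered_measurable [measurable_dest]: "tempered u \<Longrightarrow> u \<in> borel_measurable borel"
proof -
  assume "tempered u"
  then obtain N where "integrable lborel (\<lambda>x. u x / (1 + norm x) ^ N)" unfolding tempered_def by blast
  then have [measurable]: "(\<lambda>x. u x / (1 + norm x) ^ N) \<in> borel_measurable borel" by auto
  have "(\<lambda>x. u x / (1 + norm x) ^ N * (1 + norm x) ^ N) \<in> borel_measurable borel" by measurable
  moreover have "u x / (1 + norm x) ^ N * (1 + norm x) ^ N = u x" for x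
    using one_plus_norm_pow_pos[of x N] by simp
  ultimately show ?thesis by simp
qed

lemma rapid_measurable [measurable_dest]: "rapid f \<Longrightarrow> f \<in> borel_measurable borel"
  by (simp add: rapid_def)

lemma rapidE:
  assumes "rapid f"
  obtains C where "C > 0" "\<And>x. norm (f x) \<le> C / (1 + norm x) ^ K"
proof -
  obtain C where C: "norm (f x) * (1 + norm x) ^ K \<le> C" for x
    using assms unfolding rapid_def by blast
  show thesis
  proof (rule that[of "max C 1"])
    show "norm (f x) \<le> max C 1 / (1 + norm x) ^ K" for x
      using order_trans[OF C max.cobounded1[of C 1]] one_plus_norm_pow_pos[of x K]
      by (simp add: pos_le_divide_eq)
  qed simp
qed

lemma rapidI:
  assumes "f \<in> borel_measurable borel" "\<And>K. \<exists>C. \<forall>x. norm (f x) \<le> C / (1 + norm x) ^ K"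
  shows "rapid f"
  unfolding rapid_def using assms one_plus_norm_pow_pos by (simp add: pos_le_divide_eq)

lemma rapid_bounded:
  assumes "rapid f" obtains C where "C > 0" "\<And>x. norm (f x) \<le> C"
  using rapidE[OF assms, of 0] by auto

lemma rapid_integrable:
  fixes f :: "'a::euclidean_space \<Rightarrow> 'b::{banach, second_countable_topology}"
  assumes "rapid f"
  shows "integrable lborel f"
proof -
  obtain C where C: "C > 0" "\<And>x. norm (f x) \<le> C / (1 + norm x) ^ (2 * DIM('a))"
    using rapidE[OF assms] by blast
  have "integrable lborel (\<lambda>x::'a. C * (1 / (1 + norm x) ^ (2 * DIM('a))))"
    by (intro integrable_mult_right integrable_weight) simp
  then show ?thesis
    by (rule Bochner_Integration.integrable_bound)
      (use C assms in \<open>auto simp: rapid_measurable abs_of_pos intro: order_trans[OF _ abs_ge_self]\<close>)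
qed

lemma rapid_dominated:
  assumes "rapid f" "g \<in> borel_measurable borel" "\<And>x. norm (g x) \<le> B * norm (f x)"
  shows "rapid g"
proof (rule rapidI)
  fix K
  obtain C where C: "C > 0" "\<And>x. norm (f x) \<le> C / (1 + norm x) ^ K"
    using rapidE[OF assms(1)] by blast
  have "norm (g x) \<le> (\<bar>B\<bar> * C) / (1 + norm x) ^ K" for x
  proof -
    have "norm (g x) \<le> \<bar>B\<bar> * norm (f x)"
      using assms(3)[of x] mult_right_mono[OF abs_ge_self[of B] norm_ge_zero[of "f x"]] by linarith
    also have "\<dots> \<le> \<bar>B\<bar> * (C / (1 + norm x) ^ K)" by (intro mult_left_mono C) auto
    finally show ?thesis by simp
  qed
  then show "\<exists>C. \<forall>x. norm (g x) \<le> C / (1 + norm x) ^ K" by blast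
qed (rule assms(2))

lemma rapid_add:
  fixes f g :: "'a::euclidean_space \<Rightarrow> 'b::{real_normed_vector, second_countable_topology}"
  assumes "rapid f" "rapid g"
  shows "rapid (\<lambda>x. f x + g x)"
proof (rule rapidI)
  fix K
  obtain C where C: "C > 0" "\<And>x. norm (f x) \<le> C / (1 + norm x) ^ K"
    using rapidE[OF assms(1)] by blast
  obtain D where D: "D > 0" "\<And>x. norm (g x) \<le> D / (1 + norm x) ^ K"
    using rapidE[OF assms(2)] by blast
  have "norm (f x + g x) \<le> (C + D) / (1 + norm x) ^ K" for x
    using norm_triangle_ineq[of "f x" "g x"] C(2)[of x] D(2)[of x] by (simp add: add_divide_distrib)
  then show "\<exists>C. \<forall>x. norm (f x + g x) \<le> C / (1 + norm x) ^ K" by blast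
qed (use assms in \<open>simp add: rapid_measurable\<close>)

lemma rapid_cmult: "rapid f \<Longrightarrow> rapid (\<lambda>x. c * f x)" for f :: "'a::euclidean_space \<Rightarrow> real"
  by (rule rapid_dominated[where f = f and B = "\<bar>c\<bar>"]) (auto simp: abs_mult rapid_measurable)

lemma rapid_diff: "rapid f \<Longrightarrow> rapid g \<Longrightarrow> rapid (\<lambda>x. f x - g x)" for f g :: "'a::euclidean_space \<Rightarrow> real"
  using rapid_add[of f "\<lambda>x. -1 * g x"] rapid_cmult[of g "-1"] by simp

lemma rapid_mult_bounded:
  fixes f g :: "'a::euclidean_space \<Rightarrow> real"
  assumes "rapid f" "g \<in> borel_measurable borel" "\<And>x. \<bar>g x\<bar> \<le> B"
  shows "rapid (\<lambda>x. f x * g x)"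
  by (rule rapid_dominated[where f = f and B = B])
    (use assms in \<open>auto simp: abs_mult rapid_measurable mult.commute[of "\<bar>f _\<bar>"] intro: mult_right_mono\<close>)

lemma rapid_compose_dist:
  assumes "rapid f" "\<phi> \<in> borel_measurable borel" and "c > 0" "\<And>x. 1 + norm x \<le> c * (1 + norm (\<phi> x))"
  shows "rapid (\<lambda>x. f (\<phi> x))"
proof (rule rapidI)
  fix K
  obtain C where C: "C > 0" "\<And>x. norm (f x) \<le> C / (1 + norm x) ^ K"
    using rapidE[OF assms(1)] by blast
  have "norm (f (\<phi> x)) \<le> (C * c ^ K) / (1 + norm x) ^ K" for x
  proof -
    have "(1 + norm x) ^ K \<le> (c * (1 + norm (\<phi> x))) ^ K" using assms(4) by (intro power_mono) auto
    then have "C * (1 + norm x) ^ K \<le> C * (c ^ K * (1 + norm (\<phi> x)) ^ K)"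
      using C(1) by (intro mult_left_mono) (auto simp: power_mult_distrib)
    then have "C / (1 + norm (\<phi> x)) ^ K \<le> (C * c ^ K) / (1 + norm x) ^ K"
      using one_plus_norm_pow_pos[of x K] one_plus_norm_pow_pos[of "\<phi> x" K]
      by (simp add: divide_simps mult_ac)
    then show ?thesis using C(2)[of "\<phi> x"] by linarith
  qed
  then show "\<exists>C. \<forall>x. norm (f (\<phi> x)) \<le> C / (1 + norm x) ^ K" by blast
  show "(\<lambda>x. f (\<phi> x)) \<in> borel_measurable borel"
    using measurable_compose[OF assms(2) rapid_measurable[OF assms(1)]] .
qed

lemma rapid_translate: "rapid f \<Longrightarrow> rapid (\<lambda>x. f (x + t))"
proof (rule rapid_compose_dist[where c = "1 + norm t"])
  show "1 + norm x \<le> (1 + norm t) * (1 + norm (x + t))" for x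
    using one_plus_norm_diff_le[of "x + t" t] by (simp add: mult.commute)
qed (auto intro: add_pos_nonneg)

lemma rapid_scale: "rapid f \<Longrightarrow> c \<noteq> 0 \<Longrightarrow> rapid (\<lambda>x. f (c *\<^sub>R x))"
proof (rule rapid_compose_dist[where c = "1 + 1 / \<bar>c\<bar>"])
  show "1 + norm x \<le> (1 + 1 / \<bar>c\<bar>) * (1 + norm (c *\<^sub>R x))" if "c \<noteq> 0" for x
  proof -
    have "(1 + 1 / \<bar>c\<bar>) * (1 + norm (c *\<^sub>R x)) = 1 + norm x + (1 / \<bar>c\<bar> + \<bar>c\<bar> * norm x)"
      using that by (simp add: field_simps)
    then show ?thesis by simp
  qed
qed (auto intro: add_pos_nonneg)

lemma integrable_tempered_rapid:
  fixes f :: "'a::euclidean_space \<Rightarrow> 'b::{banach, second_countable_topology}"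
  assumes "tempered u" "rapid f"
  shows "integrable lborel (\<lambda>x. u x *\<^sub>R f x)"
proof -
  obtain N where N: "integrable lborel (\<lambda>x. u x / (1 + norm x) ^ N)" using assms(1) unfolding tempered_def by blast
  obtain C where C: "C > 0" "\<And>x. norm (f x) \<le> C / (1 + norm x) ^ N"
    using rapidE[OF assms(2)] by blast
  show ?thesis
  proof (rule Bochner_Integration.integrable_bound[OF integrable_mult_right[OF N, of C]])
    show "(\<lambda>x. u x *\<^sub>R f x) \<in> borel_measurable lborel" using assms by measurable
    have "norm (u x *\<^sub>R f x) \<le> norm (C * (u x / (1 + norm x) ^ N))" for x
      using mult_left_mono[OF C(2)[of x], of "\<bar>u x\<bar>"] C(1)
      by (simp add: abs_mult mult_ac)
    then show "AE x in lborel. norm (u x *\<^sub>R f x) \<le> norm (C * (u x / (1 + norm x) ^ N))" by simp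
  qed
qed

lemma tempered_mult_bounded:
  assumes "tempered u" "g \<in> borel_measurable borel" "\<And>x. \<bar>g x\<bar> \<le> B"
  shows "tempered (\<lambda>x. u x * g x)"
proof -
  obtain N where N: "integrable lborel (\<lambda>x. u x / (1 + norm x) ^ N)" using assms(1) unfolding tempered_def by blast
  have "integrable lborel (\<lambda>x. u x * g x / (1 + norm x) ^ N)"
  proof (rule Bochner_Integration.integrable_bound[OF integrable_mult_right[OF N, of B]])
    show "(\<lambda>x. u x * g x / (1 + norm x) ^ N) \<in> borel_measurable lborel" using assms by measurable
    have "norm (u x * g x / (1 + norm x) ^ N) \<le> norm (B * (u x / (1 + norm x) ^ N))" for x
      using mult_right_mono[OF order_trans[OF assms(3)[of x] abs_ge_self], of "\<bar>u x\<bar> / (1 + norm x) ^ N"]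
      by (simp add: abs_mult mult_ac)
    then show "AE x in lborel. norm (u x * g x / (1 + norm x) ^ N) \<le> norm (B * (u x / (1 + norm x) ^ N))"
      by simp
  qed
  then show ?thesis unfolding tempered_def by blast
qed

lemma tempered_poly_bound:
  assumes [measurable]: "u \<in> borel_measurable borel" and "\<And>x. x \<noteq> 0 \<Longrightarrow> \<bar>u x\<bar> \<le> C * (1 + norm x) ^ N"
  shows "tempered (u :: 'a::euclidean_space \<Rightarrow> real)"
proof -
  let ?K = "N + 2 * DIM('a)"
  have "integrable lborel (\<lambda>x. u x / (1 + norm x) ^ ?K)"
  proof (rule Bochner_Integration.integrable_bound[OF integrable_mult_right[OF integrable_weight_DIM, of C]])
    show "(\<lambda>x. u x / (1 + norm x) ^ ?K) \<in> borel_measurable lborel" by measurable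
    show "AE x in lborel. norm (u x / (1 + norm x) ^ ?K) \<le> norm (C * (1 / (1 + norm x) ^ (2 * DIM('a))))"
      using AE_lborel_singleton[of "0::'a"]
    proof eventually_elim
      case (elim x)
      have "\<bar>u x\<bar> \<le> \<bar>C\<bar> * (1 + norm x) ^ N"
        using assms(2)[OF elim] mult_right_mono[OF abs_ge_self[of C] less_imp_le[OF one_plus_norm_pow_pos[of x N]]] by linarith
      then have "\<bar>u x\<bar> / (1 + norm x) ^ ?K \<le> (\<bar>C\<bar> * (1 + norm x) ^ N) / (1 + norm x) ^ ?K"
        by (intro divide_right_mono) auto
      also have "\<dots> = \<bar>C\<bar> / (1 + norm x) ^ (2 * DIM('a))"
        using one_plus_norm_pow_pos[of x N] by (simp add: power_add)
      finally show ?case by (simp add: abs_mult)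
    qed
  qed
  then show ?thesis unfolding tempered_def by blast
qed

text \<open>After the shear, the weight (1 + |z|)^(-N) under which u is integrable is taken from f(z
  + y) and h(y) through 1 + |z| \<le> (1 + |z + y|)(1 + |y|). The 2d spare powers in the decay of h
  make the y-integral converge.\<close>

lemma
  fixes f h u :: "'a::euclidean_space \<Rightarrow> real"
  assumes f: "rapid f" and u: "tempered u" and h: "rapid h"
  shows integrable_kernel: "integrable (lborel \<Otimes>\<^sub>M lborel) (\<lambda>(x, y). f x * u (x - y) * h y)" (is ?int)
    and integral_kernel: "(\<integral>(x, y). f x * u (x - y) * h y \<partial>(lborel \<Otimes>\<^sub>M lborel)) =
      (\<integral>z. u z * (\<integral>y. f (z + y) * h y \<partial>lborel) \<partial>lborel)" (is ?eq)
proof -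
  note [measurable] = rapid_measurable[OF f] rapid_measurable[OF h] tempered_measurable[OF u]
  obtain N where N: "integrable lborel (\<lambda>x. u x / (1 + norm x) ^ N)" using u unfolding tempered_def by blast
  obtain C where C: "C > 0" "\<And>x. norm (f x) \<le> C / (1 + norm x) ^ N"
    using rapidE[OF f] by blast
  obtain D where D: "D > 0" "\<And>x. norm (h x) \<le> D / (1 + norm x) ^ (N + 2 * DIM('a))"
    using rapidE[OF h] by blast
  let ?F = "\<lambda>(x, y). f x * u (x - y) * h y"
  let ?w = "\<lambda>y::'a. 1 / (1 + norm y) ^ (2 * DIM('a))"
  have meas [measurable]: "?F \<in> borel_measurable (borel \<Otimes>\<^sub>M borel)" by measurable
  have int: "integrable (lborel \<Otimes>\<^sub>M lborel) (\<lambda>(z, y). f (z + y) * u z * h y)"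
  proof (rule Bochner_Integration.integrable_bound)
    show "integrable (lborel \<Otimes>\<^sub>M lborel) (\<lambda>(z::'a, y). (C * D * (u z / (1 + norm z) ^ N)) * ?w y)"
      by (intro integrable_prod_mult integrable_mult_right N integrable_weight_DIM)
    show "(\<lambda>(z, y). f (z + y) * u z * h y) \<in> borel_measurable (lborel \<Otimes>\<^sub>M lborel)" by measurable
    have "\<bar>f (z + y) * u z * h y\<bar> \<le> \<bar>(C * D * (u z / (1 + norm z) ^ N)) * ?w y\<bar>" for z y :: 'a
    proof -
      have "(1 + norm z) ^ N \<le> ((1 + norm (z + y)) * (1 + norm y)) ^ N"
        using one_plus_norm_diff_le[of "z + y" y] by (intro power_mono) auto
      then have 1: "1 / ((1 + norm (z + y)) ^ N * (1 + norm y) ^ N) \<le> 1 / (1 + norm z) ^ N"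
        using one_plus_norm_pow_pos[of z N] one_plus_norm_pow_pos[of "z+y" N] one_plus_norm_pow_pos[of y N]
        by (intro divide_left_mono) (auto simp: power_mult_distrib)
      have "\<bar>f (z + y)\<bar> * \<bar>h y\<bar> \<le> (C / (1 + norm (z + y)) ^ N) * (D / (1 + norm y) ^ (N + 2 * DIM('a)))"
        using C(1) C(2)[of "z + y"] D(2)[of y] by (intro mult_mono) auto
      also have "\<dots> = C * D * (1 / ((1 + norm (z + y)) ^ N * (1 + norm y) ^ N)) * ?w y"
        by (simp add: power_add)
      also have "\<dots> \<le> C * D * (1 / (1 + norm z) ^ N) * ?w y"
        using C(1) D(1) 1 by (intro mult_right_mono mult_left_mono) auto
      finally have "\<bar>u z\<bar> * (\<bar>f (z + y)\<bar> * \<bar>h y\<bar>) \<le> \<bar>u z\<bar> * (C * D * (1 / (1 + norm z) ^ N) * ?w y)"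
        by (rule mult_left_mono) simp
      then show ?thesis using C(1) D(1) by (simp add: abs_mult mult_ac)
    qed
    then show "AE p in lborel \<Otimes>\<^sub>M lborel. norm (case p of (z, y) \<Rightarrow> f (z + y) * u z * h y) \<le>
        norm (case p of (z, y) \<Rightarrow> C * D * (u z / (1 + norm z) ^ N) * ?w y)"
      by (intro AE_I2) (auto simp: case_prod_beta)
  qed
  show ?int using integrable_shear_iff[OF meas] int by simp
  have "(\<integral>p. ?F p \<partial>(lborel \<Otimes>\<^sub>M lborel)) = (\<integral>(z, y). f (z + y) * u z * h y \<partial>(lborel \<Otimes>\<^sub>M lborel))"
    using integral_shear[OF meas] by simp
  also have "\<dots> = (\<integral>z. (\<integral>y. f (z + y) * u z * h y \<partial>lborel) \<partial>lborel)"
    using lborel_pair.integral_fst'[OF int] by simp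
  also have "\<dots> = (\<integral>z. u z * (\<integral>y. f (z + y) * h y \<partial>lborel) \<partial>lborel)"
    by (rule Bochner_Integration.integral_cong[OF refl], subst integral_mult_right_zero[symmetric]) (simp add: mult_ac)
  finally show ?eq .
qed

text \<open>Shifting by half a period changes the sign of the cosine, and translation is continuous in
  \<open>L\<^sup>1\<close> at \<open>u\<close> by Scheffe's lemma.\<close>

lemma riemann_lebesgue:
  fixes u :: "'a::euclidean_space \<Rightarrow> real"
  assumes u: "integrable lborel u" and cont: "AE x in lborel. isCont u x" and "q \<noteq> 0"
  shows "(\<lambda>n. \<integral>x. u x * cos (2 * pi * real n * (x \<bullet> q)) \<partial>lborel) \<longlonglongrightarrow> 0"
proof -
  have [measurable]: "u \<in> borel_measurable borel" using u by auto
  define s where "s n = (1 / (2 * real n * (q \<bullet> q))) *\<^sub>R q" for n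
  define I where "I n = (\<integral>x. u x * cos (2 * pi * real n * (x \<bullet> q)) \<partial>lborel)" for n
  have s0: "s \<longlonglongrightarrow> 0"
  proof -
    have "(\<lambda>n. (inverse (real n) * (1 / (2 * (q \<bullet> q)))) *\<^sub>R q) \<longlonglongrightarrow> (0 * (1 / (2 * (q \<bullet> q)))) *\<^sub>R q"
      by (intro tendsto_intros lim_inverse_n)
    then show ?thesis by (simp add: s_def[abs_def] field_simps)
  qed
  have lim: "(\<lambda>n. \<integral>\<^sup>+x. norm (u (x + s n) - u x) \<partial>lborel) \<longlonglongrightarrow> 0"
  proof (rule Scheffe_lemma2[where F = "\<lambda>n x. u (x + s n)"])
    show "AE x in lborel. (\<lambda>n. u (x + s n)) \<longlonglongrightarrow> u x"
      using cont
    proof eventually_elim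
      case (elim x)
      have "(\<lambda>n. x + s n) \<longlonglongrightarrow> x" using tendsto_add[OF tendsto_const s0, of x] by simp
      then show ?case using elim isCont_tendsto_compose by blast
    qed
    show "(\<integral>\<^sup>+x. norm (u (x + s n)) \<partial>lborel) \<le> (\<integral>\<^sup>+x. norm (u x) \<partial>lborel)" for n
      using nn_integral_translate[of "\<lambda>x. ennreal (norm (u x))" "s n"] by simp
  qed (use u in auto)
  have bnd: "ennreal \<bar>2 * I n\<bar> \<le> (\<integral>\<^sup>+x. norm (u (x + s n) - u x) \<partial>lborel)" if "n > 0" for n
  proof -
    let ?c = "\<lambda>x. cos (2 * pi * real n * (x \<bullet> q))"
    have bm: "integrable lborel (\<lambda>x. v x * ?c x)" if v: "integrable lborel v" for v
      by (rule Bochner_Integration.integrable_bound[OF v])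
        (use v in \<open>auto simp: abs_mult intro!: mult_left_le abs_cos_le_one\<close>)
    have "2 * pi * real n * ((x + s n) \<bullet> q) = 2 * pi * real n * (x \<bullet> q) + pi" for x
      using that \<open>q \<noteq> 0\<close> by (simp add: s_def inner_add_left distrib_left)
    then have "?c (x + s n) = - ?c x" for x by simp
    then have "I n = - (\<integral>x. u (x + s n) * ?c x \<partial>lborel)"
      using integral_translate[of "\<lambda>x. u x * ?c x" "s n"] unfolding I_def by simp
    then have "2 * I n = - (\<integral>x. (u (x + s n) - u x) * ?c x \<partial>lborel)"
      using bm[OF u] bm[OF integrable_translate[OF u, of "s n"]]
      by (simp add: I_def left_diff_distrib)
    then have "ennreal \<bar>2 * I n\<bar> \<le> (\<integral>\<^sup>+x. norm ((u (x + s n) - u x) * ?c x) \<partial>lborel)"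
      using integral_norm_bound_ennreal[OF bm[OF Bochner_Integration.integrable_diff[OF integrable_translate[OF u, of "s n"] u]]]
      by simp
    also have "\<dots> \<le> (\<integral>\<^sup>+x. norm (u (x + s n) - u x) \<partial>lborel)"
      by (intro nn_integral_mono ennreal_leI) (auto simp: abs_mult intro!: mult_left_le abs_cos_le_one)
    finally show ?thesis .
  qed
  have ev: "\<forall>\<^sub>F n in sequentially. ennreal \<bar>2 * I n\<bar> \<le> (\<integral>\<^sup>+x. norm (u (x + s n) - u x) \<partial>lborel)"
    by (rule eventually_mono[OF eventually_gt_at_top[of 0]]) (rule bnd)
  have "(\<lambda>n. ennreal \<bar>2 * I n\<bar>) \<longlonglongrightarrow> 0"
    by (rule tendsto_sandwich[OF always_eventually[OF allI[OF zero_le]] ev tendsto_const lim])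
  then have "(\<lambda>n. \<bar>2 * I n\<bar>) \<longlonglongrightarrow> 0" 
    by (rule ennreal_tendsto_0_iff[of "\<lambda>n. \<bar>2 * I n\<bar>", OF abs_ge_zero, THEN iffD1])
  then have "(\<lambda>n. 2 * I n) \<longlonglongrightarrow> 0" by (rule tendsto_rabs_zero_cancel)
  from tendsto_mult_left[OF this, of "1/2"] show ?thesis unfolding I_def by simp
qed

text \<open>Near x0 the function u is bounded, and dominated convergence after rescaling gives the
  limit. Away from x0 it is controlled only in a weighted mean, but there the rapid decay of
  \<kappa> leaves a spare power of \<open>eps\<close>.\<close>

lemma approximate_identity:
  fixes \<kappa> u :: "'a::euclidean_space \<Rightarrow> real"
  assumes \<kappa>: "rapid \<kappa>" and u: "tempered u" and cont: "isCont u x0"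
    and eps: "\<And>j. eps j > 0" "eps \<longlonglongrightarrow> 0"
  shows "(\<lambda>j. \<integral>z. u z * (\<kappa> ((1 / eps j) *\<^sub>R (z - x0)) / eps j ^ DIM('a)) \<partial>lborel)
    \<longlonglongrightarrow> u x0 * (\<integral>x. \<kappa> x \<partial>lborel)"
proof -
  note [measurable] = rapid_measurable[OF \<kappa>] tempered_measurable[OF u]
  obtain r where r: "r > 0" "\<And>z. dist z x0 < r \<Longrightarrow> dist (u z) (u x0) < 1"
    using cont unfolding continuous_at_eps_delta by (metis zero_less_one)
  define u1 where "u1 z = indicator (ball x0 r) z * u z" for z
  define u2 where "u2 z = indicator (- ball x0 r) z * u z" for z
  have [measurable]: "u1 \<in> borel_measurable borel" "u2 \<in> borel_measurable borel"
    unfolding u1_def u2_def by (intro borel_measurable_times borel_measurable_indicator tempered_measurable[OF u]; simp)+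
  have tr: "tempered (\<lambda>z. indicator A z * u z)" if "A \<in> sets borel" for A
  proof -
    have "tempered (\<lambda>z. u z * indicator A z)"
      by (rule tempered_mult_bounded[OF u, where B = 1], rule borel_measurable_indicator[OF that])
        (simp add: indicator_def)
    then show ?thesis by (simp only: mult.commute)
  qed
  have u1: "tempered u1" and u2: "tempered u2"
    unfolding u1_def u2_def by (rule tr; simp)+
  let ?k = "\<lambda>j z. \<kappa> ((1 / eps j) *\<^sub>R (z - x0)) / eps j ^ DIM('a)"
  have rk: "rapid (?k j)" for j
    using rapid_translate[OF rapid_scale[OF rapid_cmult[OF \<kappa>, of "1 / eps j ^ DIM('a)"], of "1 / eps j"], of "- x0"] eps(1)[of j]
    by simp
  have A: "(\<lambda>j. \<integral>z. u1 z * ?k j z \<partial>lborel) \<longlonglongrightarrow> u x0 * (\<integral>x. \<kappa> x \<partial>lborel)"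
  proof -
    have eq: "(\<integral>z. u1 z * ?k j z \<partial>lborel) = (\<integral>y. u1 (x0 + eps j *\<^sub>R y) * \<kappa> y \<partial>lborel)" for j
    proof -
      have "(\<integral>z. u1 z * ?k j z \<partial>lborel) =
          eps j ^ DIM('a) * (\<integral>y. u1 (x0 + eps j *\<^sub>R y) * ?k j (x0 + eps j *\<^sub>R y) \<partial>lborel)"
        by (subst lborel_affine_integral[where c = "eps j" and t = x0])
          (use eps(1)[of j] in \<open>auto simp del: scaleR_right_diff_distrib\<close>)
      also have "\<dots> = (\<integral>y. eps j ^ DIM('a) * (u1 (x0 + eps j *\<^sub>R y) * ?k j (x0 + eps j *\<^sub>R y)) \<partial>lborel)"
        by (rule integral_mult_right_zero[symmetric])
      also have "\<dots> = (\<integral>y. u1 (x0 + eps j *\<^sub>R y) * \<kappa> y \<partial>lborel)"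
        using eps(1)[of j] by (intro Bochner_Integration.integral_cong) auto
      finally show ?thesis .
    qed
    have "(\<lambda>j. \<integral>y. u1 (x0 + eps j *\<^sub>R y) * \<kappa> y \<partial>lborel) \<longlonglongrightarrow> (\<integral>y. u x0 * \<kappa> y \<partial>lborel)"
    proof (rule integral_dominated_convergence[where w = "\<lambda>y. (\<bar>u x0\<bar> + 1) * \<bar>\<kappa> y\<bar>"])
      show "integrable lborel (\<lambda>y. (\<bar>u x0\<bar> + 1) * \<bar>\<kappa> y\<bar>)"
        using rapid_integrable[OF \<kappa>] by (intro integrable_mult_right integrable_abs)
      have "\<bar>u1 z\<bar> \<le> \<bar>u x0\<bar> + 1" for z
        using r(2)[of z] by (auto simp: u1_def indicator_def dist_real_def dist_commute)
      then show "AE y in lborel. norm (u1 (x0 + eps j *\<^sub>R y) * \<kappa> y) \<le> (\<bar>u x0\<bar> + 1) * \<bar>\<kappa> y\<bar>" for j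
        by (auto simp: abs_mult intro!: AE_I2 mult_right_mono)
      show "AE y in lborel. (\<lambda>j. u1 (x0 + eps j *\<^sub>R y) * \<kappa> y) \<longlonglongrightarrow> u x0 * \<kappa> y"
      proof (intro AE_I2 tendsto_mult tendsto_const)
        fix y :: 'a
        have lim: "(\<lambda>j. x0 + eps j *\<^sub>R y) \<longlonglongrightarrow> x0"
          using tendsto_add[OF tendsto_const tendsto_scaleR[OF eps(2) tendsto_const], of x0 y] by simp
        then have "\<forall>\<^sub>F j in sequentially. x0 + eps j *\<^sub>R y \<in> ball x0 r"
          using r(1) by (intro topological_tendstoD) auto
        then have "\<forall>\<^sub>F j in sequentially. u (x0 + eps j *\<^sub>R y) = u1 (x0 + eps j *\<^sub>R y)"
          by eventually_elim (simp add: u1_def)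
        then show "(\<lambda>j. u1 (x0 + eps j *\<^sub>R y)) \<longlonglongrightarrow> u x0"
          by (rule Lim_transform_eventually[OF isCont_tendsto_compose[OF cont lim]])
      qed
    qed simp_all
    then show ?thesis unfolding eq by simp
  qed
  have B: "(\<lambda>j. \<integral>z. u2 z * ?k j z \<partial>lborel) \<longlonglongrightarrow> 0"
  proof -
    obtain N where N: "integrable lborel (\<lambda>x. u x / (1 + norm x) ^ N)" using u unfolding tempered_def by blast
    \<comment> \<open>\<open>DIM('a)\<close> powers of \<open>eps j\<close> pay for the
      normalisation of the kernel, at least N powers are required to dominate the growth of u, and
      the extra one guarantees a factor that tends to 0.\<close>
    define K where "K = N + DIM('a) + 1"
    obtain C where C: "C > 0" "\<And>x. norm (\<kappa> x) \<le> C / (1 + norm x) ^ K"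
      using rapidE[OF \<kappa>] by blast
    define c where "c = (1 + norm x0) / r + 1"
    have c: "c > 0" using r(1) by (simp add: c_def add_pos_pos add_pos_nonneg)
    have far: "1 + norm z \<le> c * norm (z - x0)" if "r \<le> norm (z - x0)" for z
    proof -
      have "1 + norm x0 \<le> (1 + norm x0) / r * norm (z - x0)"
        using that r(1) mult_left_mono[OF that, of "(1 + norm x0) / r"] by simp
      then show ?thesis using norm_triangle_sub[of z x0] by (simp add: c_def distrib_right)
    qed
    have bd: "\<bar>u2 z * ?k j z\<bar> \<le> (C * c ^ K * eps j) * (\<bar>u z\<bar> / (1 + norm z) ^ N)" if e1: "eps j \<le> 1" for j z
    proof (cases "z \<in> ball x0 r")
      case True
      then show ?thesis using C(1) c eps(1)[of j] by (auto simp: u2_def intro!: mult_nonneg_nonneg)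
    next
      case False
      then have z: "r \<le> norm (z - x0)" by (simp add: dist_norm norm_minus_commute)
      then have zp: "norm (z - x0) > 0" using r(1) by linarith
      define y where "y = (1 / eps j) *\<^sub>R (z - x0)"
      have e: "eps j > 0" by (rule eps(1))
      have ny: "norm y = norm (z - x0) / eps j" using e by (simp add: y_def)
      have "(1 + norm z) ^ N \<le> (1 + norm z) ^ K" by (intro power_increasing) (auto simp: K_def)
      also have "\<dots> \<le> (c * norm (z - x0)) ^ K" using far[OF z] by (intro power_mono) auto
      also have "\<dots> = c ^ K * eps j ^ K * norm y ^ K"
        using e by (simp add: ny power_mult_distrib power_divide)
      also have "\<dots> \<le> c ^ K * eps j ^ K * (1 + norm y) ^ K"
        using c e by (intro mult_left_mono power_mono) auto
      finally have "1 / (1 + norm y) ^ K \<le> c ^ K * eps j ^ K / (1 + norm z) ^ N"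
        using one_plus_norm_pow_pos[of z N] one_plus_norm_pow_pos[of y K] by (simp add: divide_simps mult_ac)
      then have "C * (1 / (1 + norm y) ^ K) \<le> C * (c ^ K * eps j ^ K / (1 + norm z) ^ N)"
        using C(1) by (intro mult_left_mono) auto
      then have "\<bar>\<kappa> y\<bar> \<le> C * c ^ K * eps j ^ K / (1 + norm z) ^ N"
        using C(2)[of y] by simp
      then have "\<bar>\<kappa> y\<bar> / eps j ^ DIM('a) \<le> C * c ^ K * eps j ^ K / (1 + norm z) ^ N / eps j ^ DIM('a)"
        using e by (intro divide_right_mono) auto
      also have "\<dots> = C * c ^ K * eps j ^ (N + 1) / (1 + norm z) ^ N"
        using e by (simp add: K_def power_add)
      also have "\<dots> \<le> C * c ^ K * eps j / (1 + norm z) ^ N"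
        using e e1 C(1) c power_le_one[of "eps j" N]
        by (intro divide_right_mono mult_left_mono) (auto intro: mult_left_le)
      finally have "\<bar>u z\<bar> * (\<bar>\<kappa> y\<bar> / eps j ^ DIM('a)) \<le> \<bar>u z\<bar> * (C * c ^ K * eps j / (1 + norm z) ^ N)"
        by (rule mult_left_mono) simp
      then show ?thesis using False e by (simp add: u2_def y_def abs_mult mult_ac del: scaleR_right_diff_distrib)
    qed
    have "\<forall>\<^sub>F j in sequentially. eps j < 1"
      using eps(2) by (rule order_tendstoD) simp
    then have ev: "\<forall>\<^sub>F j in sequentially. norm (\<integral>z. u2 z * ?k j z \<partial>lborel) \<le>
        (C * c ^ K * (\<integral>z. \<bar>u z\<bar> / (1 + norm z) ^ N \<partial>lborel)) * eps j"
    proof eventually_elim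
      case (elim j)
      have "norm (\<integral>z. u2 z * ?k j z \<partial>lborel) \<le> (\<integral>z. (C * c ^ K * eps j) * (\<bar>u z\<bar> / (1 + norm z) ^ N) \<partial>lborel)"
      proof (rule order_trans[OF integral_norm_bound], rule integral_mono)
        show "integrable lborel (\<lambda>z. norm (u2 z * ?k j z))"
          using integrable_tempered_rapid[OF u2 rk[of j]] by (intro integrable_norm) simp
        show "integrable lborel (\<lambda>z. (C * c ^ K * eps j) * (\<bar>u z\<bar> / (1 + norm z) ^ N))"
          using integrable_abs[OF N] by (intro integrable_mult_right) simp
      qed (use bd elim in auto)
      also have "\<dots> = (C * c ^ K * eps j) * (\<integral>z. \<bar>u z\<bar> / (1 + norm z) ^ N \<partial>lborel)"
        by (rule integral_mult_right_zero)
      finally show ?case by (simp only: mult_ac)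
    qed
    show ?thesis
      by (rule Lim_null_comparison[OF ev]) (use tendsto_mult_right[OF eps(2)] in \<open>auto intro: tendsto_mult_right_zero eps(2)\<close>)
  qed
  have "(\<integral>z. u z * ?k j z \<partial>lborel) = (\<integral>z. u1 z * ?k j z \<partial>lborel) + (\<integral>z. u2 z * ?k j z \<partial>lborel)" for j
  proof -
    have eq: "u z * ?k j z = u1 z * ?k j z + u2 z * ?k j z" for z
      by (simp add: u1_def u2_def indicator_def)
    show ?thesis
      unfolding eq
      by (rule Bochner_Integration.integral_add;
        rule integrable_tempered_rapid[OF _ rk[of j], unfolded real_scaleR_def])
        (rule u1 u2)+
  qed
  then show ?thesis using tendsto_add[OF A B] by simp
qed


subsection \<open>The Fourier transform of test functions\<close>

lemma exp_2pi_eq_cis: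
  "exp (2 * of_real pi * \<i> * of_real t) = cis (2 * pi * t)"
  "exp (- (2 * of_real pi * \<i> * of_real t)) = cis (- (2 * pi * t))"
  by (auto simp: cis_conv_exp mult_ac)

lemma fourier_cis: "fourier f \<xi> = (\<integral>x. cis (- (2 * pi * (\<xi> \<bullet> x))) * f x \<partial>lborel)"
  and inv_fourier_cis: "inv_fourier f x = (\<integral>\<xi>. cis (2 * pi * (\<xi> \<bullet> x)) * f \<xi> \<partial>lborel)"
  unfolding fourier_def inv_fourier_def exp_2pi_eq_cis by auto

lemma fourier_eq_inv_fourier: "fourier f \<xi> = inv_fourier f (- \<xi>)"
  by (simp add: fourier_cis inv_fourier_cis inner_commute)

lemma cis_measurable [measurable]: "cis \<in> borel_measurable borel"
  by (intro borel_measurable_continuous_onI continuous_intros)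

lemma integrable_cis_mult:
  assumes "integrable lborel f" and [measurable]: "g \<in> borel_measurable borel"
  shows "integrable lborel (\<lambda>x::'a::euclidean_space. cis (g x) * f x)"
proof -
  have [measurable]: "f \<in> borel_measurable borel" using assms(1) by auto
  show ?thesis
    by (rule Bochner_Integration.integrable_bound[OF assms(1)]) (auto simp: norm_mult)
qed

lemma norm_inv_fourier_le:
  fixes f :: "'a::euclidean_space \<Rightarrow> complex"
  shows "norm (inv_fourier f x) \<le> (\<integral>\<xi>. norm (f \<xi>) \<partial>lborel)"
  unfolding inv_fourier_cis
  using integral_norm_bound[of lborel "\<lambda>\<xi>. cis (2 * pi * (\<xi> \<bullet> x)) * f \<xi>"] by (simp add: norm_mult)

lemma inv_fourier_measurable [measurable]:
  assumes [measurable]: "f \<in> borel_measurable borel"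
  shows "inv_fourier f \<in> borel_measurable (borel :: 'a::euclidean_space measure)"
proof -
  have "(\<lambda>x. \<integral>\<xi>. cis (2 * pi * (\<xi> \<bullet> x)) * f \<xi> \<partial>lborel) \<in> borel_measurable (borel :: 'a measure)"
    by (rule lborel.borel_measurable_lebesgue_integral) measurable
  then show ?thesis unfolding inv_fourier_cis[abs_def] .
qed

lemma inv_fourier_swap:
  fixes f g :: "'a::euclidean_space \<Rightarrow> complex"
  assumes f: "integrable lborel f" and g: "integrable lborel g"
  shows "(\<integral>x. inv_fourier f x * g x \<partial>lborel) = (\<integral>\<xi>. f \<xi> * inv_fourier g \<xi> \<partial>lborel)"
proof -
  have [measurable]: "f \<in> borel_measurable borel" "g \<in> borel_measurable borel" using f g by auto
  have int: "integrable (lborel \<Otimes>\<^sub>M lborel) (\<lambda>(x, \<xi>). cis (2 * pi * (\<xi> \<bullet> x)) * (g x * f \<xi>))"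
    by (rule Bochner_Integration.integrable_bound[OF integrable_prod_mult[OF g f]])
      (auto simp: norm_mult case_prod_beta)
  have "(\<integral>x. inv_fourier f x * g x \<partial>lborel) = (\<integral>x. \<integral>\<xi>. cis (2 * pi * (\<xi> \<bullet> x)) * (g x * f \<xi>) \<partial>lborel \<partial>lborel)"
    unfolding inv_fourier_cis by (subst integral_mult_left_zero[symmetric]) (simp only: mult_ac)
  also have "\<dots> = (\<integral>\<xi>. \<integral>x. cis (2 * pi * (\<xi> \<bullet> x)) * (g x * f \<xi>) \<partial>lborel \<partial>lborel)"
    by (rule lborel_pair.Fubini_integral[OF int, symmetric])
  also have "\<dots> = (\<integral>\<xi>. f \<xi> * inv_fourier g \<xi> \<partial>lborel)"
    unfolding inv_fourier_cis by (subst integral_mult_right_zero[symmetric]) (simp only: mult_ac inner_commute)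
  finally show ?thesis .
qed

text \<open>All profiles are prescribed on the frequency side as real test functions; this operator
  carries them to physical space.\<close>

definition ift :: "('a::euclidean_space \<Rightarrow> real) \<Rightarrow> 'a \<Rightarrow> complex" where
  "ift F = inv_fourier (\<lambda>\<xi>. of_real (F \<xi>))"

lemma ift_eq: "ift F x = (\<integral>\<xi>. cis (2 * pi * (\<xi> \<bullet> x)) * of_real (F \<xi>) \<partial>lborel)"
  by (simp add: ift_def inv_fourier_cis)

abbreviation tf :: "('a::euclidean_space \<Rightarrow> real) \<Rightarrow> bool" where
  "tf \<equiv> test_function UNIV"

lemma tfI:
  assumes "C_infinity_on UNIV F" "\<And>x. norm x \<ge> r \<Longrightarrow> F x = 0"
  shows "tf F"
  unfolding test_function_def using assms
  by (auto intro!: exI[of _ "cball 0 r"])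

lemma tf_support:
  assumes "tf F" obtains r where "r > 0" "\<And>x. norm x \<ge> r \<Longrightarrow> F x = 0"
proof -
  obtain K where K: "compact K" "\<And>x. x \<notin> K \<Longrightarrow> F x = 0" using assms unfolding test_function_def by blast
  obtain r where r: "r > 0" "\<And>x. x \<in> K \<Longrightarrow> norm x < r"
    using compact_imp_bounded[OF K(1)] unfolding bounded_pos_less by blast
  show thesis by (rule that[OF r(1)]) (meson K(2) r(2) not_le)
qed

lemma tf_smooth: "tf F \<Longrightarrow> C_infinity_on UNIV F"
  by (simp add: test_function_def)

lemma tf_continuous: "tf F \<Longrightarrow> continuous_on UNIV F"
  using tf_smooth C_infinity_on_continuous by blast

lemma tf_measurable: "tf F \<Longrightarrow> F \<in> borel_measurable borel"
  by (rule borel_measurable_continuous_onI[OF tf_continuous])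

lemma tf_rapid:
  assumes "tf F" shows "rapid F"
proof (rule rapidI[OF tf_measurable[OF assms]])
  fix K
  obtain r where r: "r > 0" "\<And>x. norm x \<ge> r \<Longrightarrow> F x = 0" using tf_support[OF assms] by blast
  have "continuous_on (cball 0 r) F" by (rule continuous_on_subset[OF tf_continuous[OF assms]]) simp
  then have "compact ((\<lambda>x. norm (F x) * (1 + norm x) ^ K) ` cball 0 r)"
    by (intro compact_continuous_image continuous_intros) auto
  from compact_imp_bounded[OF this] obtain B where "B > 0"
    and B: "\<And>x. x \<in> cball 0 r \<Longrightarrow> norm (norm (F x) * (1 + norm x) ^ K) \<le> B"
    unfolding bounded_pos by blast
  have "norm (F x) * (1 + norm x) ^ K \<le> B" for x
  proof (cases "norm x \<le> r")
    case True
    then show ?thesis using B[of x] by simp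
  next
    case False
    then show ?thesis using r(2)[of x] \<open>B > 0\<close> by simp
  qed
  then have "norm (F x) \<le> B / (1 + norm x) ^ K" for x by (simp add: pos_le_divide_eq)
  then show "\<exists>C. \<forall>x. norm (F x) \<le> C / (1 + norm x) ^ K" by blast
qed

lemma tf_integrable: "tf F \<Longrightarrow> integrable lborel F"
  by (simp add: rapid_integrable tf_rapid)

lemma tf_integrable_complex: "tf F \<Longrightarrow> integrable lborel (\<lambda>x. complex_of_real (F x))"
  by (rule integrable_bounded_linear[OF bounded_linear_of_real tf_integrable])

lemma tf_mult:
  assumes "tf F" "C_infinity_on UNIV H" shows "tf (\<lambda>x. F x * H x)"
proof -
  obtain r where r: "r > 0" "\<And>x. norm x \<ge> r \<Longrightarrow> F x = 0" using tf_support[OF assms(1)] by blast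
  show ?thesis
    by (rule tfI[where r = r]) (use r(2) assms tf_smooth in \<open>auto intro!: C_infinity_on_mult\<close>)
qed

lemma tf_cmult: "tf F \<Longrightarrow> tf (\<lambda>x. c * F x)"
  using tf_mult[of F "\<lambda>_. c"] by (simp add: mult.commute)

lemma tf_add:
  assumes "tf F" "tf H" shows "tf (\<lambda>x. F x + H x)"
proof -
  obtain r where r: "r > 0" "\<And>x. norm x \<ge> r \<Longrightarrow> F x = 0" using tf_support[OF assms(1)] by blast
  obtain s where s: "s > 0" "\<And>x. norm x \<ge> s \<Longrightarrow> H x = 0" using tf_support[OF assms(2)] by blast
  show ?thesis
    by (rule tfI[where r = "max r s"]) (use r(2) s(2) assms tf_smooth in \<open>auto intro!: C_infinity_on_add\<close>)
qed

lemma tf_pd: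
  assumes "tf F" "e \<in> Basis" shows "tf (pd e F)"
proof -
  obtain r where r: "r > 0" "\<And>x. norm x \<ge> r \<Longrightarrow> F x = 0" using tf_support[OF assms(1)] by blast
  show ?thesis
  proof (rule tfI[where r = "r + 1"])
    show "C_infinity_on UNIV (pd e F)" by (rule C_infinity_on_pd[OF tf_smooth[OF assms(1)] assms(2)])
    fix x :: 'a assume x: "norm x \<ge> r + 1"
    have "pd e F x = pd e (\<lambda>x. 0) x"
    proof (rule pd_cong_open[where S = "- cball 0 r"])
      show "x \<in> - cball 0 r" using x by simp
      show "F y = 0" if "y \<in> - cball 0 r" for y using that r(2)[of y] by simp
    qed auto
    then show "pd e F x = 0" by simp
  qed
qed

lemma tf_bump: "r > 0 \<Longrightarrow> tf (bump c r)"
proof (rule tfI[OF C_infinity_on_bump, where r = "norm c + r"])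
  fix x :: 'a assume "r > 0" "norm c + r \<le> norm x"
  then show "bump c r x = 0"
    using norm_triangle_ineq2[of x c] by (intro bump_eq_0) auto
qed

lemma line_has_real_derivative:
  fixes f :: "'a::euclidean_space \<Rightarrow> real"
  assumes "f differentiable (at (x + t *\<^sub>R e))"
  shows "((\<lambda>t. f (x + t *\<^sub>R e)) has_real_derivative pd e f (x + t *\<^sub>R e)) (at t)"
proof -
  let ?D = "frechet_derivative f (at (x + t *\<^sub>R e))"
  have D: "(f has_derivative ?D) (at (x + t *\<^sub>R e))" using assms by (simp add: frechet_derivative_works)
  have "((\<lambda>t. x + t *\<^sub>R e) has_derivative (\<lambda>h. h *\<^sub>R e)) (at t)"
    by (auto intro!: derivative_eq_intros)
  from has_derivative_compose[OF this D]
  have "((\<lambda>t. f (x + t *\<^sub>R e)) has_derivative (\<lambda>h. ?D (h *\<^sub>R e))) (at t)" .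
  moreover have "?D (h *\<^sub>R e) = ?D e * h" for h
    using linear_cmul[OF has_derivative_linear[OF D]] by (simp add: mult.commute)
  ultimately show ?thesis by (simp add: has_field_derivative_def)
qed

lemma difference_quotient_limit:
  fixes f :: "'a::euclidean_space \<Rightarrow> real"
  assumes "f differentiable (at x)"
  shows "(\<lambda>n. (f (x + (1 / real (Suc n)) *\<^sub>R e) - f x) / (1 / real (Suc n))) \<longlonglongrightarrow> pd e f x"
proof -
  have "((\<lambda>t. f (x + t *\<^sub>R e)) has_real_derivative pd e f (x + 0 *\<^sub>R e)) (at 0)"
    by (rule line_has_real_derivative) (use assms in simp)
  then have "((\<lambda>h. (f (x + h *\<^sub>R e) - f x) / h) \<longlongrightarrow> pd e f x) (at 0)"
    by (simp add: DERIV_def)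
  moreover have "filterlim (\<lambda>n. 1 / real (Suc n)) (at 0) sequentially"
    by (rule filterlim_atI) (use LIMSEQ_inverse_real_of_nat in \<open>auto simp: inverse_eq_divide\<close>)
  ultimately show ?thesis by (rule filterlim_compose)
qed

text \<open>By translation invariance every difference quotient integrates to 0. The mean value
  theorem bounds the quotients by the supremum of the derivative on one fixed ball, so the limit
  passes under the integral.\<close>

lemma integral_pd_eq_0:
  fixes G :: "'a::euclidean_space \<Rightarrow> real"
  assumes G: "tf G" and e: "e \<in> Basis"
  shows "(\<integral>x. pd e G x \<partial>lborel) = 0"
proof -
  obtain r where r: "r > 0" "\<And>x. norm x \<ge> r \<Longrightarrow> G x = 0" using tf_support[OF G] by blast
  obtain B where B: "B > 0" "\<And>x. norm (pd e G x) \<le> B" using rapid_bounded[OF tf_rapid[OF tf_pd[OF G e]]] by blast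
  note [measurable] = tf_measurable[OF G] tf_measurable[OF tf_pd[OF G e]]
  define q where "q n x = (G (x + (1 / real (Suc n)) *\<^sub>R e) - G x) / (1 / real (Suc n))" for n x
  have diff: "G differentiable (at x)" for x using C_infinity_onD[OF tf_smooth[OF G]] by simp
  have "(\<lambda>n. \<integral>x. q n x \<partial>lborel) \<longlonglongrightarrow> (\<integral>x. pd e G x \<partial>lborel)"
  proof (rule integral_dominated_convergence[where w = "\<lambda>x. B * indicator (cball 0 (r + 1)) x"])
    show "integrable lborel (\<lambda>x::'a. B * indicator (cball 0 (r + 1)) x)"
      using emeasure_bounded_finite[OF bounded_cball, of 0 "r + 1"]
      by (intro integrable_mult_right integrable_real_indicator) auto
    show "AE x in lborel. norm (q n x) \<le> B * indicator (cball 0 (r + 1)) x" for n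
    proof (rule AE_I2)
      fix x :: 'a
      let ?h = "1 / real (Suc n)"
      show "norm (q n x) \<le> B * indicator (cball 0 (r + 1)) x"
      proof (cases "norm x \<le> r + 1")
        case True
        obtain z where "0 < z" "z < ?h" and z: "G (x + ?h *\<^sub>R e) - G (x + 0 *\<^sub>R e) = (?h - 0) * pd e G (x + z *\<^sub>R e)"
          using MVT2[of 0 ?h "\<lambda>t. G (x + t *\<^sub>R e)" "\<lambda>t. pd e G (x + t *\<^sub>R e)"] line_has_real_derivative[OF diff] by auto
        then have "q n x = pd e G (x + z *\<^sub>R e)" by (simp add: q_def)
        then show ?thesis using B(2)[of "x + z *\<^sub>R e"] True by simp
      next
        case False
        have "norm (?h *\<^sub>R e) \<le> 1" using e by (simp add: field_simps)
        then have "norm (x + ?h *\<^sub>R e) \<ge> r" using False norm_diff_ineq[of x "?h *\<^sub>R e"] by linarith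
        then show ?thesis using False r(2)[of x] r(2)[of "x + ?h *\<^sub>R e"] by (simp add: q_def)
      qed
    qed
    show "AE x in lborel. (\<lambda>n. q n x) \<longlonglongrightarrow> pd e G x"
      unfolding q_def by (intro AE_I2 difference_quotient_limit diff)
  qed (simp_all add: q_def[abs_def])
  moreover have "(\<integral>x. q n x \<partial>lborel) = 0" for n
    unfolding q_def
    using integral_translate[OF tf_measurable[OF G], of "(1 / real (Suc n)) *\<^sub>R e"]
      integrable_translate[OF tf_integrable[OF G], of "(1 / real (Suc n)) *\<^sub>R e"] tf_integrable[OF G]
    by simp
  ultimately show ?thesis using LIMSEQ_unique[OF _ tendsto_const] by simp
qed

lemma pd_mult:
  fixes f g :: "'a::euclidean_space \<Rightarrow> real"
  assumes "f differentiable (at x)" "g differentiable (at x)"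
  shows "pd e (\<lambda>x. f x * g x) x = f x * pd e g x + pd e f x * g x"
  using assms by (intro pd_eqI[where f' = "\<lambda>h. f x * frechet_derivative g (at x) h + frechet_derivative f (at x) h * g x"])
    (auto simp: frechet_derivative_works intro: has_derivative_mult)

lemma C_infinity_on_trig:
  "C_infinity_on UNIV (\<lambda>\<xi>. cos (2 * pi * (\<xi> \<bullet> x)))" "C_infinity_on UNIV (\<lambda>\<xi>. sin (2 * pi * (\<xi> \<bullet> x)))"
  by (intro C_infinity_on_sin_cos C_infinity_on_mult C_infinity_on_const C_infinity_on_inner_left open_UNIV)+

lemma integral_cis_split:
  assumes "integrable lborel F"
  shows "(\<integral>\<xi>. cis (2 * pi * (\<xi> \<bullet> x)) * complex_of_real (F \<xi>) \<partial>lborel) =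
    of_real (\<integral>\<xi>. F \<xi> * cos (2 * pi * (\<xi> \<bullet> x)) \<partial>lborel) + \<i> * of_real (\<integral>\<xi>. F \<xi> * sin (2 * pi * (\<xi> \<bullet> x)) \<partial>lborel)"
proof -
  have m[measurable]: "F \<in> borel_measurable borel" using assms by auto
  have i: "integrable lborel (\<lambda>\<xi>. F \<xi> * cos (2 * pi * (\<xi> \<bullet> x)))" "integrable lborel (\<lambda>\<xi>. F \<xi> * sin (2 * pi * (\<xi> \<bullet> x)))"
    by (rule Bochner_Integration.integrable_bound[OF assms]; auto simp: abs_mult intro!: mult_left_le)+
  have "cis (2 * pi * (\<xi> \<bullet> x)) * complex_of_real (F \<xi>) =
      of_real (F \<xi> * cos (2 * pi * (\<xi> \<bullet> x))) + \<i> * of_real (F \<xi> * sin (2 * pi * (\<xi> \<bullet> x)))" for \<xi>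
    by (simp add: complex_eq_iff)
  then show ?thesis using i by (simp del: of_real_mult)
qed

lemma ift_Re: "integrable lborel F \<Longrightarrow> Re (ift F x) = (\<integral>\<xi>. F \<xi> * cos (2 * pi * (\<xi> \<bullet> x)) \<partial>lborel)"
  and ift_Im: "integrable lborel F \<Longrightarrow> Im (ift F x) = (\<integral>\<xi>. F \<xi> * sin (2 * pi * (\<xi> \<bullet> x)) \<partial>lborel)"
  unfolding ift_eq by (simp_all add: integral_cis_split)

text \<open>Integration by parts, as \<open>integral_pd_eq_0\<close> for F times a cosine and F
  times a sine. The exponential is split because test functions are real.\<close>

lemma ift_pd:
  fixes F :: "'a::euclidean_space \<Rightarrow> real"
  assumes F: "tf F" and e: "e \<in> Basis"
  shows "ift (pd e F) x = - (2 * pi * \<i> * (x \<bullet> e)) * ift F x"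
proof -
  have dF: "F differentiable (at y)" for y using C_infinity_onD[OF tf_smooth[OF F]] by simp
  have dc: "((\<lambda>\<xi>. cos (2 * pi * (\<xi> \<bullet> x))) has_derivative (\<lambda>h. - sin (2 * pi * (y \<bullet> x)) * (2 * pi * (h \<bullet> x)))) (at y)" for y
    by (auto intro!: derivative_eq_intros)
  have ds: "((\<lambda>\<xi>. sin (2 * pi * (\<xi> \<bullet> x))) has_derivative (\<lambda>h. cos (2 * pi * (y \<bullet> x)) * (2 * pi * (h \<bullet> x)))) (at y)" for y
    by (auto intro!: derivative_eq_intros)
  have int: "integrable lborel (\<lambda>\<xi>. H \<xi> * cos (2 * pi * (\<xi> \<bullet> x)))" "integrable lborel (\<lambda>\<xi>. H \<xi> * sin (2 * pi * (\<xi> \<bullet> x)))"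
    if "tf H" for H using that by (intro tf_integrable tf_mult C_infinity_on_trig; assumption)+
  have "pd e (\<lambda>\<xi>. F \<xi> * cos (2 * pi * (\<xi> \<bullet> x))) y =
      pd e F y * cos (2 * pi * (y \<bullet> x)) - 2 * pi * (x \<bullet> e) * (F y * sin (2 * pi * (y \<bullet> x)))" for y
    using pd_mult[OF dF, of "\<lambda>\<xi>. cos (2 * pi * (\<xi> \<bullet> x))" y e] dc[of y] pd_eqI[OF dc[of y], of e]
    by (auto simp: differentiable_def inner_commute algebra_simps)
  then have c: "(\<integral>\<xi>. pd e F \<xi> * cos (2 * pi * (\<xi> \<bullet> x)) \<partial>lborel) = 2 * pi * (x \<bullet> e) * (\<integral>\<xi>. F \<xi> * sin (2 * pi * (\<xi> \<bullet> x)) \<partial>lborel)"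
    using integral_pd_eq_0[OF tf_mult[OF F C_infinity_on_trig(1)] e, of x] int(1)[OF tf_pd[OF F e]] int(2)[OF F]
    by simp
  have "pd e (\<lambda>\<xi>. F \<xi> * sin (2 * pi * (\<xi> \<bullet> x))) y =
      pd e F y * sin (2 * pi * (y \<bullet> x)) + 2 * pi * (x \<bullet> e) * (F y * cos (2 * pi * (y \<bullet> x)))" for y
    using pd_mult[OF dF, of "\<lambda>\<xi>. sin (2 * pi * (\<xi> \<bullet> x))" y e] ds[of y] pd_eqI[OF ds[of y], of e]
    by (auto simp: differentiable_def inner_commute algebra_simps)
  then have s: "(\<integral>\<xi>. pd e F \<xi> * sin (2 * pi * (\<xi> \<bullet> x)) \<partial>lborel) = - (2 * pi * (x \<bullet> e) * (\<integral>\<xi>. F \<xi> * cos (2 * pi * (\<xi> \<bullet> x)) \<partial>lborel))"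
    using integral_pd_eq_0[OF tf_mult[OF F C_infinity_on_trig(2)] e, of x] int(2)[OF tf_pd[OF F e]] int(1)[OF F]
    by simp
  show ?thesis
    using c s by (simp add: complex_eq_iff ift_Re ift_Im tf_integrable F e tf_pd)
qed

lemma ift_measurable: "tf F \<Longrightarrow> ift F \<in> borel_measurable borel"
  unfolding ift_def by (rule inv_fourier_measurable) (use tf_measurable in measurable)

text \<open>A factor |x| is traded for partial derivatives of F, which are again test functions;
  hence the induction on the power generalises F.\<close>

lemma ift_rapid:
  fixes F :: "'a::euclidean_space \<Rightarrow> real"
  assumes "tf F" shows "rapid (ift F)"
proof -
  have "\<exists>C. \<forall>x. norm (ift F x) * (1 + norm x) ^ K \<le> C" for K
    using assms
  proof (induction K arbitrary: F)
    case 0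
    then show ?case using norm_inv_fourier_le unfolding ift_def by (metis mult.right_neutral power_0)
  next
    case (Suc K)
    obtain C where C: "\<And>x. norm (ift F x) * (1 + norm x) ^ K \<le> C" using Suc by blast
    have "\<forall>b\<in>Basis. \<exists>C. \<forall>x. norm (ift (pd b F) x) * (1 + norm x) ^ K \<le> C"
      using Suc.IH tf_pd[OF Suc.prems] by blast
    then obtain D where D: "\<And>b x. b \<in> Basis \<Longrightarrow> norm (ift (pd b F) x) * (1 + norm x) ^ K \<le> D b"
      by metis
    have "norm (ift F x) * (1 + norm x) ^ Suc K \<le> C + (\<Sum>b\<in>Basis. D b)" for x
    proof -
      let ?A = "norm (ift F x) * (1 + norm x) ^ K"
      have A0: "?A \<ge> 0" by simp
      have "?A * norm x \<le> ?A * (\<Sum>b\<in>Basis. \<bar>x \<bullet> b\<bar>)" using norm_le_l1[of x] A0 by (intro mult_left_mono)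
      also have "\<dots> = (\<Sum>b\<in>Basis. \<bar>x \<bullet> b\<bar> * ?A)" by (simp add: sum_distrib_left mult_ac)
      also have "\<dots> \<le> (\<Sum>b\<in>Basis. D b)"
      proof (rule sum_mono)
        fix b :: 'a assume b: "b \<in> Basis"
        have "norm (ift (pd b F) x) = 2 * pi * (\<bar>x \<bullet> b\<bar> * norm (ift F x))"
          by (simp add: ift_pd[OF Suc.prems b] norm_mult)
        moreover have "1 \<le> 2 * pi" using pi_ge_two by linarith
        ultimately have "\<bar>x \<bullet> b\<bar> * norm (ift F x) \<le> norm (ift (pd b F) x)"
          using mult_right_mono[of 1 "2 * pi" "\<bar>x \<bullet> b\<bar> * norm (ift F x)"] by simp
        then have "\<bar>x \<bullet> b\<bar> * norm (ift F x) * (1 + norm x) ^ K \<le> norm (ift (pd b F) x) * (1 + norm x) ^ K"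
          by (rule mult_right_mono) simp
        moreover have "\<bar>x \<bullet> b\<bar> * ?A = \<bar>x \<bullet> b\<bar> * norm (ift F x) * (1 + norm x) ^ K" by simp
        ultimately show "\<bar>x \<bullet> b\<bar> * ?A \<le> D b" using D[OF b, of x] by linarith
      qed
      finally show ?thesis using C[of x] by (simp add: distrib_left distrib_right mult_ac)
    qed
    then show ?case by blast
  qed
  then show ?thesis unfolding rapid_def using ift_measurable[OF assms] by blast
qed

lemma norm_cis_minus_linear_le: "norm (cis t - 1 - \<i> * t) \<le> t\<^sup>2 / 2"
  using iexp_approx1[of t 1] by (simp add: cis_conv_exp diff_diff_eq power2_eq_square)

text \<open>Second-order expansion of the exponential under the integral: the remainder is quadratic
  in h, with a multiple of the second moment of |F| as its constant. This moment is finite by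
  compact support.\<close>

lemma ift_has_derivative:
  fixes F :: "'a::euclidean_space \<Rightarrow> real"
  assumes F: "tf F"
  shows "(ift F has_derivative (\<lambda>h. 2 * pi * \<i> * (\<Sum>b\<in>Basis. (h \<bullet> b) * ift (\<lambda>\<xi>. F \<xi> * (\<xi> \<bullet> b)) x))) (at x)"
proof -
  have tb: "tf (\<lambda>\<xi>. F \<xi> * (\<xi> \<bullet> b))" for b by (rule tf_mult[OF F C_infinity_on_inner_left])
  have tbb: "tf (\<lambda>\<xi>. F \<xi> * (norm \<xi>)\<^sup>2)"
    using tf_mult[OF F, of "\<lambda>\<xi>. (norm (\<xi> - 0))\<^sup>2"] C_infinity_on_norm_sq[of UNIV 0] by simp
  define M where "M = (\<integral>\<xi>. \<bar>F \<xi> * (norm \<xi>)\<^sup>2\<bar> \<partial>lborel)"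
  have M0: "M \<ge> 0" unfolding M_def by simp
  define L where "L h = 2 * pi * \<i> * (\<Sum>b\<in>Basis. (h \<bullet> b) * ift (\<lambda>\<xi>. F \<xi> * (\<xi> \<bullet> b)) x)" for h
  have bl: "bounded_linear L"
    unfolding L_def
    by (intro bounded_linear_const_mult bounded_linear_sum bounded_linear_mult_const
        bounded_linear_compose[OF bounded_linear_of_real] bounded_linear_inner_left)
  have L: "L h = (\<integral>\<xi>. cis (2 * pi * (\<xi> \<bullet> x)) * (\<i> * (2 * pi * (\<xi> \<bullet> h))) * of_real (F \<xi>) \<partial>lborel)"
    and Lint: "integrable lborel (\<lambda>\<xi>. cis (2 * pi * (\<xi> \<bullet> x)) * (\<i> * (2 * pi * (\<xi> \<bullet> h))) * of_real (F \<xi>))" for h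
  proof -
    have ib: "integrable lborel (\<lambda>\<xi>. cis (2 * pi * (\<xi> \<bullet> x)) * of_real (F \<xi> * (\<xi> \<bullet> b)))" for b
      by (rule integrable_cis_mult[OF tf_integrable_complex[OF tb]]) measurable
    have eq: "cis (2 * pi * (\<xi> \<bullet> x)) * (\<i> * (2 * pi * (\<xi> \<bullet> h))) * of_real (F \<xi>) =
        (\<Sum>b\<in>Basis. (2 * pi * \<i> * (h \<bullet> b)) * (cis (2 * pi * (\<xi> \<bullet> x)) * of_real (F \<xi> * (\<xi> \<bullet> b))))" for \<xi>
      by (subst euclidean_inner[of \<xi> h]) (simp add: sum_distrib_left sum_distrib_right mult_ac)
    show "integrable lborel (\<lambda>\<xi>. cis (2 * pi * (\<xi> \<bullet> x)) * (\<i> * (2 * pi * (\<xi> \<bullet> h))) * of_real (F \<xi>))"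
      unfolding eq by (intro Bochner_Integration.integrable_sum integrable_mult_right ib)
    have "(\<integral>\<xi>. cis (2 * pi * (\<xi> \<bullet> x)) * (\<i> * (2 * pi * (\<xi> \<bullet> h))) * of_real (F \<xi>) \<partial>lborel) =
        (\<Sum>b\<in>Basis. (2 * pi * \<i> * (h \<bullet> b)) * ift (\<lambda>\<xi>. F \<xi> * (\<xi> \<bullet> b)) x)"
      unfolding eq ift_eq using ib
      by (subst Bochner_Integration.integral_sum) (auto intro!: integrable_mult_right)
    then show "L h = (\<integral>\<xi>. cis (2 * pi * (\<xi> \<bullet> x)) * (\<i> * (2 * pi * (\<xi> \<bullet> h))) * of_real (F \<xi>) \<partial>lborel)"
      unfolding L_def by (simp add: sum_distrib_left mult_ac)
  qed
  have est: "norm (ift F (x + h) - ift F x - L h) \<le> 2 * pi\<^sup>2 * M * (norm h)\<^sup>2" for h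
  proof -
    have i1: "integrable lborel (\<lambda>\<xi>. cis (2 * pi * (\<xi> \<bullet> y)) * of_real (F \<xi>))" for y
      by (rule integrable_cis_mult[OF tf_integrable_complex[OF F]]) measurable
    let ?I = "(\<integral>\<xi>. cis (2 * pi * (\<xi> \<bullet> (x + h))) * of_real (F \<xi>)
        - cis (2 * pi * (\<xi> \<bullet> x)) * of_real (F \<xi>)
        - cis (2 * pi * (\<xi> \<bullet> x)) * (\<i> * (2 * pi * (\<xi> \<bullet> h))) * of_real (F \<xi>) \<partial>lborel)"
    have "ift F (x + h) - ift F x - L h = ?I"
      using i1 Lint unfolding L ift_eq by simp
    then have "norm (ift F (x + h) - ift F x - L h) = norm ?I" by (rule arg_cong)
    also have "\<dots> \<le> (\<integral>\<xi>. 2 * pi\<^sup>2 * (norm h)\<^sup>2 * \<bar>F \<xi> * (norm \<xi>)\<^sup>2\<bar> \<partial>lborel)"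
    proof (rule order_trans[OF integral_norm_bound], rule integral_mono)
      show "integrable lborel (\<lambda>\<xi>. 2 * pi\<^sup>2 * (norm h)\<^sup>2 * \<bar>F \<xi> * (norm \<xi>)\<^sup>2\<bar>)"
        by (intro integrable_mult_right integrable_abs tf_integrable tbb)
      fix \<xi> :: 'a
      let ?t = "2 * pi * (\<xi> \<bullet> h)"
      have "cis (2 * pi * (\<xi> \<bullet> (x + h))) * of_real (F \<xi>) - cis (2 * pi * (\<xi> \<bullet> x)) * of_real (F \<xi>)
          - cis (2 * pi * (\<xi> \<bullet> x)) * (\<i> * ?t) * of_real (F \<xi>) =
          cis (2 * pi * (\<xi> \<bullet> x)) * of_real (F \<xi>) * (cis ?t - 1 - \<i> * ?t)"
        by (simp add: inner_add_right distrib_left cis_mult[symmetric] right_diff_distrib mult_ac)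
      then have "norm (cis (2 * pi * (\<xi> \<bullet> (x + h))) * of_real (F \<xi>) - cis (2 * pi * (\<xi> \<bullet> x)) * of_real (F \<xi>)
          - cis (2 * pi * (\<xi> \<bullet> x)) * (\<i> * ?t) * of_real (F \<xi>)) = \<bar>F \<xi>\<bar> * norm (cis ?t - 1 - \<i> * ?t)"
        by (simp only: norm_mult norm_cis norm_of_real mult_1)
      also have "\<dots> \<le> \<bar>F \<xi>\<bar> * (?t\<^sup>2 / 2)"
        by (rule mult_left_mono[OF norm_cis_minus_linear_le]) simp
      also have "?t\<^sup>2 = 4 * pi\<^sup>2 * (\<xi> \<bullet> h)\<^sup>2" by (simp add: power_mult_distrib)
      also have "\<bar>F \<xi>\<bar> * (4 * pi\<^sup>2 * (\<xi> \<bullet> h)\<^sup>2 / 2) \<le> \<bar>F \<xi>\<bar> * (4 * pi\<^sup>2 * ((norm \<xi>)\<^sup>2 * (norm h)\<^sup>2) / 2)"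
        using Cauchy_Schwarz_ineq[of \<xi> h]
        by (intro mult_left_mono divide_right_mono) (auto simp: power2_norm_eq_inner)
      finally show "norm (cis (2 * pi * (\<xi> \<bullet> (x + h))) * of_real (F \<xi>) - cis (2 * pi * (\<xi> \<bullet> x)) * of_real (F \<xi>)
          - cis (2 * pi * (\<xi> \<bullet> x)) * (\<i> * ?t) * of_real (F \<xi>)) \<le> 2 * pi\<^sup>2 * (norm h)\<^sup>2 * \<bar>F \<xi> * (norm \<xi>)\<^sup>2\<bar>"
        by (simp add: abs_mult mult_ac)
    qed (intro integrable_norm Bochner_Integration.integrable_diff i1 Lint)
    also have "\<dots> = 2 * pi\<^sup>2 * (norm h)\<^sup>2 * M" unfolding M_def by (rule integral_mult_right_zero)
    also have "\<dots> = 2 * pi\<^sup>2 * M * (norm h)\<^sup>2" by simp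
    finally show ?thesis .
  qed
  have "(ift F has_derivative L) (at x)"
    unfolding has_derivative_iff_norm
  proof (intro conjI bl)
    show "((\<lambda>y. norm (ift F y - ift F x - L (y - x)) / norm (y - x)) \<longlongrightarrow> 0) (at x)"
    proof (rule Lim_null_comparison[where g = "\<lambda>y. 2 * pi\<^sup>2 * M * norm (y - x)"])
      show "\<forall>\<^sub>F y in at x. norm (norm (ift F y - ift F x - L (y - x)) / norm (y - x)) \<le> 2 * pi\<^sup>2 * M * norm (y - x)"
      proof (rule always_eventually, rule allI)
        fix y
        show "norm (norm (ift F y - ift F x - L (y - x)) / norm (y - x)) \<le> 2 * pi\<^sup>2 * M * norm (y - x)"
          using est[of "y - x"] by (cases "y = x") (auto simp: pos_divide_le_eq power2_eq_square mult_ac)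
      qed
      show "((\<lambda>y. 2 * pi\<^sup>2 * M * norm (y - x)) \<longlongrightarrow> 0) (at x)"
        by (auto intro!: tendsto_eq_intros)
    qed
  qed
  then show ?thesis unfolding L_def .
qed

lemma ift_differentiable: "tf F \<Longrightarrow> ift F differentiable (at x)"
  using ift_has_derivative differentiable_def by blast

lemma pd_ift:
  assumes "tf F" "e \<in> Basis"
  shows "pd e (ift F) x = 2 * pi * \<i> * ift (\<lambda>\<xi>. F \<xi> * (\<xi> \<bullet> e)) x"
proof -
  have "(\<Sum>b\<in>Basis. complex_of_real (e \<bullet> b) * ift (\<lambda>\<xi>. F \<xi> * (\<xi> \<bullet> b)) x) =
      (\<Sum>b\<in>Basis. if b = e then ift (\<lambda>\<xi>. F \<xi> * (\<xi> \<bullet> b)) x else 0)"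
    using assms(2) by (intro sum.cong) (auto simp: inner_Basis)
  then show ?thesis using pd_eqI[OF ift_has_derivative[OF assms(1), of x], where e = e] assms(2) by simp
qed

text \<open>Transforms of test functions are closed under differentiation up to constants, so the
  Schwartz bounds on all derivatives reduce to \<open>ift_rapid\<close>.\<close>

lemma iter_partial_ift:
  assumes "tf F" "set es \<subseteq> Basis"
  shows "\<exists>c H. tf H \<and> iter_partial es (ift F) = (\<lambda>x. c * ift H x)"
  using assms(2)
proof (induction es)
  case Nil
  then show ?case using assms(1) by (auto intro!: exI[of _ 1])
next
  case (Cons e es)
  then obtain c H where H: "tf H" "iter_partial es (ift F) = (\<lambda>x. c * ift H x)" by auto
  have "pd e (\<lambda>x. c * ift H x) x = c * (2 * pi * \<i>) * ift (\<lambda>\<xi>. H \<xi> * (\<xi> \<bullet> e)) x" for x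
  proof -
    have "((\<lambda>x. c * ift H x) has_derivative (\<lambda>h. c * frechet_derivative (ift H) (at x) h)) (at x)"
      using ift_differentiable[OF H(1)] by (intro has_derivative_mult_right) (simp add: frechet_derivative_works)
    from pd_eqI[OF this, of e] show ?thesis using pd_ift[OF H(1), of e x] Cons.prems by (simp add: mult_ac)
  qed
  then show ?case using H(2) tf_mult[OF H(1) C_infinity_on_inner_left, of e] by auto
qed

text \<open>L will be the real or the imaginary part, which makes real-valued Schwartz functions out
  of a complex transform.\<close>

lemma schwartz_linear_ift:
  assumes F: "tf F" and L: "bounded_linear L"
  shows "schwartz (\<lambda>x. L (ift F x))"
proof -
  have smooth: "C_infinity_on UNIV (ift F)"
    unfolding C_infinity_on_def
  proof (intro allI impI ballI)
    fix es x assume "set es \<subseteq> (Basis::'a set)"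
    then obtain c H where "tf H" "iter_partial es (ift F) = (\<lambda>x. c * ift H x)" using iter_partial_ift[OF F] by blast
    then show "iter_partial es (ift F) differentiable at x"
      using ift_differentiable by (auto intro!: derivative_intros)
  qed
  have it: "iter_partial es (\<lambda>x. L (ift F x)) = (\<lambda>x. L (iter_partial es (ift F) x))" if "set es \<subseteq> Basis" for es
    using that
  proof (induction es)
    case (Cons e es)
    have "pd e (\<lambda>x. L (iter_partial es (ift F) x)) x = L (pd e (iter_partial es (ift F)) x)" for x
    proof -
      have "iter_partial es (ift F) differentiable (at x)"
        using smooth Cons.prems unfolding C_infinity_on_def by simp
      then have "((\<lambda>x. L (iter_partial es (ift F) x)) has_derivative
          (\<lambda>h. L (frechet_derivative (iter_partial es (ift F)) (at x) h))) (at x)"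
        by (intro bounded_linear.has_derivative[OF L]) (simp add: frechet_derivative_works)
      from pd_eqI[OF this] show ?thesis .
    qed
    then show ?case using Cons by simp
  qed simp
  obtain B where B: "\<And>z. norm (L z) \<le> norm z * B" "B > 0"
    using bounded_linear.pos_bounded[OF L] by blast
  show ?thesis
    unfolding schwartz_def
  proof (intro conjI allI impI)
    show "C_infinity_on UNIV (\<lambda>x. L (ift F x))"
      by (rule C_infinity_on_bounded_linear[OF open_UNIV L smooth])
    fix k es assume es: "set es \<subseteq> (Basis::'a set)"
    then obtain c H where H: "tf H" "iter_partial es (ift F) = (\<lambda>x. c * ift H x)" using iter_partial_ift[OF F] by blast
    obtain C where C: "C > 0" "\<And>x. norm (ift H x) \<le> C / (1 + norm x) ^ k"
      using rapidE[OF ift_rapid[OF H(1)]] by blast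
    have "norm (norm x ^ k * iter_partial es (\<lambda>x. L (ift F x)) x) \<le> norm c * C * B" for x
    proof -
      have "norm x ^ k * norm (ift H x) \<le> (1 + norm x) ^ k * norm (ift H x)"
        by (intro mult_right_mono power_mono) auto
      also have "\<dots> \<le> C" using C(2)[of x] by (simp add: pos_le_divide_eq mult.commute)
      finally have 1: "norm x ^ k * norm (ift H x) \<le> C" .
      have "norm (norm x ^ k * iter_partial es (\<lambda>x. L (ift F x)) x) = norm x ^ k * norm (L (c * ift H x))"
        by (simp add: it[OF es] H(2) abs_mult)
      also have "\<dots> \<le> norm x ^ k * (norm (c * ift H x) * B)" using B(1) by (intro mult_left_mono) auto
      also have "\<dots> = (norm x ^ k * norm (ift H x)) * (norm c * B)" by (simp add: norm_mult mult_ac)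
      also have "\<dots> \<le> C * (norm c * B)" using 1 B(2) by (intro mult_right_mono) auto
      finally show ?thesis by (simp add: mult_ac)
    qed
    then show "bounded (range (\<lambda>x. norm x ^ k * iter_partial es (\<lambda>x. L (ift F x)) x))"
      unfolding bounded_iff by auto
  qed
qed


subsection \<open>Gaussians, Fourier inversion and Plancherel\<close>

lemma cnj_measurable [measurable]: "cnj \<in> borel_measurable borel"
  by (intro borel_measurable_continuous_onI continuous_intros)

lemma integral_lborel_prod:
  fixes f :: "'a::euclidean_space \<Rightarrow> real \<Rightarrow> complex"
  assumes "\<And>b. b \<in> Basis \<Longrightarrow> integrable lborel (f b)"
  shows "(\<integral>x. (\<Prod>b\<in>Basis. f b (x \<bullet> b)) \<partial>lborel) = (\<Prod>b\<in>Basis. \<integral>t. f b t \<partial>lborel)"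
proof -
  interpret P: product_sigma_finite "\<lambda>_::'a. lborel :: real measure"
    by standard
  have [measurable]: "f b \<in> borel_measurable borel" if "b \<in> Basis" for b
    using assms[OF that] by auto
  have "(\<integral>x. (\<Prod>b\<in>Basis. f b (x \<bullet> b)) \<partial>lborel) =
      (\<integral>w. (\<Prod>b\<in>Basis. f b ((\<Sum>c\<in>Basis. w c *\<^sub>R c) \<bullet> b)) \<partial>(\<Pi>\<^sub>M b\<in>Basis. lborel))"
    by (subst lborel_eq, subst integral_distr) auto
  also have "\<dots> = (\<integral>w. (\<Prod>b\<in>Basis. f b (w b)) \<partial>(\<Pi>\<^sub>M b\<in>Basis. lborel))"
    by (intro Bochner_Integration.integral_cong prod.cong refl) simp
  also have "\<dots> = (\<Prod>b\<in>Basis. \<integral>t. f b t \<partial>lborel)"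
    by (rule P.product_integral_prod) (use assms in auto)
  finally show ?thesis .
qed

lemma std_normal_fourier:
  "integrable lborel (\<lambda>y::real. cis (2 * pi * (y * s)) * of_real (exp (- pi * y\<^sup>2)))"
  "(\<integral>y. cis (2 * pi * (y * s)) * of_real (exp (- pi * y\<^sup>2)) \<partial>lborel) = of_real (exp (- pi * s\<^sup>2))"
proof -
  \<comment> \<open>Rescaling the characteristic function of the standard normal law by this
    constant yields the Gaussian that is its own transform.\<close>
  define c where "c = sqrt (2 * pi)"
  have c: "c > 0" "c\<^sup>2 = 2 * pi" by (auto simp: c_def)
  have dens: "std_normal_density (c * y) = exp (- pi * y\<^sup>2) / c" for y
    unfolding std_normal_density_def c_def[symmetric] using c by (simp add: power_mult_distrib)
  have int1: "integrable lborel std_normal_density"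
    by (rule integrable_normal_density) simp
  have int: "integrable lborel (\<lambda>y::real. exp (- pi * y\<^sup>2))"
    using integrable_mult_right[OF lborel_integrable_real_affine[OF int1, of c 0], of c] c(1) by (simp add: dens)
  then show i: "integrable lborel (\<lambda>y::real. cis (2 * pi * (y * s)) * of_real (exp (- pi * y\<^sup>2)))"
    by (intro integrable_cis_mult integrable_bounded_linear[OF bounded_linear_of_real]) auto
  have "of_real (exp (- ((c * s)\<^sup>2) / 2)) = char std_normal_distribution (c * s)"
    by (simp add: char_std_normal_distribution)
  also have "\<dots> = (\<integral>x. std_normal_density x *\<^sub>R iexp (c * s * x) \<partial>lborel)"
    unfolding char_def by (subst integral_density) (auto simp: mult_ac)
  also have "\<dots> = c *\<^sub>R (\<integral>y. std_normal_density (c * y) *\<^sub>R iexp (c * s * (c * y)) \<partial>lborel)"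
    by (subst lborel_integral_real_affine[where c = c and t = 0]) (use c in auto)
  also have "\<dots> = (\<integral>y. c *\<^sub>R (std_normal_density (c * y) *\<^sub>R iexp (c * s * (c * y))) \<partial>lborel)"
    unfolding scaleR_conv_of_real by (rule integral_mult_right_zero[symmetric])
  also have "\<dots> = (\<integral>y. cis (2 * pi * (y * s)) * of_real (exp (- pi * y\<^sup>2)) \<partial>lborel)"
  proof (rule Bochner_Integration.integral_cong[OF refl])
    fix y
    have e: "c * s * (c * y) = 2 * pi * (y * s)" using c(2) by (simp add: power2_eq_square mult_ac)
    show "c *\<^sub>R (std_normal_density (c * y) *\<^sub>R iexp (c * s * (c * y))) =
        cis (2 * pi * (y * s)) * of_real (exp (- pi * y\<^sup>2))"
      using c(1) unfolding dens cis_conv_exp[symmetric] e by (simp add: scaleR_conv_of_real)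
  qed
  finally show "(\<integral>y. cis (2 * pi * (y * s)) * of_real (exp (- pi * y\<^sup>2)) \<partial>lborel) = of_real (exp (- pi * s\<^sup>2))"
    using c(2) by (simp add: power_mult_distrib)
qed

text \<open>Normalised to be its own Fourier transform; it is the summability kernel of the
  inversion formula and of the L^2 bound.\<close>

definition gauss :: "'a::euclidean_space \<Rightarrow> real" where
  "gauss x = exp (- pi * (norm x)\<^sup>2)"

lemma gauss_pos: "gauss x > 0" and gauss_le_1: "gauss x \<le> 1" and gauss_0 [simp]: "gauss 0 = 1"
  and gauss_uminus [simp]: "gauss (- x) = gauss x"
  by (auto simp: gauss_def)

lemma gauss_measurable [measurable]: "gauss \<in> borel_measurable borel"
  unfolding gauss_def by measurable

lemma continuous_gauss: "isCont gauss x"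
  unfolding gauss_def by (intro continuous_intros)

lemma power_le_fact_exp:
  assumes "y \<ge> (0::real)" shows "y ^ K \<le> fact K * exp y"
proof -
  have "(\<Sum>n\<in>{K}. y ^ n /\<^sub>R fact n) \<le> (\<Sum>n. y ^ n /\<^sub>R fact n)"
    by (rule sum_le_suminf[OF summable_exp_generic]) (use assms in auto)
  then have "y ^ K / fact K \<le> exp y" by (simp add: exp_def divide_inverse mult.commute)
  then show ?thesis by (simp add: pos_divide_le_eq mult.commute)
qed

lemma gauss_rapid: "rapid gauss"
proof (rule rapidI)
  fix K
  have "norm (gauss x) \<le> (fact K * exp 2) / (1 + norm x) ^ K" for x :: 'a
  proof -
    let ?r = "norm x"
    have "?r \<le> 1 + ?r\<^sup>2"
    proof (cases "?r \<le> 1")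
      case True
      then show ?thesis using zero_le_power2[of ?r] by linarith
    next
      case False
      then have "?r * 1 \<le> ?r * ?r" by (intro mult_left_mono) auto
      then show ?thesis by (simp add: power2_eq_square)
    qed
    moreover have "1 * ?r\<^sup>2 \<le> pi * ?r\<^sup>2" using pi_ge_two by (intro mult_right_mono) auto
    ultimately have le: "- pi * ?r\<^sup>2 + (1 + ?r) \<le> 2" by linarith
    have "gauss x * (1 + ?r) ^ K \<le> gauss x * (fact K * exp (1 + ?r))"
      by (intro mult_left_mono power_le_fact_exp less_imp_le[OF gauss_pos]) auto
    also have "\<dots> = fact K * exp (- pi * ?r\<^sup>2 + (1 + ?r))"
      by (simp only: gauss_def exp_add mult_ac)
    also have "\<dots> \<le> fact K * exp 2" using le by (intro mult_left_mono) auto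
    finally show ?thesis using less_imp_le[OF gauss_pos[of x]] by (simp add: pos_le_divide_eq)
  qed
  then show "\<exists>C. \<forall>x::'a. norm (gauss x) \<le> C / (1 + norm x) ^ K" by blast
qed measurable

lemma ift_gauss: "ift gauss \<xi> = of_real (gauss (\<xi> :: 'a::euclidean_space))"
proof -
  have ex: "gauss x = (\<Prod>b\<in>Basis. exp (- pi * (x \<bullet> b)\<^sup>2))" for x :: 'a
    unfolding gauss_def power2_norm_eq_inner
    by (subst euclidean_inner) (simp add: exp_sum[symmetric] sum_distrib_left power2_eq_square sum_negf)
  have ci: "cis (2 * pi * (x \<bullet> \<xi>)) = (\<Prod>b\<in>Basis. cis (2 * pi * ((x \<bullet> b) * (\<xi> \<bullet> b))))" for x :: 'a
    unfolding cis_conv_exp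
    by (subst euclidean_inner) (simp add: exp_sum[symmetric] sum_distrib_left)
  have "ift gauss \<xi> = (\<integral>x. (\<Prod>b\<in>Basis. cis (2 * pi * ((x \<bullet> b) * (\<xi> \<bullet> b))) * of_real (exp (- pi * (x \<bullet> b)\<^sup>2))) \<partial>lborel)"
    unfolding ift_eq ci ex by (simp add: prod.distrib)
  also have "\<dots> = (\<Prod>b\<in>Basis. \<integral>t. cis (2 * pi * (t * (\<xi> \<bullet> b))) * of_real (exp (- pi * t\<^sup>2)) \<partial>lborel)"
    by (rule integral_lborel_prod[where f = "\<lambda>b t. cis (2 * pi * (t * (\<xi> \<bullet> b))) * of_real (exp (- pi * t\<^sup>2))"])
      (rule std_normal_fourier)
  also have "\<dots> = of_real (gauss \<xi>)"
    unfolding std_normal_fourier(2) ex by simp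
  finally show ?thesis .
qed

lemma integral_gauss: "(\<integral>x. gauss x \<partial>(lborel :: 'a::euclidean_space measure)) = 1"
proof -
  have "complex_of_real (\<integral>x. gauss x \<partial>(lborel :: 'a measure)) = ift gauss (0::'a)"
    unfolding ift_eq by simp
  then show ?thesis unfolding ift_gauss by simp
qed

definition gauss_kernel :: "real \<Rightarrow> 'a::euclidean_space \<Rightarrow> real" where
  "gauss_kernel \<epsilon> \<zeta> = gauss ((1 / \<epsilon>) *\<^sub>R \<zeta>) / \<epsilon> ^ DIM('a)"

lemma gauss_scale_rapid: "\<epsilon> > 0 \<Longrightarrow> rapid (\<lambda>x::'a::euclidean_space. gauss (\<epsilon> *\<^sub>R x))"
  using rapid_scale[OF gauss_rapid, of \<epsilon>] by simp

lemma gauss_kernel_rapid: "\<epsilon> > 0 \<Longrightarrow> rapid (gauss_kernel \<epsilon> :: 'a::euclidean_space \<Rightarrow> real)"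
  using rapid_cmult[OF gauss_scale_rapid[of "1/\<epsilon>", where 'a = 'a], of "1 / \<epsilon> ^ DIM('a)"]
  by (simp add: gauss_kernel_def[abs_def])

lemma gauss_kernel_nonneg: "\<epsilon> > 0 \<Longrightarrow> gauss_kernel \<epsilon> x \<ge> 0"
  by (simp add: gauss_kernel_def less_imp_le[OF gauss_pos])

lemma ift_scale:
  fixes F :: "'a::euclidean_space \<Rightarrow> real"
  assumes [measurable]: "F \<in> borel_measurable borel" and "\<epsilon> > 0"
  shows "ift (\<lambda>\<xi>. F (\<epsilon> *\<^sub>R \<xi>)) x = of_real (1 / \<epsilon> ^ DIM('a)) * ift F ((1 / \<epsilon>) *\<^sub>R x)"
proof -
  have "ift F ((1 / \<epsilon>) *\<^sub>R x) = \<bar>\<epsilon>\<bar> ^ DIM('a) *\<^sub>R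
      (\<integral>\<xi>. cis (2 * pi * ((0 + \<epsilon> *\<^sub>R \<xi>) \<bullet> ((1 / \<epsilon>) *\<^sub>R x))) * of_real (F (0 + \<epsilon> *\<^sub>R \<xi>)) \<partial>lborel)"
    unfolding ift_eq by (rule lborel_affine_integral) (use assms in auto)
  also have "\<dots> = \<epsilon> ^ DIM('a) *\<^sub>R ift (\<lambda>\<xi>. F (\<epsilon> *\<^sub>R \<xi>)) x"
    unfolding ift_eq using assms(2) by simp
  finally show ?thesis using assms(2) by (simp add: scaleR_conv_of_real)
qed

lemma ift_shift:
  fixes F :: "'a::euclidean_space \<Rightarrow> real"
  assumes [measurable]: "F \<in> borel_measurable borel"
  shows "ift (\<lambda>\<xi>. F (\<xi> - c)) x = cis (2 * pi * (c \<bullet> x)) * ift F x"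
proof -
  have "ift (\<lambda>\<xi>. F (\<xi> - c)) x = (\<integral>\<xi>. cis (2 * pi * ((\<xi> + c) \<bullet> x)) * of_real (F (\<xi> + c - c)) \<partial>lborel)"
    unfolding ift_eq by (rule integral_translate[symmetric]) measurable
  also have "\<dots> = (\<integral>\<xi>. cis (2 * pi * (c \<bullet> x)) * (cis (2 * pi * (\<xi> \<bullet> x)) * of_real (F \<xi>)) \<partial>lborel)"
    by (simp add: inner_add_left distrib_left cis_mult[symmetric] mult_ac)
  finally show ?thesis unfolding ift_eq by simp
qed

lemma inv_fourier_modulate:
  "inv_fourier (\<lambda>x. cis (2 * pi * (c \<bullet> x)) * f x) \<xi> = inv_fourier f (\<xi> + c)"
  unfolding inv_fourier_cis by (simp add: inner_add_right distrib_left cis_mult[symmetric] mult_ac inner_commute)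

lemma ift_gauss_scale:
  "\<epsilon> > 0 \<Longrightarrow> ift (\<lambda>x::'a::euclidean_space. gauss (\<epsilon> *\<^sub>R x)) \<xi> = of_real (gauss_kernel \<epsilon> \<xi>)"
  by (subst ift_scale) (auto simp: ift_gauss gauss_kernel_def)

lemma integral_gauss_kernel:
  assumes "\<epsilon> > 0" shows "(\<integral>x. gauss_kernel \<epsilon> (c - x) \<partial>(lborel :: 'a::euclidean_space measure)) = 1"
    "(\<integral>x. gauss_kernel \<epsilon> (x - c) \<partial>(lborel :: 'a::euclidean_space measure)) = 1"
proof -
  have [measurable]: "gauss_kernel \<epsilon> \<in> borel_measurable (borel :: 'a measure)"
    by (rule rapid_measurable[OF gauss_kernel_rapid[OF assms]])
  have "(\<integral>x. gauss_kernel \<epsilon> x \<partial>(lborel :: 'a measure)) = \<epsilon> ^ DIM('a) * (\<integral>x. gauss_kernel \<epsilon> (\<epsilon> *\<^sub>R x :: 'a) \<partial>lborel)"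
    using assms lborel_affine_integral[of "gauss_kernel \<epsilon> :: 'a \<Rightarrow> real" \<epsilon> 0] by simp
  also have "\<dots> = 1" using assms by (simp add: gauss_kernel_def integral_gauss)
  finally have 1: "(\<integral>x. gauss_kernel \<epsilon> x \<partial>(lborel :: 'a measure)) = 1" .
  show "(\<integral>x. gauss_kernel \<epsilon> (x - c) \<partial>(lborel :: 'a measure)) = 1"
    using integral_translate[of "gauss_kernel \<epsilon> :: 'a \<Rightarrow> real" "- c"] 1 by simp
  moreover have "gauss_kernel \<epsilon> (c - x) = gauss_kernel \<epsilon> (x - c)" for x :: 'a
    by (simp add: gauss_kernel_def gauss_def norm_minus_commute)
  ultimately show "(\<integral>x. gauss_kernel \<epsilon> (c - x) \<partial>(lborel :: 'a measure)) = 1" by simp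
qed

lemma inverse_Suc_pos: "0 < 1 / real (Suc j)" and inverse_Suc_tendsto: "(\<lambda>j. 1 / real (Suc j)) \<longlonglongrightarrow> 0"
  using LIMSEQ_inverse_real_of_nat by (auto simp: inverse_eq_divide)

lemma gauss_regularize:
  fixes V :: "'a::euclidean_space \<Rightarrow> complex"
  assumes "integrable lborel V"
  shows "(\<lambda>j. \<integral>x. V x * of_real (gauss ((1 / real (Suc j)) *\<^sub>R x)) \<partial>lborel) \<longlonglongrightarrow> (\<integral>x. V x \<partial>lborel)"
proof (rule integral_dominated_convergence[where w = "\<lambda>x. norm (V x)"])
  have [measurable]: "V \<in> borel_measurable borel" using assms by auto
  show "V \<in> borel_measurable lborel" "(\<lambda>x. V x * of_real (gauss ((1 / real (Suc j)) *\<^sub>R x))) \<in> borel_measurable lborel" for j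
    by measurable
  show "integrable lborel (\<lambda>x. norm (V x))" using assms by simp
  show "AE x in lborel. norm (V x * of_real (gauss ((1 / real (Suc j)) *\<^sub>R x))) \<le> norm (V x)" for j
    by (intro AE_I2) (auto simp: norm_mult less_imp_le[OF gauss_pos] intro!: mult_left_le gauss_le_1)
  show "AE x in lborel. (\<lambda>j. V x * of_real (gauss ((1 / real (Suc j)) *\<^sub>R x))) \<longlonglongrightarrow> V x"
  proof (rule AE_I2)
    fix x :: 'a
    have "(\<lambda>j. (1 / real (Suc j)) *\<^sub>R x) \<longlonglongrightarrow> 0"
      using tendsto_scaleR[OF inverse_Suc_tendsto tendsto_const, of x] by simp
    from isCont_tendsto_compose[OF continuous_gauss this]
    have "(\<lambda>j. V x * of_real (gauss ((1 / real (Suc j)) *\<^sub>R x))) \<longlonglongrightarrow> V x * of_real 1"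
      by (intro tendsto_intros) simp
    then show "(\<lambda>j. V x * of_real (gauss ((1 / real (Suc j)) *\<^sub>R x))) \<longlonglongrightarrow> V x" by simp
  qed
qed

text \<open>The integral is damped by a Gaussian and the transforms are interchanged by Fubini; what
  remains is a mollification of F at \<eta>. Removing the damping is dominated convergence, since
  \<open>ift F\<close> is integrable.\<close>

theorem fourier_ift:
  fixes F :: "'a::euclidean_space \<Rightarrow> real"
  assumes F: "tf F"
  shows "fourier (ift F) \<eta> = of_real (F \<eta>)"
proof -
  let ?e = "\<lambda>j. 1 / real (Suc j)"
  have V: "integrable lborel (ift F)" by (rule rapid_integrable[OF ift_rapid[OF F]])
  have cV: "integrable lborel (\<lambda>x. cis (- (2 * pi * (\<eta> \<bullet> x))) * ift F x)"
    by (rule integrable_cis_mult[OF V]) measurable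
  have lim1: "(\<lambda>j. \<integral>x. cis (- (2 * pi * (\<eta> \<bullet> x))) * ift F x * of_real (gauss (?e j *\<^sub>R x)) \<partial>lborel)
      \<longlonglongrightarrow> fourier (ift F) \<eta>"
    unfolding fourier_cis by (rule gauss_regularize[OF cV])
  have "(\<integral>x. cis (- (2 * pi * (\<eta> \<bullet> x))) * ift F x * of_real (gauss (?e j *\<^sub>R x)) \<partial>lborel) =
      of_real (\<integral>\<xi>. F \<xi> * (gauss ((1 / ?e j) *\<^sub>R (\<xi> - \<eta>)) / ?e j ^ DIM('a)) \<partial>lborel)" for j
  proof -
    let ?g = "\<lambda>x. cis (2 * pi * ((- \<eta>) \<bullet> x)) * complex_of_real (gauss (?e j *\<^sub>R x))"
    have gi: "integrable lborel (\<lambda>x. complex_of_real (gauss (?e j *\<^sub>R x :: 'a)))"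
      by (intro integrable_bounded_linear[OF bounded_linear_of_real] rapid_integrable gauss_scale_rapid inverse_Suc_pos)
    have g: "integrable lborel ?g"
      by (rule integrable_cis_mult[OF gi]) measurable
    have "(\<integral>x. cis (- (2 * pi * (\<eta> \<bullet> x))) * ift F x * of_real (gauss (?e j *\<^sub>R x)) \<partial>lborel) =
        (\<integral>x. ift F x * ?g x \<partial>lborel)"
      by (intro Bochner_Integration.integral_cong) (auto simp: mult_ac)
    also have "\<dots> = (\<integral>\<xi>. of_real (F \<xi>) * inv_fourier ?g \<xi> \<partial>lborel)"
      unfolding ift_def by (rule inv_fourier_swap[OF tf_integrable_complex[OF F] g])
    also have "\<dots> = (\<integral>\<xi>. of_real (F \<xi>) * of_real (gauss_kernel (?e j) (\<xi> - \<eta>)) \<partial>lborel)"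
      unfolding inv_fourier_modulate ift_gauss_scale[OF inverse_Suc_pos, unfolded ift_def] by simp
    also have "\<dots> = of_real (\<integral>\<xi>. F \<xi> * gauss_kernel (?e j) (\<xi> - \<eta>) \<partial>lborel)"
      unfolding of_real_mult[symmetric] by (rule integral_complex_of_real)
    finally show ?thesis unfolding gauss_kernel_def .
  qed
  moreover have "(\<lambda>j. complex_of_real (\<integral>\<xi>. F \<xi> * (gauss ((1 / ?e j) *\<^sub>R (\<xi> - \<eta>)) / ?e j ^ DIM('a)) \<partial>lborel)) \<longlonglongrightarrow> of_real (F \<eta> * 1)"
  proof (intro tendsto_of_real)
    have "tempered F"
      unfolding tempered_def using tf_integrable[OF F] by (intro exI[of _ 0]) simp
    moreover have "isCont F \<eta>" using tf_continuous[OF F] by (simp add: continuous_on_eq_continuous_at)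
    ultimately show "(\<lambda>j. \<integral>\<xi>. F \<xi> * (gauss ((1 / ?e j) *\<^sub>R (\<xi> - \<eta>)) / ?e j ^ DIM('a)) \<partial>lborel) \<longlonglongrightarrow> F \<eta> * 1"
      using approximate_identity[OF gauss_rapid _ _ inverse_Suc_pos inverse_Suc_tendsto, of F \<eta>]
      unfolding integral_gauss by blast
  qed
  ultimately show ?thesis using LIMSEQ_unique[OF lim1] by simp
qed

lemma cnj_inv_fourier: "cnj (inv_fourier f x) = fourier (\<lambda>\<xi>. cnj (f \<xi>)) x"
proof -
  have "cnj (inv_fourier f x) = (\<integral>\<xi>. cnj (cis (2 * pi * (\<xi> \<bullet> x)) * f \<xi>) \<partial>lborel)"
    unfolding inv_fourier_cis by (rule Bochner_Integration.integral_cnj[symmetric])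
  then show ?thesis unfolding fourier_cis by (simp add: cis_cnj inner_commute)
qed

text \<open>Moving the transform off H leaves the transform of a reflected translate of
  \<open>ift F\<close>, which the inversion formula identifies with F times a phase. H is real, so
  no conjugate appears in the product.\<close>

lemma ift_correlation:
  fixes F H :: "'a::euclidean_space \<Rightarrow> real"
  assumes F: "tf F" and H: "tf H"
  shows "(\<integral>y. ift F (z + y) * cnj (ift H y) \<partial>lborel) = ift (\<lambda>\<xi>. F \<xi> * H \<xi>) z"
proof -
  have V: "integrable lborel (ift F)" by (rule rapid_integrable[OF ift_rapid[OF F]])
  have Vz: "integrable lborel (\<lambda>y. ift F (z - y))"
    using lborel_affine_integrable[OF V, of "-1" z] by simp
  note [measurable] = ift_measurable[OF F] ift_measurable[OF H]
  have "(\<integral>y. ift F (z + y) * cnj (ift H y) \<partial>lborel) = (\<integral>y. ift F (z - y) * cnj (ift H (- y)) \<partial>lborel)"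
    using integral_reflect[of "\<lambda>y. ift F (z + y) * cnj (ift H y)"] by simp
  also have "\<dots> = (\<integral>y. ift H y * ift F (z - y) \<partial>lborel)"
    by (intro Bochner_Integration.integral_cong) (auto simp: ift_def cnj_inv_fourier fourier_eq_inv_fourier mult.commute)
  also have "\<dots> = (\<integral>\<xi>. of_real (H \<xi>) * inv_fourier (\<lambda>y. ift F (z - y)) \<xi> \<partial>lborel)"
    unfolding ift_def[of H] by (rule inv_fourier_swap[OF tf_integrable_complex[OF H] Vz])
  also have "\<dots> = (\<integral>\<xi>. cis (2 * pi * (\<xi> \<bullet> z)) * of_real (F \<xi> * H \<xi>) \<partial>lborel)"
  proof (rule Bochner_Integration.integral_cong[OF refl])
    fix \<xi>
    have "inv_fourier (\<lambda>y. ift F (z - y)) \<xi> = (\<integral>y. cis (2 * pi * ((z + - y) \<bullet> \<xi>)) * ift F (z - (z + - y)) \<partial>lborel)"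
      unfolding inv_fourier_cis
      using lborel_affine_integral[of "\<lambda>y. cis (2 * pi * (y \<bullet> \<xi>)) * ift F (z - y)" "-1" z] by simp
    also have "\<dots> = (\<integral>y. cis (2 * pi * (\<xi> \<bullet> z)) * (cis (- (2 * pi * (\<xi> \<bullet> y))) * ift F y) \<partial>lborel)"
      by (intro Bochner_Integration.integral_cong)
        (auto simp: inner_diff_left inner_diff_right inner_commute[of _ \<xi>] right_diff_distrib cis_mult mult.assoc[symmetric])
    also have "\<dots> = cis (2 * pi * (\<xi> \<bullet> z)) * of_real (F \<xi>)"
      using fourier_ift[OF F, of \<xi>] unfolding fourier_cis by simp
    finally show "of_real (H \<xi>) * inv_fourier (\<lambda>y. ift F (z - y)) \<xi> = cis (2 * pi * (\<xi> \<bullet> z)) * of_real (F \<xi> * H \<xi>)"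
      by simp
  qed
  finally show ?thesis unfolding ift_eq .
qed

lemma ift_even_real:
  fixes F :: "'a::euclidean_space \<Rightarrow> real"
  assumes [measurable]: "F \<in> borel_measurable borel" and even: "\<And>\<xi>. F (- \<xi>) = F \<xi>"
  shows "ift F x = of_real (Re (ift F x))"
proof -
  have "cnj (ift F x) = ift F (- x)"
    unfolding ift_def cnj_inv_fourier fourier_eq_inv_fourier by simp
  also have "\<dots> = (\<integral>\<xi>. cis (2 * pi * ((- \<xi>) \<bullet> x)) * of_real (F (- (- \<xi>))) \<partial>lborel)"
    unfolding ift_eq by simp
  also have "\<dots> = (\<integral>\<xi>. cis (2 * pi * ((- \<xi>) \<bullet> x)) * of_real (F (- \<xi>)) \<partial>lborel)"
    using even by simp
  also have "\<dots> = ift F x"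
    unfolding ift_eq by (rule integral_reflect[of "\<lambda>\<xi>. cis (2 * pi * (\<xi> \<bullet> x)) * complex_of_real (F \<xi>)"]) measurable
  finally show ?thesis by (simp add: complex_eq_iff)
qed

text \<open>Inserting the factor \<open>gauss (\<epsilon> x)\<close> turns the square of the norm into a double integral against the
  positive kernel \<open>gauss_kernel\<close>, where \<open>|a b| \<le> (a\<^sup>2 + b\<^sup>2) / 2\<close> applies; then \<open>\<epsilon> \<rightarrow> 0\<close> by Fatou.\<close>

theorem inv_fourier_L2_bound:
  fixes W :: "'a::euclidean_space \<Rightarrow> complex"
  assumes W: "integrable lborel W" and W2: "integrable lborel (\<lambda>\<xi>. (norm (W \<xi>))\<^sup>2)"
  shows "integrable lborel (\<lambda>x. (norm (inv_fourier W x))\<^sup>2)"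
    and "(\<integral>x. (norm (inv_fourier W x))\<^sup>2 \<partial>lborel) \<le> (\<integral>\<xi>. (norm (W \<xi>))\<^sup>2 \<partial>lborel)"
proof -
  let ?e = "\<lambda>j. 1 / real (Suc j)"
  define V where "V = inv_fourier W"
  define B where "B = (\<integral>\<xi>. (norm (W \<xi>))\<^sup>2 \<partial>lborel)"
  have B0: "B \<ge> 0" unfolding B_def by simp
  have [measurable]: "W \<in> borel_measurable borel" using W by auto
  have [measurable]: "V \<in> borel_measurable borel" unfolding V_def by measurable
  have bd: "(\<integral>\<^sup>+x. ennreal ((norm (V x))\<^sup>2 * gauss (?e j *\<^sub>R x)) \<partial>lborel) \<le> ennreal B" for j
  proof -
    let ?k = "gauss_kernel (?e j) :: 'a \<Rightarrow> real"
    have kr: "rapid ?k" by (rule gauss_kernel_rapid[OF inverse_Suc_pos])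
    note [measurable] = rapid_measurable[OF kr]
    obtain Ck where Ck: "Ck > 0" "\<And>x. norm (?k x) \<le> Ck" using rapid_bounded[OF kr] by blast
    let ?g = "\<lambda>x::'a. complex_of_real (gauss (?e j *\<^sub>R x))"
    have gi: "integrable lborel ?g"
      by (intro integrable_bounded_linear[OF bounded_linear_of_real] rapid_integrable gauss_scale_rapid inverse_Suc_pos)
    obtain CV where CV: "\<And>x. norm (V x) \<le> CV" unfolding V_def using norm_inv_fourier_le by blast
    have Pi: "integrable lborel (\<lambda>x. cnj (V x) * ?g x)"
      by (rule Bochner_Integration.integrable_bound[OF integrable_mult_right[OF gi, of "complex_of_real CV"]])
        (auto simp: norm_mult intro!: AE_I2 mult_right_mono order_trans[OF CV])
    have int2: "integrable lborel (\<lambda>x. (norm (V x))\<^sup>2 * gauss (?e j *\<^sub>R x))"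
    proof (rule Bochner_Integration.integrable_bound[OF integrable_mult_right[of "CV\<^sup>2", OF rapid_integrable[OF gauss_scale_rapid[OF inverse_Suc_pos[of j]]]]])
      show "AE x::'a in lborel. norm ((norm (V x))\<^sup>2 * gauss (?e j *\<^sub>R x)) \<le> norm (CV\<^sup>2 * gauss (?e j *\<^sub>R x))"
        by (intro AE_I2) (auto simp: abs_mult less_imp_le[OF gauss_pos] intro!: mult_right_mono power_mono CV)
    qed measurable
    have Phat: "inv_fourier (\<lambda>x. cnj (V x) * ?g x) \<xi> = (\<integral>\<eta>. cnj (W \<eta>) * of_real (?k (\<xi> - \<eta>)) \<partial>lborel)" for \<xi>
    proof -
      let ?h = "\<lambda>x. cis (2 * pi * (\<xi> \<bullet> x)) * ?g x"
      have h: "integrable lborel ?h" by (rule integrable_cis_mult[OF gi]) measurable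
      have hr: "integrable lborel (\<lambda>x. ?h (- x))"
        using lborel_affine_integrable[OF h, of "-1" 0] by simp
      have cW: "integrable lborel (\<lambda>x. cnj (W x))"
        using W by simp
      have "inv_fourier (\<lambda>x. cnj (V x) * ?g x) \<xi> = (\<integral>x. inv_fourier (\<lambda>\<eta>. cnj (W \<eta>)) (- x) * ?h x \<partial>lborel)"
        unfolding V_def cnj_inv_fourier fourier_eq_inv_fourier
        by (subst inv_fourier_cis, intro Bochner_Integration.integral_cong) (auto simp: mult_ac inner_commute)
      also have "\<dots> = (\<integral>x. inv_fourier (\<lambda>\<eta>. cnj (W \<eta>)) x * ?h (- x) \<partial>lborel)"
        using integral_reflect[of "\<lambda>x. inv_fourier (\<lambda>\<eta>. cnj (W \<eta>)) x * ?h (- x)"] by simp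
      also have "\<dots> = (\<integral>\<eta>. cnj (W \<eta>) * inv_fourier (\<lambda>x. ?h (- x)) \<eta> \<partial>lborel)"
        by (rule inv_fourier_swap[OF cW hr])
      also have "inv_fourier (\<lambda>x. ?h (- x)) = (\<lambda>\<eta>. of_real (?k (\<xi> - \<eta>)))"
      proof
        fix \<eta>
        have "inv_fourier (\<lambda>x. ?h (- x)) \<eta> = inv_fourier (\<lambda>x. cis (2 * pi * ((- \<xi>) \<bullet> x)) * ?g x) \<eta>"
          by simp
        also have "\<dots> = of_real (?k (\<eta> - \<xi>))"
          unfolding inv_fourier_modulate ift_gauss_scale[OF inverse_Suc_pos, unfolded ift_def] by simp
        also have "?k (\<eta> - \<xi>) = ?k (\<xi> - \<eta>)" by (simp add: gauss_kernel_def gauss_def norm_minus_commute)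
        finally show "inv_fourier (\<lambda>x. ?h (- x)) \<eta> = of_real (?k (\<xi> - \<eta>))" .
      qed
      finally show ?thesis .
    qed
    let ?n = "\<lambda>\<xi>. norm (W \<xi>)"
    have prod_int: "integrable (lborel \<Otimes>\<^sub>M lborel) (\<lambda>(\<xi>, \<eta>). (?n \<xi>)\<^sup>2 * ?k (\<xi> - \<eta>))"
      "integrable (lborel \<Otimes>\<^sub>M lborel) (\<lambda>(\<xi>, \<eta>). (?n \<eta>)\<^sup>2 * ?k (\<xi> - \<eta>))"
    proof -
      have ki: "integrable lborel (\<lambda>\<eta>. ?k (\<xi> - \<eta>))" "integrable lborel (\<lambda>\<eta>. ?k (\<eta> - \<xi>))" for \<xi>
        using lborel_affine_integrable[OF rapid_integrable[OF kr], of "-1" \<xi>]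
          integrable_translate[OF rapid_integrable[OF kr], of "- \<xi>"] by simp_all
      have k0: "norm (?k x) = ?k x" for x using gauss_kernel_nonneg[OF inverse_Suc_pos, of j x] by simp
      show "integrable (lborel \<Otimes>\<^sub>M lborel) (\<lambda>(\<xi>, \<eta>). (?n \<xi>)\<^sup>2 * ?k (\<xi> - \<eta>))"
        by (rule lborel_pair.Fubini_integrable)
          (use ki W2 k0 in \<open>simp_all add: abs_mult integral_gauss_kernel[OF inverse_Suc_pos] del: of_nat_Suc\<close>)
      have "integrable (lborel \<Otimes>\<^sub>M lborel) (\<lambda>(\<eta>, \<xi>). (?n \<eta>)\<^sup>2 * ?k (\<xi> - \<eta>))"
        by (rule lborel_pair.Fubini_integrable)
          (use ki W2 k0 in \<open>simp_all add: abs_mult integral_gauss_kernel[OF inverse_Suc_pos] del: of_nat_Suc\<close>)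
      from lborel_pair.integrable_product_swap[OF this]
      show "integrable (lborel \<Otimes>\<^sub>M lborel) (\<lambda>(\<xi>, \<eta>). (?n \<eta>)\<^sup>2 * ?k (\<xi> - \<eta>))"
        by (simp add: case_prod_beta')
    qed
    have pv: "(\<integral>(\<xi>, \<eta>). (?n \<xi>)\<^sup>2 * ?k (\<xi> - \<eta>) \<partial>(lborel \<Otimes>\<^sub>M lborel)) = B"
      "(\<integral>(\<xi>, \<eta>). (?n \<eta>)\<^sup>2 * ?k (\<xi> - \<eta>) \<partial>(lborel \<Otimes>\<^sub>M lborel)) = B"
      using lborel_pair.integral_fst[of "\<lambda>\<xi> \<eta>. (?n \<xi>)\<^sup>2 * ?k (\<xi> - \<eta>)", OF prod_int(1)]
        lborel_pair.integral_snd[of "\<lambda>\<xi> \<eta>. (?n \<eta>)\<^sup>2 * ?k (\<xi> - \<eta>)", OF prod_int(2)]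
      by (simp_all add: integral_gauss_kernel[OF inverse_Suc_pos] B_def del: of_nat_Suc)
    define D where "D \<xi> \<eta> = (?n \<xi>)\<^sup>2 * ?k (\<xi> - \<eta>) / 2 + (?n \<eta>)\<^sup>2 * ?k (\<xi> - \<eta>) / 2" for \<xi> \<eta>
    have Dint: "integrable (lborel \<Otimes>\<^sub>M lborel) (\<lambda>(\<xi>, \<eta>). D \<xi> \<eta>)"
      using Bochner_Integration.integrable_add[OF integrable_divide[OF prod_int(1), of 2] integrable_divide[OF prod_int(2), of 2]]
      unfolding D_def case_prod_beta' by simp
    have Dval: "(\<integral>(\<xi>, \<eta>). D \<xi> \<eta> \<partial>(lborel \<Otimes>\<^sub>M lborel)) = B"
    proof -
      have "(\<integral>(\<xi>, \<eta>). D \<xi> \<eta> \<partial>(lborel \<Otimes>\<^sub>M lborel)) =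
          (\<integral>(\<xi>, \<eta>). (?n \<xi>)\<^sup>2 * ?k (\<xi> - \<eta>) \<partial>(lborel \<Otimes>\<^sub>M lborel)) / 2 + (\<integral>(\<xi>, \<eta>). (?n \<eta>)\<^sup>2 * ?k (\<xi> - \<eta>) \<partial>(lborel \<Otimes>\<^sub>M lborel)) / 2"
        using prod_int unfolding D_def case_prod_beta' by simp
      then show ?thesis unfolding pv by simp
    qed
    have WkD: "norm (W \<xi> * (cnj (W \<eta>) * of_real (?k (\<xi> - \<eta>)))) \<le> D \<xi> \<eta>" for \<xi> \<eta>
    proof -
      have "?n \<xi> * ?n \<eta> \<le> (?n \<xi>)\<^sup>2 / 2 + (?n \<eta>)\<^sup>2 / 2"
        using zero_le_power2[of "?n \<xi> - ?n \<eta>"] by (simp add: power2_diff)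
      then have "?n \<xi> * ?n \<eta> * ?k (\<xi> - \<eta>) \<le> ((?n \<xi>)\<^sup>2 / 2 + (?n \<eta>)\<^sup>2 / 2) * ?k (\<xi> - \<eta>)"
        by (rule mult_right_mono) (rule gauss_kernel_nonneg[OF inverse_Suc_pos])
      then show ?thesis using gauss_kernel_nonneg[OF inverse_Suc_pos, of j "\<xi> - \<eta>"]
        by (simp add: D_def norm_mult distrib_right)
    qed
    have Fint: "integrable (lborel \<Otimes>\<^sub>M lborel) (\<lambda>(\<xi>, \<eta>). W \<xi> * (cnj (W \<eta>) * of_real (?k (\<xi> - \<eta>))))"
    proof (rule Bochner_Integration.integrable_bound[OF Dint])
      show "(\<lambda>(\<xi>, \<eta>). W \<xi> * (cnj (W \<eta>) * of_real (?k (\<xi> - \<eta>)))) \<in> borel_measurable (lborel \<Otimes>\<^sub>M lborel)"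
        by measurable
      have "norm (case p of (\<xi>, \<eta>) \<Rightarrow> W \<xi> * (cnj (W \<eta>) * of_real (?k (\<xi> - \<eta>)))) \<le> norm (case p of (\<xi>, \<eta>) \<Rightarrow> D \<xi> \<eta>)" for p
        unfolding case_prod_beta real_norm_def by (rule order_trans[OF WkD abs_ge_self])
      then show "AE p in lborel \<Otimes>\<^sub>M lborel. norm (case p of (\<xi>, \<eta>) \<Rightarrow> W \<xi> * (cnj (W \<eta>) * of_real (?k (\<xi> - \<eta>))))
          \<le> norm (case p of (\<xi>, \<eta>) \<Rightarrow> D \<xi> \<eta>)" by (rule AE_I2)
    qed
    have "complex_of_real (\<integral>x. (norm (V x))\<^sup>2 * gauss (?e j *\<^sub>R x) \<partial>lborel) = (\<integral>x. V x * (cnj (V x) * ?g x) \<partial>lborel)"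
      unfolding integral_complex_of_real[symmetric]
      by (intro Bochner_Integration.integral_cong refl) (simp only: of_real_mult complex_norm_square mult.assoc)
    also have "\<dots> = (\<integral>\<xi>. W \<xi> * inv_fourier (\<lambda>x. cnj (V x) * ?g x) \<xi> \<partial>lborel)"
      using inv_fourier_swap[OF W Pi] unfolding V_def .
    also have "\<dots> = (\<integral>\<xi>. \<integral>\<eta>. W \<xi> * (cnj (W \<eta>) * of_real (?k (\<xi> - \<eta>))) \<partial>lborel \<partial>lborel)"
      unfolding Phat by simp
    also have "\<dots> = (\<integral>(\<xi>, \<eta>). W \<xi> * (cnj (W \<eta>) * of_real (?k (\<xi> - \<eta>))) \<partial>(lborel \<Otimes>\<^sub>M lborel))"
      by (rule lborel_pair.integral_fst[OF Fint])
    finally have eq: "complex_of_real (\<integral>x. (norm (V x))\<^sup>2 * gauss (?e j *\<^sub>R x) \<partial>lborel) =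
        (\<integral>(\<xi>, \<eta>). W \<xi> * (cnj (W \<eta>) * of_real (?k (\<xi> - \<eta>))) \<partial>(lborel \<Otimes>\<^sub>M lborel))" .
    have "(\<integral>x. (norm (V x))\<^sup>2 * gauss (?e j *\<^sub>R x) \<partial>lborel) \<le> norm (complex_of_real (\<integral>x. (norm (V x))\<^sup>2 * gauss (?e j *\<^sub>R x) \<partial>lborel))"
      by simp
    also have "\<dots> \<le> (\<integral>(\<xi>, \<eta>). D \<xi> \<eta> \<partial>(lborel \<Otimes>\<^sub>M lborel))"
      unfolding eq
    proof (rule order_trans[OF integral_norm_bound], rule integral_mono[OF integrable_norm[OF Fint] Dint])
      show "norm (case p of (\<xi>, \<eta>) \<Rightarrow> W \<xi> * (cnj (W \<eta>) * of_real (?k (\<xi> - \<eta>)))) \<le> (case p of (\<xi>, \<eta>) \<Rightarrow> D \<xi> \<eta>)" for p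
        using WkD by (simp add: case_prod_beta)
    qed
    finally have "(\<integral>x. (norm (V x))\<^sup>2 * gauss (?e j *\<^sub>R x) \<partial>lborel) \<le> B" unfolding Dval .
    moreover have "(\<integral>\<^sup>+x. ennreal ((norm (V x))\<^sup>2 * gauss (?e j *\<^sub>R x)) \<partial>lborel) =
        ennreal (\<integral>x. (norm (V x))\<^sup>2 * gauss (?e j *\<^sub>R x) \<partial>lborel)"
      by (rule nn_integral_eq_integral[OF int2], intro AE_I2 mult_nonneg_nonneg zero_le_power2 less_imp_le[OF gauss_pos])
    ultimately show ?thesis by (simp only: ennreal_leI)
  qed
  have "(\<integral>\<^sup>+x. ennreal ((norm (V x))\<^sup>2) \<partial>lborel) = (\<integral>\<^sup>+x. liminf (\<lambda>j. ennreal ((norm (V x))\<^sup>2 * gauss (?e j *\<^sub>R x))) \<partial>lborel)"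
  proof (rule nn_integral_cong)
    fix x :: 'a
    have "(\<lambda>j. ?e j *\<^sub>R x) \<longlonglongrightarrow> 0"
      using tendsto_scaleR[OF inverse_Suc_tendsto tendsto_const, of x] by simp
    from isCont_tendsto_compose[OF continuous_gauss this]
    have "(\<lambda>j. (norm (V x))\<^sup>2 * gauss (?e j *\<^sub>R x)) \<longlonglongrightarrow> (norm (V x))\<^sup>2 * 1"
      by (intro tendsto_intros) simp
    then have "(\<lambda>j. ennreal ((norm (V x))\<^sup>2 * gauss (?e j *\<^sub>R x))) \<longlonglongrightarrow> ennreal ((norm (V x))\<^sup>2)"
      by (intro tendsto_ennrealI) simp
    then show "ennreal ((norm (V x))\<^sup>2) = liminf (\<lambda>j. ennreal ((norm (V x))\<^sup>2 * gauss (?e j *\<^sub>R x)))"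
      using lim_imp_Liminf[OF sequentially_bot] by metis
  qed
  also have "\<dots> \<le> liminf (\<lambda>j. \<integral>\<^sup>+x. ennreal ((norm (V x))\<^sup>2 * gauss (?e j *\<^sub>R x)) \<partial>lborel)"
    by (rule nn_integral_liminf) measurable
  also have "\<dots> \<le> ennreal B"
    using Liminf_le[OF sequentially_bot always_eventually[OF allI[OF bd]]] by simp
  finally have nn: "(\<integral>\<^sup>+x. ennreal ((norm (V x))\<^sup>2) \<partial>lborel) \<le> ennreal B" .
  show int: "integrable lborel (\<lambda>x. (norm (inv_fourier W x))\<^sup>2)"
    unfolding V_def[symmetric]
    by (rule integrableI_bounded) (use nn in \<open>auto intro: le_less_trans\<close>)
  show "(\<integral>x. (norm (inv_fourier W x))\<^sup>2 \<partial>lborel) \<le> (\<integral>\<xi>. (norm (W \<xi>))\<^sup>2 \<partial>lborel)"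
    using nn nn_integral_eq_integral[OF int] B0 unfolding V_def[symmetric] B_def[symmetric]
    by simp
qed


subsection \<open>Real wave packets\<close>

lemma C_infinity_on_reflect:
  fixes f :: "'a::euclidean_space \<Rightarrow> real"
  assumes "C_infinity_on UNIV f"
  shows "C_infinity_on UNIV (\<lambda>x. f (- x))"
proof -
  have "Ck_on n UNIV f \<Longrightarrow> Ck_on n UNIV (\<lambda>x. f (- x))" for n
  proof (induction n arbitrary: f)
    case (Suc n)
    have der: "((\<lambda>x. f (- x)) has_derivative (\<lambda>h. frechet_derivative f (at (- x)) (- h))) (at x)" for x
    proof (rule has_derivative_compose[of uminus uminus])
      show "(f has_derivative frechet_derivative f (at (- x))) (at (- x))"
        using Suc.prems by (simp add: frechet_derivative_works)
    qed (auto intro!: derivative_eq_intros)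
    have "Ck_on n UNIV (pd e (\<lambda>x. f (- x)))" if e: "e \<in> Basis" for e
    proof -
      have "pd e (\<lambda>x. f (- x)) = (\<lambda>x. (-1) * pd e f (- x))"
      proof
        fix x
        have "frechet_derivative f (at (- x)) (- e) = - frechet_derivative f (at (- x)) e"
          using linear_cmul[OF linear_frechet_derivative, of f "at (- x)" "-1" e] Suc.prems by simp
        then show "pd e (\<lambda>x. f (- x)) x = (-1) * pd e f (- x)" using pd_eqI[OF der, where e = e] by simp
      qed
      then show ?thesis
        using Ck_on_mult[OF open_UNIV Ck_on_const[of n UNIV "-1"] Suc.IH[of "pd e f"]] Suc.prems e by simp
    qed
    then show ?case using der by (auto simp: differentiable_def)
  qed simp
  then show ?thesis using assms by (simp add: C_infinity_on_iff_Ck_on)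
qed

text \<open>The real part of the inverse transform of a real function is the inverse transform of
  its even part. The packets are one-sided in frequency; passing to the real part splits each into
  two mirror images of half the height.\<close>

definition symm :: "('a::euclidean_space \<Rightarrow> real) \<Rightarrow> 'a \<Rightarrow> real" where
  "symm H \<xi> = (H \<xi> + H (- \<xi>)) / 2"

definition rift :: "('a::euclidean_space \<Rightarrow> real) \<Rightarrow> 'a \<Rightarrow> real" where
  "rift H x = Re (ift H x)"

lemma rift_eq: "integrable lborel H \<Longrightarrow> rift H x = (\<integral>\<xi>. H \<xi> * cos (2 * pi * (\<xi> \<bullet> x)) \<partial>lborel)"
  by (simp add: rift_def ift_Re)

lemma tf_reflect:
  assumes "tf H" shows "tf (\<lambda>\<xi>. H (- \<xi>))"
proof -
  obtain r where r: "\<And>x. norm x \<ge> r \<Longrightarrow> H x = 0" using tf_support[OF assms] by blast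
  show ?thesis
    by (rule tfI[OF C_infinity_on_reflect[OF tf_smooth[OF assms]], where r = r]) (rule r, simp)
qed

lemma tf_symm: "tf H \<Longrightarrow> tf (symm H)"
  using tf_cmult[OF tf_add[OF _ tf_reflect], of H H "1/2"] by (simp add: symm_def[abs_def])

lemma symm_uminus [simp]: "symm H (- \<xi>) = symm H \<xi>"
  by (simp add: symm_def add.commute)

lemma symm_even: "(\<And>\<xi>. H (- \<xi>) = H \<xi>) \<Longrightarrow> symm H = H"
  by (auto simp: symm_def)

lemma ift_reflect:
  assumes [measurable]: "H \<in> borel_measurable borel"
  shows "ift (\<lambda>\<xi>. H (- \<xi>)) x = cnj (ift H x)"
proof -
  have "ift (\<lambda>\<xi>. H (- \<xi>)) x = (\<integral>\<xi>. cis (2 * pi * ((- (- \<xi>)) \<bullet> x)) * of_real (H (- \<xi>)) \<partial>lborel)"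
    by (simp add: ift_eq)
  also have "\<dots> = (\<integral>\<xi>. cis (2 * pi * ((- \<xi>) \<bullet> x)) * of_real (H \<xi>) \<partial>lborel)"
    by (rule integral_reflect[of "\<lambda>\<xi>. cis (2 * pi * ((- \<xi>) \<bullet> x)) * complex_of_real (H \<xi>)"]) measurable
  also have "\<dots> = cnj (ift H x)"
    by (simp add: ift_def cnj_inv_fourier fourier_cis inner_commute)
  finally show ?thesis .
qed

lemma ift_symm:
  assumes "tf H"
  shows "ift (symm H) x = of_real (rift H x)"
proof -
  have "ift (symm H) x = (ift H x + ift (\<lambda>\<xi>. H (- \<xi>)) x) / 2"
  proof -
    have "integrable lborel (\<lambda>\<xi>. cis (2 * pi * (\<xi> \<bullet> x)) * of_real (K \<xi>))" if "tf K" for K :: "'a \<Rightarrow> real"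
      by (rule integrable_cis_mult[OF tf_integrable_complex[OF that]]) measurable
    from this[OF assms] this[OF tf_reflect[OF assms]] show ?thesis
      unfolding ift_eq symm_def by (simp add: add_divide_distrib distrib_left)
  qed
  then show ?thesis
    by (simp add: ift_reflect[OF tf_measurable[OF assms]] rift_def complex_eq_iff)
qed

lemma rift_schwartz: "tf H \<Longrightarrow> schwartz (rift H)"
  unfolding rift_def by (rule schwartz_linear_ift[OF _ bounded_linear_Re])

lemma rift_rapid: "tf H \<Longrightarrow> rapid (rift H)"
proof (rule rapid_dominated[where f = "ift H" and B = 1, OF ift_rapid])
  assume "tf H"
  note [measurable] = ift_measurable[OF this]
  show "rift H \<in> borel_measurable borel" unfolding rift_def by measurable
qed (auto simp: rift_def abs_Re_le_cmod)

lemma rift_continuous: "tf H \<Longrightarrow> isCont (rift H) x"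
  unfolding rift_def
  by (intro isCont_o2[OF differentiable_imp_continuous_within[OF ift_differentiable]]
      bounded_linear.continuous[OF bounded_linear_Re] continuous_ident)

lemma rift_smooth: "tf H \<Longrightarrow> C_infinity_on UNIV (rift H)"
  using rift_schwartz schwartz_def by blast

lemma fourier_rift: "tf H \<Longrightarrow> fourier (\<lambda>x. of_real (rift H x)) \<xi> = of_real (symm H \<xi>)"
proof -
  assume H: "tf H"
  have "ift (symm H) = (\<lambda>x. of_real (rift H x))" using ift_symm[OF H] by blast
  then show ?thesis using fourier_ift[OF tf_symm[OF H], of \<xi>] by simp
qed

lemma integral_ift: "tf H \<Longrightarrow> (\<integral>x. ift H x \<partial>lborel) = of_real (H 0)"
  using fourier_ift[of H 0] by (simp add: fourier_cis)

lemma integral_rift: "tf H \<Longrightarrow> (\<integral>x. rift H x \<partial>lborel) = H 0"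
  using integral_Re[OF rapid_integrable[OF ift_rapid], of H] by (simp add: integral_ift rift_def)

lemma zero_mean_schwartz_rift: "tf H \<Longrightarrow> H 0 = 0 \<Longrightarrow> zero_mean_schwartz (rift H)"
  by (simp add: zero_mean_schwartz_def rift_schwartz integral_rift)

text \<open>Through this identity an energy becomes an integral of the transform of the potential
  against a nonnegative weight.\<close>

lemma rift_correlation:
  fixes H :: "'a::euclidean_space \<Rightarrow> real"
  assumes "tf H"
  shows "(\<integral>y. rift H (z + y) * rift H y \<partial>lborel) = rift (\<lambda>\<xi>. (symm H \<xi>)\<^sup>2) z"
proof -
  have "complex_of_real (\<integral>y. rift H (z + y) * rift H y \<partial>lborel) =
      (\<integral>y. ift (symm H) (z + y) * cnj (ift (symm H) y) \<partial>lborel)"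
    unfolding integral_complex_of_real[symmetric] ift_symm[OF assms] by simp
  also have "\<dots> = ift (\<lambda>\<xi>. symm H \<xi> * symm H \<xi>) z"
    by (rule ift_correlation[OF tf_symm[OF assms] tf_symm[OF assms]])
  finally show ?thesis unfolding rift_def power2_eq_square by (metis Re_complex_of_real)
qed

lemma rift_scale:
  fixes F :: "'a::euclidean_space \<Rightarrow> real"
  assumes "F \<in> borel_measurable borel" "\<epsilon> > 0"
  shows "rift (\<lambda>\<xi>. F (\<epsilon> *\<^sub>R \<xi>)) x = rift F ((1 / \<epsilon>) *\<^sub>R x) / \<epsilon> ^ DIM('a)"
  unfolding rift_def ift_scale[OF assms] by (simp add: Re_divide_of_real del: of_real_power of_real_divide)

text \<open>A shift in frequency is a modulation in space. The unshifted profile is real because its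
  bump is even, so only the cosine survives in the real part.\<close>

lemma rift_shift_bump:
  fixes c :: "'a::euclidean_space"
  assumes "r > 0"
  shows "rift (bump c r) x = rift (bump 0 r) x * cos (2 * pi * (c \<bullet> x))"
proof -
  have "bump c r = (\<lambda>\<xi>. bump 0 r (\<xi> - c))" by (simp add: bump_def fun_eq_iff)
  then have "ift (bump c r) x = cis (2 * pi * (c \<bullet> x)) * ift (bump 0 r) x"
    using ift_shift[OF tf_measurable[OF tf_bump[OF assms]], of 0 c x] by simp
  moreover have "ift (bump 0 r) x = of_real (rift (bump 0 r) x)"
    unfolding rift_def
    by (rule ift_even_real[OF tf_measurable[OF tf_bump[OF assms]]]) (use bump_uminus[of 0 r] in simp)
  ultimately have "ift (bump c r) x = cis (2 * pi * (c \<bullet> x)) * of_real (rift (bump 0 r) x)" by simp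
  then show ?thesis unfolding rift_def[of "bump c r"] by simp
qed

text \<open>Here p is merely integrable: it will be a symbol times a test function, and the symbol
  may fail to be smooth at the origin.\<close>

lemma ift_fourier_swap:
  fixes W :: "'a::euclidean_space \<Rightarrow> real"
  assumes W: "tf W" and p: "integrable lborel p"
  shows "(\<integral>x. ift W x * fourier p x \<partial>lborel) = (\<integral>\<xi>. of_real (W \<xi>) * p \<xi> \<partial>lborel)"
proof -
  have V: "integrable lborel (ift W)" by (rule rapid_integrable[OF ift_rapid[OF W]])
  have Vr: "integrable lborel (\<lambda>x. ift W (- x))" using lborel_affine_integrable[OF V, of "-1" 0] by simp
  have [measurable]: "p \<in> borel_measurable borel" using p by auto
  note [measurable] = ift_measurable[OF W]
  have "(\<integral>x. ift W x * fourier p x \<partial>lborel) = (\<integral>x. inv_fourier p x * ift W (- x) \<partial>lborel)"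
    using integral_reflect[of "\<lambda>x. inv_fourier p x * ift W (- x)"]
    by (simp add: fourier_eq_inv_fourier mult.commute)
  also have "\<dots> = (\<integral>\<xi>. p \<xi> * inv_fourier (\<lambda>x. ift W (- x)) \<xi> \<partial>lborel)"
    by (rule inv_fourier_swap[OF p Vr])
  also have "inv_fourier (\<lambda>x. ift W (- x)) = (\<lambda>\<xi>. of_real (W \<xi>))"
  proof
    fix \<xi>
    have "inv_fourier (\<lambda>x. ift W (- x)) \<xi> = fourier (ift W) \<xi>"
      unfolding inv_fourier_cis fourier_cis
      using integral_reflect[of "\<lambda>x. cis (- (2 * pi * (\<xi> \<bullet> x))) * ift W x"] by (simp add: inner_commute)
    then show "inv_fourier (\<lambda>x. ift W (- x)) \<xi> = of_real (W \<xi>)" using fourier_ift[OF W] by simp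
  qed
  finally show ?thesis by (simp add: mult.commute)
qed

lemma integrable_rapid_mult_fourier:
  fixes f :: "'a::euclidean_space \<Rightarrow> complex"
  assumes "integrable lborel f" "integrable lborel p"
  shows "integrable lborel (\<lambda>x. f x * fourier p x)"
proof -
  have [measurable]: "f \<in> borel_measurable borel" "p \<in> borel_measurable borel" using assms by auto
  have [measurable]: "fourier p \<in> borel_measurable borel"
    unfolding fourier_eq_inv_fourier[abs_def] by measurable
  show ?thesis
  proof (rule Bochner_Integration.integrable_bound[OF integrable_mult_left[OF assms(1), of "complex_of_real (\<integral>\<xi>. norm (p \<xi>) \<partial>lborel)"]])
    have "norm (f x * fourier p x) \<le> norm (f x * complex_of_real (\<integral>\<xi>. norm (p \<xi>) \<partial>lborel))" for x
      unfolding fourier_eq_inv_fourier norm_mult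
      by (intro mult_left_mono order_trans[OF norm_inv_fourier_le]) auto
    then show "AE x in lborel. norm (f x * fourier p x) \<le> norm (f x * complex_of_real (\<integral>\<xi>. norm (p \<xi>) \<partial>lborel))" by simp
  qed measurable
qed

text \<open>Both sides of the distributional identity are moved to the frequency side, where they
  agree because the even parts of the two transforms do so pointwise.\<close>

lemma fourier_multiplier_rift:
  fixes V W :: "'a::euclidean_space \<Rightarrow> real"
  assumes V: "tf V" and W: "tf W"
    and eq: "\<And>\<xi>. symm W \<xi> = \<sigma> \<xi> * symm V \<xi>"
    and loc: "\<And>\<psi>. tf \<psi> \<Longrightarrow> integrable lborel (\<lambda>\<xi>. \<sigma> \<xi> * \<psi> \<xi>)"
  shows "fourier_multiplier \<sigma> (\<lambda>x. rift V x *\<^sub>R e) (\<lambda>x. rift W x *\<^sub>R e)"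
  unfolding fourier_multiplier_def
proof (intro allI impI ballI)
  fix \<psi> :: "'a \<Rightarrow> real" and b :: 'a assume \<psi>: "tf \<psi>" and b: "b \<in> Basis"
  have i1: "integrable lborel (\<lambda>\<xi>. complex_of_real (\<psi> \<xi>))" by (rule tf_integrable_complex[OF \<psi>])
  have i2: "integrable lborel (\<lambda>\<xi>. complex_of_real (\<sigma> \<xi> * \<psi> \<xi>))"
    by (rule integrable_bounded_linear[OF bounded_linear_of_real loc[OF \<psi>]])
  have r: "complex_of_real ((rift H x *\<^sub>R e) \<bullet> b) = of_real (e \<bullet> b) * ift (symm H) x" if "tf H" for H x
    by (simp add: ift_symm[OF that])
  have ii: "integrable lborel (\<lambda>x. of_real (e \<bullet> b) * ift (symm H) x)" if "tf H" for H :: "'a \<Rightarrow> real"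
    by (intro integrable_mult_right rapid_integrable ift_rapid tf_symm that)
  have val: "(\<integral>x. of_real (e \<bullet> b) * ift (symm H) x * fourier p x \<partial>lborel) =
      of_real (e \<bullet> b) * (\<integral>\<xi>. of_real (symm H \<xi>) * p \<xi> \<partial>lborel)" if "tf H" "integrable lborel p" for H :: "'a \<Rightarrow> real" and p
    unfolding mult.assoc ift_fourier_swap[OF tf_symm[OF that(1)] that(2), symmetric] by (rule integral_mult_right_zero)
  show "integrable lborel (\<lambda>x. of_real ((rift W x *\<^sub>R e) \<bullet> b) * fourier (\<lambda>\<xi>. of_real (\<psi> \<xi>)) x) \<and>
      integrable lborel (\<lambda>x. of_real ((rift V x *\<^sub>R e) \<bullet> b) * fourier (\<lambda>\<xi>. of_real (\<sigma> \<xi> * \<psi> \<xi>)) x) \<and>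
      (\<integral>x. of_real ((rift W x *\<^sub>R e) \<bullet> b) * fourier (\<lambda>\<xi>. of_real (\<psi> \<xi>)) x \<partial>lborel) =
      (\<integral>x. of_real ((rift V x *\<^sub>R e) \<bullet> b) * fourier (\<lambda>\<xi>. of_real (\<sigma> \<xi> * \<psi> \<xi>)) x \<partial>lborel)"
    unfolding r[OF W] r[OF V] val[OF W i1] val[OF V i2]
    using integrable_rapid_mult_fourier[OF ii[OF W] i1] integrable_rapid_mult_fourier[OF ii[OF V] i2] eq
    by (simp add: mult_ac)
qed

section \<open>Dipole densities\<close>

lemma rift_translate_eq:
  fixes F :: "'a::euclidean_space \<Rightarrow> real"
  assumes F: "tf F" and even: "\<And>\<xi>. F (- \<xi>) = F \<xi>"
  shows "rift F (y + p) - rift F (y - p) = -2 * Im (ift (\<lambda>\<xi>. F \<xi> * sin (2 * pi * (\<xi> \<bullet> p))) y)"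
proof -
  have F2: "tf (\<lambda>\<xi>. F \<xi> * sin (2 * pi * (\<xi> \<bullet> p)))" by (rule tf_mult[OF F C_infinity_on_trig(2)])
  have i: "integrable lborel (\<lambda>\<xi>. F \<xi> * cos (2 * pi * (\<xi> \<bullet> x)))" for x
    by (rule tf_integrable[OF tf_mult[OF F C_infinity_on_trig(1)]])
  have "rift F (y + p) - rift F (y - p) =
      (\<integral>\<xi>. F \<xi> * cos (2 * pi * (\<xi> \<bullet> (y + p))) - F \<xi> * cos (2 * pi * (\<xi> \<bullet> (y - p))) \<partial>lborel)"
    by (simp add: rift_eq tf_integrable F i)
  also have "\<dots> = (\<integral>\<xi>. -2 * (F \<xi> * sin (2 * pi * (\<xi> \<bullet> p)) * sin (2 * pi * (\<xi> \<bullet> y))) \<partial>lborel)"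
    by (intro Bochner_Integration.integral_cong)
      (auto simp: inner_add_right inner_diff_right distrib_left right_diff_distrib cos_add cos_diff)
  also have "\<dots> = -2 * Im (ift (\<lambda>\<xi>. F \<xi> * sin (2 * pi * (\<xi> \<bullet> p))) y)"
    unfolding ift_Im[OF tf_integrable[OF F2]] by (rule integral_mult_right_zero)
  finally show ?thesis .
qed

text \<open>The profile has integral 1 and width of order 1/r, so for large r this approximates the
  difference of the unit masses at -p and p. Zero mean is built in.\<close>

definition dipole :: "real \<Rightarrow> 'a::euclidean_space \<Rightarrow> 'a \<Rightarrow> real" where
  "dipole r p y = rift (bump 0 r) (y + p) - rift (bump 0 r) (y - p)"

lemma bump_0_even: "bump 0 r (- \<xi>) = bump 0 r \<xi>"
  using bump_uminus[of 0 r \<xi>] by simp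

text \<open>The symbol is odd, so its inverse transform is purely imaginary. This exhibits the
  dipole as a linear image of the transform of a single test function, to which
  \<open>schwartz_linear_ift\<close> applies.\<close>

lemma dipole_eq:
  "r > 0 \<Longrightarrow> dipole r p y = Im (ift (\<lambda>\<xi>. -2 * (bump 0 r \<xi> * sin (2 * pi * (\<xi> \<bullet> p)))) y)"
proof -
  assume r: "r > 0"
  have "ift (\<lambda>\<xi>. -2 * (bump 0 r \<xi> * sin (2 * pi * (\<xi> \<bullet> p)))) y = -2 * ift (\<lambda>\<xi>. bump 0 r \<xi> * sin (2 * pi * (\<xi> \<bullet> p))) y"
    unfolding ift_eq by (subst integral_mult_right_zero[symmetric]) (simp add: mult_ac)
  then show ?thesis unfolding dipole_def using rift_translate_eq[OF tf_bump[OF r] bump_0_even] by simp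
qed

lemma tf_dipole: "r > 0 \<Longrightarrow> tf (\<lambda>\<xi>. -2 * (bump 0 r \<xi> * sin (2 * pi * (\<xi> \<bullet> p))))"
  by (intro tf_cmult tf_mult tf_bump C_infinity_on_trig)

lemma zero_mean_schwartz_dipole:
  assumes "r > 0" shows "zero_mean_schwartz (dipole r p)"
proof -
  let ?H = "\<lambda>\<xi>. -2 * (bump 0 r \<xi> * sin (2 * pi * (\<xi> \<bullet> p)))"
  have "schwartz (\<lambda>y. Im (ift ?H y))"
    by (rule schwartz_linear_ift[OF tf_dipole[OF assms] bounded_linear_Im])
  moreover have "(\<integral>y. Im (ift ?H y) \<partial>lborel) = 0"
    using integral_Im[OF rapid_integrable[OF ift_rapid[OF tf_dipole[OF assms]]], of p]
    unfolding integral_ift[OF tf_dipole[OF assms]] by simp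
  ultimately show ?thesis unfolding zero_mean_schwartz_def dipole_eq[OF assms, abs_def] by simp
qed

lemma dipole_rapid: "r > 0 \<Longrightarrow> rapid (dipole r p)"
  unfolding dipole_def
  using rapid_diff[OF rapid_translate[OF rift_rapid[OF tf_bump]] rapid_translate[OF rift_rapid[OF tf_bump]], of r r 0 p 0 "- p"]
  by simp

lemma dipole_continuous: "r > 0 \<Longrightarrow> isCont (dipole r p) x"
  unfolding dipole_def
  by (intro continuous_intros isCont_o2[OF _ rift_continuous] tf_bump)


subsection \<open>The commutator on oscillating wave packets\<close>

text \<open>With D a component of the gradient of the potential this is the limit of the commutator;
  with D the potential itself and f = h it is the energy.\<close>

definition pairing :: "('a::euclidean_space \<Rightarrow> real) \<Rightarrow> ('a \<Rightarrow> real) \<Rightarrow> ('a \<Rightarrow> real) \<Rightarrow> real" where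
  "pairing D f h = (\<integral>(x, y). f x * D (x - y) * h y \<partial>(lborel \<Otimes>\<^sub>M lborel))"

text \<open>The commutator of a field that points in one fixed direction, where D is the component
  of the gradient in this direction.\<close>

definition comm :: "('a::euclidean_space \<Rightarrow> real) \<Rightarrow> ('a \<Rightarrow> real) \<Rightarrow> ('a \<Rightarrow> real) \<Rightarrow> ('a \<Rightarrow> real) \<Rightarrow> real" where
  "comm D v f h = (\<integral>(x, y). (v x - v y) * D (x - y) * f x * h y \<partial>(lborel \<Otimes>\<^sub>M lborel))"

lemma commutator_form_scaleR:
  "commutator_form g (\<lambda>x. v x *\<^sub>R e) f h = comm (\<lambda>z. e \<bullet> gradient g z) v f h"
  unfolding commutator_form_def comm_def
  by (intro Bochner_Integration.integral_cong) (auto simp: scaleR_diff_left[symmetric])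

text \<open>The diagonal lies in the hyperplane orthogonal to (e, -e).\<close>

lemma AE_off_diagonal: "AE p in (lborel :: ('a::euclidean_space \<times> 'a) measure). fst p \<noteq> snd p"
proof -
  obtain e :: 'a where e: "e \<in> Basis" using nonempty_Basis by blast
  let ?q = "(e, - e)"
  have "negligible {p. ?q \<bullet> p = 0}" by (rule negligible_hyperplane) (use e in \<open>auto simp: zero_prod_def\<close>)
  then have "AE p in lebesgue. p \<notin> {p. ?q \<bullet> p = 0}" using AE_not_in negligible_iff_null_sets by blast
  then have "AE p in lborel. p \<notin> {p. ?q \<bullet> p = 0}" by (simp add: AE_completion_iff)
  then show ?thesis by eventually_elim (auto simp: inner_Pair)
qed

lemma integrable_comm:
  fixes D :: "'a::euclidean_space \<Rightarrow> real"
  assumes D: "tempered D" and f: "rapid f" and h: "rapid h"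
    and v: "v \<in> borel_measurable borel" "\<And>x. \<bar>v x\<bar> \<le> B"
  shows "integrable (lborel \<Otimes>\<^sub>M lborel) (\<lambda>(x, y). (v x - v y) * D (x - y) * f x * h y)"
proof -
  have 1: "integrable (lborel \<Otimes>\<^sub>M lborel) (\<lambda>(x, y). (f x * v x) * D (x - y) * h y)"
    by (rule integrable_kernel[OF rapid_mult_bounded[OF f v] D h])
  have 2: "integrable (lborel \<Otimes>\<^sub>M lborel) (\<lambda>(x, y). f x * D (x - y) * (h y * v y))"
    by (rule integrable_kernel[OF f D rapid_mult_bounded[OF h v]])
  show ?thesis
    by (rule Bochner_Integration.integrable_cong[THEN iffD1, OF refl _ Bochner_Integration.integrable_diff[OF 1 2]])
      (auto simp: algebra_simps)
qed

lemma comm_linear: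
  fixes D :: "'a::euclidean_space \<Rightarrow> real"
  assumes D: "tempered D" and f: "rapid f" and k: "rapid k" and h: "rapid h"
    and v: "v \<in> borel_measurable borel" "\<And>x. \<bar>v x\<bar> \<le> B"
  shows "comm D v (\<lambda>x. f x + l * k x) h = comm D v f h + l * comm D v k h"
proof -
  note i = integrable_comm[OF D f h v] integrable_comm[OF D k h v]
  have "comm D v (\<lambda>x. f x + l * k x) h =
      (\<integral>p. (case p of (x, y) \<Rightarrow> (v x - v y) * D (x - y) * f x * h y)
        + l * (case p of (x, y) \<Rightarrow> (v x - v y) * D (x - y) * k x * h y) \<partial>(lborel \<Otimes>\<^sub>M lborel))"
    unfolding comm_def by (intro Bochner_Integration.integral_cong) (auto simp: algebra_simps)
  also have "\<dots> = comm D v f h + l * comm D v k h"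
    unfolding comm_def using Bochner_Integration.integral_add[OF i(1) integrable_mult_right[OF i(2), of l]] by simp
  finally show ?thesis .
qed

lemma comm_scale: "comm D (\<lambda>x. c * v x) f h = c * comm D v f h"
proof -
  have "comm D (\<lambda>x. c * v x) f h = (\<integral>p. c * (case p of (x, y) \<Rightarrow> (v x - v y) * D (x - y) * f x * h y) \<partial>(lborel \<Otimes>\<^sub>M lborel))"
    unfolding comm_def by (intro Bochner_Integration.integral_cong) (auto simp: algebra_simps)
  then show ?thesis unfolding comm_def by simp
qed

lemma pairing_linear:
  fixes D :: "'a::euclidean_space \<Rightarrow> real"
  assumes D: "tempered D" and f: "rapid f" and k: "rapid k" and h: "rapid h"
  shows "pairing D h (\<lambda>x. f x + l * k x) = pairing D h f + l * pairing D h k"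
proof -
  note i = integrable_kernel[OF h D f] integrable_kernel[OF h D k]
  have "pairing D h (\<lambda>x. f x + l * k x) =
      (\<integral>p. (case p of (x, y) \<Rightarrow> h x * D (x - y) * f y)
        + l * (case p of (x, y) \<Rightarrow> h x * D (x - y) * k y) \<partial>(lborel \<Otimes>\<^sub>M lborel))"
    unfolding pairing_def by (intro Bochner_Integration.integral_cong) (auto simp: algebra_simps)
  also have "\<dots> = pairing D h f + l * pairing D h k"
    unfolding pairing_def using Bochner_Integration.integral_add[OF i(1) integrable_mult_right[OF i(2), of l]] by simp
  finally show ?thesis .
qed

lemma abs_diff_le_double: "\<bar>x\<bar> \<le> M \<Longrightarrow> \<bar>y\<bar> \<le> M \<Longrightarrow> \<bar>x - y\<bar> \<le> 2 * M" for x y M :: real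
  by linarith

text \<open>Only the resonant part of \<open>cos\<^sup>2 = (1 + cos 2 \<cdot>) / 2\<close> survives; all other products oscillate in
  \<open>'a \<times> 'a\<close> and vanish by Riemann--Lebesgue.\<close>

lemma comm_limit:
  fixes D \<phi> h :: "'a::euclidean_space \<Rightarrow> real"
  assumes D: "tempered D" "continuous_on (- {0}) D"
    and \<phi>: "rapid \<phi>" "\<And>x. isCont \<phi> x" and h: "rapid h" "\<And>x. isCont h x" and e: "e \<noteq> 0"
    and v: "\<And>n. v n \<in> borel_measurable borel" "\<And>n x. \<bar>v n x\<bar> \<le> B"
      "\<And>x. (\<lambda>n. v n x - \<kappa> * cos (2 * pi * real n * (x \<bullet> e))) \<longlonglongrightarrow> 0"
  shows "(\<lambda>n. comm D (v n) (\<lambda>x. \<phi> x * cos (2 * pi * real n * (x \<bullet> e))) h) \<longlonglongrightarrow> \<kappa> / 2 * pairing D \<phi> h"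
proof -
  define k where "k p = \<phi> (fst p) * D (fst p - snd p) * h (snd p)" for p
  have k_int: "integrable lborel k"
    using integrable_kernel[OF \<phi>(1) D(1) h(1)] by (simp add: lborel_prod k_def[abs_def] case_prod_beta')
  note [measurable] = tempered_measurable[OF D(1)] rapid_measurable[OF \<phi>(1)] rapid_measurable[OF h(1)] v(1)
  have [measurable]: "k \<in> borel_measurable borel" using k_int by auto
  have pk: "pairing D \<phi> h = (\<integral>p. k p \<partial>lborel)"
    unfolding pairing_def by (simp add: lborel_prod k_def[abs_def] case_prod_beta')
  \<comment> \<open>\<open>riemann_lebesgue\<close> asks for continuity almost everywhere, so a
    singularity of D on the diagonal does no harm.\<close>
  have k_cont: "AE p in lborel. isCont k p"
    using AE_off_diagonal
  proof eventually_elim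
    case (elim p)
    have "isCont D (fst p - snd p)"
      using D(2) elim by (simp add: continuous_on_eq_continuous_at open_Compl)
    then have "isCont (\<lambda>p. D (fst p - snd p)) p" by (rule isCont_o2[rotated]) (intro continuous_intros)
    moreover have "isCont (\<lambda>p. \<phi> (fst p)) p" by (rule isCont_o2[OF _ \<phi>(2)]) (intro continuous_intros)
    moreover have "isCont (\<lambda>p. h (snd p)) p" by (rule isCont_o2[OF _ h(2)]) (intro continuous_intros)
    ultimately show ?case unfolding k_def by (intro continuous_intros)
  qed
  define C where "C n x = cos (2 * pi * real n * (x \<bullet> e))" for n x
  \<comment> \<open>The deviation of \<open>v n\<close> from a pure cosine tends to 0 pointwise and
    is uniformly bounded, so dominated convergence disposes of it without any oscillation.\<close>
  define a where "a n x = v n x - \<kappa> * C n x" for n x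
  have aB: "\<bar>a n x\<bar> \<le> B + \<bar>\<kappa>\<bar>" for n x
  proof -
    have "\<bar>\<kappa> * C n x\<bar> \<le> \<bar>\<kappa>\<bar>" by (simp add: C_def abs_mult mult_left_le)
    then show ?thesis using v(2)[of n x] unfolding a_def by linarith
  qed
  have fs: "fst \<in> borel_measurable (borel :: ('a \<times> 'a) measure)" "snd \<in> borel_measurable (borel :: ('a \<times> 'a) measure)"
    by (intro borel_measurable_continuous_onI continuous_intros)+
  have [measurable]: "C n \<in> borel_measurable borel" for n unfolding C_def by measurable
  have [measurable]: "a n \<in> borel_measurable borel" for n unfolding a_def by measurable
  have am [measurable]: "(\<lambda>p. (a n (fst p) - a n (snd p)) * C n (fst p)) \<in> borel_measurable borel" for n
    by (intro borel_measurable_times borel_measurable_diff measurable_compose[OF fs(1)] measurable_compose[OF fs(2)]) measurable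
  have s1: "(\<lambda>n. \<integral>p. k p * ((a n (fst p) - a n (snd p)) * C n (fst p)) \<partial>lborel) \<longlonglongrightarrow> (\<integral>p. 0 \<partial>(lborel :: ('a \<times> 'a) measure))"
  proof (rule integral_dominated_convergence[where w = "\<lambda>p. 2 * (B + \<bar>\<kappa>\<bar>) * \<bar>k p\<bar>"])
    show "integrable lborel (\<lambda>p. 2 * (B + \<bar>\<kappa>\<bar>) * \<bar>k p\<bar>)"
      by (intro integrable_mult_right integrable_abs k_int)
    have bd: "norm (k p * ((a n (fst p) - a n (snd p)) * C n (fst p))) \<le> 2 * (B + \<bar>\<kappa>\<bar>) * \<bar>k p\<bar>" for n p
    proof -
      have "\<bar>a n (fst p) - a n (snd p)\<bar> \<le> 2 * (B + \<bar>\<kappa>\<bar>)" by (rule abs_diff_le_double[OF aB aB])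
      moreover have "\<bar>C n (fst p)\<bar> \<le> 1" by (simp add: C_def)
      ultimately have "\<bar>a n (fst p) - a n (snd p)\<bar> * \<bar>C n (fst p)\<bar> \<le> 2 * (B + \<bar>\<kappa>\<bar>) * 1"
        by (intro mult_mono) auto
      from mult_left_mono[OF this, of "\<bar>k p\<bar>"] show ?thesis by (simp add: abs_mult mult_ac)
    qed
    then show "AE p in lborel. norm (k p * ((a n (fst p) - a n (snd p)) * C n (fst p))) \<le> 2 * (B + \<bar>\<kappa>\<bar>) * \<bar>k p\<bar>" for n
      by simp
    show "AE p in lborel. (\<lambda>n. k p * ((a n (fst p) - a n (snd p)) * C n (fst p))) \<longlonglongrightarrow> 0"
    proof (rule AE_I2)
      fix p :: "'a \<times> 'a"
      have lim: "(\<lambda>n. a n x) \<longlonglongrightarrow> 0" for x using v(3)[of x] by (simp add: a_def C_def)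
      have "(\<lambda>n. 2 * \<bar>k p\<bar> * (\<bar>a n (fst p)\<bar> + \<bar>a n (snd p)\<bar>)) \<longlonglongrightarrow> 2 * \<bar>k p\<bar> * (\<bar>0\<bar> + \<bar>0\<bar>)"
        by (intro tendsto_intros lim)
      then have z: "(\<lambda>n. 2 * \<bar>k p\<bar> * (\<bar>a n (fst p)\<bar> + \<bar>a n (snd p)\<bar>)) \<longlonglongrightarrow> 0" by simp
      show "(\<lambda>n. k p * ((a n (fst p) - a n (snd p)) * C n (fst p))) \<longlonglongrightarrow> 0"
      proof (rule Lim_null_comparison[OF always_eventually z], rule allI)
        fix n
        have "\<bar>a n (fst p) - a n (snd p)\<bar> * \<bar>C n (fst p)\<bar> \<le> (\<bar>a n (fst p)\<bar> + \<bar>a n (snd p)\<bar>) * 1"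
          by (intro mult_mono) (auto simp: C_def)
        from mult_left_mono[OF this, of "\<bar>k p\<bar>"]
        have "norm (k p * ((a n (fst p) - a n (snd p)) * C n (fst p))) \<le> \<bar>k p\<bar> * (\<bar>a n (fst p)\<bar> + \<bar>a n (snd p)\<bar>)"
          by (simp add: abs_mult mult_ac)
        also have "\<dots> \<le> 2 * \<bar>k p\<bar> * (\<bar>a n (fst p)\<bar> + \<bar>a n (snd p)\<bar>)"
          by (intro mult_right_mono) auto
        finally show "norm (k p * ((a n (fst p) - a n (snd p)) * C n (fst p))) \<le> 2 * \<bar>k p\<bar> * (\<bar>a n (fst p)\<bar> + \<bar>a n (snd p)\<bar>)" .
      qed
    qed
  qed measurable
  let ?Q = "\<lambda>q n. \<integral>p. k p * cos (2 * pi * real n * (p \<bullet> q)) \<partial>lborel"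
  have rl: "?Q q \<longlonglongrightarrow> 0" if "q \<noteq> 0" for q
    by (rule riemann_lebesgue[OF k_int k_cont that])
  have ki: "integrable lborel (\<lambda>p. k p * b p)" if [measurable]: "b \<in> borel_measurable borel" and "\<And>p. \<bar>b p\<bar> \<le> M" for b and M :: real
  proof (rule Bochner_Integration.integrable_bound[OF integrable_mult_right[OF k_int, of M]])
    have "norm (k p * b p) \<le> norm (M * k p)" for p
      using mult_left_mono[OF order_trans[OF that(2)[of p] abs_ge_self], of "\<bar>k p\<bar>"] by (simp add: abs_mult mult.commute)
    then show "AE p in lborel. norm (k p * b p) \<le> norm (M * k p)" by simp
  qed measurable
  have kc: "integrable lborel (\<lambda>p. k p * cos (2 * pi * real n * (p \<bullet> q)))" for n q
    by (rule ki[where M = 1]) auto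
  \<comment> \<open>Product formulas turn the oscillating factors into single cosines in the joint
    variable (x, y), with the nonzero frequencies (2e, 0), (e, -e) and (e, e), plus a constant
    term.\<close>
  have eq: "comm D (v n) (\<lambda>x. \<phi> x * C n x) h =
      (\<integral>p. k p * ((a n (fst p) - a n (snd p)) * C n (fst p)) \<partial>lborel) +
      \<kappa> / 2 * (pairing D \<phi> h + ?Q (2 *\<^sub>R e, 0) n - ?Q (e, - e) n - ?Q (e, e) n)" for n
  proof -
    have "comm D (v n) (\<lambda>x. \<phi> x * C n x) h =
        (\<integral>p. k p * ((a n (fst p) - a n (snd p)) * C n (fst p)) + \<kappa> / 2 *
          (k p + k p * cos (2 * pi * real n * (p \<bullet> (2 *\<^sub>R e, 0))) - k p * cos (2 * pi * real n * (p \<bullet> (e, - e)))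
            - k p * cos (2 * pi * real n * (p \<bullet> (e, e)))) \<partial>lborel)"
      unfolding comm_def lborel_prod
    proof (rule Bochner_Integration.integral_cong[OF refl], clarify)
      fix x y :: 'a
      let ?s = "2 * pi * real n * (x \<bullet> e)" and ?t = "2 * pi * real n * (y \<bullet> e)"
      have 1: "cos (2 * pi * real n * ((x, y) \<bullet> (2 *\<^sub>R e, 0))) = 2 * (cos ?s)\<^sup>2 - 1"
        using cos_double_cos[of ?s] by (simp add: mult_ac)
      have 2: "cos (2 * pi * real n * ((x, y) \<bullet> (e, - e))) = cos ?s * cos ?t + sin ?s * sin ?t"
        by (simp add: right_diff_distrib cos_diff)
      have 3: "cos (2 * pi * real n * ((x, y) \<bullet> (e, e))) = cos ?s * cos ?t - sin ?s * sin ?t"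
        by (simp add: distrib_left cos_add)
      have va: "v n x = a n x + \<kappa> * cos ?s" "v n y = a n y + \<kappa> * cos ?t" by (simp_all add: a_def C_def)
      show "(v n x - v n y) * D (x - y) * (\<phi> x * C n x) * h y =
          k (x, y) * ((a n (fst (x, y)) - a n (snd (x, y))) * C n (fst (x, y))) + \<kappa> / 2 *
          (k (x, y) + k (x, y) * cos (2 * pi * real n * ((x, y) \<bullet> (2 *\<^sub>R e, 0))) - k (x, y) * cos (2 * pi * real n * ((x, y) \<bullet> (e, - e)))
            - k (x, y) * cos (2 * pi * real n * ((x, y) \<bullet> (e, e))))"
        unfolding 1 2 3 va k_def C_def by (simp add: field_simps power2_eq_square)
    qed
    also have "\<dots> = (\<integral>p. k p * ((a n (fst p) - a n (snd p)) * C n (fst p)) \<partial>lborel) +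
      \<kappa> / 2 * (pairing D \<phi> h + ?Q (2 *\<^sub>R e, 0) n - ?Q (e, - e) n - ?Q (e, e) n)"
    proof -
      have i0: "integrable lborel (\<lambda>p. k p * ((a n (fst p) - a n (snd p)) * C n (fst p)))"
      proof (rule ki[where M = "2 * (B + \<bar>\<kappa>\<bar>)"])
        fix p :: "'a \<times> 'a"
        have "\<bar>a n (fst p) - a n (snd p)\<bar> * \<bar>C n (fst p)\<bar> \<le> 2 * (B + \<bar>\<kappa>\<bar>) * 1"
          using abs_diff_le_double[OF aB[of n "fst p"] aB[of n "snd p"]] by (intro mult_mono) (auto simp: C_def)
        then show "\<bar>(a n (fst p) - a n (snd p)) * C n (fst p)\<bar> \<le> 2 * (B + \<bar>\<kappa>\<bar>)" by (simp add: abs_mult)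
      qed measurable
      note i = k_int kc[of n "(2 *\<^sub>R e, 0)"] kc[of n "(e, - e)"] kc[of n "(e, e)"]
      show ?thesis
        unfolding pk
        by (subst Bochner_Integration.integral_add[OF i0], intro integrable_mult_right Bochner_Integration.integrable_add
            Bochner_Integration.integrable_diff i,
            simp only: integral_mult_right_zero Bochner_Integration.integral_add[OF i(1,2)]
            Bochner_Integration.integral_diff[OF Bochner_Integration.integrable_add[OF i(1,2)] i(3)]
            Bochner_Integration.integral_diff[OF Bochner_Integration.integrable_diff[OF Bochner_Integration.integrable_add[OF i(1,2)] i(3)] i(4)])
    qed
    finally show ?thesis .
  qed
  have q: "(2 *\<^sub>R e, 0 :: 'a) \<noteq> 0" "(e, - e) \<noteq> 0" "(e, e) \<noteq> 0" using e by (auto simp: zero_prod_def)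
  have "(\<lambda>n. comm D (v n) (\<lambda>x. \<phi> x * C n x) h) \<longlonglongrightarrow> (\<integral>p. 0 \<partial>(lborel :: ('a \<times> 'a) measure)) + \<kappa> / 2 * (pairing D \<phi> h + 0 - 0 - 0)"
    unfolding eq by (intro tendsto_intros s1 rl q)
  then show ?thesis by (simp add: C_def)
qed

section \<open>Sampling a kernel by profiles of growing frequency radius\<close>

lemma bump_radius: "r > 0 \<Longrightarrow> bump 0 r = (\<lambda>\<xi>. bump 0 1 ((1 / r) *\<^sub>R \<xi>))"
  by (simp add: bump_def fun_eq_iff power_divide)

text \<open>The autocorrelation of the profile \<open>rift (bump 0 r)\<close>. It is the inner
  integral that the shear leaves when two such profiles are paired.\<close>

definition corr :: "real \<Rightarrow> 'a::euclidean_space \<Rightarrow> real" where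
  "corr r z = rift (\<lambda>\<xi>. (bump 0 r \<xi>)\<^sup>2) z"

lemma tf_bump_sq: "r > 0 \<Longrightarrow> tf (\<lambda>\<xi>. (bump c r \<xi>)\<^sup>2)"
  unfolding power2_eq_square by (intro tf_mult tf_bump C_infinity_on_bump)

lemma corr_rapid: "r > 0 \<Longrightarrow> rapid (corr r)"
  unfolding corr_def[abs_def] by (rule rift_rapid[OF tf_bump_sq])

lemma integral_bump_corr:
  assumes "r > 0"
  shows "(\<integral>y. rift (bump 0 r) (z + y) * rift (bump 0 r) (y + p) \<partial>lborel) = corr r (z - p)"
proof -
  note [measurable] = rapid_measurable[OF rift_rapid[OF tf_bump[OF assms]]]
  have "(\<integral>y. rift (bump 0 r) (z + y) * rift (bump 0 r) (y + p) \<partial>lborel) =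
      (\<integral>y. rift (bump 0 r) ((z - p) + (y + p)) * rift (bump 0 r) (y + p) \<partial>lborel)"
    by (simp add: algebra_simps)
  also have "\<dots> = (\<integral>y. rift (bump 0 r) ((z - p) + y) * rift (bump 0 r) y \<partial>lborel)"
    by (rule integral_translate[of "\<lambda>y. rift (bump 0 r) ((z - p) + y) * rift (bump 0 r) y"]) measurable
  also have "\<dots> = corr r (z - p)"
    unfolding rift_correlation[OF tf_bump[OF assms]] corr_def
    by (simp add: symm_even bump_0_even)
  finally show ?thesis .
qed

lemma integral_dipole_corr:
  assumes "r > 0"
  shows "(\<integral>y. rift (bump 0 r) (z + y) * dipole r p y \<partial>lborel) = corr r (z - p) - corr r (z + p)"
proof -
  have "integrable lborel (\<lambda>y. rift (bump 0 r) (z + y) * rift (bump 0 r) (y + q))" for q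
  proof -
    obtain B where "\<And>x::'a. norm (rift (bump 0 r) x) \<le> B" using rapid_bounded[OF rift_rapid[OF tf_bump[OF assms]]] by metis
    then have "rapid (\<lambda>y. rift (bump 0 r) (y + z) * rift (bump 0 r) (y + q))"
      using rapid_measurable[OF rapid_translate[OF rift_rapid[OF tf_bump[OF assms]]], of 0 q]
      by (intro rapid_mult_bounded[where B = B] rapid_translate[OF rift_rapid[OF tf_bump[OF assms]]]) auto
    then show ?thesis using rapid_integrable by (simp add: add.commute)
  qed
  from Bochner_Integration.integral_diff[OF this[of p] this[of "- p"]] show ?thesis
    unfolding dipole_def using integral_bump_corr[OF assms, of z p] integral_bump_corr[OF assms, of z "- p"]
    by (simp add: right_diff_distrib)
qed

text \<open>The mass of the correlation is the value of the squared bump at 0, that is 1, and a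
  larger frequency radius concentrates it.\<close>

lemma corr_approximate_identity:
  fixes u :: "'a::euclidean_space \<Rightarrow> real"
  assumes u: "tempered u" "isCont u p"
  shows "(\<lambda>j. \<integral>z. u z * corr (real (Suc j)) (z - p) \<partial>lborel) \<longlonglongrightarrow> u p"
proof -
  have c: "corr (real (Suc j)) (z - p) = corr 1 ((1 / (1 / real (Suc j))) *\<^sub>R (z - p)) / (1 / real (Suc j)) ^ DIM('a)" for j and z :: 'a
    unfolding corr_def by (subst bump_radius, simp, rule rift_scale) (auto intro: tf_measurable[OF tf_bump_sq])
  have "(\<integral>z. corr 1 z \<partial>(lborel :: 'a measure)) = 1"
    unfolding corr_def by (subst integral_rift[OF tf_bump_sq]) (auto simp: bump_eq_1)
  then show ?thesis
    unfolding c using approximate_identity[OF corr_rapid[of 1] u inverse_Suc_pos inverse_Suc_tendsto] by simp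
qed

text \<open>In the limit the first function is a unit mass at 0 and the second a difference of unit
  masses at -p and p, so the kernel is sampled at p and at -p. For an odd kernel the two
  contributions add up.\<close>

lemma pairing_dipole_limit:
  fixes u :: "'a::euclidean_space \<Rightarrow> real"
  assumes u: "tempered u" "isCont u p" "isCont u (- p)"
  shows "(\<lambda>j. pairing u (rift (bump 0 (real (Suc j)))) (dipole (real (Suc j)) p)) \<longlonglongrightarrow> u p - u (- p)"
proof -
  have eq: "pairing u (rift (bump 0 r)) (dipole r p) =
      (\<integral>z. u z * corr r (z - p) \<partial>lborel) - (\<integral>z. u z * corr r (z - (- p)) \<partial>lborel)" if r: "r > 0" for r
  proof -
    have i: "integrable lborel (\<lambda>z. u z * corr r (z - q))" for q
      using integrable_tempered_rapid[OF u(1) rapid_translate[OF corr_rapid[OF r], of "- q"]] by simp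
    have "pairing u (rift (bump 0 r)) (dipole r p) = (\<integral>z. u z * (corr r (z - p) - corr r (z + p)) \<partial>lborel)"
      unfolding pairing_def integral_dipole_corr[OF r, symmetric]
      by (rule integral_kernel[OF rift_rapid[OF tf_bump[OF r]] u(1) dipole_rapid[OF r]])
    then show ?thesis using i[of p] i[of "- p"] by (simp add: right_diff_distrib)
  qed
  show ?thesis
    using tendsto_diff[OF corr_approximate_identity[OF u(1,2)] corr_approximate_identity[OF u(1,3)]]
    by (simp only: eq of_nat_0_less_iff zero_less_Suc)
qed


lemma lborel_integral_pos:
  fixes f :: "'a::euclidean_space \<Rightarrow> real"
  assumes f: "integrable lborel f" "\<And>x. 0 \<le> f x" and a: "isCont f a" "f a > 0"
  shows "0 < (\<integral>x. f x \<partial>lborel)"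
proof (rule ccontr)
  assume "\<not> 0 < (\<integral>x. f x \<partial>lborel)"
  moreover have "0 \<le> (\<integral>x. f x \<partial>lborel)" by (rule Bochner_Integration.integral_nonneg) (rule f(2))
  ultimately have "(\<integral>x. f x \<partial>lborel) = 0" by linarith
  then have "AE x in lborel. f x = 0" using integral_nonneg_eq_0_iff_AE[OF f(1)] f(2) by simp
  then have "AE x in lebesgue. f x = 0" by (simp add: AE_completion)
  then obtain N where N: "\<And>x. x \<notin> N \<Longrightarrow> f x = 0" "N \<in> null_sets lebesgue"
    by (elim AE_E3) auto
  have "\<forall>\<^sub>F x in nhds a. 0 < f x"
    by (rule order_tendstoD(1)[OF a(1)[unfolded isCont_def tendsto_at_iff_tendsto_nhds] a(2)])
  then obtain S where S: "open S" "a \<in> S" "\<And>x. x \<in> S \<Longrightarrow> f x > 0"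
    unfolding eventually_nhds by blast
  have "S \<subseteq> N" using N(1) S(3) by force
  then have "negligible S"
    using negligible_subset[of N S] N(2) negligible_iff_null_sets by blast
  then show False using open_not_negligible[OF S(1)] S(2) by blast
qed

text \<open>S will be the reciprocal of a symbol and may be singular at the origin, where the
  vanishing of F hides it.\<close>

lemma tf_localize:
  assumes F: "tf F" and zero: "\<And>\<xi>. norm \<xi> < \<rho> \<Longrightarrow> F \<xi> = 0" "\<rho> > 0"
    and S: "C_infinity_on (- {0}) S"
  shows "tf (\<lambda>\<xi>. F \<xi> * S \<xi>)"
proof -
  obtain r where r: "\<And>x. norm x \<ge> r \<Longrightarrow> F x = 0" using tf_support[OF F] by blast
  show ?thesis
  proof (rule tfI[where r = r])
    have 1: "C_infinity_on (- {0}) (\<lambda>\<xi>. F \<xi> * S \<xi>)"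
      by (intro C_infinity_on_mult C_infinity_on_subset[OF tf_smooth[OF F]] S) auto
    have "C_infinity_on (ball 0 \<rho>) (\<lambda>\<xi>. F \<xi> * S \<xi>) \<longleftrightarrow> C_infinity_on (ball 0 \<rho>) (\<lambda>\<xi>::'a. 0 :: real)"
      by (rule C_infinity_on_cong) (use zero in auto)
    then have 2: "C_infinity_on (ball 0 \<rho>) (\<lambda>\<xi>. F \<xi> * S \<xi>)" by simp
    have "- {0} \<union> ball 0 \<rho> = (UNIV :: 'a set)" using zero(2) by auto
    then show "C_infinity_on UNIV (\<lambda>\<xi>. F \<xi> * S \<xi>)" using C_infinity_on_Un[OF 1 2] by simp
  qed (use r in simp)
qed

section \<open>Wave packets for a general symbol\<close>

definition bump_mass :: "'a::euclidean_space itself \<Rightarrow> real" where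
  "bump_mass _ = (\<integral>x. bump (0::'a) 1 x \<partial>lborel)"

lemma bump_mass_pos: "bump_mass TYPE('a::euclidean_space) > 0"
  unfolding bump_mass_def
proof (rule lborel_integral_pos[where a = 0])
  show "isCont (bump (0::'a) 1) 0"
    using tf_continuous[OF tf_bump[of 1 "0::'a"]] by (simp add: continuous_on_eq_continuous_at)
qed (use tf_integrable[OF tf_bump[of 1 "0::'a"]] in \<open>auto simp: bump_nonneg bump_eq_1\<close>)

lemma rift_bump_0: "rift (bump (0::'a::euclidean_space) 1) 0 = bump_mass TYPE('a)"
  by (simp add: rift_eq tf_integrable tf_bump bump_mass_def)

text \<open>S is the reciprocal of the symbol \<sigma> off the origin and \<kappa> fixes the width
  of the packet. The ratio conditions say that S is asymptotically constant on the packet, with the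
  uniform factor 2 for domination. \<open>n0 \<ge> 2\<close> keeps the packets, whose radius is at
  most 1, at distance at least 1 from the origin.\<close>

locale wave_packets =
  fixes \<sigma> S :: "'a::euclidean_space \<Rightarrow> real" and \<kappa> :: real and e :: 'a and n0 :: nat
  assumes e: "e \<in> Basis" and \<kappa>: "\<kappa> > 0" and n0: "n0 \<ge> 2"
    and smooth: "C_infinity_on (- {0}) S"
    and inverse_symbol: "\<And>\<xi>. \<xi> \<noteq> 0 \<Longrightarrow> \<sigma> \<xi> * S \<xi> = 1"
    and S_pos: "\<And>\<xi>. \<xi> \<noteq> 0 \<Longrightarrow> S \<xi> > 0"
    and S_even: "\<And>\<xi>. S (- \<xi>) = S \<xi>"
    and \<sigma>_loc: "\<And>\<psi>. tf \<psi> \<Longrightarrow> integrable lborel (\<lambda>\<xi>. \<sigma> \<xi> * \<psi> \<xi>)"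
    and ratio_limit: "\<And>\<zeta>. norm \<zeta> \<le> 1 \<Longrightarrow>
      (\<lambda>n. S (real n *\<^sub>R e + real n powr (- \<kappa>) *\<^sub>R \<zeta>) / S (real n *\<^sub>R e)) \<longlonglongrightarrow> 1"
    and ratio_bound: "\<And>n \<zeta>. n \<ge> n0 \<Longrightarrow> norm \<zeta> \<le> 1 \<Longrightarrow>
      S (real n *\<^sub>R e + real n powr (- \<kappa>) *\<^sub>R \<zeta>) \<le> 2 * S (real n *\<^sub>R e)"
begin

definition \<delta> :: "nat \<Rightarrow> real" where "\<delta> n = real n powr (- \<kappa>)"

lemma \<delta>: "n \<ge> n0 \<Longrightarrow> 0 < \<delta> n" "n \<ge> n0 \<Longrightarrow> \<delta> n \<le> 1"
  using n0 \<kappa> by (auto simp: \<delta>_def powr_le1 powr_minus intro!: inverse_le_1_iff[THEN iffD2] ge_one_powr_ge_zero)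

lemma \<delta>_tendsto: "\<delta> \<longlonglongrightarrow> 0"
  unfolding \<delta>_def using \<kappa> by (intro tendsto_neg_powr filterlim_real_sequentially) simp

text \<open>With this normalisation all packets have the same mass, so \<open>w n\<close> has the
  same value at 0 for every n although its spatial extent grows like 1/\<delta>.\<close>

definition Wh :: "nat \<Rightarrow> 'a \<Rightarrow> real" where
  "Wh n \<xi> = 1 / \<delta> n ^ DIM('a) * bump (real n *\<^sub>R e) (\<delta> n) \<xi>"

definition w :: "nat \<Rightarrow> 'a \<Rightarrow> real" where "w n = rift (Wh n)"

definition v :: "nat \<Rightarrow> 'a \<Rightarrow> real" where "v n = rift (\<lambda>\<xi>. Wh n \<xi> * S \<xi>)"

lemma norm_e [simp]: "norm e = 1" using e by simp

lemma e_nonzero [simp]: "e \<noteq> 0" using e by auto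

lemma tf_Wh: "n \<ge> n0 \<Longrightarrow> tf (Wh n)"
  unfolding Wh_def[abs_def] by (intro tf_cmult tf_bump \<delta>)

lemma Wh_near_0: "n \<ge> n0 \<Longrightarrow> norm \<xi> < 1 \<Longrightarrow> Wh n \<xi> = 0"
proof -
  assume n: "n \<ge> n0" "norm \<xi> < 1"
  have "norm (real n *\<^sub>R e) - norm \<xi> \<le> norm (\<xi> - real n *\<^sub>R e)"
    using norm_triangle_ineq2[of "real n *\<^sub>R e" \<xi>] by (simp add: norm_minus_commute)
  then have "\<delta> n \<le> norm (\<xi> - real n *\<^sub>R e)" using n n0 \<delta>[OF n(1)] by simp
  then show ?thesis unfolding Wh_def using bump_eq_0 \<delta>[OF n(1)] by simp
qed

lemma tf_Vh: "n \<ge> n0 \<Longrightarrow> tf (\<lambda>\<xi>. Wh n \<xi> * S \<xi>)"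
  by (rule tf_localize[OF tf_Wh _ _ smooth, where \<rho> = 1]) (auto simp: Wh_near_0)

lemma v_multiplier: "n \<ge> n0 \<Longrightarrow> fourier_multiplier \<sigma> (\<lambda>x. v n x *\<^sub>R e) (\<lambda>x. w n x *\<^sub>R e)"
  unfolding v_def w_def
proof (rule fourier_multiplier_rift[OF tf_Vh tf_Wh _ \<sigma>_loc])
  fix \<xi> assume n: "n \<ge> n0"
  show "symm (Wh n) \<xi> = \<sigma> \<xi> * symm (\<lambda>\<xi>. Wh n \<xi> * S \<xi>) \<xi>"
  proof (cases "\<xi> = 0")
    case True
    then show ?thesis using Wh_near_0[OF n, of 0] by (simp add: symm_def)
  next
    case False
    have "\<sigma> \<xi> * symm (\<lambda>\<xi>. Wh n \<xi> * S \<xi>) \<xi> = (\<sigma> \<xi> * S \<xi>) * symm (Wh n) \<xi>"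
      by (simp add: symm_def S_even field_simps)
    then show ?thesis using inverse_symbol[OF False] by simp
  qed
qed

lemma v_smooth: "n \<ge> n0 \<Longrightarrow> C_infinity_on UNIV (\<lambda>x. v n x *\<^sub>R e)"
  unfolding v_def
  by (rule C_infinity_on_bounded_linear[OF open_UNIV bounded_linear_scaleR_left rift_smooth[OF tf_Vh]])

text \<open>An envelope that varies on the length 1/\<delta>, times a cosine; the envelope alone
  bounds the L^p norms.\<close>

lemma w_eq: "n \<ge> n0 \<Longrightarrow> w n x = rift (bump 0 1) (\<delta> n *\<^sub>R x) * cos (2 * pi * real n * (x \<bullet> e))"
proof -
  assume n: "n \<ge> n0"
  have "w n x = 1 / \<delta> n ^ DIM('a) * rift (bump (real n *\<^sub>R e) (\<delta> n)) x"
    unfolding w_def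
    by (subst (1 2) rift_eq, rule tf_integrable[OF tf_bump[OF \<delta>(1)[OF n]]], rule tf_integrable[OF tf_Wh[OF n]])
      (simp add: Wh_def mult.assoc del: mult_1_left times_divide_eq_left)
  also have "\<dots> = 1 / \<delta> n ^ DIM('a) * (rift (bump 0 (\<delta> n)) x * cos (2 * pi * real n * (x \<bullet> e)))"
    by (simp add: rift_shift_bump[OF \<delta>(1)[OF n], of "real n *\<^sub>R e"] inner_commute mult_ac)
  also have "rift (bump 0 (\<delta> n)) x = rift (bump 0 1) ((1 / (1 / \<delta> n)) *\<^sub>R x) / (1 / \<delta> n) ^ DIM('a)"
    by (subst bump_radius[OF \<delta>(1)[OF n]], rule rift_scale) (use \<delta>(1)[OF n] tf_measurable[OF tf_bump[of 1 0]] in auto)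
  finally show ?thesis using \<delta>(1)[OF n] by (simp add: power_divide)
qed

text \<open>The frequency is rescaled to \<xi> = n e + \<delta> \<zeta>, so that the domain of
  integration does not depend on n and limits can be taken under the integral.\<close>

lemma v_eq:
  assumes n: "n \<ge> n0"
  shows "v n x = (\<integral>\<zeta>. bump (0::'a) 1 \<zeta> * S (real n *\<^sub>R e + \<delta> n *\<^sub>R \<zeta>) *
    cos (2 * pi * ((real n *\<^sub>R e + \<delta> n *\<^sub>R \<zeta>) \<bullet> x)) \<partial>lborel)"
proof -
  note d = \<delta>(1)[OF n]
  have [measurable]: "(\<lambda>\<xi>. Wh n \<xi> * S \<xi>) \<in> borel_measurable borel" by (rule tf_measurable[OF tf_Vh[OF n]])
  let ?c = "real n *\<^sub>R e"
  have "v n x = (\<integral>\<xi>. Wh n \<xi> * S \<xi> * cos (2 * pi * (\<xi> \<bullet> x)) \<partial>lborel)"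
    unfolding v_def by (rule rift_eq[OF tf_integrable[OF tf_Vh[OF n]]])
  also have "\<dots> = \<delta> n ^ DIM('a) * (\<integral>\<zeta>. Wh n (?c + \<delta> n *\<^sub>R \<zeta>) * S (?c + \<delta> n *\<^sub>R \<zeta>) * cos (2 * pi * ((?c + \<delta> n *\<^sub>R \<zeta>) \<bullet> x)) \<partial>lborel)"
    by (subst lborel_affine_integral[where c = "\<delta> n" and t = ?c]) (use d in auto)
  also have "\<dots> = (\<integral>\<zeta>. \<delta> n ^ DIM('a) * (Wh n (?c + \<delta> n *\<^sub>R \<zeta>) * S (?c + \<delta> n *\<^sub>R \<zeta>) * cos (2 * pi * ((?c + \<delta> n *\<^sub>R \<zeta>) \<bullet> x))) \<partial>lborel)"
    by (rule integral_mult_right_zero[symmetric])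
  also have "\<dots> = (\<integral>\<zeta>. bump (0::'a) 1 \<zeta> * S (?c + \<delta> n *\<^sub>R \<zeta>) * cos (2 * pi * ((?c + \<delta> n *\<^sub>R \<zeta>) \<bullet> x)) \<partial>lborel)"
  proof (rule Bochner_Integration.integral_cong[OF refl])
    fix \<zeta> :: 'a
    have "bump ?c (\<delta> n) (?c + \<delta> n *\<^sub>R \<zeta>) = bump (0::'a) 1 \<zeta>"
      using d by (simp add: bump_def power_mult_distrib)
    then show "\<delta> n ^ DIM('a) * (Wh n (?c + \<delta> n *\<^sub>R \<zeta>) * S (?c + \<delta> n *\<^sub>R \<zeta>) * cos (2 * pi * ((?c + \<delta> n *\<^sub>R \<zeta>) \<bullet> x))) =
        bump (0::'a) 1 \<zeta> * S (?c + \<delta> n *\<^sub>R \<zeta>) * cos (2 * pi * ((?c + \<delta> n *\<^sub>R \<zeta>) \<bullet> x))"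
      using d by (simp add: Wh_def)
  qed
  finally show ?thesis .
qed

lemma Sn_pos: "n \<ge> n0 \<Longrightarrow> S (real n *\<^sub>R e) > 0"
  using n0 by (intro S_pos) auto

lemma shifted_nonzero: "n \<ge> n0 \<Longrightarrow> norm \<zeta> \<le> 1 \<Longrightarrow> real n *\<^sub>R e + \<delta> n *\<^sub>R \<zeta> \<noteq> 0"
proof
  assume n: "n \<ge> n0" and z: "norm \<zeta> \<le> 1" and eq: "real n *\<^sub>R e + \<delta> n *\<^sub>R \<zeta> = 0"
  have "norm (real n *\<^sub>R e) = norm (\<delta> n *\<^sub>R \<zeta>)" using eq by (metis add_eq_0_iff norm_minus_cancel)
  moreover have "\<delta> n * norm \<zeta> \<le> 1 * 1" using \<delta>[OF n] z by (intro mult_mono) auto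
  ultimately show False using n n0 \<delta>[OF n] by simp
qed

text \<open>The packet divided by its amplitude. The value 0 for n < n0 makes the bounds hold for
  all n, as \<open>comm_limit\<close> demands.\<close>

definition u :: "nat \<Rightarrow> 'a \<Rightarrow> real" where
  "u n x = (if n \<ge> n0 then v n x / S (real n *\<^sub>R e) else 0)"

text \<open>Measurability is inherited from the product of S with the packet \<open>Wh n\<close>,
  which is a test function.\<close>

lemma bump_S_measurable:
  assumes n: "n \<ge> n0"
  shows "(\<lambda>\<zeta>. bump (0::'a) 1 \<zeta> * S (real n *\<^sub>R e + \<delta> n *\<^sub>R \<zeta>)) \<in> borel_measurable borel"
proof -
  note d = \<delta>(1)[OF n]
  have m: "(\<lambda>\<xi>. Wh n \<xi> * S \<xi>) \<in> borel_measurable borel" by (rule tf_measurable[OF tf_Vh[OF n]])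
  have "(\<lambda>\<zeta>. \<delta> n ^ DIM('a) * (Wh n (real n *\<^sub>R e + \<delta> n *\<^sub>R \<zeta>) * S (real n *\<^sub>R e + \<delta> n *\<^sub>R \<zeta>))) \<in> borel_measurable borel"
    by (intro borel_measurable_times borel_measurable_const measurable_compose[OF _ m]) measurable
  moreover have "bump (real n *\<^sub>R e) (\<delta> n) (real n *\<^sub>R e + \<delta> n *\<^sub>R \<zeta>) = bump (0::'a) 1 \<zeta>" for \<zeta>
    using d by (simp add: bump_def power_mult_distrib)
  ultimately show ?thesis using d by (simp add: Wh_def)
qed

lemma bump_S_bound:
  assumes n: "n \<ge> n0"
  shows "\<bar>bump (0::'a) 1 \<zeta> * S (real n *\<^sub>R e + \<delta> n *\<^sub>R \<zeta>)\<bar> \<le> 2 * S (real n *\<^sub>R e) * bump (0::'a) 1 \<zeta>"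
proof (cases "norm \<zeta> \<le> 1")
  case True
  have "\<bar>S (real n *\<^sub>R e + \<delta> n *\<^sub>R \<zeta>)\<bar> \<le> 2 * S (real n *\<^sub>R e)"
    using S_pos[OF shifted_nonzero[OF n True]] ratio_bound[OF n True] by (simp add: \<delta>_def)
  from mult_left_mono[OF this bump_nonneg[of 0 1 \<zeta>]] show ?thesis
    using bump_nonneg[of 0 1 \<zeta>] by (simp add: abs_mult mult_ac)
qed (simp add: bump_eq_0)

lemma bump_mass_integrable: "integrable lborel (bump (0::'a) 1)"
  by (rule tf_integrable[OF tf_bump]) simp

lemma u_bound: "\<bar>u n x\<bar> \<le> 2 * bump_mass TYPE('a)"
proof (cases "n \<ge> n0")
  case n: True
  note m[measurable] = bump_S_measurable[OF n]
  have "norm (v n x) \<le> (\<integral>\<zeta>. 2 * S (real n *\<^sub>R e) * bump (0::'a) 1 \<zeta> \<partial>lborel)"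
    unfolding v_eq[OF n]
  proof (rule order_trans[OF integral_norm_bound], rule Bochner_Integration.integral_mono')
    show "integrable lborel (\<lambda>\<zeta>::'a. 2 * S (real n *\<^sub>R e) * bump (0::'a) 1 \<zeta>)"
      by (intro integrable_mult_right bump_mass_integrable)
    fix \<zeta> :: 'a
    let ?b = "\<bar>bump (0::'a) 1 \<zeta> * S (real n *\<^sub>R e + \<delta> n *\<^sub>R \<zeta>)\<bar>"
    have "\<bar>bump (0::'a) 1 \<zeta> * S (real n *\<^sub>R e + \<delta> n *\<^sub>R \<zeta>) * cos (2 * pi * ((real n *\<^sub>R e + \<delta> n *\<^sub>R \<zeta>) \<bullet> x))\<bar> \<le> ?b * 1"
      unfolding abs_mult[of _ "cos _"] by (intro mult_left_mono abs_cos_le_one) simp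
    then show "norm (bump (0::'a) 1 \<zeta> * S (real n *\<^sub>R e + \<delta> n *\<^sub>R \<zeta>) * cos (2 * pi * ((real n *\<^sub>R e + \<delta> n *\<^sub>R \<zeta>) \<bullet> x))) \<le> 2 * S (real n *\<^sub>R e) * bump (0::'a) 1 \<zeta>"
      using bump_S_bound[OF n, of \<zeta>] unfolding real_norm_def by linarith
    show "0 \<le> 2 * S (real n *\<^sub>R e) * bump (0::'a) 1 \<zeta>"
      using Sn_pos[OF n] bump_nonneg[of 0 1 \<zeta>] by simp
  qed
  then show ?thesis using n Sn_pos[OF n] by (simp add: u_def bump_mass_def abs_divide pos_divide_le_eq mult_ac)
qed (use bump_mass_pos[where 'a = 'a] in \<open>simp add: u_def\<close>)

lemma u_measurable: "u n \<in> borel_measurable borel"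
proof (cases "n \<ge> n0")
  case True
  note [measurable] = rapid_measurable[OF rift_rapid[OF tf_Vh[OF True]], folded v_def]
  show ?thesis using True unfolding u_def by simp
next
  case False
  then have "u n = (\<lambda>x. 0)" by (auto simp: u_def)
  then show ?thesis by simp
qed

lemma cos_diff_le: "\<bar>cos x - cos y\<bar> \<le> \<bar>x - y\<bar>" for x y :: real
proof -
  have "\<bar>cos x - cos y\<bar> = 2 * \<bar>sin ((x + y) / 2)\<bar> * \<bar>sin ((y - x) / 2)\<bar>"
    by (simp add: cos_diff_cos abs_mult)
  also have "\<dots> \<le> 2 * 1 * \<bar>(y - x) / 2\<bar>" by (intro mult_mono abs_sin_x_le_abs_x) auto
  finally show ?thesis by simp
qed

text \<open>Two errors occur under the rescaled integral: the relative variation of S over the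
  packet, and the phase error 2 pi \<delta> (\<zeta> \<bullet> x). For fixed x and \<zeta> both tend
  to 0.\<close>

lemma u_limit: "(\<lambda>n. u n x - bump_mass TYPE('a) * cos (2 * pi * real n * (x \<bullet> e))) \<longlonglongrightarrow> 0"
proof -
  let ?c = "\<lambda>n. real n *\<^sub>R e" and ?z = "\<lambda>n \<zeta>. real n *\<^sub>R e + \<delta> n *\<^sub>R \<zeta>"
  define I where "I n \<zeta> = (if n \<ge> n0 then bump (0::'a) 1 \<zeta> * S (?z n \<zeta>) * cos (2 * pi * (?z n \<zeta> \<bullet> x)) / S (?c n)
      - bump (0::'a) 1 \<zeta> * cos (2 * pi * (?c n \<bullet> x)) else 0)" for n \<zeta>
  have bm: "(\<lambda>\<zeta>. bump (0::'a) 1 \<zeta>) \<in> borel_measurable borel" by (rule tf_measurable[OF tf_bump]) simp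
  have m1: "(\<lambda>\<zeta>. bump (0::'a) 1 \<zeta> * S (?z n \<zeta>) * cos (2 * pi * (?z n \<zeta> \<bullet> x)) / S (?c n)) \<in> borel_measurable borel" if n: "n \<ge> n0" for n
    using bump_S_measurable[OF n] by measurable
  have b1: "\<bar>bump (0::'a) 1 \<zeta> * S (?z n \<zeta>) * cos (2 * pi * (?z n \<zeta> \<bullet> x)) / S (?c n)\<bar> \<le> 2 * bump (0::'a) 1 \<zeta>" if n: "n \<ge> n0" for n \<zeta>
  proof -
    have "\<bar>bump (0::'a) 1 \<zeta> * S (?z n \<zeta>) * cos (2 * pi * (?z n \<zeta> \<bullet> x))\<bar> \<le> \<bar>bump (0::'a) 1 \<zeta> * S (?z n \<zeta>)\<bar> * 1"
      unfolding abs_mult[of _ "cos _"] by (intro mult_left_mono abs_cos_le_one) simp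
    then have "\<bar>bump (0::'a) 1 \<zeta> * S (?z n \<zeta>) * cos (2 * pi * (?z n \<zeta> \<bullet> x))\<bar> \<le> 2 * S (?c n) * bump (0::'a) 1 \<zeta>"
      using bump_S_bound[OF n, of \<zeta>] by linarith
    then show ?thesis using Sn_pos[OF n] by (simp add: abs_divide pos_divide_le_eq mult_ac)
  qed
  have i1: "integrable lborel (\<lambda>\<zeta>. bump (0::'a) 1 \<zeta> * S (?z n \<zeta>) * cos (2 * pi * (?z n \<zeta> \<bullet> x)) / S (?c n))" if n: "n \<ge> n0" for n
  proof (rule Bochner_Integration.integrable_bound[OF integrable_mult_right[OF bump_mass_integrable, of 2]])
    show "AE \<zeta> in lborel. norm (bump (0::'a) 1 \<zeta> * S (?z n \<zeta>) * cos (2 * pi * (?z n \<zeta> \<bullet> x)) / S (?c n)) \<le> norm (2 * bump (0::'a) 1 \<zeta>)"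
      unfolding real_norm_def by (intro AE_I2 order_trans[OF b1[OF n] abs_ge_self])
  qed (use m1[OF n] in simp)
  have eq: "u n x - bump_mass TYPE('a) * cos (2 * pi * real n * (x \<bullet> e)) = (\<integral>\<zeta>. I n \<zeta> \<partial>lborel)" if n: "n \<ge> n0" for n
  proof -
    have I: "I n = (\<lambda>\<zeta>. bump (0::'a) 1 \<zeta> * S (?z n \<zeta>) * cos (2 * pi * (?z n \<zeta> \<bullet> x)) / S (?c n)
        - bump (0::'a) 1 \<zeta> * cos (2 * pi * (?c n \<bullet> x)))" using n by (simp add: I_def fun_eq_iff)
    have "(\<integral>\<zeta>. I n \<zeta> \<partial>lborel) = (\<integral>\<zeta>. bump (0::'a) 1 \<zeta> * S (?z n \<zeta>) * cos (2 * pi * (?z n \<zeta> \<bullet> x)) / S (?c n) \<partial>lborel)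
        - (\<integral>\<zeta>. bump (0::'a) 1 \<zeta> * cos (2 * pi * (?c n \<bullet> x)) \<partial>lborel)"
      unfolding I by (intro Bochner_Integration.integral_diff i1[OF n] integrable_mult_left bump_mass_integrable)
    also have "\<dots> = u n x - bump_mass TYPE('a) * cos (2 * pi * real n * (x \<bullet> e))"
      using n by (simp add: u_def v_eq bump_mass_def inner_commute mult_ac)
    finally show ?thesis by simp
  qed
  \<comment> \<open>The dominating factor 3 below is 2 from \<open>ratio_bound\<close> plus 1 from
    the pure cosine.\<close>
  have lim: "(\<lambda>n. \<integral>\<zeta>. I n \<zeta> \<partial>lborel) \<longlonglongrightarrow> (\<integral>\<zeta>. 0 \<partial>(lborel :: 'a measure))"
  proof (rule integral_dominated_convergence[where w = "\<lambda>\<zeta>. 3 * bump (0::'a) 1 \<zeta>"])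
    show "integrable lborel (\<lambda>\<zeta>::'a. 3 * bump (0::'a) 1 \<zeta>)" by (intro integrable_mult_right bump_mass_integrable)
    show "I n \<in> borel_measurable lborel" for n
      using m1[of n] bm unfolding I_def by (cases "n \<ge> n0") auto
    have "norm (I n \<zeta>) \<le> 3 * bump (0::'a) 1 \<zeta>" for n \<zeta>
    proof (cases "n \<ge> n0")
      case n: True
      have "\<bar>bump (0::'a) 1 \<zeta> * cos (2 * pi * (?c n \<bullet> x))\<bar> \<le> bump (0::'a) 1 \<zeta> * 1"
        using bump_nonneg[of 0 1 \<zeta>] unfolding abs_mult by (intro mult_mono) auto
      then show ?thesis using b1[OF n, of \<zeta>] n unfolding I_def real_norm_def by (simp only: if_True)
    qed (simp add: I_def bump_nonneg)
    then show "AE \<zeta> in lborel. norm (I n \<zeta>) \<le> 3 * bump (0::'a) 1 \<zeta>" for n by simp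
    show "AE \<zeta> in lborel. (\<lambda>n. I n \<zeta>) \<longlonglongrightarrow> 0"
    proof (rule AE_I2)
      fix \<zeta> :: 'a
      show "(\<lambda>n. I n \<zeta>) \<longlonglongrightarrow> 0"
      proof (cases "norm \<zeta> \<le> 1")
        case z: True
        let ?r = "\<lambda>n. S (?z n \<zeta>) / S (?c n)"
        have "(\<lambda>n. \<bar>?r n - 1\<bar> + 2 * pi * \<bar>\<zeta> \<bullet> x\<bar> * \<delta> n) \<longlonglongrightarrow> \<bar>1 - 1\<bar> + 2 * pi * \<bar>\<zeta> \<bullet> x\<bar> * 0"
          using ratio_limit[OF z, folded \<delta>_def] by (intro tendsto_intros \<delta>_tendsto)
        then have g: "(\<lambda>n. \<bar>?r n - 1\<bar> + 2 * pi * \<bar>\<zeta> \<bullet> x\<bar> * \<delta> n) \<longlonglongrightarrow> 0" by simp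
        show ?thesis
        proof (rule Lim_null_comparison[OF _ g])
          show "\<forall>\<^sub>F n in sequentially. norm (I n \<zeta>) \<le> \<bar>?r n - 1\<bar> + 2 * pi * \<bar>\<zeta> \<bullet> x\<bar> * \<delta> n"
            using eventually_ge_at_top[of n0]
          proof eventually_elim
            case n: (elim n)
            let ?A = "2 * pi * (?z n \<zeta> \<bullet> x)" and ?B = "2 * pi * (?c n \<bullet> x)"
            have Ieq: "I n \<zeta> = bump (0::'a) 1 \<zeta> * ((?r n - 1) * cos ?A + (cos ?A - cos ?B))"
              using n by (simp add: I_def field_simps)
            have "\<bar>I n \<zeta>\<bar> \<le> 1 * \<bar>(?r n - 1) * cos ?A + (cos ?A - cos ?B)\<bar>"
              using bump_nonneg[of 0 1 \<zeta>] bump_le_1[of 0 1 \<zeta>] unfolding Ieq abs_mult[of "bump (0::'a) 1 \<zeta>"]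
              by (intro mult_right_mono) auto
            also have "\<dots> \<le> \<bar>?r n - 1\<bar> * \<bar>cos ?A\<bar> + \<bar>cos ?A - cos ?B\<bar>"
              unfolding abs_mult[symmetric] by (simp add: abs_triangle_ineq)
            also have "\<dots> \<le> \<bar>?r n - 1\<bar> * 1 + \<bar>?A - ?B\<bar>"
              by (intro add_mono mult_left_mono cos_diff_le) auto
            also have "?A - ?B = 2 * pi * (\<zeta> \<bullet> x) * \<delta> n" by (simp add: inner_add_left algebra_simps)
            finally show ?case using \<delta>(1)[OF n] by (simp add: abs_mult)
          qed
        qed
      next
        case False
        have "bump (0::'a) 1 \<zeta> = 0" by (rule bump_eq_0) (use False in auto)
        then have "I n \<zeta> = 0" for n by (simp add: I_def)
        then show ?thesis by simp
      qed
    qed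
  qed simp
  show ?thesis
    by (rule Lim_transform_eventually[OF lim[simplified]])
      (rule eventually_mono[OF eventually_ge_at_top[of n0]], rule eq[symmetric])
qed

theorem packet_comm_limit:
  assumes D: "tempered D" "continuous_on (- {0}) D" and r: "r > 0" and h: "rapid h" "\<And>x. isCont h x"
  shows "(\<lambda>n. comm D (v n) (rift (bump (real n *\<^sub>R e) r)) h / S (real n *\<^sub>R e))
    \<longlonglongrightarrow> bump_mass TYPE('a) / 2 * pairing D (rift (bump 0 r)) h"
proof -
  have f: "rift (bump (real n *\<^sub>R e) r) = (\<lambda>x. rift (bump 0 r) x * cos (2 * pi * real n * (x \<bullet> e)))" for n
    by (rule ext, subst rift_shift_bump[OF r]) (simp add: inner_commute mult_ac)
  have "(\<lambda>n. comm D (u n) (\<lambda>x. rift (bump 0 r) x * cos (2 * pi * real n * (x \<bullet> e))) h)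
      \<longlonglongrightarrow> bump_mass TYPE('a) / 2 * pairing D (rift (bump 0 r)) h"
    by (rule comm_limit[OF D rift_rapid[OF tf_bump[OF r]] rift_continuous[OF tf_bump[OF r]] h e_nonzero u_measurable u_bound u_limit])
  moreover have "\<forall>\<^sub>F n in sequentially. comm D (u n) (\<lambda>x. rift (bump 0 r) x * cos (2 * pi * real n * (x \<bullet> e))) h =
      comm D (v n) (rift (bump (real n *\<^sub>R e) r)) h / S (real n *\<^sub>R e)"
    using eventually_ge_at_top[of n0]
  proof eventually_elim
    case (elim n)
    then have "u n = (\<lambda>x. (1 / S (real n *\<^sub>R e)) * v n x)" by (auto simp: u_def)
    then show ?case unfolding f by (simp only: comm_scale) simp
  qed
  ultimately show ?thesis by (rule Lim_transform_eventually)
qed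

lemma w_rapid: "n \<ge> n0 \<Longrightarrow> rapid (w n)"
  unfolding w_def by (rule rift_rapid[OF tf_Wh])

text \<open>Rescaling the envelope gives the exponent \<kappa> d / p. Positivity, from continuity
  and the nonzero value at 0, prevents the final quotient from being a division by 0.\<close>

lemma w_Lp:
  assumes n: "n \<ge> n0" and p: "p \<ge> 1"
  defines "A \<equiv> (\<integral>x. \<bar>rift (bump 0 1) x\<bar> powr p \<partial>(lborel :: 'a measure))"
  shows "in_Lp p (\<lambda>x. w n x *\<^sub>R e)" "0 < Lp_norm p (\<lambda>x. w n x *\<^sub>R e)"
    "Lp_norm p (\<lambda>x. w n x *\<^sub>R e) \<le> real n powr (\<kappa> * DIM('a) / p) * A powr (1 / p)"
proof -
  note d = \<delta>(1)[OF n]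
  note [measurable] = rapid_measurable[OF w_rapid[OF n]]
  let ?c = "rift (bump (0::'a) 1)"
  have c: "rapid ?c" by (rule rift_rapid[OF tf_bump]) simp
  note [measurable] = rapid_measurable[OF c]
  obtain B where B: "B > 0" "\<And>x. norm (?c x) \<le> B" using rapid_bounded[OF c] by blast
  have ci: "integrable lborel (\<lambda>x. \<bar>?c x\<bar> powr p)"
  proof (rule Bochner_Integration.integrable_bound[OF integrable_mult_right[OF rapid_integrable[OF c], of "B powr (p - 1)"]])
    have "\<bar>?c x\<bar> powr p \<le> B powr (p - 1) * \<bar>?c x\<bar>" for x
    proof (cases "?c x = 0")
      case False
      have "\<bar>?c x\<bar> powr p = \<bar>?c x\<bar> powr (p - 1) * \<bar>?c x\<bar> powr 1" unfolding powr_add[symmetric] by simp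
      also have "\<dots> \<le> B powr (p - 1) * \<bar>?c x\<bar>" using B(2)[of x] p False by (intro mult_mono powr_mono2) auto
      finally show ?thesis .
    qed simp
    then show "AE x in lborel. norm (\<bar>?c x\<bar> powr p) \<le> norm (B powr (p - 1) * ?c x)" by (simp add: abs_mult)
  qed measurable
  have ci2: "integrable lborel (\<lambda>x. \<bar>?c (0 + \<delta> n *\<^sub>R x)\<bar> powr p)"
    by (rule lborel_affine_integrable[OF ci]) (use d in simp)
  have le: "\<bar>w n x\<bar> powr p \<le> \<bar>?c (0 + \<delta> n *\<^sub>R x)\<bar> powr p" for x
    unfolding w_eq[OF n] using p by (intro powr_mono2) (auto simp: abs_mult mult_left_le)
  have wi: "integrable lborel (\<lambda>x. \<bar>w n x\<bar> powr p)"
    by (rule Bochner_Integration.integrable_bound[OF ci2]) (use le in auto)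
  show "in_Lp p (\<lambda>x. w n x *\<^sub>R e)"
    using wi unfolding in_Lp_def by simp
  have pos: "0 < (\<integral>x. \<bar>w n x\<bar> powr p \<partial>lborel)"
  proof (rule lborel_integral_pos[OF wi, where a = 0])
    have w0: "w n 0 = bump_mass TYPE('a)" by (simp add: w_eq[OF n] rift_bump_0)
    then show "0 < \<bar>w n 0\<bar> powr p" using bump_mass_pos[where 'a = 'a] by simp
    have "isCont (w n) 0" unfolding w_def by (rule rift_continuous[OF tf_Wh[OF n]])
    then show "isCont (\<lambda>x. \<bar>w n x\<bar> powr p) 0"
      using w0 bump_mass_pos[where 'a = 'a] p by (intro continuous_intros) auto
  qed simp
  then show "0 < Lp_norm p (\<lambda>x. w n x *\<^sub>R e)"
    unfolding Lp_norm_def by simp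
  have "(\<integral>x. \<bar>w n x\<bar> powr p \<partial>lborel) \<le> (\<integral>x. \<bar>?c (0 + \<delta> n *\<^sub>R x)\<bar> powr p \<partial>lborel)"
    by (rule integral_mono[OF wi ci2 le])
  also have "\<dots> = (1 / \<delta> n ^ DIM('a)) * A"
    using d lborel_affine_integral[of "\<lambda>x. \<bar>?c x\<bar> powr p" "\<delta> n" 0] by (simp add: A_def)
  also have "1 / \<delta> n ^ DIM('a) = real n powr (\<kappa> * DIM('a))"
  proof -
    have "\<delta> n ^ DIM('a) = real n powr (- (\<kappa> * DIM('a)))"
      using powr_realpow[OF d, of "DIM('a)"] by (simp add: \<delta>_def powr_powr)
    then show ?thesis by (simp add: powr_minus inverse_eq_divide)
  qed
  finally have "(\<integral>x. \<bar>w n x\<bar> powr p \<partial>lborel) powr (1 / p) \<le> (real n powr (\<kappa> * DIM('a)) * A) powr (1 / p)"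
    using pos p by (intro powr_mono2) auto
  also have "\<dots> = real n powr (\<kappa> * DIM('a) / p) * A powr (1 / p)"
    by (simp add: powr_mult A_def powr_powr)
  finally show "Lp_norm p (\<lambda>x. w n x *\<^sub>R e) \<le> real n powr (\<kappa> * DIM('a) / p) * A powr (1 / p)"
    unfolding Lp_norm_def by simp
qed

end


subsection \<open>Potentials with rapidly decaying Fourier transform\<close>

lemma test_function_off_0:
  assumes "tf \<psi>" "\<And>x. norm x < \<rho> \<Longrightarrow> \<psi> x = 0" "\<rho> > 0"
  shows "test_function (UNIV - {0}) \<psi>"
proof -
  obtain r where r: "\<And>x. norm x \<ge> r \<Longrightarrow> \<psi> x = 0" using tf_support[OF assms(1)] by blast
  show ?thesis
    unfolding test_function_def
  proof (intro conjI exI[of _ "cball 0 r - ball 0 \<rho>"])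
    show "compact (cball 0 r - ball (0::'a) \<rho>)" by (intro compact_diff) auto
  qed (use assms r tf_smooth in \<open>auto simp: not_le not_less\<close>)
qed

lemma has_fourier_transform_integrable:
  assumes "has_fourier_transform g G" "test_function (UNIV - {0}) \<psi>"
  shows "integrable lborel (\<lambda>\<xi>. G \<xi> * \<psi> \<xi>)"
    "(\<integral>x. of_real (g x) * fourier (\<lambda>\<xi>. of_real (\<psi> \<xi>)) x \<partial>lborel) = complex_of_real (\<integral>\<xi>. G \<xi> * \<psi> \<xi> \<partial>lborel)"
  using assms unfolding has_fourier_transform_def by auto

lemma has_fourier_transform_tempered: "has_fourier_transform g G \<Longrightarrow> tempered g"
  unfolding has_fourier_transform_def tempered_def by blast

text \<open>Nothing is known about G near the origin, so the low frequencies are cut away; they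
  reappear as a mollification of the potential.\<close>

definition hi :: "('a::euclidean_space \<Rightarrow> real) \<Rightarrow> 'a \<Rightarrow> real" where
  "hi G \<xi> = G \<xi> * (1 - bump 0 1 \<xi>)"

lemma C_infinity_on_one_minus_bump: "C_infinity_on UNIV (\<lambda>\<xi>. 1 - bump c r \<xi>)"
  by (intro C_infinity_on_diff C_infinity_on_bump) auto

lemma test_function_hi:
  assumes "tf \<psi>" shows "test_function (UNIV - {0}) (\<lambda>\<xi>. (1 - bump 0 1 \<xi>) * \<psi> \<xi>)"
  using test_function_off_0[OF tf_mult[OF assms C_infinity_on_one_minus_bump[of 0 1]], of "1/2"]
  by (simp add: bump_eq_1 mult.commute)

text \<open>Measurability comes from the products of G with test functions, which are integrable by
  assumption. Decay of order 2d + 1 leaves an integrable weight after one power is spent on the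
  moment.\<close>

lemma hi_integrable:
  fixes G :: "'a::euclidean_space \<Rightarrow> real"
  assumes G: "has_fourier_transform g G" and dec: "super_polynomial_decay G"
  shows "integrable lborel (\<lambda>\<xi>. hi G \<xi> * (1 + norm \<xi>))" and "integrable lborel (hi G)"
proof -
  let ?X = "\<lambda>j. bump (0::'a) (real (Suc j))"
  have X1: "(\<lambda>j. ?X j \<xi>) \<longlonglongrightarrow> 1" for \<xi>
  proof -
    obtain N :: nat where N: "2 * norm \<xi> \<le> real N" using real_arch_simple by blast
    have "\<forall>\<^sub>F j in sequentially. ?X j \<xi> = 1"
      using eventually_ge_at_top[of N] by eventually_elim (use N in \<open>auto intro!: bump_eq_1\<close>)
    then show ?thesis by (rule tendsto_eventually)
  qed
  have "(\<lambda>\<xi>. hi G \<xi> * ?X j \<xi>) \<in> borel_measurable lborel" for j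
    using has_fourier_transform_integrable(1)[OF G test_function_hi[OF tf_bump[of "real (Suc j)" 0]]]
    by (simp add: hi_def mult.assoc borel_measurable_integrable del: of_nat_Suc)
  moreover have "(\<lambda>j. hi G \<xi> * ?X j \<xi>) \<longlonglongrightarrow> hi G \<xi>" for \<xi>
    using tendsto_mult[OF tendsto_const X1, of "hi G \<xi>" \<xi>] by simp
  ultimately have m[measurable]: "hi G \<in> borel_measurable lborel"
    by (rule borel_measurable_LIMSEQ_real[rotated])
  define d where "d = 2 * DIM('a)"
  obtain C where C: "\<And>\<xi>. \<xi> \<noteq> 0 \<Longrightarrow> \<bar>G \<xi>\<bar> \<le> C * norm \<xi> powr (- real (d + 1))"
    using dec unfolding super_polynomial_decay_def by (metis of_nat_0_le_iff)
  have bd: "\<bar>hi G \<xi> * (1 + norm \<xi>)\<bar> \<le> \<bar>C\<bar> * 3 ^ (d + 1) * (1 / (1 + norm \<xi>) ^ d)" for \<xi>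
  proof (cases "norm \<xi> \<le> 1 / 2")
    case True
    then show ?thesis by (simp add: hi_def bump_eq_1)
  next
    case False
    let ?n = "norm \<xi>"
    \<comment> \<open>The cut-off removes |\<xi>| \<le> 1/2; outside this ball 1 + |\<xi>| \<le> 3
      |\<xi>|, hence the powers of 3.\<close>
    have n: "?n > 0" "1 + ?n \<le> 3 * ?n" using False by linarith+
    have "\<bar>hi G \<xi>\<bar> \<le> \<bar>G \<xi>\<bar> * 1"
      unfolding hi_def abs_mult using bump_nonneg[of 0 1 \<xi>] bump_le_1[of 0 1 \<xi>] by (intro mult_left_mono) auto
    also have "\<dots> \<le> \<bar>C\<bar> * ?n powr (- real (d + 1))"
    proof -
      have "\<bar>G \<xi>\<bar> \<le> C * ?n powr (- real (d + 1))" using C[of \<xi>] n by auto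
      also have "\<dots> \<le> \<bar>C\<bar> * ?n powr (- real (d + 1))" by (intro mult_right_mono) auto
      finally show ?thesis by simp
    qed
    also have "?n powr (- real (d + 1)) = 1 / ?n ^ (d + 1)"
      unfolding powr_minus_divide powr_realpow[OF n(1)] by (rule refl)
    finally have 1: "\<bar>hi G \<xi>\<bar> \<le> \<bar>C\<bar> * (1 / ?n ^ (d + 1))" .
    have "(1 + ?n) ^ (d + 1) \<le> (3 * ?n) ^ (d + 1)" using n by (intro power_mono) auto
    then have "1 / ?n ^ (d + 1) \<le> 3 ^ (d + 1) / (1 + ?n) ^ (d + 1)"
      using n(1) one_plus_norm_pow_pos[of \<xi> "d + 1"] zero_less_power[OF n(1), of "d + 1"]
      unfolding power_mult_distrib by (simp add: divide_simps mult.commute del: power_Suc power_add)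
    from order_trans[OF 1 mult_left_mono[OF this, of "\<bar>C\<bar>"]]
    have "\<bar>hi G \<xi>\<bar> \<le> \<bar>C\<bar> * (3 ^ (d + 1) / (1 + ?n) ^ (d + 1))" by simp
    from mult_right_mono[OF this, of "1 + ?n"]
    have "\<bar>hi G \<xi>\<bar> * (1 + ?n) \<le> \<bar>C\<bar> * (3 ^ (d + 1) / (1 + ?n) ^ (d + 1)) * (1 + ?n)" by simp
    also have "\<dots> = \<bar>C\<bar> * 3 ^ (d + 1) * (1 / (1 + ?n) ^ d)" by (simp add: power_add)
    finally show ?thesis by (simp add: abs_mult)
  qed
  show i: "integrable lborel (\<lambda>\<xi>. hi G \<xi> * (1 + norm \<xi>))"
  proof (rule Bochner_Integration.integrable_bound[OF integrable_mult_right[OF integrable_weight_DIM, of "\<bar>C\<bar> * 3 ^ (d + 1)"]])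
    show "AE \<xi> in lborel. norm (hi G \<xi> * (1 + norm \<xi>)) \<le> norm (\<bar>C\<bar> * 3 ^ (d + 1) * (1 / (1 + norm \<xi>) ^ (2 * DIM('a))))"
      unfolding real_norm_def by (intro AE_I2 order_trans[OF bd[unfolded d_def] abs_ge_self[THEN order_trans]]) (auto simp: d_def)
  qed measurable
  show "integrable lborel (hi G)"
  proof (rule Bochner_Integration.integrable_bound[OF i])
    have "norm (hi G \<xi>) \<le> norm (hi G \<xi> * (1 + norm \<xi>))" for \<xi>
      using mult_left_mono[OF one_plus_norm_ge_1[of \<xi>], of "\<bar>hi G \<xi>\<bar>"] by (simp add: abs_mult)
    then show "AE \<xi> in lborel. norm (hi G \<xi>) \<le> norm (hi G \<xi> * (1 + norm \<xi>))" by simp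
  qed measurable
qed

lemma fourier_tf_rapid:
  assumes "tf \<psi>" shows "rapid (fourier (\<lambda>\<xi>. complex_of_real (\<psi> \<xi>)))"
  using rapid_scale[OF ift_rapid[OF assms], of "-1"] by (simp add: fourier_eq_inv_fourier[abs_def] ift_def)

text \<open>\<open>has_fourier_transform\<close> speaks only of test functions that vanish near the
  origin. It is applied to the high part of \<psi>, while the low part stays on the side of
  g.\<close>

lemma fourier_low_high:
  fixes g :: "'a::euclidean_space \<Rightarrow> real"
  assumes G: "has_fourier_transform g G" and \<psi>: "tf \<psi>"
  shows "(\<integral>x. g x *\<^sub>R fourier (\<lambda>\<xi>. of_real (\<psi> \<xi>)) x \<partial>lborel) =
    (\<integral>x. g x *\<^sub>R fourier (\<lambda>\<xi>. of_real (bump 0 1 \<xi> * \<psi> \<xi>)) x \<partial>lborel) + of_real (\<integral>\<xi>. hi G \<xi> * \<psi> \<xi> \<partial>lborel)"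
proof -
  note g = has_fourier_transform_tempered[OF G]
  have t1: "tf (\<lambda>\<xi>. bump 0 1 \<xi> * \<psi> \<xi>)" by (rule tf_mult[OF tf_bump tf_smooth[OF \<psi>]]) simp
  have t2: "tf (\<lambda>\<xi>. (1 - bump 0 1 \<xi>) * \<psi> \<xi>)"
    using tf_mult[OF \<psi> C_infinity_on_one_minus_bump[of 0 1]] by (simp add: mult.commute)
  have split: "fourier (\<lambda>\<xi>. of_real (\<psi> \<xi>)) x = fourier (\<lambda>\<xi>. of_real (bump 0 1 \<xi> * \<psi> \<xi>)) x
      + fourier (\<lambda>\<xi>. of_real ((1 - bump 0 1 \<xi>) * \<psi> \<xi>)) x" for x
  proof -
    have i: "integrable lborel (\<lambda>\<xi>. cis (- (2 * pi * (x \<bullet> \<xi>))) * complex_of_real (k \<xi>))" if "tf k" for k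
      by (rule integrable_cis_mult[OF tf_integrable_complex[OF that]]) measurable
    have "complex_of_real (\<psi> \<xi>) = of_real (bump 0 1 \<xi> * \<psi> \<xi>) + of_real ((1 - bump 0 1 \<xi>) * \<psi> \<xi>)" for \<xi>
      by (simp add: algebra_simps)
    then show ?thesis
      unfolding fourier_cis using Bochner_Integration.integral_add[OF i[OF t1] i[OF t2]]
      by (simp only: distrib_left[symmetric])
  qed
  have "(\<integral>x. g x *\<^sub>R fourier (\<lambda>\<xi>. of_real (\<psi> \<xi>)) x \<partial>lborel) =
    (\<integral>x. g x *\<^sub>R fourier (\<lambda>\<xi>. of_real (bump 0 1 \<xi> * \<psi> \<xi>)) x \<partial>lborel)
    + (\<integral>x. g x *\<^sub>R fourier (\<lambda>\<xi>. of_real ((1 - bump 0 1 \<xi>) * \<psi> \<xi>)) x \<partial>lborel)"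
    unfolding split scaleR_add_right
    by (rule Bochner_Integration.integral_add; rule integrable_tempered_rapid[OF g fourier_tf_rapid]; fact)
  also have "(\<integral>x. g x *\<^sub>R fourier (\<lambda>\<xi>. of_real ((1 - bump 0 1 \<xi>) * \<psi> \<xi>)) x \<partial>lborel) = of_real (\<integral>\<xi>. hi G \<xi> * \<psi> \<xi> \<partial>lborel)"
    using has_fourier_transform_integrable(2)[OF G test_function_hi[OF \<psi>]]
    unfolding scaleR_conv_of_real by (simp only: hi_def mult.assoc)
  finally show ?thesis .
qed

text \<open>A translate of \<open>rift K\<close> has a complex symbol, whereas the hypothesis on g
  concerns real test functions; the phase is therefore distributed over a cosine symbol and a sine
  symbol.\<close>

lemma rift_shift_eq:
  fixes K :: "'a::euclidean_space \<Rightarrow> real"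
  assumes K: "tf K"
  shows "rift K (z - x) = Re (fourier (\<lambda>\<xi>. of_real (K \<xi> * cos (2 * pi * (\<xi> \<bullet> x)))) z)
    - Im (fourier (\<lambda>\<xi>. of_real (K \<xi> * sin (2 * pi * (\<xi> \<bullet> x)))) z)"
proof -
  have t: "tf (\<lambda>\<xi>. K \<xi> * cos (2 * pi * (\<xi> \<bullet> x)))" "tf (\<lambda>\<xi>. K \<xi> * sin (2 * pi * (\<xi> \<bullet> x)))"
    by (intro tf_mult K C_infinity_on_trig)+
  have f: "fourier (\<lambda>\<xi>. of_real (k \<xi>)) z = ift k (- z)" for k
    by (simp add: fourier_eq_inv_fourier ift_def)
  have i: "integrable lborel (\<lambda>\<xi>. K \<xi> * cos (2 * pi * (\<xi> \<bullet> x)) * cos (2 * pi * (\<xi> \<bullet> - z)))"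
    "integrable lborel (\<lambda>\<xi>. K \<xi> * sin (2 * pi * (\<xi> \<bullet> x)) * sin (2 * pi * (\<xi> \<bullet> - z)))"
    by (intro tf_integrable tf_mult t C_infinity_on_trig)+
  have "rift K (z - x) = (\<integral>\<xi>. K \<xi> * cos (2 * pi * (\<xi> \<bullet> x)) * cos (2 * pi * (\<xi> \<bullet> - z))
      - K \<xi> * sin (2 * pi * (\<xi> \<bullet> x)) * sin (2 * pi * (\<xi> \<bullet> - z)) \<partial>lborel)"
    unfolding rift_eq[OF tf_integrable[OF K]]
    by (intro Bochner_Integration.integral_cong) (auto simp: inner_diff_right right_diff_distrib cos_diff algebra_simps)
  then show ?thesis
    unfolding f using i by (simp add: ift_Re ift_Im tf_integrable t)
qed

lemma low_high:
  fixes g :: "'a::euclidean_space \<Rightarrow> real"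
  assumes G: "has_fourier_transform g G" and K: "tf K"
  shows "(\<integral>z. g z * rift K (z - x) \<partial>lborel) =
    (\<integral>z. g z * rift (\<lambda>\<xi>. bump 0 1 \<xi> * K \<xi>) (z - x) \<partial>lborel) + (\<integral>\<xi>. hi G \<xi> * (K \<xi> * cos (2 * pi * (\<xi> \<bullet> x))) \<partial>lborel)"
proof -
  note g = has_fourier_transform_tempered[OF G]
  let ?F = "\<lambda>k x. fourier (\<lambda>\<xi>. complex_of_real (k \<xi>)) x"
  have int: "integrable lborel (\<lambda>z. g z *\<^sub>R ?F k z)" if "tf k" for k
    by (rule integrable_tempered_rapid[OF g fourier_tf_rapid[OF that]])
  have val: "(\<integral>z. g z * rift k (z - x) \<partial>lborel) =
      Re (\<integral>z. g z *\<^sub>R ?F (\<lambda>\<xi>. k \<xi> * cos (2 * pi * (\<xi> \<bullet> x))) z \<partial>lborel)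
      - Im (\<integral>z. g z *\<^sub>R ?F (\<lambda>\<xi>. k \<xi> * sin (2 * pi * (\<xi> \<bullet> x))) z \<partial>lborel)" if k: "tf k" for k
  proof -
    have t: "tf (\<lambda>\<xi>. k \<xi> * cos (2 * pi * (\<xi> \<bullet> x)))" "tf (\<lambda>\<xi>. k \<xi> * sin (2 * pi * (\<xi> \<bullet> x)))"
      by (intro tf_mult k C_infinity_on_trig)+
    have "(\<integral>z. g z * rift k (z - x) \<partial>lborel) = (\<integral>z. Re (g z *\<^sub>R ?F (\<lambda>\<xi>. k \<xi> * cos (2 * pi * (\<xi> \<bullet> x))) z)
        - Im (g z *\<^sub>R ?F (\<lambda>\<xi>. k \<xi> * sin (2 * pi * (\<xi> \<bullet> x))) z) \<partial>lborel)"
      unfolding rift_shift_eq[OF k] by (simp add: right_diff_distrib)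
    also have "\<dots> = (\<integral>z. Re (g z *\<^sub>R ?F (\<lambda>\<xi>. k \<xi> * cos (2 * pi * (\<xi> \<bullet> x))) z) \<partial>lborel)
        - (\<integral>z. Im (g z *\<^sub>R ?F (\<lambda>\<xi>. k \<xi> * sin (2 * pi * (\<xi> \<bullet> x))) z) \<partial>lborel)"
      by (rule Bochner_Integration.integral_diff; rule integrable_Re integrable_Im; rule int; rule t)
    finally show ?thesis unfolding integral_Re[OF int[OF t(1)]] integral_Im[OF int[OF t(2)]] .
  qed
  have t: "tf (\<lambda>\<xi>. K \<xi> * cos (2 * pi * (\<xi> \<bullet> x)))" "tf (\<lambda>\<xi>. K \<xi> * sin (2 * pi * (\<xi> \<bullet> x)))"
    by (intro tf_mult K C_infinity_on_trig)+
  have tb: "tf (\<lambda>\<xi>. bump 0 1 \<xi> * K \<xi>)" by (rule tf_mult[OF tf_bump tf_smooth[OF K]]) simp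
  show ?thesis
    unfolding val[OF K] val[OF tb] fourier_low_high[OF G t(1)] fourier_low_high[OF G t(2)]
    by (simp add: mult.assoc)
qed

text \<open>The low frequencies of g enter as a mollification, the high ones as an absolutely
  convergent cosine integral. Both make sense at 0 as well, so this extends g continuously across
  the origin.\<close>

definition regular_part :: "('a::euclidean_space \<Rightarrow> real) \<Rightarrow> ('a \<Rightarrow> real) \<Rightarrow> 'a \<Rightarrow> real" where
  "regular_part g G x = (\<integral>z. g z * rift (bump 0 1) (z - x) \<partial>lborel) + (\<integral>\<xi>. hi G \<xi> * cos (2 * pi * (\<xi> \<bullet> x)) \<partial>lborel)"

text \<open>Mollifications of g at frequency radius r tend to g(x) as r grows. By
  \<open>low_high\<close> their low part is the same for all these r, and their high part converges
  because \<open>hi G\<close> is integrable.\<close>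

theorem eq_regular_part:
  fixes g :: "'a::euclidean_space \<Rightarrow> real"
  assumes G: "has_fourier_transform g G" "super_polynomial_decay G" and cont: "isCont g x"
  shows "g x = regular_part g G x"
proof -
  note g = has_fourier_transform_tempered[OF G(1)]
  note hi = hi_integrable(2)[OF G]
  have hm[measurable]: "hi G \<in> borel_measurable borel" using hi by auto
  define r where "r j = real (Suc (Suc j))" for j
  have r: "r j \<ge> 2" "r j > 0" for j by (auto simp: r_def)
  let ?B = "\<lambda>j. bump (0::'a) (r j)"
  have e0: "(\<lambda>j. 1 / r j) \<longlonglongrightarrow> 0"
    using LIMSEQ_Suc[OF inverse_Suc_tendsto] by (simp add: r_def)
  have lhs: "(\<lambda>j. \<integral>z. g z * rift (?B j) (z - x) \<partial>lborel) \<longlonglongrightarrow> g x"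
  proof -
    have "rift (?B j) (z - x) = rift (bump 0 1) ((1 / (1 / r j)) *\<^sub>R (z - x)) / (1 / r j) ^ DIM('a)" for j z
      by (subst bump_radius[OF r(2)], rule rift_scale) (use r(2)[of j] tf_measurable[OF tf_bump[of 1 0]] in auto)
    then show ?thesis
      using approximate_identity[OF rift_rapid[OF tf_bump[of 1 "0::'a"]] g cont _ e0] r
      by (simp add: integral_rift[OF tf_bump] bump_eq_1)
  qed
  \<comment> \<open>This is why the radii start at 2: the larger bump is 1 on the whole support of
    the small one.\<close>
  have bb: "bump 0 1 \<xi> * ?B j \<xi> = bump 0 1 \<xi>" for j \<xi>
  proof (cases "norm \<xi> \<le> 1")
    case True
    then have "norm (\<xi> - 0) \<le> r j / 2" using r(1)[of j] by simp
    from bump_eq_1[OF r(2) this] show ?thesis by simp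
  qed (simp add: bump_eq_0)
  have "(\<lambda>j. \<integral>\<xi>. hi G \<xi> * (?B j \<xi> * cos (2 * pi * (\<xi> \<bullet> x))) \<partial>lborel) \<longlonglongrightarrow> (\<integral>\<xi>. hi G \<xi> * cos (2 * pi * (\<xi> \<bullet> x)) \<partial>lborel)"
  proof (rule integral_dominated_convergence[where w = "\<lambda>\<xi>. \<bar>hi G \<xi>\<bar>"])
    note [measurable] = tf_measurable[OF tf_bump[OF r(2)]]
    show "(\<lambda>\<xi>. hi G \<xi> * (?B j \<xi> * cos (2 * pi * (\<xi> \<bullet> x)))) \<in> borel_measurable lborel" for j by measurable
    show "(\<lambda>\<xi>. hi G \<xi> * cos (2 * pi * (\<xi> \<bullet> x))) \<in> borel_measurable lborel" by measurable
    show "integrable lborel (\<lambda>\<xi>. \<bar>hi G \<xi>\<bar>)" using hi by (rule integrable_abs)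
    have "norm (hi G \<xi> * (?B j \<xi> * cos (2 * pi * (\<xi> \<bullet> x)))) \<le> \<bar>hi G \<xi>\<bar>" for j \<xi>
    proof -
      have "\<bar>?B j \<xi>\<bar> * \<bar>cos (2 * pi * (\<xi> \<bullet> x))\<bar> \<le> 1 * 1"
        using bump_nonneg[of 0 "r j" \<xi>] bump_le_1[of 0 "r j" \<xi>] by (intro mult_mono) auto
      from mult_left_mono[OF this, of "\<bar>hi G \<xi>\<bar>"] show ?thesis by (simp add: abs_mult)
    qed
    then show "AE \<xi> in lborel. norm (hi G \<xi> * (?B j \<xi> * cos (2 * pi * (\<xi> \<bullet> x)))) \<le> \<bar>hi G \<xi>\<bar>" for j by simp
    show "AE \<xi> in lborel. (\<lambda>j. hi G \<xi> * (?B j \<xi> * cos (2 * pi * (\<xi> \<bullet> x)))) \<longlonglongrightarrow> hi G \<xi> * cos (2 * pi * (\<xi> \<bullet> x))"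
    proof (rule AE_I2)
      fix \<xi> :: 'a
      obtain N :: nat where N: "2 * norm \<xi> \<le> real N" using real_arch_simple by blast
      have "\<forall>\<^sub>F j in sequentially. ?B j \<xi> = 1"
        using eventually_ge_at_top[of N]
        by eventually_elim (use N in \<open>auto intro!: bump_eq_1 simp: r_def\<close>)
      then have "(\<lambda>j. ?B j \<xi>) \<longlonglongrightarrow> 1" by (rule tendsto_eventually)
      then have "(\<lambda>j. hi G \<xi> * (?B j \<xi> * cos (2 * pi * (\<xi> \<bullet> x)))) \<longlonglongrightarrow> hi G \<xi> * (1 * cos (2 * pi * (\<xi> \<bullet> x)))"
        by (intro tendsto_intros)
      then show "(\<lambda>j. hi G \<xi> * (?B j \<xi> * cos (2 * pi * (\<xi> \<bullet> x)))) \<longlonglongrightarrow> hi G \<xi> * cos (2 * pi * (\<xi> \<bullet> x))" by simp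
    qed
  qed
  then have "(\<lambda>j. \<integral>z. g z * rift (?B j) (z - x) \<partial>lborel) \<longlonglongrightarrow> regular_part g G x"
    unfolding low_high[OF G(1) tf_bump[OF r(2)]] bb regular_part_def by (intro tendsto_add tendsto_const)
  from LIMSEQ_unique[OF lhs this] show ?thesis .
qed

lemma rift_has_real_derivative:
  fixes F :: "'a::euclidean_space \<Rightarrow> real"
  assumes F: "tf F"
  shows "((\<lambda>t. rift F (z + t *\<^sub>R y)) has_real_derivative
    Re (2 * pi * \<i> * (\<Sum>b\<in>Basis. (y \<bullet> b) * ift (\<lambda>\<xi>. F \<xi> * (\<xi> \<bullet> b)) (z + t *\<^sub>R y)))) (at t)"
proof -
  have 1: "((\<lambda>t. z + t *\<^sub>R y) has_derivative (\<lambda>h. h *\<^sub>R y)) (at t)" by (auto intro!: derivative_eq_intros)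
  have "((\<lambda>t. Re (ift F (z + t *\<^sub>R y))) has_derivative
      (\<lambda>h. Re (2 * pi * \<i> * (\<Sum>b\<in>Basis. ((h *\<^sub>R y) \<bullet> b) * ift (\<lambda>\<xi>. F \<xi> * (\<xi> \<bullet> b)) (z + t *\<^sub>R y))))) (at t)"
    by (rule bounded_linear.has_derivative[OF bounded_linear_Re has_derivative_compose[OF 1 ift_has_derivative[OF F]]])
  moreover have "Re (2 * pi * \<i> * (\<Sum>b\<in>Basis. ((h *\<^sub>R y) \<bullet> b) * ift (\<lambda>\<xi>. F \<xi> * (\<xi> \<bullet> b)) (z + t *\<^sub>R y))) =
      Re (2 * pi * \<i> * (\<Sum>b\<in>Basis. (y \<bullet> b) * ift (\<lambda>\<xi>. F \<xi> * (\<xi> \<bullet> b)) (z + t *\<^sub>R y))) * h" for h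
  proof -
    have "(\<Sum>b\<in>Basis. ((h *\<^sub>R y) \<bullet> b) * ift (\<lambda>\<xi>. F \<xi> * (\<xi> \<bullet> b)) (z + t *\<^sub>R y)) =
        of_real h * (\<Sum>b\<in>Basis. (y \<bullet> b) * ift (\<lambda>\<xi>. F \<xi> * (\<xi> \<bullet> b)) (z + t *\<^sub>R y))"
      by (simp add: sum_distrib_left mult.assoc)
    then show ?thesis by (simp add: algebra_simps)
  qed
  ultimately show ?thesis unfolding rift_def has_field_derivative_def by (simp only: mult.commute[of _ "Re _"])
qed

text \<open>Mean value theorem along the segment from z to z + y, with rapidly decaying derivatives.
  Since |y| \<le> 1, the intermediate point satisfies 1 + |z| \<le> 2 (1 + |z + t y|), which gives
  the factor 2^N.\<close>

lemma rift_lipschitz: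
  fixes F :: "'a::euclidean_space \<Rightarrow> real"
  assumes F: "tf F"
  obtains C where "C > 0" "\<And>z y. norm y \<le> 1 \<Longrightarrow> \<bar>rift F (z + y) - rift F z\<bar> \<le> C * norm y / (1 + norm z) ^ N"
proof -
  have "\<forall>b\<in>(Basis::'a set). \<exists>C. C > 0 \<and> (\<forall>x. norm (ift (\<lambda>\<xi>. F \<xi> * (\<xi> \<bullet> b)) x) \<le> C / (1 + norm x) ^ N)"
    using rapidE[OF ift_rapid[OF tf_mult[OF F C_infinity_on_inner_left]]] by metis
  then obtain C where C: "\<And>b. b \<in> (Basis::'a set) \<Longrightarrow> C b > 0"
    "\<And>b x. b \<in> (Basis::'a set) \<Longrightarrow> norm (ift (\<lambda>\<xi>. F \<xi> * (\<xi> \<bullet> b)) x) \<le> C b / (1 + norm x) ^ N" by metis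
  define M where "M = 2 * pi * (\<Sum>b\<in>Basis. C b) * 2 ^ N"
  have "(\<Sum>b\<in>Basis. C b) > 0" using C(1) by (intro sum_pos) auto
  then have M: "M > 0" by (simp add: M_def)
  have "\<bar>rift F (z + y) - rift F z\<bar> \<le> M * norm y / (1 + norm z) ^ N" if y: "norm y \<le> 1" for z y
  proof -
    let ?d = "\<lambda>t. Re (2 * pi * \<i> * (\<Sum>b\<in>Basis. (y \<bullet> b) * ift (\<lambda>\<xi>. F \<xi> * (\<xi> \<bullet> b)) (z + t *\<^sub>R y)))"
    obtain t where t: "0 < t" "t < 1" and eq: "rift F (z + 1 *\<^sub>R y) - rift F (z + 0 *\<^sub>R y) = (1 - 0) * ?d t"
      using MVT2[of 0 1 "\<lambda>t. rift F (z + t *\<^sub>R y)" ?d] rift_has_real_derivative[OF F] by auto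
    let ?x = "z + t *\<^sub>R y"
    have ty: "norm (t *\<^sub>R y) \<le> 1 * 1" unfolding norm_scaleR using t y by (intro mult_mono) auto
    have "1 + norm z \<le> (1 + norm ?x) * 2"
    proof -
      have "1 + c \<le> (1 + a) * 2" if "b \<le> 1 * 1" "c \<le> a + b" "0 \<le> a" for a b c :: real
      proof -
        have "1 + c \<le> 2 + a" using that(1,2) by simp
        also have "\<dots> \<le> (1 + a) * 2" using that(3) by simp
        finally show ?thesis .
      qed
      from this[OF ty norm_triangle_ineq4[of ?x "t *\<^sub>R y", unfolded add_diff_cancel_right'] norm_ge_zero]
      show ?thesis .
    qed
    then have "(1 + norm z) ^ N \<le> ((1 + norm ?x) * 2) ^ N" by (intro power_mono) auto
    then have w: "1 / (1 + norm ?x) ^ N \<le> 2 ^ N / (1 + norm z) ^ N"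
      unfolding power_mult_distrib by (simp add: divide_simps mult.commute)
    have "\<bar>?d t\<bar> \<le> norm (2 * pi * \<i> * (\<Sum>b\<in>Basis. (y \<bullet> b) * ift (\<lambda>\<xi>. F \<xi> * (\<xi> \<bullet> b)) ?x))" by (rule abs_Re_le_cmod)
    also have "\<dots> = 2 * pi * norm (\<Sum>b\<in>Basis. (y \<bullet> b) * ift (\<lambda>\<xi>. F \<xi> * (\<xi> \<bullet> b)) ?x)"
      by (simp add: norm_mult)
    also have "\<dots> \<le> 2 * pi * (\<Sum>b\<in>Basis. norm y * (C b * (1 / (1 + norm ?x) ^ N)))"
    proof (intro mult_left_mono order_trans[OF norm_sum] sum_mono)
      fix b :: 'a assume b: "b \<in> Basis"
      show "norm (complex_of_real (y \<bullet> b) * ift (\<lambda>\<xi>. F \<xi> * (\<xi> \<bullet> b)) ?x) \<le> norm y * (C b * (1 / (1 + norm ?x) ^ N))"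
        unfolding norm_mult using C(2)[OF b, of ?x] Basis_le_norm[OF b, of y] by (intro mult_mono) auto
    qed auto
    also have "\<dots> = 2 * pi * (\<Sum>b\<in>Basis. C b) * norm y * (1 / (1 + norm ?x) ^ N)"
      by (simp add: sum_distrib_left sum_distrib_right mult_ac)
    also have "\<dots> \<le> 2 * pi * (\<Sum>b\<in>Basis. C b) * norm y * (2 ^ N / (1 + norm z) ^ N)"
      using \<open>(\<Sum>b\<in>Basis. C b) > 0\<close> by (intro mult_left_mono w) auto
    also have "\<dots> = M * norm y / (1 + norm z) ^ N" by (simp add: M_def)
    finally show ?thesis using eq by simp
  qed
  with M show thesis by (rule that)
qed

text \<open>In the low part the difference falls on the smooth kernel, in the high part on the
  cosine, at the price of one moment of \<open>hi G\<close>. A polynomial weight in the Lipschitz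
  bound is what makes the gradient of g tempered.\<close>

theorem regular_part_lipschitz:
  fixes g :: "'a::euclidean_space \<Rightarrow> real"
  assumes G: "has_fourier_transform g G" "super_polynomial_decay G"
  obtains C N where "C > 0"
    "\<And>x y. norm y \<le> 1 \<Longrightarrow> \<bar>regular_part g G (x + y) - regular_part g G x\<bar> \<le> C * norm y * (1 + norm x) ^ N"
proof -
  note g = has_fourier_transform_tempered[OF G(1)]
  note [measurable] = tempered_measurable[OF g]
  obtain N where N: "integrable lborel (\<lambda>x. g x / (1 + norm x) ^ N)" using g unfolding tempered_def by blast
  let ?r = "rift (bump (0::'a) 1)"
  have tb: "tf (bump (0::'a) 1)" by (rule tf_bump) simp
  obtain C where C: "C > 0" "\<And>z y. norm y \<le> 1 \<Longrightarrow> \<bar>?r (z + y) - ?r z\<bar> \<le> C * norm y / (1 + norm z) ^ N"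
    using rift_lipschitz[OF tb] by blast
  note hi = hi_integrable[OF G]
  have [measurable]: "hi G \<in> borel_measurable borel" using hi(2) by auto
  define A where "A = (\<integral>z. \<bar>g z / (1 + norm z) ^ N\<bar> \<partial>lborel)"
  define B where "B = (\<integral>\<xi>. \<bar>hi G \<xi> * (1 + norm \<xi>)\<bar> \<partial>lborel)"
  have AB: "A \<ge> 0" "B \<ge> 0" by (auto simp: A_def B_def)
  have "\<bar>regular_part g G (x + y) - regular_part g G x\<bar> \<le> (C * A + 2 * pi * B + 1) * norm y * (1 + norm x) ^ N" if y: "norm y \<le> 1" for x y
  proof -
    have ig: "integrable lborel (\<lambda>z. g z * ?r (z - x))" for x
      using integrable_tempered_rapid[OF g rapid_translate[OF rift_rapid[OF tb], of "- x"]] by simp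
    have ih: "integrable lborel (\<lambda>\<xi>. hi G \<xi> * cos (2 * pi * (\<xi> \<bullet> x)))" for x
      by (rule Bochner_Integration.integrable_bound[OF hi(2)]) (auto simp: abs_mult mult_left_le)
    have "norm (\<integral>z. g z * ?r (z - (x + y)) - g z * ?r (z - x) \<partial>lborel) \<le>
        (\<integral>z. C * norm y * (1 + norm x) ^ N * \<bar>g z / (1 + norm z) ^ N\<bar> \<partial>lborel)"
    proof (rule order_trans[OF integral_norm_bound], rule integral_mono)
      show "integrable lborel (\<lambda>z. norm (g z * ?r (z - (x + y)) - g z * ?r (z - x)))"
        by (intro integrable_norm Bochner_Integration.integrable_diff ig)
      show "integrable lborel (\<lambda>z. C * norm y * (1 + norm x) ^ N * \<bar>g z / (1 + norm z) ^ N\<bar>)"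
        by (intro integrable_mult_right integrable_abs N)
      fix z :: 'a
      have "(1 + norm z) ^ N \<le> ((1 + norm (z - x)) * (1 + norm x)) ^ N"
        using one_plus_norm_add_le[of "z - x" x] by (intro power_mono) auto
      then have w: "1 / (1 + norm (z - x)) ^ N \<le> (1 + norm x) ^ N / (1 + norm z) ^ N"
        by (simp add: divide_simps power_mult_distrib mult.commute)
      have "\<bar>?r ((z - x) + (- y)) - ?r (z - x)\<bar> \<le> C * norm (- y) / (1 + norm (z - x)) ^ N"
        using y by (intro C(2)) simp
      also have "\<dots> = C * norm y * (1 / (1 + norm (z - x)) ^ N)" by simp
      also have "\<dots> \<le> C * norm y * ((1 + norm x) ^ N / (1 + norm z) ^ N)"
        using C(1) by (intro mult_left_mono w) auto
      finally have "\<bar>?r (z - (x + y)) - ?r (z - x)\<bar> \<le> C * norm y * ((1 + norm x) ^ N / (1 + norm z) ^ N)"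
        by (simp add: algebra_simps)
      from mult_left_mono[OF this, of "\<bar>g z\<bar>"]
      show "norm (g z * ?r (z - (x + y)) - g z * ?r (z - x)) \<le> C * norm y * (1 + norm x) ^ N * \<bar>g z / (1 + norm z) ^ N\<bar>"
        unfolding right_diff_distrib[symmetric] by (simp add: abs_mult mult_ac)
    qed
    then have "norm (\<integral>z. g z * ?r (z - (x + y)) - g z * ?r (z - x) \<partial>lborel) \<le> C * norm y * (1 + norm x) ^ N * A"
      unfolding integral_mult_right_zero A_def .
    then have 1: "\<bar>(\<integral>z. g z * ?r (z - (x + y)) \<partial>lborel) - (\<integral>z. g z * ?r (z - x) \<partial>lborel)\<bar> \<le> C * norm y * (1 + norm x) ^ N * A"
      using ig by simp
    have "norm (\<integral>\<xi>. hi G \<xi> * cos (2 * pi * (\<xi> \<bullet> (x + y))) - hi G \<xi> * cos (2 * pi * (\<xi> \<bullet> x)) \<partial>lborel) \<le>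
        (\<integral>\<xi>. 2 * pi * norm y * \<bar>hi G \<xi> * (1 + norm \<xi>)\<bar> \<partial>lborel)"
    proof (rule order_trans[OF integral_norm_bound], rule integral_mono)
      show "integrable lborel (\<lambda>\<xi>. norm (hi G \<xi> * cos (2 * pi * (\<xi> \<bullet> (x + y))) - hi G \<xi> * cos (2 * pi * (\<xi> \<bullet> x))))"
        by (intro integrable_norm Bochner_Integration.integrable_diff ih)
      show "integrable lborel (\<lambda>\<xi>. 2 * pi * norm y * \<bar>hi G \<xi> * (1 + norm \<xi>)\<bar>)"
        by (intro integrable_mult_right integrable_abs hi(1))
      fix \<xi> :: 'a
      have lip: "\<bar>cos a - cos b\<bar> \<le> \<bar>a - b\<bar>" for a b :: real
      proof -
        have "\<bar>cos a - cos b\<bar> = 2 * \<bar>sin ((a + b) / 2)\<bar> * \<bar>sin ((b - a) / 2)\<bar>"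
          by (simp add: cos_diff_cos abs_mult)
        also have "\<dots> \<le> 2 * 1 * \<bar>(b - a) / 2\<bar>" by (intro mult_mono abs_sin_x_le_abs_x) auto
        finally show ?thesis by simp
      qed
      have "\<bar>cos (2 * pi * (\<xi> \<bullet> (x + y))) - cos (2 * pi * (\<xi> \<bullet> x))\<bar> \<le> \<bar>2 * pi * (\<xi> \<bullet> y)\<bar>"
        using lip[of "2 * pi * (\<xi> \<bullet> (x + y))" "2 * pi * (\<xi> \<bullet> x)"] by (simp add: inner_add_right algebra_simps)
      also have "\<dots> \<le> 2 * pi * ((1 + norm \<xi>) * norm y)"
        unfolding abs_mult
        by (intro mult_mono order_trans[OF Cauchy_Schwarz_ineq2]) (auto intro: mult_right_mono)
      finally have "\<bar>cos (2 * pi * (\<xi> \<bullet> (x + y))) - cos (2 * pi * (\<xi> \<bullet> x))\<bar> \<le> 2 * pi * ((1 + norm \<xi>) * norm y)" .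
      from mult_left_mono[OF this, of "\<bar>hi G \<xi>\<bar>"]
      show "norm (hi G \<xi> * cos (2 * pi * (\<xi> \<bullet> (x + y))) - hi G \<xi> * cos (2 * pi * (\<xi> \<bullet> x))) \<le> 2 * pi * norm y * \<bar>hi G \<xi> * (1 + norm \<xi>)\<bar>"
        unfolding right_diff_distrib[symmetric] by (simp add: abs_mult mult_ac)
    qed
    then have "norm (\<integral>\<xi>. hi G \<xi> * cos (2 * pi * (\<xi> \<bullet> (x + y))) - hi G \<xi> * cos (2 * pi * (\<xi> \<bullet> x)) \<partial>lborel) \<le> 2 * pi * norm y * B"
      unfolding integral_mult_right_zero B_def .
    then have 2: "\<bar>(\<integral>\<xi>. hi G \<xi> * cos (2 * pi * (\<xi> \<bullet> (x + y))) \<partial>lborel) - (\<integral>\<xi>. hi G \<xi> * cos (2 * pi * (\<xi> \<bullet> x)) \<partial>lborel)\<bar> \<le> 2 * pi * norm y * B"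
      using ih by simp
    have "2 * pi * norm y * B * 1 \<le> 2 * pi * norm y * B * (1 + norm x) ^ N"
      using AB by (intro mult_left_mono one_le_power) auto
    moreover have "0 \<le> norm y * (1 + norm x) ^ N" by simp
    moreover have "(C * A + 2 * pi * B + 1) * norm y * (1 + norm x) ^ N =
        C * norm y * (1 + norm x) ^ N * A + 2 * pi * norm y * B * (1 + norm x) ^ N + norm y * (1 + norm x) ^ N"
      by (simp add: algebra_simps)
    ultimately show ?thesis using 1 2 unfolding regular_part_def by linarith
  qed
  moreover have "C * A + 2 * pi * B + 1 > 0" using C(1) AB by (simp add: add_nonneg_pos)
  ultimately show thesis using that by blast
qed


subsection \<open>The energy of a potential\<close>

lemma inverse_power_le:
  fixes A B c :: real
  assumes "0 < A" "0 < B" "A \<le> c * B"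
  shows "1 / B ^ N \<le> c ^ N / A ^ N"
proof -
  have "A ^ N \<le> c ^ N * B ^ N" using assms power_mono[OF assms(3), of N] by (simp add: power_mult_distrib)
  then show ?thesis using assms zero_less_power[of A N] zero_less_power[of B N]
    by (simp add: pos_divide_le_eq pos_le_divide_eq mult.commute)
qed

lemma tempered_dilate:
  assumes u: "tempered u" and t: "t > 0"
  shows "tempered (dilate t u)"
proof -
  obtain N where N: "integrable lborel (\<lambda>x. u x / (1 + norm x) ^ N)" using u unfolding tempered_def by blast
  have i: "integrable lborel (\<lambda>x. u (0 + (1 / t) *\<^sub>R x) / (1 + norm (0 + (1 / t) *\<^sub>R x)) ^ N)"
    by (rule lborel_affine_integrable[OF N]) (use t in simp)
  have m[measurable]: "u \<in> borel_measurable borel" by (rule tempered_measurable[OF u])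
  have "integrable lborel (\<lambda>x. dilate t u x / (1 + norm x) ^ N)"
  proof (rule Bochner_Integration.integrable_bound[OF integrable_mult_right[OF i, of "(1 + 1 / t) ^ N"]])
    show "(\<lambda>x. dilate t u x / (1 + norm x) ^ N) \<in> borel_measurable lborel" unfolding dilate_def by measurable
    have "norm (dilate t u x / (1 + norm x) ^ N) \<le> norm ((1 + 1 / t) ^ N * (u (0 + (1 / t) *\<^sub>R x) / (1 + norm (0 + (1 / t) *\<^sub>R x)) ^ N))" for x
    proof -
      let ?y = "(1 / t) *\<^sub>R x"
      have "1 + norm ?y \<le> (1 + 1 / t) * (1 + norm x)"
        using t by (simp add: field_simps)
      then have "1 / (1 + norm x) ^ N \<le> (1 + 1 / t) ^ N / (1 + norm ?y) ^ N"
        by (intro inverse_power_le) (simp_all add: add_pos_nonneg)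
      from mult_left_mono[OF this, of "\<bar>u ?y\<bar>"] t show ?thesis
        by (simp add: dilate_def abs_mult power_abs divide_inverse mult_ac)
    qed
    then show "AE x in lborel. norm (dilate t u x / (1 + norm x) ^ N) \<le> norm ((1 + 1 / t) ^ N * (u (0 + (1 / t) *\<^sub>R x) / (1 + norm (0 + (1 / t) *\<^sub>R x)) ^ N))"
      by (rule AE_I2)
  qed
  then show ?thesis unfolding tempered_def by blast
qed

lemma tempered_cong_off_0:
  assumes u: "tempered u" and eq: "\<And>x. x \<noteq> 0 \<Longrightarrow> v x = u x"
  shows "tempered v"
proof -
  obtain N where N: "integrable lborel (\<lambda>x. u x / (1 + norm x) ^ N)" using u unfolding tempered_def by blast
  have [measurable]: "u \<in> borel_measurable borel" by (rule tempered_measurable[OF u])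
  have "v = (\<lambda>x. if x = 0 then v 0 else u x)" using eq by auto
  moreover have "(\<lambda>x. if x = 0 then v 0 else u x) \<in> borel_measurable borel" by measurable
  ultimately have [measurable]: "v \<in> borel_measurable borel" by simp
  have "integrable lborel (\<lambda>x. v x / (1 + norm x) ^ N)"
  proof (rule integrable_cong_AE_imp[OF N])
    show "(\<lambda>x. v x / (1 + norm x) ^ N) \<in> borel_measurable lborel" by measurable
    show "AE x in lborel. u x / (1 + norm x) ^ N = v x / (1 + norm x) ^ N"
      using AE_lborel_singleton[of 0] by eventually_elim (simp add: eq)
  qed
  then show ?thesis unfolding tempered_def by blast
qed

lemma pairing_cong_off_0:
  fixes u v :: "'a::euclidean_space \<Rightarrow> real"
  assumes u: "tempered u" and eq: "\<And>x. x \<noteq> 0 \<Longrightarrow> v x = u x" and f: "rapid f" "rapid h"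
  shows "pairing v f h = pairing u f h"
  unfolding pairing_def
proof (rule integral_cong_AE)
  have v: "tempered v" by (rule tempered_cong_off_0[OF u eq])
  show "(\<lambda>(x, y). f x * v (x - y) * h y) \<in> borel_measurable (lborel \<Otimes>\<^sub>M lborel)"
    "(\<lambda>(x, y). f x * u (x - y) * h y) \<in> borel_measurable (lborel \<Otimes>\<^sub>M lborel)"
    using integrable_kernel[OF f(1) v f(2)] integrable_kernel[OF f(1) u f(2)] by auto
  show "AE p in lborel \<Otimes>\<^sub>M lborel. (case p of (x, y) \<Rightarrow> f x * v (x - y) * h y) = (case p of (x, y) \<Rightarrow> f x * u (x - y) * h y)"
    unfolding lborel_prod using AE_off_diagonal by eventually_elim (auto simp: eq)
qed

lemma pairing_linear_left:
  fixes D :: "'a::euclidean_space \<Rightarrow> real"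
  assumes D: "tempered D" and f: "rapid f" and k: "rapid k" and h: "rapid h"
  shows "pairing D (\<lambda>x. f x + l * k x) h = pairing D f h + l * pairing D k h"
proof -
  note i = integrable_kernel[OF f D h] integrable_kernel[OF k D h]
  have "pairing D (\<lambda>x. f x + l * k x) h =
      (\<integral>p. (case p of (x, y) \<Rightarrow> f x * D (x - y) * h y)
        + l * (case p of (x, y) \<Rightarrow> k x * D (x - y) * h y) \<partial>(lborel \<Otimes>\<^sub>M lborel))"
    unfolding pairing_def by (intro Bochner_Integration.integral_cong) (auto simp: algebra_simps)
  also have "\<dots> = pairing D f h + l * pairing D k h"
    unfolding pairing_def using Bochner_Integration.integral_add[OF i(1) integrable_mult_right[OF i(2), of l]] by simp
  finally show ?thesis .
qed

lemma pairing_quadratic: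
  fixes D :: "'a::euclidean_space \<Rightarrow> real"
  assumes D: "tempered D" and f: "rapid f" and k: "rapid k"
  shows "pairing D (\<lambda>x. f x + l * k x) (\<lambda>x. f x + l * k x) =
    pairing D f f + l * (pairing D f k + pairing D k f) + l\<^sup>2 * pairing D k k"
proof -
  have fk: "rapid (\<lambda>x. f x + l * k x)" by (intro rapid_add rapid_cmult f k)
  show ?thesis
    unfolding pairing_linear_left[OF D f k fk] pairing_linear[OF D f k f] pairing_linear[OF D f k k]
    by (simp add: algebra_simps power2_eq_square)
qed

lemma potential_norm_eq: "potential_norm g f = sqrt (pairing g f f)"
  unfolding potential_norm_def pairing_def
  by (intro arg_cong[of _ _ sqrt] Bochner_Integration.integral_cong) (auto simp: mult_ac)

text \<open>Conditional positive definiteness is assumed of g, while the energies are those of its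
  dilate; pushing the density forward under x / t moves the dilation from the potential to the
  measure.\<close>

definition scaled_measure :: "real \<Rightarrow> ('a::euclidean_space \<Rightarrow> real) \<Rightarrow> 'a measure" where
  "scaled_measure t f = distr (density lborel (\<lambda>x. ennreal (f x))) borel (\<lambda>x. x /\<^sub>R t)"

lemma scaled_measure:
  fixes f h u :: "'a::euclidean_space \<Rightarrow> real"
  assumes t: "t > 0" and f: "rapid f" "\<And>x. 0 \<le> f x"
  shows "finite_measure (scaled_measure t f)" "sets (scaled_measure t f) = sets borel"
    "measure (scaled_measure t f) UNIV = (\<integral>x. f x \<partial>lborel)"
    "measure (scaled_measure t f) {x} = 0"
proof -
  note [measurable] = rapid_measurable[OF f(1)]
  have e: "emeasure (density lborel (\<lambda>x. ennreal (f x))) UNIV = ennreal (\<integral>x. f x \<partial>lborel)"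
    by (subst emeasure_density) (auto simp: nn_integral_eq_integral rapid_integrable f)
  then show "finite_measure (scaled_measure t f)"
    unfolding scaled_measure_def by (intro finite_measureI) (simp add: emeasure_distr)
  show "sets (scaled_measure t f) = sets borel" by (simp add: scaled_measure_def)
  show "measure (scaled_measure t f) UNIV = (\<integral>x. f x \<partial>lborel)"
    unfolding scaled_measure_def measure_def using e f(2) by (simp add: emeasure_distr)
  have v: "(\<lambda>y. y /\<^sub>R t) -` {x} = {t *\<^sub>R x}" using t by auto
  have "emeasure (scaled_measure t f) {x} = (\<integral>\<^sup>+y. ennreal (f y) * indicator {t *\<^sub>R x} y \<partial>lborel)"
    unfolding scaled_measure_def by (simp add: emeasure_distr v emeasure_density)
  also have "\<dots> = (\<integral>\<^sup>+y. 0 \<partial>(lborel :: 'a measure))"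
  proof (rule nn_integral_cong_AE)
    show "AE y in lborel. ennreal (f y) * indicator {t *\<^sub>R x} y = 0"
      using AE_lborel_singleton[of "t *\<^sub>R x"] by eventually_elim simp
  qed
  finally show "measure (scaled_measure t f) {x} = 0" by (simp add: measure_def)
qed

lemma interaction_scaled_measure:
  fixes f h u :: "'a::euclidean_space \<Rightarrow> real"
  assumes t: "t > 0" and u: "tempered u" and f: "rapid f" "\<And>x. 0 \<le> f x" and h: "rapid h" "\<And>x. 0 \<le> h x"
  shows "interaction_defined u (scaled_measure t f) (scaled_measure t h)"
    "interaction u (scaled_measure t f) (scaled_measure t h) = pairing (dilate t u) f h"
proof -
  note [measurable] = rapid_measurable[OF f(1)] rapid_measurable[OF h(1)] tempered_measurable[OF u]
  let ?d = "\<lambda>f. density lborel (\<lambda>x. ennreal (f x))" and ?T = "\<lambda>x::'a. x /\<^sub>R t"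
  let ?P = "density (lborel \<Otimes>\<^sub>M lborel) (\<lambda>(x, y). ennreal (f x) * ennreal (h y))"
  have fin: "finite_measure (?d k)" if "rapid k" "\<And>x. 0 \<le> k x" for k :: "'a \<Rightarrow> real"
  proof (rule finite_measureI)
    note [measurable] = rapid_measurable[OF that(1)]
    show "emeasure (?d k) (space (?d k)) \<noteq> \<infinity>"
      by (subst emeasure_density) (auto simp: nn_integral_eq_integral rapid_integrable that)
  qed
  interpret h: finite_measure "?d h" by (rule fin[OF h])
  interpret hT: finite_measure "scaled_measure t h" by (rule scaled_measure(1)[OF t h])
  have prod: "scaled_measure t f \<Otimes>\<^sub>M scaled_measure t h = distr ?P (borel \<Otimes>\<^sub>M borel) (\<lambda>(x, y). (?T x, ?T y))"
  proof -
    have "scaled_measure t f \<Otimes>\<^sub>M scaled_measure t h = distr (?d f \<Otimes>\<^sub>M ?d h) (borel \<Otimes>\<^sub>M borel) (\<lambda>(x, y). (?T x, ?T y))"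
      unfolding scaled_measure_def
      by (rule pair_measure_distr) (use hT.sigma_finite_measure_axioms in \<open>auto simp: scaled_measure_def\<close>)
    also have "?d f \<Otimes>\<^sub>M ?d h = ?P"
      by (rule pair_measure_density) (auto intro: sigma_finite_lborel h.sigma_finite_measure_axioms)
    finally show ?thesis .
  qed
  have T[measurable]: "(\<lambda>(x, y). (?T x, ?T y)) \<in> ?P \<rightarrow>\<^sub>M borel \<Otimes>\<^sub>M borel" by simp
  have U: "(\<lambda>(x, y). u (x - y)) \<in> borel_measurable (borel \<Otimes>\<^sub>M (borel :: 'a measure))" by measurable
  have dens: "?P = density (lborel \<Otimes>\<^sub>M lborel) (\<lambda>p. ennreal (f (fst p) * h (snd p)))"
    by (intro density_cong) (auto simp: ennreal_mult f h case_prod_beta)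
  have eq: "(f (fst p) * h (snd p)) *\<^sub>R (case (case p of (x, y) \<Rightarrow> (?T x, ?T y)) of (x, y) \<Rightarrow> u (x - y)) =
      (case p of (x, y) \<Rightarrow> f x * dilate t u (x - y) * h y)" for p
    by (simp add: case_prod_beta dilate_def scaleR_diff_right mult_ac)
  have k: "integrable (lborel \<Otimes>\<^sub>M lborel) (\<lambda>(x, y). f x * dilate t u (x - y) * h y)"
    by (rule integrable_kernel[OF f(1) tempered_dilate[OF u t] h(1)])
  have m: "(\<lambda>p. case (case p of (x, y) \<Rightarrow> (?T x, ?T y)) of (x, y) \<Rightarrow> u (x - y)) \<in> borel_measurable (lborel \<Otimes>\<^sub>M lborel)"
    by measurable
  show "interaction_defined u (scaled_measure t f) (scaled_measure t h)"
    unfolding interaction_defined_def prod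
    by (subst integrable_distr_eq[OF T U], unfold dens, subst integrable_density)
      (use k m f(2) h(2) in \<open>auto simp: eq[unfolded real_scaleR_def]\<close>)
  show "interaction u (scaled_measure t f) (scaled_measure t h) = pairing (dilate t u) f h"
    unfolding interaction_def prod pairing_def
    by (subst integral_distr[OF T U], unfold dens, subst integral_density)
      (use m f(2) h(2) in \<open>auto simp: eq[unfolded real_scaleR_def]\<close>)
qed

text \<open>The positive and negative parts of f have equal mass and define measures without atoms.
  Hence the condition applies whether or not g has a limit at 0, and the value assigned at 0 does
  not influence the double integrals.\<close>

theorem cond_positive_definite_pairing:
  fixes g :: "'a::euclidean_space \<Rightarrow> real"
  assumes cpd: "cond_positive_definite g" and g: "tempered g" and t: "t > 0"
    and f: "rapid f" "(\<integral>x. f x \<partial>lborel) = 0"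
  shows "0 \<le> pairing (dilate t g) f f"
proof -
  define g0 where "g0 = g(0 := Lim (at 0) g)"
  have g0: "tempered g0" by (rule tempered_cong_off_0[OF g]) (simp add: g0_def)
  define p where "p x = max 0 (f x)" for x
  define n where "n x = max 0 (- f x)" for x
  note [measurable] = rapid_measurable[OF f(1)]
  have p: "rapid p" "\<And>x. 0 \<le> p x" and n: "rapid n" "\<And>x. 0 \<le> n x"
    by (auto simp: p_def n_def intro!: rapid_dominated[OF f(1), where B = 1]) (measurable, auto simp: p_def[abs_def] n_def[abs_def])
  have fpn: "f x = p x + (-1) * n x" for x by (simp add: p_def n_def)
  have "(\<integral>x. f x \<partial>lborel) = (\<integral>x. p x \<partial>lborel) - (\<integral>x. n x \<partial>lborel)"
    unfolding fpn using rapid_integrable[OF p(1)] rapid_integrable[OF n(1)] by simp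
  then have mass: "(\<integral>x. p x \<partial>lborel) = (\<integral>x. n x \<partial>lborel)" using f(2) by simp
  note sp = scaled_measure[OF t p] and sn = scaled_measure[OF t n]
  have "0 \<le> interaction g0 (scaled_measure t p) (scaled_measure t p) - interaction g0 (scaled_measure t p) (scaled_measure t n)
      - interaction g0 (scaled_measure t n) (scaled_measure t p) + interaction g0 (scaled_measure t n) (scaled_measure t n)"
    using cpd unfolding cond_positive_definite_def Let_def g0_def[symmetric]
    using sp sn mass interaction_scaled_measure(1)[OF t g0] p n by simp
  then have "0 \<le> pairing (dilate t g0) p p - pairing (dilate t g0) p n - pairing (dilate t g0) n p + pairing (dilate t g0) n n"
    using interaction_scaled_measure(2)[OF t g0] p n by simp
  also have "\<dots> = pairing (dilate t g0) (\<lambda>x. p x + (-1) * n x) (\<lambda>x. p x + (-1) * n x)"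
    unfolding pairing_quadratic[OF tempered_dilate[OF g0 t] p(1) n(1)] by simp
  also have "\<dots> = pairing (dilate t g0) f f" by (simp only: fpn[symmetric])
  also have "\<dots> = pairing (dilate t g) f f"
    by (rule pairing_cong_off_0[OF tempered_dilate[OF g t] _ f(1) f(1)]) (use t in \<open>simp add: dilate_def g0_def\<close>)
  finally show ?thesis .
qed

text \<open>The self-correlation of the dipole tends to twice the unit mass at 0 minus the unit
  masses at 2p and -2p. For an even kernel whose value at 2p differs from its value at 0 the limit
  is nonzero, which yields a function of nonzero energy.\<close>

lemma pairing_dipole_dipole_limit:
  fixes u :: "'a::euclidean_space \<Rightarrow> real"
  assumes u: "tempered u" and c: "isCont u 0" "isCont u (2 *\<^sub>R p)" "isCont u (- (2 *\<^sub>R p))"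
  shows "(\<lambda>j. pairing u (dipole (real (Suc j)) p) (dipole (real (Suc j)) p)) \<longlonglongrightarrow> 2 * u 0 - u (2 *\<^sub>R p) - u (- (2 *\<^sub>R p))"
proof -
  have eq: "pairing u (dipole r p) (dipole r p) =
      2 * (\<integral>z. u z * corr r (z - 0) \<partial>lborel) - (\<integral>z. u z * corr r (z - 2 *\<^sub>R p) \<partial>lborel)
       - (\<integral>z. u z * corr r (z - (- (2 *\<^sub>R p))) \<partial>lborel)" if r: "r > 0" for r
  proof -
    have i: "integrable lborel (\<lambda>z. u z * corr r (z - q))" for q
      using integrable_tempered_rapid[OF u rapid_translate[OF corr_rapid[OF r], of "- q"]] by simp
    note rb = rift_rapid[OF tf_bump[OF r, of "0::'a"]]
    have ib: "integrable lborel (\<lambda>y. rift (bump 0 r) (z + y) * dipole r p y)" for z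
    proof -
      obtain B where "\<And>x::'a. norm (dipole r p x) \<le> B" using rapid_bounded[OF dipole_rapid[OF r]] by metis
      then have "rapid (\<lambda>y. rift (bump 0 r) (y + z) * dipole r p y)"
        using rapid_measurable[OF dipole_rapid[OF r, of p]]
        by (intro rapid_mult_bounded[where B = B] rapid_translate[OF rb]) auto
      then show ?thesis using rapid_integrable by (simp add: add.commute)
    qed
    have dd: "(\<integral>y. dipole r p (z + y) * dipole r p y \<partial>lborel) =
        2 * corr r (z - 0) - corr r (z - 2 *\<^sub>R p) - corr r (z - (- (2 *\<^sub>R p)))" for z
    proof -
      have "(\<integral>y. dipole r p (z + y) * dipole r p y \<partial>lborel) =
          (\<integral>y. rift (bump 0 r) ((z + p) + y) * dipole r p y - rift (bump 0 r) ((z - p) + y) * dipole r p y \<partial>lborel)"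
      proof (rule Bochner_Integration.integral_cong[OF refl])
        fix y
        have "dipole r p (z + y) = rift (bump 0 r) ((z + p) + y) - rift (bump 0 r) ((z - p) + y)"
          by (simp add: dipole_def algebra_simps)
        then show "dipole r p (z + y) * dipole r p y =
            rift (bump 0 r) ((z + p) + y) * dipole r p y - rift (bump 0 r) ((z - p) + y) * dipole r p y"
          by (simp only: left_diff_distrib)
      qed
      also have "\<dots> = (corr r (z + p - p) - corr r (z + p + p)) - (corr r (z - p - p) - corr r (z - p + p))"
        by (subst Bochner_Integration.integral_diff[OF ib ib]) (simp only: integral_dipole_corr[OF r])
      finally show ?thesis by (simp add: scaleR_2 algebra_simps)
    qed
    have "pairing u (dipole r p) (dipole r p) =
        (\<integral>z. 2 * (u z * corr r (z - 0)) - u z * corr r (z - 2 *\<^sub>R p) - u z * corr r (z - (- (2 *\<^sub>R p))) \<partial>lborel)"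
      unfolding pairing_def integral_kernel[OF dipole_rapid[OF r] u dipole_rapid[OF r]] dd
      by (intro Bochner_Integration.integral_cong) (auto simp: algebra_simps)
    then show ?thesis
      by (simp only: Bochner_Integration.integral_diff[OF Bochner_Integration.integrable_diff[OF integrable_mult_right[OF i] i] i]
        Bochner_Integration.integral_diff[OF integrable_mult_right[OF i] i] integral_mult_right_zero)
  qed
  have "(\<lambda>j. 2 * (\<integral>z. u z * corr (real (Suc j)) (z - 0) \<partial>lborel) - (\<integral>z. u z * corr (real (Suc j)) (z - 2 *\<^sub>R p) \<partial>lborel)
       - (\<integral>z. u z * corr (real (Suc j)) (z - (- (2 *\<^sub>R p))) \<partial>lborel)) \<longlonglongrightarrow> 2 * u 0 - u (2 *\<^sub>R p) - u (- (2 *\<^sub>R p))"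
    by (intro tendsto_intros corr_approximate_identity[OF u] c)
  then show ?thesis by (simp only: eq of_nat_0_less_iff zero_less_Suc)
qed

text \<open>On the Fourier side the energy of a wave packet is an integral of \<open>G\<close> over its frequency support.\<close>

theorem packet_energy_le:
  fixes g :: "'a::euclidean_space \<Rightarrow> real"
  assumes G: "has_fourier_transform g G" and t: "t > 0" and r: "r > 0" and c: "norm c > r"
    and bd: "\<And>\<xi>. norm \<xi> \<ge> t * (norm c - r) \<Longrightarrow> \<bar>G \<xi>\<bar> \<le> M"
  shows "pairing (dilate t g) (rift (bump c r)) (rift (bump c r)) \<le> M * t ^ DIM('a) * (\<integral>\<xi>. bump (0::'a) r \<xi> \<partial>lborel)"
proof -
  note g = has_fourier_transform_tempered[OF G]
  note [measurable] = tempered_measurable[OF g]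
  note b = tf_bump[OF r, of c] and tr = mult_pos_pos[OF t r]
  \<comment> \<open>The energy carries the squared symmetrised bump as its weight; dilating the
    potential by t moves this weight to centre t c and radius t r.\<close>
  let ?K = "\<lambda>\<xi>. (symm (bump c r) \<xi>)\<^sup>2" and ?Kt = "\<lambda>\<xi>. (symm (bump (t *\<^sub>R c) (t * r)) \<xi>)\<^sup>2"
  have K: "tf ?K" unfolding power2_eq_square by (intro tf_mult tf_symm tf_smooth b)
  have Kt: "tf ?Kt" unfolding power2_eq_square by (intro tf_mult tf_symm tf_smooth tf_bump tr)
  have scale: "?Kt (t *\<^sub>R \<xi>) = ?K \<xi>" for \<xi>
    unfolding symm_def scaleR_minus_right[symmetric] bump_scale[OF r t] by simp
  \<comment> \<open>Some frequency is large enough for the bound on G to apply. The sign of M is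
    then used at the small frequencies, which the bound does not reach.\<close>
  have M: "M \<ge> 0"
  proof -
    obtain e :: 'a where e: "e \<in> Basis" using nonempty_Basis by blast
    have "norm ((t * norm c) *\<^sub>R e) \<ge> t * (norm c - r)" using e t r by (simp add: abs_mult mult_left_mono)
    from order_trans[OF abs_ge_zero bd[OF this]] show ?thesis .
  qed
  have supp: "?Kt \<xi> = 0" if "norm \<xi> < t * (norm c - r)" for \<xi>
  proof -
    have "bump (t *\<^sub>R c) (t * r) \<eta> = 0" if "norm \<eta> = norm \<xi>" for \<eta>
    proof (rule bump_eq_0[OF tr])
      show "t * r \<le> norm (\<eta> - t *\<^sub>R c)"
        using norm_triangle_ineq2[of "t *\<^sub>R c" \<eta>] \<open>norm \<xi> < _\<close> that t
        by (simp add: norm_minus_commute right_diff_distrib)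
    qed
    from this[of \<xi>] this[of "- \<xi>"] show ?thesis by (simp add: symm_def)
  qed
  have pos: "t * (norm c - r) > 0" using t c by simp
  have "pairing (dilate t g) (rift (bump c r)) (rift (bump c r)) = (\<integral>z. dilate t g z * rift ?K z \<partial>lborel)"
    unfolding pairing_def integral_kernel[OF rift_rapid[OF b] tempered_dilate[OF g t] rift_rapid[OF b]] rift_correlation[OF b]
    by (rule refl)
  also have "\<dots> = (\<integral>z. g ((1 / t) *\<^sub>R z) * rift (\<lambda>\<xi>. ?Kt (t *\<^sub>R \<xi>)) z \<partial>lborel)"
    unfolding scale dilate_def by (simp add: inverse_eq_divide)
  also have "\<dots> = (\<integral>z. g ((1 / t) *\<^sub>R z) * (rift ?Kt ((1 / t) *\<^sub>R z) / t ^ DIM('a)) \<partial>lborel)"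
    by (subst rift_scale[OF tf_measurable[OF Kt] t]) (rule refl)
  also have "\<dots> = (\<integral>z. g z * rift ?Kt z \<partial>lborel)"
  proof -
    note [measurable] = rapid_measurable[OF rift_rapid[OF Kt]]
    have "(\<integral>z. g ((1 / t) *\<^sub>R z) * (rift ?Kt ((1 / t) *\<^sub>R z) / t ^ DIM('a)) \<partial>lborel) =
        t ^ DIM('a) * (\<integral>z. g z * rift ?Kt z / t ^ DIM('a) \<partial>lborel)"
      using t lborel_affine_integral[of "\<lambda>z. g ((1 / t) *\<^sub>R z) * (rift ?Kt ((1 / t) *\<^sub>R z) / t ^ DIM('a))" t 0] by simp
    then show ?thesis using t by simp
  qed
  also have "complex_of_real \<dots> = complex_of_real (\<integral>\<xi>. G \<xi> * ?Kt \<xi> \<partial>lborel)"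
  proof -
    have "symm ?Kt = ?Kt" by (rule symm_even) simp
    then have "complex_of_real (rift ?Kt (- x)) = fourier (\<lambda>\<xi>. of_real (?Kt \<xi>)) x" for x
      using ift_symm[OF Kt, of "- x"] by (simp add: fourier_eq_inv_fourier ift_def)
    moreover have "rift ?Kt (- x) = rift ?Kt x" for x
      unfolding rift_eq[OF tf_integrable[OF Kt]] by simp
    ultimately have f: "complex_of_real (rift ?Kt x) = fourier (\<lambda>\<xi>. of_real (?Kt \<xi>)) x" for x by metis
    show ?thesis
      using has_fourier_transform_integrable(2)[OF G test_function_off_0[OF Kt supp pos]]
      unfolding f[symmetric] of_real_mult[symmetric] integral_complex_of_real by simp
  qed
  finally have "pairing (dilate t g) (rift (bump c r)) (rift (bump c r)) = (\<integral>\<xi>. G \<xi> * ?Kt \<xi> \<partial>lborel)"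
    using of_real_eq_iff by blast
  also have "\<dots> \<le> (\<integral>\<xi>. M * symm (bump (t *\<^sub>R c) (t * r)) \<xi> \<partial>lborel)"
  proof (rule integral_mono[OF has_fourier_transform_integrable(1)[OF G test_function_off_0[OF Kt supp pos]]])
    show "integrable lborel (\<lambda>\<xi>. M * symm (bump (t *\<^sub>R c) (t * r)) \<xi>)"
      by (intro integrable_mult_right tf_integrable tf_symm tf_bump tr)
    fix \<xi> :: 'a
    let ?s = "symm (bump (t *\<^sub>R c) (t * r)) \<xi>"
    have s: "0 \<le> ?s" "?s \<le> 1"
      using bump_nonneg[of "t *\<^sub>R c" "t * r"] bump_le_1[of "t *\<^sub>R c" "t * r" \<xi>] bump_le_1[of "t *\<^sub>R c" "t * r" "- \<xi>"]
      by (auto simp: symm_def)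
    show "G \<xi> * ?s\<^sup>2 \<le> M * ?s"
    proof (cases "norm \<xi> < t * (norm c - r)")
      case True
      then show ?thesis using supp[OF True] s M by simp
    next
      case False
      then have "G \<xi> \<le> M" using bd[of \<xi>] by (simp add: abs_le_iff)
      then have "G \<xi> * ?s\<^sup>2 \<le> M * ?s\<^sup>2" by (rule mult_right_mono) simp
      also have "\<dots> \<le> M * (?s * 1)" unfolding power2_eq_square using M s by (intro mult_left_mono) auto
      finally show ?thesis by simp
    qed
  qed
  also have "\<dots> = M * (\<integral>\<xi>. symm (bump (t *\<^sub>R c) (t * r)) \<xi> \<partial>lborel)" by simp
  also have "(\<integral>\<xi>. symm (bump (t *\<^sub>R c) (t * r)) \<xi> \<partial>lborel) = (\<integral>\<xi>. bump (t *\<^sub>R c) (t * r) \<xi> \<partial>lborel)"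
  proof -
    note tb = tf_bump[OF tr, of "t *\<^sub>R c"]
    have "(\<integral>\<xi>. bump (t *\<^sub>R c) (t * r) (- \<xi>) \<partial>lborel) = (\<integral>\<xi>. bump (t *\<^sub>R c) (t * r) \<xi> \<partial>lborel)"
      by (rule integral_reflect[OF tf_measurable[OF tb]])
    then show ?thesis
      unfolding symm_def using tf_integrable[OF tb] tf_integrable[OF tf_reflect[OF tb]] by simp
  qed
  also have "\<dots> = t ^ DIM('a) * (\<integral>\<xi>. bump (t *\<^sub>R c) (t * r) (t *\<^sub>R c + t *\<^sub>R \<xi>) \<partial>lborel)"
    using lborel_affine_integral[OF tf_measurable[OF tf_bump[OF tr, of "t *\<^sub>R c"]], of t "t *\<^sub>R c"] t by simp
  also have "(\<lambda>\<xi>::'a. bump (t *\<^sub>R c) (t * r) (t *\<^sub>R c + t *\<^sub>R \<xi>)) = bump 0 r"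
    using t by (auto simp: bump_def power_mult_distrib fun_eq_iff)
  finally show ?thesis by (simp add: mult.assoc)
qed


subsection \<open>Gradients of radial potentials\<close>

lemma gradient_inner:
  fixes g :: "'a::euclidean_space \<Rightarrow> real"
  assumes "g differentiable (at z)"
  shows "e \<bullet> gradient g z = pd e g z"
proof -
  let ?f = "frechet_derivative g (at z)"
  have f: "(g has_derivative ?f) (at z)" using assms by (simp add: frechet_derivative_works)
  have lin: "linear ?f" by (rule linear_frechet_derivative[OF assms])
  define D where "D = (\<Sum>b\<in>Basis. ?f b *\<^sub>R b)"
  have fD: "?f h = h \<bullet> D" for h
  proof -
    have "?f h = ?f (\<Sum>b\<in>Basis. (h \<bullet> b) *\<^sub>R b)" by (simp add: euclidean_representation)
    also have "\<dots> = (\<Sum>b\<in>Basis. (h \<bullet> b) * ?f b)" by (simp add: linear_sum[OF lin] linear_cmul[OF lin])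
    finally show ?thesis by (simp add: D_def inner_sum_right mult.commute)
  qed
  then have GD: "GDERIV g z :> D" using f unfolding gderiv_def by (metis (no_types, lifting) ext)
  have "gradient g z = D"
    unfolding gradient_def
  proof (rule the_equality)
    show "GDERIV g z :> D" by (rule GD)
  next
    fix E assume "GDERIV g z :> E"
    then have "(\<lambda>h. h \<bullet> E) = (\<lambda>h. h \<bullet> D)"
      using GD unfolding gderiv_def by (rule has_derivative_unique)
    then show "E = D" using vector_eq_ldot by metis
  qed
  then show ?thesis using fD[of e] by simp
qed

lemma off_0: "UNIV - {0} = - {0::'a::euclidean_space}" "open (- {0::'a})" by auto

text \<open>At 0 the gradient is an unspecified value, but a single exceptional point does not
  affect Borel measurability.\<close>

lemma gradient_regular:
  fixes g :: "'a::euclidean_space \<Rightarrow> real"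
  assumes g: "C_infinity_on (- {0}) g" and e: "e \<in> Basis"
  defines "D \<equiv> (\<lambda>z. e \<bullet> gradient g z)"
  shows "\<And>z. z \<noteq> 0 \<Longrightarrow> D z = pd e g z" "continuous_on (- {0}) D" "D \<in> borel_measurable borel"
proof -
  show eq: "D z = pd e g z" if "z \<noteq> 0" for z
    unfolding D_def by (rule gradient_inner, rule C_infinity_onD[OF g]) (use that in simp)
  show c: "continuous_on (- {0}) D"
    by (rule continuous_on_eq[OF C_infinity_on_continuous[OF C_infinity_on_pd[OF g e]]]) (use eq in auto)
  show "D \<in> borel_measurable borel"
    by (rule borel_measurable_continuous_countable_exceptions[OF _ c]) simp
qed

text \<open>By symmetry two different values of g occur on the ray through e, so the mean value
  theorem finds a point p of the ray with nonzero derivative along e. The gradient is odd, hence the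
  values at p and -p do not cancel in the difference.\<close>

lemma radial_gradient_dipole:
  fixes g :: "'a::euclidean_space \<Rightarrow> real"
  assumes g: "C_infinity_on (- {0}) g" and rad: "radially_symmetric g" and nc: "nonconstant_potential g"
    and e: "e \<in> Basis"
  obtains p where "p \<noteq> 0" "e \<bullet> gradient g p - e \<bullet> gradient g (- p) \<noteq> 0"
proof -
  have diff: "g differentiable (at z)" if "z \<noteq> 0" for z using C_infinity_onD[OF g] that by simp
  obtain x y where xy: "x \<noteq> 0" "y \<noteq> 0" "g x \<noteq> g y" "norm x < norm y"
  proof -
    obtain x y where "x \<noteq> 0" "y \<noteq> 0" "g x \<noteq> g y" using nc unfolding nonconstant_potential_def by blast
    moreover from this have "norm x \<noteq> norm y" using rad unfolding radially_symmetric_def by blast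
    ultimately show thesis using that by (metis linorder_neqE_linordered_idom)
  qed
  have pos: "0 < norm x" using xy(1) by simp
  have ray: "g (norm z *\<^sub>R e) = g z" if "z \<noteq> 0" for z
    by (rule rad[unfolded radially_symmetric_def, rule_format]) (use that e in auto)
  have der: "((\<lambda>t. g (0 + t *\<^sub>R e)) has_real_derivative pd e g (0 + t *\<^sub>R e)) (at t)" if "t > 0" for t
    by (rule line_has_real_derivative, rule diff) (use that e in auto)
  have "\<exists>t. norm x < t \<and> t < norm y \<and>
      g (0 + norm y *\<^sub>R e) - g (0 + norm x *\<^sub>R e) = (norm y - norm x) * pd e g (0 + t *\<^sub>R e)"
    by (rule MVT2[OF xy(4), of "\<lambda>t. g (0 + t *\<^sub>R e)" "\<lambda>t. pd e g (0 + t *\<^sub>R e)"]) (rule der, use pos in linarith)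
  then obtain t where t: "norm x < t" "t < norm y"
    and eq: "g (0 + norm y *\<^sub>R e) - g (0 + norm x *\<^sub>R e) = (norm y - norm x) * pd e g (0 + t *\<^sub>R e)"
    by blast
  define p where "p = t *\<^sub>R e"
  have p: "p \<noteq> 0" using t pos e by (auto simp: p_def)
  have nz: "pd e g p \<noteq> 0"
    by (rule notI) (use eq ray[OF xy(1)] ray[OF xy(2)] xy(3) in \<open>simp add: p_def\<close>)
  have "pd e g p = - pd e g (- p)"
  proof -
    let ?f = "frechet_derivative g (at (- p))"
    have f: "(g has_derivative ?f) (at (- p))" using diff[of "- p"] p by (simp add: frechet_derivative_works)
    have refl: "((\<lambda>x. g (- x)) has_derivative (\<lambda>h. ?f (- h))) (at p)"
      by (rule has_derivative_compose[OF has_derivative_minus[OF has_derivative_ident] f])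
    have "(g has_derivative (\<lambda>h. ?f (- h))) (at p)"
    proof (rule has_derivative_transform_within_open[OF refl off_0(2)])
      show "p \<in> - {0}" using p by simp
      show "g (- x) = g x" if "x \<in> - {0}" for x
        by (rule rad[unfolded radially_symmetric_def, rule_format]) (use that in simp)
    qed
    then have "pd e g p = ?f (- e)" by (rule pd_eqI)
    also have "\<dots> = - ?f e" by (rule linear_neg[OF has_derivative_linear[OF f]])
    finally show ?thesis .
  qed
  moreover have "e \<bullet> gradient g p = pd e g p" "e \<bullet> gradient g (- p) = pd e g (- p)"
    using p by (intro gradient_inner diff; simp)+
  ultimately have "e \<bullet> gradient g p - e \<bullet> gradient g (- p) = 2 * pd e g p" by linarith
  then have "e \<bullet> gradient g p - e \<bullet> gradient g (- p) \<noteq> 0" using nz by simp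
  with p show thesis by (rule that)
qed

section \<open>Perturbation of the data\<close>

lemma schwartz_add_scaled:
  assumes f: "schwartz f" and h: "schwartz h"
  shows "schwartz (\<lambda>x. f x + l * h x)"
proof -
  have cf: "C_infinity_on UNIV f" and ch: "C_infinity_on UNIV h" using f h unfolding schwartz_def by auto
  have it: "iter_partial es (\<lambda>x. f x + l * h x) = (\<lambda>x. iter_partial es f x + l * iter_partial es h x)"
    if "set es \<subseteq> Basis" for es
    using that
  proof (induction es)
    case (Cons e es)
    have "pd e (\<lambda>x. iter_partial es f x + l * iter_partial es h x) x = pd e (iter_partial es f) x + l * pd e (iter_partial es h) x" for x
    proof (rule pd_eqI[where f' = "\<lambda>k. frechet_derivative (iter_partial es f) (at x) k + l * frechet_derivative (iter_partial es h) (at x) k"])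
      have "iter_partial es f differentiable (at x)" "iter_partial es h differentiable (at x)"
        using cf ch Cons.prems unfolding C_infinity_on_def by auto
      then show "((\<lambda>x. iter_partial es f x + l * iter_partial es h x) has_derivative
          (\<lambda>k. frechet_derivative (iter_partial es f) (at x) k + l * frechet_derivative (iter_partial es h) (at x) k)) (at x)"
        by (intro has_derivative_add has_derivative_mult_right) (simp_all add: frechet_derivative_works)
    qed
    then show ?case using Cons by simp
  qed simp
  show ?thesis
    unfolding schwartz_def
  proof (intro conjI allI impI)
    show "C_infinity_on UNIV (\<lambda>x. f x + l * h x)" by (intro C_infinity_on_add C_infinity_on_mult cf ch) auto
    fix k es assume es: "set es \<subseteq> (Basis :: 'a set)"
    have "bounded (range (\<lambda>x. norm x ^ k * iter_partial es f x))" "bounded (range (\<lambda>x. norm x ^ k * iter_partial es h x))"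
      using f h es unfolding schwartz_def by auto
    then obtain A B where A: "\<And>x. norm (norm x ^ k * iter_partial es f x) \<le> A" and B: "\<And>x. norm (norm x ^ k * iter_partial es h x) \<le> B"
      unfolding bounded_iff by auto
    have "norm (norm x ^ k * iter_partial es (\<lambda>x. f x + l * h x) x) \<le> A + \<bar>l\<bar> * B" for x
    proof -
      have "norm x ^ k * iter_partial es (\<lambda>x. f x + l * h x) x = norm x ^ k * iter_partial es f x + l * (norm x ^ k * iter_partial es h x)"
        by (simp add: it[OF es] algebra_simps)
      also have "norm (norm x ^ k * iter_partial es f x + l * (norm x ^ k * iter_partial es h x)) \<le>
          norm (norm x ^ k * iter_partial es f x) + \<bar>l\<bar> * norm (norm x ^ k * iter_partial es h x)"
        using norm_triangle_ineq[of "norm x ^ k * iter_partial es f x" "l * (norm x ^ k * iter_partial es h x)"]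
        by (simp add: abs_mult)
      finally show ?thesis using A[of x] mult_left_mono[OF B[of x], of "\<bar>l\<bar>"] by linarith
    qed
    then show "bounded (range (\<lambda>x. norm x ^ k * iter_partial es (\<lambda>x. f x + l * h x) x))"
      unfolding bounded_iff by blast
  qed
qed

lemma zero_mean_schwartz_add_scaled:
  assumes "zero_mean_schwartz f" "zero_mean_schwartz h" "rapid f" "rapid h"
  shows "zero_mean_schwartz (\<lambda>x. f x + l * h x)"
  using assms schwartz_add_scaled[of f h l] rapid_integrable[OF assms(3)] rapid_integrable[OF assms(4)]
  by (simp add: zero_mean_schwartz_def)

text \<open>Insert l = - c / (q + 1); the added 1 covers q = 0. In the application, as with
  Cauchy-Schwarz, a function of zero energy has vanishing cross terms with every other one.\<close>

lemma nonneg_quadratic_imp_linear_0: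
  fixes c q :: real
  assumes "\<And>l. 0 \<le> l * c + l\<^sup>2 * q" "0 \<le> q"
  shows "c = 0"
proof (rule ccontr)
  assume "c \<noteq> 0"
  have "(- c / (q + 1)) * c + (- c / (q + 1))\<^sup>2 * q = - (c\<^sup>2 / (q + 1)\<^sup>2)"
    using assms(2) by (simp add: power2_eq_square divide_simps) (simp add: algebra_simps)
  moreover have "c\<^sup>2 / (q + 1)\<^sup>2 > 0" using \<open>c \<noteq> 0\<close> assms(2) by simp
  ultimately show False using assms(1)[of "- c / (q + 1)"] by linarith
qed

subsection \<open>Blow-up for admissible potentials\<close>

text \<open>The energy may vanish on all wave packets (for \<open>g x = - |x|\<^sup>2\<close> the function \<open>G\<close> is \<open>0\<close>), so \<open>f\<close> and
  \<open>h\<close> are perturbed by a multiple of a fixed function of positive energy.\<close>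

theorem (in wave_packets) admissible_blowup:
  fixes g G :: "'a \<Rightarrow> real"
  assumes adm: "admissible g G" and nc: "nonconstant_potential g" and dec: "super_polynomial_decay G" and t: "t > 0"
    and decay: "\<And>r. r > 0 \<Longrightarrow> \<exists>m. (\<forall>\<^sub>F n in sequentially. \<forall>\<xi>. norm \<xi> \<ge> t * (real n - r) \<longrightarrow> \<bar>G \<xi>\<bar> \<le> m n) \<and>
      (\<lambda>n. real n powr (\<kappa> * DIM('a)) * sqrt (m n) / S (real n *\<^sub>R e)) \<longlonglongrightarrow> 0"
    and M: "M > 0"
  shows "\<exists>v w f h. C_infinity_on UNIV v \<and> zero_mean_schwartz f \<and> zero_mean_schwartz h \<and>
    fourier_multiplier \<sigma> v w \<and> in_Lp 1 w \<and>
    \<bar>commutator_form g v f h\<bar> / (Lp_norm 1 w * potential_norm (dilate t g) f * potential_norm (dilate t g) h) \<ge> M"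
proof -
  have gs: "C_infinity_on (- {0}) g" and rad: "radially_symmetric g" and cpd: "cond_positive_definite g"
    and ft: "has_fourier_transform g G" using adm unfolding admissible_def off_0 by auto
  note g = has_fourier_transform_tempered[OF ft]
  have gcont: "isCont g z" if "z \<noteq> 0" for z
    using C_infinity_on_continuous[OF gs] that by (simp add: continuous_on_eq_continuous_at off_0)
  let ?P = "regular_part g G"
  have gP: "g z = ?P z" if "z \<noteq> 0" for z by (rule eq_regular_part[OF ft dec gcont[OF that]])
  obtain C N where C: "C > 0" "\<And>x y. norm y \<le> 1 \<Longrightarrow> \<bar>?P (x + y) - ?P x\<bar> \<le> C * norm y * (1 + norm x) ^ N"
    using regular_part_lipschitz[OF ft dec] by blast
  define D where "D = (\<lambda>z. e \<bullet> gradient g z)"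
  have Dz: "D z = pd e g z" if "z \<noteq> 0" for z using gradient_regular(1)[OF gs e that] by (simp add: D_def)
  have Dc: "continuous_on (- {0}) D" and Dm: "D \<in> borel_measurable borel"
    using gradient_regular(2,3)[OF gs e] by (simp_all add: D_def)
  \<comment> \<open>D is a limit of difference quotients of g, and these inherit the weighted
    Lipschitz bound of the regular part as soon as the shifted point avoids 0 as well.\<close>
  have Dt: "tempered D"
  proof (rule tempered_poly_bound[OF Dm])
    fix z :: 'a assume z: "z \<noteq> 0"
    have lim: "(\<lambda>n. (g (z + (1 / real (Suc n)) *\<^sub>R e) - g z) / (1 / real (Suc n))) \<longlonglongrightarrow> D z"
      unfolding Dz[OF z] by (rule difference_quotient_limit, rule C_infinity_onD[OF gs]) (use z in simp)
    have "(\<lambda>n. z + (1 / real (Suc n)) *\<^sub>R e) \<longlonglongrightarrow> z + 0 *\<^sub>R e"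
      by (intro tendsto_intros inverse_Suc_tendsto)
    then have "\<forall>\<^sub>F n in sequentially. z + (1 / real (Suc n)) *\<^sub>R e \<noteq> 0"
      using z by (intro tendsto_imp_eventually_ne) auto
    then have "\<forall>\<^sub>F n in sequentially. \<bar>(g (z + (1 / real (Suc n)) *\<^sub>R e) - g z) / (1 / real (Suc n))\<bar> \<le> C * (1 + norm z) ^ N"
    proof eventually_elim
      case (elim n)
      let ?h = "1 / real (Suc n)"
      have "norm (?h *\<^sub>R e) \<le> 1" by (simp add: field_simps)
      from C(2)[OF this, of z] have "\<bar>g (z + ?h *\<^sub>R e) - g z\<bar> \<le> C * ?h * (1 + norm z) ^ N"
        using gP[OF elim] gP[OF z] by simp
      then have "\<bar>g (z + ?h *\<^sub>R e) - g z\<bar> \<le> C * (1 + norm z) ^ N * ?h" by (simp only: mult_ac)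
      then show ?case
        by (subst abs_divide) (simp only: abs_of_pos[OF inverse_Suc_pos] pos_divide_le_eq[OF inverse_Suc_pos])
    qed
    then show "\<bar>D z\<bar> \<le> C * (1 + norm z) ^ N"
      using tendsto_upperbound[OF tendsto_rabs[OF lim]] by simp
  qed
  obtain p where p: "p \<noteq> 0" "D p - D (- p) \<noteq> 0" using radial_gradient_dipole[OF gs rad nc e] unfolding D_def by blast
  have Dcont: "isCont D z" if "z \<noteq> 0" for z
    using Dc that by (simp add: continuous_on_eq_continuous_at off_0)
  have "\<forall>\<^sub>F j in sequentially. pairing D (rift (bump 0 (real (Suc j)))) (dipole (real (Suc j)) p) \<noteq> 0"
    using tendsto_imp_eventually_ne[OF pairing_dipole_limit[OF Dt Dcont Dcont, of p] p(2)] p(1) by simp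
  then obtain j1 where j1: "pairing D (rift (bump 0 (real (Suc j1)))) (dipole (real (Suc j1)) p) \<noteq> 0"
    unfolding eventually_sequentially by blast
  define r where "r = real (Suc j1)"
  have r: "r > 0" by (simp add: r_def)
  define \<phi> where "\<phi> = rift (bump (0::'a) r)"
  define h1 where "h1 = dipole r p"
  have h1: "pairing D \<phi> h1 \<noteq> 0" using j1 by (simp add: \<phi>_def h1_def r_def)
  have \<phi>: "rapid \<phi>" unfolding \<phi>_def by (rule rift_rapid[OF tf_bump[OF r]])
  define Q where "Q f = pairing (dilate t g) f f" for f
  note gt = tempered_dilate[OF g t]
  have Q0: "0 \<le> Q f" if "rapid f" "zero_mean_schwartz f" for f
    unfolding Q_def by (rule cond_positive_definite_pairing[OF cpd g t that(1)]) (use that(2) in \<open>simp add: zero_mean_schwartz_def\<close>)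
  \<comment> \<open>A nonconstant g differs somewhere from the central value of its continuous
    extension. Such a point determines the spacing of a dipole whose energies have a nonzero limit
    as its profile sharpens.\<close>
  obtain h0 where h0: "rapid h0" "zero_mean_schwartz h0" "\<And>x. isCont h0 x" "Q h0 > 0"
  proof -
    let ?L = "?P 0"
    obtain x where x: "x \<noteq> 0" "g x \<noteq> ?L" using nc unfolding nonconstant_potential_def by metis
    define u where "u = dilate t (g(0 := ?L))"
    \<comment> \<open>The spacing 2q equals t x, and there the dilated potential takes the value
      \<open>g x\<close>.\<close>
    define q where "q = (t / 2) *\<^sub>R x"
    have q2: "2 *\<^sub>R q = t *\<^sub>R x" by (simp add: q_def)
    have eqg: "(g(0 := ?L)) z = ?P z" for z using gP by simp
    have Pc: "isCont ?P z" for z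
    proof -
      have n0: "((\<lambda>y::'a. norm y) \<longlongrightarrow> norm (0::'a)) (at 0)" by (rule tendsto_norm[OF tendsto_ident_at])
      have "((\<lambda>y::'a. C * norm y * (1 + norm z) ^ N) \<longlongrightarrow> C * norm (0::'a) * (1 + norm z) ^ N) (at 0)"
        by (intro tendsto_mult tendsto_const n0)
      then have z0: "((\<lambda>y. C * norm y * (1 + norm z) ^ N) \<longlongrightarrow> 0) (at (0::'a))" by simp
      have "\<forall>\<^sub>F y in at (0::'a). norm (?P (z + y) - ?P z) \<le> C * norm y * (1 + norm z) ^ N"
        unfolding eventually_at by (rule exI[of _ 1]) (use C(2) in \<open>auto simp: dist_norm\<close>)
      from Lim_null_comparison[OF this z0] show ?thesis
        unfolding isCont_iff by (rule LIM_zero_cancel)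
    qed
    have uP: "u = (\<lambda>z. ?P (z /\<^sub>R t))" by (rule ext) (simp only: u_def dilate_def eqg)
    have uc: "isCont u z" for z unfolding uP by (intro isCont_o2[OF _ Pc] continuous_intros)
    have ut: "tempered u"
      unfolding u_def by (intro tempered_dilate t tempered_cong_off_0[OF g]) simp
    have ug: "u z = dilate t g z" if "z \<noteq> 0" for z using that t by (simp add: u_def dilate_def)
    have "g (- x) = g x" by (rule rad[unfolded radially_symmetric_def, rule_format]) (use x in simp)
    then have "u (2 *\<^sub>R q) = g x" "u (- (2 *\<^sub>R q)) = g x"
      using t x unfolding q2 u_def dilate_def by auto
    moreover have "u 0 = ?L" by (simp add: u_def dilate_def)
    ultimately have "(\<lambda>j. pairing u (dipole (real (Suc j)) q) (dipole (real (Suc j)) q)) \<longlonglongrightarrow> 2 * ?L - g x - g x"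
      using pairing_dipole_dipole_limit[OF ut uc uc uc, of q] by simp
    moreover have "2 * ?L - g x - g x \<noteq> 0" using x by simp
    ultimately have "\<forall>\<^sub>F j in sequentially. pairing u (dipole (real (Suc j)) q) (dipole (real (Suc j)) q) \<noteq> 0"
      by (rule tendsto_imp_eventually_ne)
    then obtain j where j: "pairing u (dipole (real (Suc j)) q) (dipole (real (Suc j)) q) \<noteq> 0"
      unfolding eventually_sequentially by blast
    have rp: "0 < real (Suc j)" by simp
    have "pairing u (dipole (real (Suc j)) q) (dipole (real (Suc j)) q) = Q (dipole (real (Suc j)) q)"
      unfolding Q_def by (rule pairing_cong_off_0[OF gt ug dipole_rapid[OF rp] dipole_rapid[OF rp]])
    then have "Q (dipole (real (Suc j)) q) > 0"
      using j Q0[OF dipole_rapid[OF rp] zero_mean_schwartz_dipole[OF rp], of q] by linarith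
    then show thesis
      by (rule that[OF dipole_rapid[OF rp] zero_mean_schwartz_dipole[OF rp] dipole_continuous[OF rp]])
  qed
  \<comment> \<open>The energy is a nonnegative quadratic form, so Q f = 0 kills the cross terms and
    only the energy of \<open>h0\<close> remains.\<close>
  have perturb: "Q (\<lambda>x. f x + l * h0 x) = l\<^sup>2 * Q h0" if f: "rapid f" "zero_mean_schwartz f" "Q f = 0" for f l
  proof -
    have "0 \<le> l * (pairing (dilate t g) f h0 + pairing (dilate t g) h0 f) + l\<^sup>2 * Q h0" for l
      using Q0[of "\<lambda>x. f x + l * h0 x"] zero_mean_schwartz_add_scaled[OF f(2) h0(2) f(1) h0(1), of l]
        rapid_add[OF f(1) rapid_cmult[OF h0(1), of l]] pairing_quadratic[OF gt f(1) h0(1), of l] f(3)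
      by (simp add: Q_def)
    from nonneg_quadratic_imp_linear_0[OF this] h0(4)
    show ?thesis unfolding Q_def pairing_quadratic[OF gt f(1) h0(1)] using f(3) by (simp add: Q_def)
  qed
  have h1r: "rapid h1" "zero_mean_schwartz h1" "\<And>x. isCont h1 x"
    unfolding h1_def by (rule dipole_rapid[OF r] zero_mean_schwartz_dipole[OF r] dipole_continuous[OF r])+
  obtain h where h: "rapid h" "zero_mean_schwartz h" "\<And>x. isCont h x" "Q h > 0" "pairing D \<phi> h \<noteq> 0"
  proof (cases "Q h1 = 0")
    case False
    then show thesis using that[OF h1r] Q0[OF h1r(1,2)] h1 by simp
  next
    case True
    \<comment> \<open>At least one of l = 1 and l = 2 works: if both sums vanished, the pairing with
      \<open>h1\<close> would vanish.\<close>
    have "\<exists>l. l \<noteq> 0 \<and> pairing D \<phi> h1 + l * pairing D \<phi> h0 \<noteq> 0"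
    proof (cases "pairing D \<phi> h1 + 1 * pairing D \<phi> h0 = 0")
      case True
      then have "pairing D \<phi> h1 + 2 * pairing D \<phi> h0 = - pairing D \<phi> h1" by linarith
      then show ?thesis using h1 by (intro exI[of _ 2]) simp
    qed (intro exI[of _ 1], simp)
    then obtain l where l: "l \<noteq> 0" "pairing D \<phi> h1 + l * pairing D \<phi> h0 \<noteq> 0" by blast
    show thesis
    proof (rule that[of "\<lambda>x. h1 x + l * h0 x"])
      show "rapid (\<lambda>x. h1 x + l * h0 x)" by (intro rapid_add rapid_cmult h1r h0)
      show "zero_mean_schwartz (\<lambda>x. h1 x + l * h0 x)" by (rule zero_mean_schwartz_add_scaled[OF h1r(2) h0(2) h1r(1) h0(1)])
      show "isCont (\<lambda>x. h1 x + l * h0 x) x" for x by (intro continuous_intros h1r h0)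
      show "Q (\<lambda>x. h1 x + l * h0 x) > 0" unfolding perturb[OF h1r(1,2) True] using l(1) h0(4) by simp
      show "pairing D \<phi> (\<lambda>x. h1 x + l * h0 x) \<noteq> 0" unfolding pairing_linear[OF Dt h1r(1) h0(1) \<phi>] by (rule l(2))
    qed
  qed
  define f where "f n = rift (bump (real n *\<^sub>R e) r)" for n
  have fr: "rapid (f n)" for n unfolding f_def by (rule rift_rapid[OF tf_bump[OF r]])
  have fz: "zero_mean_schwartz (f n)" if "real n > r" for n
    unfolding f_def by (rule zero_mean_schwartz_rift[OF tf_bump[OF r]], rule bump_eq_0[OF r]) (use that in simp)
  define L where "L = \<bar>bump_mass TYPE('a) / 2 * pairing D \<phi> h\<bar>"
  have L: "L > 0" using bump_mass_pos[where 'a = 'a] h(5) by (simp add: L_def)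
  have lim: "(\<lambda>n. \<bar>comm D (v n) (f n) h / S (real n *\<^sub>R e)\<bar>) \<longlonglongrightarrow> L"
    unfolding L_def f_def \<phi>_def by (intro tendsto_rabs packet_comm_limit Dt Dc r h)
  define W where "W n = Lp_norm 1 (\<lambda>x. w n x *\<^sub>R e)" for n
  define A where "A = (\<integral>x. \<bar>rift (bump 0 1) x\<bar> powr 1 \<partial>(lborel :: 'a measure))"
  define b where "b = (\<integral>\<xi>. bump (0::'a) r \<xi> \<partial>lborel)"
  obtain m where m: "\<forall>\<^sub>F n in sequentially. \<forall>\<xi>. norm \<xi> \<ge> t * (real n - r) \<longrightarrow> \<bar>G \<xi>\<bar> \<le> m n"
    "(\<lambda>n. real n powr (\<kappa> * DIM('a)) * sqrt (m n) / S (real n *\<^sub>R e)) \<longlonglongrightarrow> 0" using decay[OF r] by blast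
  have a0: "(\<lambda>n. (A * sqrt (t ^ DIM('a) * b) * sqrt (Q h) * M) * (real n powr (\<kappa> * DIM('a)) * sqrt (m n) / S (real n *\<^sub>R e))) \<longlonglongrightarrow> 0"
    by (rule tendsto_mult_right_zero[OF m(2)])
  \<comment> \<open>Half of the limit serves as the margin: for large n the form divided by the
    amplitude stays above L / 2, and the product of the norms and M divided by the amplitude stays
    below it.\<close>
  have L2: "L / 2 < L" "0 < L / 2" using L by simp_all
  have "\<forall>\<^sub>F n in sequentially. n \<ge> n0 \<and> real n > r \<and> \<bar>comm D (v n) (f n) h / S (real n *\<^sub>R e)\<bar> > L / 2 \<and>
      W n * sqrt (Q (f n)) * sqrt (Q h) * M / S (real n *\<^sub>R e) < L / 2"
    using eventually_ge_at_top[of n0] eventually_gt_at_top[of "nat \<lceil>r\<rceil>"] order_tendstoD(1)[OF lim L2(1)]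
      order_tendstoD(2)[OF a0 L2(2)] m(1)
  proof (eventually_elim, goal_cases)
    case (1 n)
    then have n: "n \<ge> n0" and rn: "real n > r" by linarith+
    have Qf: "Q (f n) \<le> m n * t ^ DIM('a) * b"
      unfolding Q_def f_def b_def by (rule packet_energy_le[OF ft t r]) (use 1 rn in auto)
    have WA: "W n \<le> real n powr (\<kappa> * DIM('a)) * A"
    proof -
      have "A \<ge> 0" by (simp add: A_def)
      then show ?thesis using w_Lp(3)[OF n, of 1] by (simp add: W_def A_def)
    qed
    have "sqrt (Q (f n)) \<le> sqrt (m n) * sqrt (t ^ DIM('a) * b)"
      using real_sqrt_le_mono[OF Qf] by (simp add: real_sqrt_mult mult.assoc)
    then have "W n * sqrt (Q (f n)) \<le> (real n powr (\<kappa> * DIM('a)) * A) * (sqrt (m n) * sqrt (t ^ DIM('a) * b))"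
      using WA w_Lp(2)[OF n, of 1] Q0[OF fr fz[OF rn]] by (intro mult_mono) (auto simp: W_def A_def)
    then have "W n * sqrt (Q (f n)) * (sqrt (Q h) * M / S (real n *\<^sub>R e)) \<le>
        (real n powr (\<kappa> * DIM('a)) * A) * (sqrt (m n) * sqrt (t ^ DIM('a) * b)) * (sqrt (Q h) * M / S (real n *\<^sub>R e))"
      using h(4) M Sn_pos[OF n] by (intro mult_right_mono) auto
    also have "\<dots> = (A * sqrt (t ^ DIM('a) * b) * sqrt (Q h) * M) * (real n powr (\<kappa> * DIM('a)) * sqrt (m n) / S (real n *\<^sub>R e))"
      by simp
    finally have le: "W n * sqrt (Q (f n)) * (sqrt (Q h) * M / S (real n *\<^sub>R e)) \<le> \<dots>" .
    have eq: "W n * sqrt (Q (f n)) * sqrt (Q h) * M / S (real n *\<^sub>R e) =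
        W n * sqrt (Q (f n)) * (sqrt (Q h) * M / S (real n *\<^sub>R e))" by simp
    show ?case unfolding eq using n rn 1(3) le_less_trans[OF le 1(4)] by blast
  qed
  then obtain n where n: "n \<ge> n0" and rn: "real n > r" and big: "\<bar>comm D (v n) (f n) h / S (real n *\<^sub>R e)\<bar> > L / 2"
    and small: "W n * sqrt (Q (f n)) * sqrt (Q h) * M / S (real n *\<^sub>R e) < L / 2"
    unfolding eventually_sequentially by blast
  have Sp: "S (real n *\<^sub>R e) > 0" by (rule Sn_pos[OF n])
  have Wp: "W n > 0" unfolding W_def by (rule w_Lp(2)[OF n]) simp
  let ?c = "\<bar>comm D (v n) (f n) h\<bar>"
  have cpos: "?c > 0" using big L by auto
  have ge: "W n * sqrt (Q (f n)) * sqrt (Q h) * M \<le> ?c"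
  proof -
    have "W n * sqrt (Q (f n)) * sqrt (Q h) * M / S (real n *\<^sub>R e) \<le> ?c / S (real n *\<^sub>R e)"
    proof -
      have "?c / S (real n *\<^sub>R e) = \<bar>comm D (v n) (f n) h / S (real n *\<^sub>R e)\<bar>" using Sp by (simp add: abs_divide)
      then show ?thesis using big small by linarith
    qed
    then show ?thesis using Sp by (simp add: divide_le_cancel)
  qed
  have "\<exists>k. rapid k \<and> zero_mean_schwartz k \<and> Q k > 0 \<and> W n * sqrt (Q k) * sqrt (Q h) * M \<le> \<bar>comm D (v n) k h\<bar>"
  proof (cases "Q (f n) = 0")
    case False
    then show ?thesis using ge fr[of n] fz[OF rn] Q0[OF fr[of n] fz[OF rn]] by (intro exI[of _ "f n"]) auto
  next
    case True
    have vr: "rapid (v n)" unfolding v_def by (rule rift_rapid[OF tf_Vh[OF n]])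
    obtain B where B: "\<And>x. \<bar>v n x\<bar> \<le> B" using rapid_bounded[OF vr] by (metis real_norm_def)
    let ?d = "\<bar>comm D (v n) h0 h\<bar>" and ?E = "W n * sqrt (Q h0) * sqrt (Q h) * M"
    have E: "?E > 0" using Wp h0(4) h(4) M by simp
    \<comment> \<open>Both the possible loss \<open>l * ?d\<close> in the form and the new
      requirement \<open>l * ?E\<close> are linear in l; this choice keeps their sum below
      \<open>?c\<close>.\<close>
    define l where "l = ?c / (?d + ?E + 1)"
    have l: "l > 0" using cpos E by (simp add: l_def add_nonneg_pos)
    have le: "l * ?d + l * ?E \<le> ?c"
    proof -
      have "l * (?d + ?E + 1) = ?c" using E unfolding l_def by (simp add: add_nonneg_pos)
      then show ?thesis using l by (simp add: algebra_simps)
    qed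
    let ?k = "\<lambda>x. f n x + l * h0 x"
    have Qk: "Q ?k = l\<^sup>2 * Q h0" by (rule perturb[OF fr fz[OF rn] True])
    have "comm D (v n) ?k h = comm D (v n) (f n) h + l * comm D (v n) h0 h"
      by (rule comm_linear[OF Dt fr h0(1) h(1) rapid_measurable[OF vr] B])
    then have "?c - l * ?d \<le> \<bar>comm D (v n) ?k h\<bar>"
      using abs_triangle_ineq2[of "comm D (v n) (f n) h" "- (l * comm D (v n) h0 h)"] l by (simp add: abs_mult)
    moreover have "W n * sqrt (Q ?k) * sqrt (Q h) * M = l * ?E"
      unfolding Qk using l by (simp add: real_sqrt_mult)
    ultimately have "W n * sqrt (Q ?k) * sqrt (Q h) * M \<le> \<bar>comm D (v n) ?k h\<bar>" using le by linarith
    moreover have "Q ?k > 0" unfolding Qk using l h0(4) by simp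
    ultimately show ?thesis
      using rapid_add[OF fr rapid_cmult[OF h0(1)], of n l] zero_mean_schwartz_add_scaled[OF fz[OF rn] h0(2) fr h0(1), of l]
      by blast
  qed
  then obtain k where k: "rapid k" "zero_mean_schwartz k" "Q k > 0" "W n * sqrt (Q k) * sqrt (Q h) * M \<le> \<bar>comm D (v n) k h\<bar>"
    by blast
  have "M \<le> \<bar>comm D (v n) k h\<bar> / (W n * sqrt (Q k) * sqrt (Q h))"
    using k(3,4) Wp h(4) by (simp add: pos_le_divide_eq mult.commute)
  then have "\<bar>commutator_form g (\<lambda>x. v n x *\<^sub>R e) k h\<bar> /
      (Lp_norm 1 (\<lambda>x. w n x *\<^sub>R e) * potential_norm (dilate t g) k * potential_norm (dilate t g) h) \<ge> M"
    by (simp add: commutator_form_scaleR potential_norm_eq Q_def W_def D_def)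
  moreover have "in_Lp 1 (\<lambda>x. w n x *\<^sub>R e)" by (rule w_Lp(1)[OF n]) simp
  ultimately show ?thesis using v_smooth[OF n] v_multiplier[OF n] k(2) h(2) by blast
qed


subsection \<open>Radial symbols\<close>

text \<open>By the mean value theorem the exponent \<psi> varies over a packet by at most a constant
  times n to the power q - \<kappa>. As q < \<kappa> this tends to 0, which gives both ratio
  conditions.\<close>

lemma radial_wave_packets:
  fixes \<sigma> S :: "'a::euclidean_space \<Rightarrow> real" and \<psi> \<psi>' :: "real \<Rightarrow> real"
  assumes e: "e \<in> Basis" and q: "0 \<le> q" "q < \<kappa>" and C: "C \<ge> 0"
    and der: "\<And>\<rho>. \<rho> \<ge> 1 \<Longrightarrow> (\<psi> has_real_derivative \<psi>' \<rho>) (at \<rho>)"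
    and bd: "\<And>\<rho>. \<rho> \<ge> 1 \<Longrightarrow> \<bar>\<psi>' \<rho>\<bar> \<le> C * \<rho> powr q"
    and S: "\<And>\<xi>. S \<xi> = exp (- \<psi> (norm \<xi>))" and smooth: "C_infinity_on (- {0}) S"
    and \<sigma>: "\<And>\<xi>. \<xi> \<noteq> 0 \<Longrightarrow> \<sigma> \<xi> = exp (\<psi> (norm \<xi>))"
    and loc: "\<And>\<psi>. tf \<psi> \<Longrightarrow> integrable lborel (\<lambda>\<xi>. \<sigma> \<xi> * \<psi> \<xi>)"
  shows "\<exists>n0. wave_packets \<sigma> S \<kappa> e n0"
proof -
  \<comment> \<open>The factor \<open>2 powr q\<close> accounts for radii up to 2n within the
    packet.\<close>
  define E where "E n = C * 2 powr q * real n powr (q - \<kappa>)" for n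
  have E0: "E \<longlonglongrightarrow> 0"
    unfolding E_def using q
    by (intro tendsto_mult_right_zero tendsto_neg_powr filterlim_real_sequentially) simp
  have est: "\<bar>\<psi> (norm (real n *\<^sub>R e + real n powr (- \<kappa>) *\<^sub>R \<zeta>)) - \<psi> (real n)\<bar> \<le> E n"
    if n: "n \<ge> 2" and z: "norm \<zeta> \<le> 1" for n \<zeta>
  proof -
    let ?d = "real n powr (- \<kappa>)"
    let ?s = "norm (real n *\<^sub>R e + ?d *\<^sub>R \<zeta>)"
    have d: "0 < ?d" "?d \<le> 1" using n q by (auto simp: powr_minus intro!: inverse_le_1_iff[THEN iffD2] ge_one_powr_ge_zero)
    have dz: "norm (?d *\<^sub>R \<zeta>) \<le> ?d" using d z by (simp add: mult_left_le)
    have ne: "norm (real n *\<^sub>R e) = real n" using e by simp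
    have s: "\<bar>?s - real n\<bar> \<le> ?d"
      using norm_triangle_ineq[of "real n *\<^sub>R e" "?d *\<^sub>R \<zeta>"] norm_triangle_ineq2[of "real n *\<^sub>R e" "- (?d *\<^sub>R \<zeta>)"] dz
      unfolding ne norm_minus_cancel by (simp only: abs_le_iff minus_diff_eq diff_minus_eq_add) linarith
    have range: "1 \<le> ?s" "?s \<le> 2 * real n" "1 \<le> real n" using s d(2) n by (auto simp: abs_le_iff)
    have mvt: "\<bar>\<psi> b - \<psi> a\<bar> \<le> (b - a) * (C * (2 * real n) powr q)" if ab: "a < b" "1 \<le> a" "b \<le> 2 * real n" for a b
    proof -
      have "\<exists>z. a < z \<and> z < b \<and> \<psi> b - \<psi> a = (b - a) * \<psi>' z"
        by (rule MVT2[OF ab(1)]) (rule der, use ab in linarith)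
      then obtain z where zz: "a < z" "z < b" and eq: "\<psi> b - \<psi> a = (b - a) * \<psi>' z" by blast
      have "\<bar>\<psi>' z\<bar> \<le> C * z powr q" by (rule bd) (use zz ab in linarith)
      also have "\<dots> \<le> C * (2 * real n) powr q" using zz ab q C by (intro mult_left_mono powr_mono2) auto
      finally show ?thesis unfolding eq abs_mult using ab(1) by (intro mult_mono) auto
    qed
    have "\<bar>\<psi> ?s - \<psi> (real n)\<bar> \<le> \<bar>?s - real n\<bar> * (C * (2 * real n) powr q)"
    proof (cases "?s" "real n" rule: linorder_cases)
      case less
      from mvt[OF less range(1)] show ?thesis using less by (simp add: abs_minus_commute)
    next
      case greater
      from mvt[OF greater range(3) range(2)] show ?thesis using greater by simp
    qed (use C in simp)
    also have "\<dots> \<le> ?d * (C * (2 * real n) powr q)" using s C by (intro mult_right_mono) auto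
    also have "\<dots> = E n" by (simp add: E_def powr_mult powr_diff powr_minus divide_inverse)
    finally show ?thesis .
  qed
  have ratio: "S (real n *\<^sub>R e + real n powr (- \<kappa>) *\<^sub>R \<zeta>) / S (real n *\<^sub>R e) =
      exp (- (\<psi> (norm (real n *\<^sub>R e + real n powr (- \<kappa>) *\<^sub>R \<zeta>)) - \<psi> (real n)))" for n \<zeta>
    using e by (simp add: S exp_diff[symmetric])
  have "\<forall>\<^sub>F n in sequentially. E n < ln 2" using E0 by (rule order_tendstoD) simp
  \<comment> \<open>A variation of the exponent by ln 2 corresponds to the factor 2 in
    \<open>ratio_bound\<close>.\<close>
  then obtain N where N: "\<And>n. n \<ge> N \<Longrightarrow> E n < ln 2" unfolding eventually_sequentially by blast
  have "wave_packets \<sigma> S \<kappa> e (max 2 N)"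
  proof
    show "e \<in> Basis" "C_infinity_on (- {0}) S" by fact+
    show "\<kappa> > 0" using q by linarith
    show "max 2 N \<ge> 2" by simp
    show "\<sigma> \<xi> * S \<xi> = 1" if "\<xi> \<noteq> 0" for \<xi> using \<sigma>[OF that] by (simp add: S exp_minus)
    show "S \<xi> > 0" for \<xi> by (simp add: S)
    show "S (- \<xi>) = S \<xi>" for \<xi> by (simp add: S)
    show "integrable lborel (\<lambda>\<xi>. \<sigma> \<xi> * \<psi> \<xi>)" if "tf \<psi>" for \<psi> by (rule loc[OF that])
    show "(\<lambda>n. S (real n *\<^sub>R e + real n powr (- \<kappa>) *\<^sub>R \<zeta>) / S (real n *\<^sub>R e)) \<longlonglongrightarrow> 1" if z: "norm \<zeta> \<le> 1" for \<zeta>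
    proof -
      have "(\<lambda>n. \<psi> (norm (real n *\<^sub>R e + real n powr (- \<kappa>) *\<^sub>R \<zeta>)) - \<psi> (real n)) \<longlonglongrightarrow> 0"
        by (rule Lim_null_comparison[OF _ E0], rule eventually_mono[OF eventually_ge_at_top[of 2]])
          (use est z in simp)
      then have "(\<lambda>n. exp (- (\<psi> (norm (real n *\<^sub>R e + real n powr (- \<kappa>) *\<^sub>R \<zeta>)) - \<psi> (real n)))) \<longlonglongrightarrow> exp (- 0)"
        by (intro tendsto_intros)
      then show ?thesis unfolding ratio by simp
    qed
    show "S (real n *\<^sub>R e + real n powr (- \<kappa>) *\<^sub>R \<zeta>) \<le> 2 * S (real n *\<^sub>R e)" if n: "n \<ge> max 2 N" and z: "norm \<zeta> \<le> 1" for n \<zeta>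
    proof -
      have "- (\<psi> (norm (real n *\<^sub>R e + real n powr (- \<kappa>) *\<^sub>R \<zeta>)) - \<psi> (real n)) \<le> ln 2"
        using est[OF _ z, of n] N[of n] n by (simp add: abs_le_iff)
      then have "exp (- (\<psi> (norm (real n *\<^sub>R e + real n powr (- \<kappa>) *\<^sub>R \<zeta>)) - \<psi> (real n))) \<le> exp (ln 2)"
        by (simp only: exp_le_cancel_iff)
      then have "S (real n *\<^sub>R e + real n powr (- \<kappa>) *\<^sub>R \<zeta>) / S (real n *\<^sub>R e) \<le> 2"
        unfolding ratio by simp
      moreover have "S (real n *\<^sub>R e) > 0" by (simp add: S)
      ultimately show ?thesis by (simp add: pos_divide_le_eq)
    qed
  qed
  then show ?thesis by blast
qed

lemma continuous_symbol_loc: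
  fixes \<sigma> \<psi> :: "'a::euclidean_space \<Rightarrow> real"
  assumes \<sigma>: "continuous_on UNIV \<sigma>" and \<psi>: "tf \<psi>"
  shows "integrable lborel (\<lambda>\<xi>. \<sigma> \<xi> * \<psi> \<xi>)"
proof -
  obtain r where r: "\<And>x. norm x \<ge> r \<Longrightarrow> \<psi> x = 0" using tf_support[OF \<psi>] by blast
  have "compact (\<sigma> ` cball 0 r)" by (intro compact_continuous_image continuous_on_subset[OF \<sigma>]) auto
  from compact_imp_bounded[OF this] obtain B where B: "\<And>x. x \<in> cball 0 r \<Longrightarrow> norm (\<sigma> x) \<le> B"
    unfolding bounded_iff by blast
  note [measurable] = borel_measurable_continuous_onI[OF \<sigma>] tf_measurable[OF \<psi>]
  show ?thesis
  proof (rule Bochner_Integration.integrable_bound[OF integrable_mult_right[OF tf_integrable[OF \<psi>], of B]])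
    have "norm (\<sigma> \<xi> * \<psi> \<xi>) \<le> norm (B * \<psi> \<xi>)" for \<xi>
    proof (cases "norm \<xi> \<le> r")
      case True
      then have "\<bar>\<sigma> \<xi>\<bar> \<le> \<bar>B\<bar>" using B[of \<xi>] by simp
      from mult_right_mono[OF this, of "\<bar>\<psi> \<xi>\<bar>"] show ?thesis by (simp add: abs_mult)
    qed (use r[of \<xi>] in simp)
    then show "AE \<xi> in lborel. norm (\<sigma> \<xi> * \<psi> \<xi>) \<le> norm (B * \<psi> \<xi>)" by simp
  qed measurable
qed

lemma C_infinity_on_norm_powr:
  "C_infinity_on (- {0}) (\<lambda>\<xi>::'a::euclidean_space. norm \<xi> powr p)"
proof -
  have "C_infinity_on (- {0}) (\<lambda>\<xi>::'a. ((norm (\<xi> - 0))\<^sup>2) powr (p / 2))"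
    by (intro C_infinity_on_powr C_infinity_on_norm_sq) auto
  moreover have "((norm (\<xi> - 0))\<^sup>2) powr (p / 2) = norm \<xi> powr p" if "\<xi> \<in> - {0}" for \<xi> :: 'a
    using that powr_powr[of "norm \<xi>" 2 "p / 2"] by (simp add: powr_numeral)
  ultimately show ?thesis
    using C_infinity_on_cong[of "- {0::'a}" "\<lambda>\<xi>. ((norm (\<xi> - 0))\<^sup>2) powr (p / 2)" "\<lambda>\<xi>. norm \<xi> powr p"] by auto
qed

text \<open>The logarithm of the symbol has a bounded derivative, so q = 0, and a packet of width
  1/n is narrow enough.\<close>

lemma bessel_wave_packets:
  fixes k :: real
  assumes e: "(e::'a::euclidean_space) \<in> Basis" and k: "k > 0"
  defines "S \<equiv> (\<lambda>\<xi>::'a. exp (- (k / 2 * ln (1 + (2 * pi * norm \<xi>)\<^sup>2))))"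
  shows "\<exists>n0. wave_packets (bessel_symbol k) S 1 e n0"
proof (rule radial_wave_packets[OF e order_refl zero_less_one, where C = k and \<psi> = "\<lambda>\<rho>. k / 2 * ln (1 + (2 * pi * \<rho>)\<^sup>2)"
      and \<psi>' = "\<lambda>\<rho>. k / 2 * ((8 * pi\<^sup>2 * \<rho>) / (1 + (2 * pi * \<rho>)\<^sup>2))"])
  have pos: "1 + (2 * pi * \<rho>)\<^sup>2 > 0" for \<rho> by (simp add: add_pos_nonneg)
  show "k \<ge> 0" using k by simp
  show "((\<lambda>\<rho>. k / 2 * ln (1 + (2 * pi * \<rho>)\<^sup>2)) has_real_derivative k / 2 * ((8 * pi\<^sup>2 * \<rho>) / (1 + (2 * pi * \<rho>)\<^sup>2))) (at \<rho>)" for \<rho>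
  proof -
    have "((\<lambda>\<rho>. 1 + (2 * pi * \<rho>)\<^sup>2) has_real_derivative 8 * pi\<^sup>2 * \<rho>) (at \<rho>)"
      by (auto intro!: derivative_eq_intros simp: power2_eq_square)
    from DERIV_cmult[OF DERIV_chain2[OF DERIV_ln_divide[OF pos] this], of "k / 2"] show ?thesis by simp
  qed
  show "\<bar>k / 2 * ((8 * pi\<^sup>2 * \<rho>) / (1 + (2 * pi * \<rho>)\<^sup>2))\<bar> \<le> k * \<rho> powr 0" if r: "\<rho> \<ge> 1" for \<rho> :: real
  proof -
    have "4 * pi\<^sup>2 * \<rho> \<le> 4 * pi\<^sup>2 * (\<rho> * \<rho>)" using r by (intro mult_left_mono) auto
    also have "\<dots> \<le> 1 + (2 * pi * \<rho>)\<^sup>2" by (simp add: power2_eq_square)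
    finally have "4 * pi\<^sup>2 * \<rho> \<le> 1 + (2 * pi * \<rho>)\<^sup>2" .
    then have "(8 * pi\<^sup>2 * \<rho>) / (1 + (2 * pi * \<rho>)\<^sup>2) \<le> 2" using pos[of \<rho>] by (simp add: pos_divide_le_eq)
    from mult_left_mono[OF this, of "k / 2"] k r pos[of \<rho>] show ?thesis
      by (simp add: abs_mult abs_divide)
  qed
  show "S \<xi> = exp (- (k / 2 * ln (1 + (2 * pi * norm \<xi>)\<^sup>2)))" for \<xi> by (simp add: S_def)
  show "bessel_symbol k \<xi> = exp (k / 2 * ln (1 + (2 * pi * norm \<xi>)\<^sup>2))" for \<xi> :: 'a
    using pos[of "norm \<xi>"] by (simp add: bessel_symbol_def powr_powr) (simp add: powr_def)
  show "C_infinity_on (- {0}) S"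
  proof -
    have "C_infinity_on (- {0}) (\<lambda>\<xi>::'a. (1 + (2 * pi)\<^sup>2 * (norm (\<xi> - 0))\<^sup>2) powr (- (k / 2)))"
      by (intro C_infinity_on_powr C_infinity_on_add C_infinity_on_mult C_infinity_on_norm_sq) (auto simp: add_pos_nonneg)
    moreover have "(1 + (2 * pi)\<^sup>2 * (norm (\<xi> - 0))\<^sup>2) powr (- (k / 2)) = S \<xi>" for \<xi> :: 'a
      using pos[of "norm \<xi>"] by (simp add: S_def powr_def power_mult_distrib)
    ultimately show ?thesis by simp
  qed
  show "integrable lborel (\<lambda>\<xi>. bessel_symbol k \<xi> * \<psi> \<xi>)" if "tf \<psi>" for \<psi> :: "'a \<Rightarrow> real"
  proof (rule continuous_symbol_loc[OF _ that])
    show "continuous_on UNIV (bessel_symbol k :: 'a \<Rightarrow> real)"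
      unfolding bessel_symbol_def by (intro continuous_intros) (auto simp: add_nonneg_eq_0_iff)
  qed
qed

text \<open>The exponent has derivative of order \<rho>^(m - 1), so q is m - 1 for m \<ge> 1 and 0
  otherwise; either value lies below \<kappa> = m. The constant b may be negative, hence the
  absolute value in C.\<close>

lemma exp_wave_packets:
  fixes b m :: real
  assumes e: "(e::'a::euclidean_space) \<in> Basis" and m: "m > 0"
  defines "S \<equiv> (\<lambda>\<xi>::'a. exp (- (b * norm \<xi> powr m)))"
  shows "\<exists>n0. wave_packets (exp_symbol b m) S m e n0"
proof (rule radial_wave_packets[OF e, where C = "\<bar>b * m\<bar>" and q = "max 0 (m - 1)" and \<psi> = "\<lambda>\<rho>. b * \<rho> powr m"
      and \<psi>' = "\<lambda>\<rho>. b * (m * \<rho> powr (m - 1))"])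
  show "0 \<le> max 0 (m - 1)" "max 0 (m - 1) < m" using m by auto
  show "((\<lambda>\<rho>. b * \<rho> powr m) has_real_derivative b * (m * \<rho> powr (m - 1))) (at \<rho>)" if "\<rho> \<ge> 1" for \<rho>
    using that by (auto intro!: derivative_eq_intros)
  show "\<bar>b * (m * \<rho> powr (m - 1))\<bar> \<le> \<bar>b * m\<bar> * \<rho> powr max 0 (m - 1)" if "\<rho> \<ge> 1" for \<rho> :: real
    using powr_mono[of "m - 1" "max 0 (m - 1)" \<rho>] that by (simp add: abs_mult mult.assoc mult_left_mono)
  show "C_infinity_on (- {0}) S"
  proof -
    have "C_infinity_on (- {0}) (\<lambda>\<xi>::'a. exp (- b * norm \<xi> powr m))"
      by (intro C_infinity_on_exp C_infinity_on_mult C_infinity_on_norm_powr) auto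
    then show ?thesis by (simp add: S_def)
  qed
  show "integrable lborel (\<lambda>\<xi>. exp_symbol b m \<xi> * \<psi> \<xi>)" if "tf \<psi>" for \<psi> :: "'a \<Rightarrow> real"
  proof (rule continuous_symbol_loc[OF _ that])
    show "continuous_on UNIV (exp_symbol b m :: 'a \<Rightarrow> real)"
      unfolding exp_symbol_def using m by (intro continuous_on_powr' continuous_intros) auto
  qed
qed (auto simp: S_def exp_symbol_def)

lemma riesz_wave_packets:
  fixes k \<kappa> :: real
  assumes e: "(e::'a::euclidean_space) \<in> Basis" and k: "k > 0" and \<kappa>: "\<kappa> > 0"
  defines "S \<equiv> (\<lambda>\<xi>::'a. exp (- (k * ln (2 * pi * norm \<xi>))))"
  shows "\<exists>n0. wave_packets (riesz_symbol k) S \<kappa> e n0"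
proof (rule radial_wave_packets[OF e order_refl \<kappa>, where C = k and \<psi> = "\<lambda>\<rho>. k * ln (2 * pi * \<rho>)" and \<psi>' = "\<lambda>\<rho>. k / \<rho>"])
  show "k \<ge> 0" using k by simp
  show "((\<lambda>\<rho>. k * ln (2 * pi * \<rho>)) has_real_derivative k / \<rho>) (at \<rho>)" if "\<rho> \<ge> 1" for \<rho>
    using that by (auto intro!: derivative_eq_intros)
  show "\<bar>k / \<rho>\<bar> \<le> k * \<rho> powr 0" if "\<rho> \<ge> 1" for \<rho> :: real
    using that k by (simp add: pos_divide_le_eq)
  show "riesz_symbol k \<xi> = exp (k * ln (2 * pi * norm \<xi>))" if "\<xi> \<noteq> 0" for \<xi> :: 'a
    using that by (simp add: riesz_symbol_def powr_def)
  show "C_infinity_on (- {0}) S"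
  proof -
    have "C_infinity_on (- {0}) (\<lambda>\<xi>::'a. (2 * pi) powr (- k) * norm \<xi> powr (- k))"
      by (intro C_infinity_on_mult C_infinity_on_norm_powr) auto
    moreover have "(2 * pi) powr (- k) * norm \<xi> powr (- k) = S \<xi>" if "\<xi> \<in> - {0}" for \<xi> :: 'a
      using that by (simp add: S_def powr_def ln_mult exp_add[symmetric] algebra_simps)
    ultimately show ?thesis
      using C_infinity_on_cong[of "- {0::'a}" "\<lambda>\<xi>. (2 * pi) powr (- k) * norm \<xi> powr (- k)" S] by auto
  qed
  show "integrable lborel (\<lambda>\<xi>. riesz_symbol k \<xi> * \<psi> \<xi>)" if "tf \<psi>" for \<psi> :: "'a \<Rightarrow> real"
  proof (rule continuous_symbol_loc[OF _ that])
    show "continuous_on UNIV (riesz_symbol k :: 'a \<Rightarrow> real)"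
      unfolding riesz_symbol_def using k by (intro continuous_on_powr' continuous_intros) auto
  qed
qed (auto simp: S_def)


subsection \<open>Rapidly decaying transforms\<close>

theorem super_polynomial_blowup:
  fixes g G :: "'a::euclidean_space \<Rightarrow> real"
  assumes adm: "admissible g G" and nc: "nonconstant_potential g" and dec: "super_polynomial_decay G"
    and k: "k > 0" and M: "M > 0" and t: "t > 0"
  shows "\<exists>v w f h. C_infinity_on UNIV v \<and> zero_mean_schwartz f \<and> zero_mean_schwartz h \<and>
    fourier_multiplier (bessel_symbol k) v w \<and> in_Lp 1 w \<and>
    \<bar>commutator_form g v f h\<bar> / (Lp_norm 1 w * potential_norm (dilate t g) f * potential_norm (dilate t g) h) \<ge> M"
proof -
  obtain e :: 'a where e: "e \<in> Basis" using nonempty_Basis by blast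
  define S where "S = (\<lambda>\<xi>::'a. exp (- (k / 2 * ln (1 + (2 * pi * norm \<xi>)\<^sup>2))))"
  obtain n0 where wp: "wave_packets (bessel_symbol k) S 1 e n0"
    using bessel_wave_packets[OF e k] unfolding S_def by blast
  define d where "d = real DIM('a)"
  \<comment> \<open>The square root in the energy norm halves the decay to d + k + 1: d powers
    cancel the growth of the L^1 norm of \<open>w\<close>, k powers that of the symbol, and one is
    left over.\<close>
  define K where "K = 2 * (d + k + 1)"
  have K: "K \<ge> 0" using k by (simp add: K_def d_def)
  obtain C where C: "\<And>\<xi>. \<xi> \<noteq> 0 \<Longrightarrow> \<bar>G \<xi>\<bar> \<le> C * norm \<xi> powr (- K)"
    using dec K unfolding super_polynomial_decay_def by blast
  have decay: "\<exists>m. (\<forall>\<^sub>F n in sequentially. \<forall>\<xi>. norm \<xi> \<ge> t * (real n - r) \<longrightarrow> \<bar>G \<xi>\<bar> \<le> m n) \<and>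
      (\<lambda>n. real n powr (1 * real DIM('a)) * sqrt (m n) / S (real n *\<^sub>R e)) \<longlonglongrightarrow> 0" if r: "r > 0" for r
  proof (intro exI conjI)
    let ?m = "\<lambda>n. \<bar>C\<bar> * (t * (real n - r)) powr (- K)"
    show "\<forall>\<^sub>F n in sequentially. \<forall>\<xi>. norm \<xi> \<ge> t * (real n - r) \<longrightarrow> \<bar>G \<xi>\<bar> \<le> ?m n"
      using eventually_gt_at_top[of "nat \<lceil>r\<rceil>"]
    proof eventually_elim
      case (elim n)
      then have p: "t * (real n - r) > 0" using t by (intro mult_pos_pos) linarith+
      show ?case
      proof (intro allI impI)
        fix \<xi> :: 'a assume x: "t * (real n - r) \<le> norm \<xi>"
        have "\<bar>G \<xi>\<bar> \<le> C * norm \<xi> powr (- K)" by (rule C) (use x p in auto)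
        also have "\<dots> \<le> \<bar>C\<bar> * norm \<xi> powr (- K)" by (intro mult_right_mono) auto
        also have "\<dots> \<le> ?m n" using x p K by (intro mult_left_mono powr_mono2') auto
        finally show "\<bar>G \<xi>\<bar> \<le> ?m n" .
      qed
    qed
    let ?A = "sqrt \<bar>C\<bar> * (t / 2) powr (- (d + k + 1)) * (1 + 4 * pi\<^sup>2) powr (k / 2)"
    show "(\<lambda>n. real n powr (1 * real DIM('a)) * sqrt (?m n) / S (real n *\<^sub>R e)) \<longlonglongrightarrow> 0"
    proof (rule Lim_null_comparison)
      show "(\<lambda>n. ?A * (1 / real n)) \<longlonglongrightarrow> 0" by (intro tendsto_mult_right_zero lim_1_over_n)
      show "\<forall>\<^sub>F n in sequentially. norm (real n powr (1 * real DIM('a)) * sqrt (?m n) / S (real n *\<^sub>R e)) \<le> ?A * (1 / real n)"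
        using eventually_gt_at_top[of "nat \<lceil>2 * r\<rceil>"]
      proof eventually_elim
        case (elim n)
        then have n: "real n > 2 * r" by linarith
        then have n1: "real n \<ge> 1" using r by (cases n) auto
        have "sqrt (?m n) = sqrt \<bar>C\<bar> * (t * (real n - r)) powr (- (d + k + 1))"
        proof -
          have "sqrt ((t * (real n - r)) powr (- K)) = ((t * (real n - r)) powr (- K)) powr (1 / 2)"
            by (simp add: powr_half_sqrt)
          also have "\<dots> = (t * (real n - r)) powr (- K * (1 / 2))" by (rule powr_powr)
          also have "- K * (1 / 2) = - (d + k + 1)" by (simp add: K_def)
          finally show ?thesis by (simp add: real_sqrt_mult)
        qed
        also have "\<dots> \<le> sqrt \<bar>C\<bar> * (t / 2 * real n) powr (- (d + k + 1))"
          using n r t k by (intro mult_left_mono powr_mono2') (auto simp: d_def)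
        also have "\<dots> = sqrt \<bar>C\<bar> * (t / 2) powr (- (d + k + 1)) * real n powr (- (d + k + 1))"
          by (subst powr_mult) (use t n1 in \<open>simp_all add: mult.assoc\<close>)
        finally have 1: "sqrt (?m n) \<le> sqrt \<bar>C\<bar> * (t / 2) powr (- (d + k + 1)) * real n powr (- (d + k + 1))" .
        have "inverse (S (real n *\<^sub>R e)) = (1 + (2 * pi * real n)\<^sup>2) powr (k / 2)"
          using e n1 by (simp add: S_def exp_minus powr_def add_pos_nonneg[THEN less_imp_neq, symmetric] add_nonneg_eq_0_iff)
        also have "\<dots> \<le> ((1 + 4 * pi\<^sup>2) * (real n)\<^sup>2) powr (k / 2)"
          using n1 k by (intro powr_mono2) (auto simp: algebra_simps power_mult_distrib)
        also have "\<dots> = (1 + 4 * pi\<^sup>2) powr (k / 2) * real n powr k"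
          using n1 powr_powr[of "real n" 2 "k / 2"] by (simp add: powr_mult powr_numeral add_nonneg_nonneg)
        finally have 2: "inverse (S (real n *\<^sub>R e)) \<le> (1 + 4 * pi\<^sup>2) powr (k / 2) * real n powr k" .
        have S0: "inverse (S (real n *\<^sub>R e)) \<ge> 0" by (simp add: S_def)
        have "norm (real n powr (1 * real DIM('a)) * sqrt (?m n) / S (real n *\<^sub>R e)) =
            real n powr d * (sqrt (?m n) * inverse (S (real n *\<^sub>R e)))"
          using S0 by (simp add: divide_inverse d_def abs_mult mult.assoc)
        also have "\<dots> \<le> real n powr d * ((sqrt \<bar>C\<bar> * (t / 2) powr (- (d + k + 1)) * real n powr (- (d + k + 1))) *
            ((1 + 4 * pi\<^sup>2) powr (k / 2) * real n powr k))"
          using S0 by (intro mult_left_mono mult_mono 1 2) auto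
        also have "\<dots> = ?A * (real n powr d * real n powr (- (d + k + 1)) * real n powr k)" by (simp only: mult_ac)
        also have "real n powr d * real n powr (- (d + k + 1)) * real n powr k = 1 / real n"
          using n1 by (simp add: powr_add[symmetric] powr_minus_divide)
        finally show ?case .
      qed
    qed
  qed
  show ?thesis by (rule wave_packets.admissible_blowup[OF wp adm nc dec t decay M])
qed

lemma exponential_decay_imp_super_polynomial:
  fixes G :: "'a::euclidean_space \<Rightarrow> real"
  assumes c: "c > 0" and m: "m > 0" and G: "exponential_decay c m G"
  shows "super_polynomial_decay G"
  unfolding super_polynomial_decay_def
proof (intro allI impI)
  fix n :: real assume n: "n \<ge> 0"
  obtain C where C: "\<And>\<xi>. \<xi> \<noteq> 0 \<Longrightarrow> \<bar>G \<xi>\<bar> \<le> C * exp (- (c * norm \<xi> powr m))"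
    using G unfolding exponential_decay_def by blast
  \<comment> \<open>The estimate used is ln y \<le> y / a + ln a - 1 for y = |\<xi>|^m. This a makes
    the coefficient n / (m a) at most c, and the added 1 keeps it positive for n = 0.\<close>
  define a where "a = (n / m + 1) / c"
  have a: "a > 0" using n m c by (simp add: a_def add_nonneg_pos)
  define B where "B = n / m * (ln a - 1)"
  have "\<bar>G \<xi>\<bar> \<le> \<bar>C\<bar> * exp B * norm \<xi> powr (- n)" if \<xi>: "\<xi> \<noteq> 0" for \<xi>
  proof -
    let ?y = "norm \<xi> powr m"
    have y: "?y > 0" using \<xi> by simp
    have "ln (?y / a) \<le> ?y / a - 1" using y a by (intro ln_le_minus_one) simp
    then have "ln ?y \<le> ?y / a + (ln a - 1)" using y a by (simp add: ln_div)
    from mult_left_mono[OF this, of "n / m"] have "n / m * ln ?y \<le> n / m * (?y / a) + B"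
      using n m by (simp add: B_def distrib_left)
    moreover have "n / m * (?y / a) \<le> c * ?y"
    proof -
      have "n / m / a \<le> c" using c n m by (simp add: a_def field_simps)
      from mult_right_mono[OF this, of ?y] show ?thesis by simp
    qed
    moreover have "n / m * ln ?y = n * ln (norm \<xi>)" using \<xi> m by (simp add: ln_powr)
    ultimately have "- (c * ?y) \<le> B + - n * ln (norm \<xi>)" by simp
    then have "exp (- (c * ?y)) \<le> exp (B + - n * ln (norm \<xi>))" by (simp only: exp_le_cancel_iff)
    also have "\<dots> = exp B * norm \<xi> powr (- n)" using \<xi> by (simp only: exp_add powr_def norm_eq_zero if_False)
    finally have e: "exp (- (c * ?y)) \<le> exp B * norm \<xi> powr (- n)" .
    have "\<bar>G \<xi>\<bar> \<le> C * exp (- (c * ?y))" by (rule C[OF \<xi>])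
    also have "\<dots> \<le> \<bar>C\<bar> * exp (- (c * ?y))" by (intro mult_right_mono) auto
    also have "\<dots> \<le> \<bar>C\<bar> * (exp B * norm \<xi> powr (- n))" by (intro mult_left_mono e) simp
    finally show ?thesis by (simp only: mult.assoc)
  qed
  then show "\<exists>C. \<forall>\<xi>. \<xi> \<noteq> 0 \<longrightarrow> \<bar>G \<xi>\<bar> \<le> C * norm \<xi> powr (- n)" by blast
qed

theorem exponential_blowup:
  fixes g G :: "'a::euclidean_space \<Rightarrow> real"
  assumes adm: "admissible g G" and nc: "nonconstant_potential g" and c: "c > 0" and m: "m > 0"
    and dec: "exponential_decay c m G" and t: "t > 0" and b: "b < c * t powr m / 2" and M: "M > 0"
  shows "\<exists>v w f h. C_infinity_on UNIV v \<and> zero_mean_schwartz f \<and> zero_mean_schwartz h \<and>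
    fourier_multiplier (exp_symbol b m) v w \<and> in_Lp 1 w \<and>
    \<bar>commutator_form g v f h\<bar> / (Lp_norm 1 w * potential_norm (dilate t g) f * potential_norm (dilate t g) h) \<ge> M"
proof -
  obtain e :: 'a where e: "e \<in> Basis" using nonempty_Basis by blast
  define S where "S = (\<lambda>\<xi>::'a. exp (- (b * norm \<xi> powr m)))"
  obtain n0 where wp: "wave_packets (exp_symbol b m) S m e n0"
    using exp_wave_packets[OF e m] unfolding S_def by blast
  define d where "d = real DIM('a)"
  obtain C where C: "\<And>\<xi>. \<xi> \<noteq> 0 \<Longrightarrow> \<bar>G \<xi>\<bar> \<le> C * exp (- (c * norm \<xi> powr m))"
    using dec unfolding exponential_decay_def by blast
  have decay: "\<exists>A. (\<forall>\<^sub>F n in sequentially. \<forall>\<xi>. norm \<xi> \<ge> t * (real n - r) \<longrightarrow> \<bar>G \<xi>\<bar> \<le> A n) \<and>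
      (\<lambda>n. real n powr (m * DIM('a)) * sqrt (A n) / S (real n *\<^sub>R e)) \<longlonglongrightarrow> 0" if r: "r > 0" for r
  proof (intro exI conjI)
    let ?A = "\<lambda>n. \<bar>C\<bar> * exp (- (c * (t * (real n - r)) powr m))"
    show "\<forall>\<^sub>F n in sequentially. \<forall>\<xi>. norm \<xi> \<ge> t * (real n - r) \<longrightarrow> \<bar>G \<xi>\<bar> \<le> ?A n"
      using eventually_gt_at_top[of "nat \<lceil>r\<rceil>"]
    proof eventually_elim
      case (elim n)
      then have p: "t * (real n - r) > 0" using t by (intro mult_pos_pos) linarith+
      show ?case
      proof (intro allI impI)
        fix \<xi> :: 'a assume x: "t * (real n - r) \<le> norm \<xi>"
        have "(t * (real n - r)) powr m \<le> norm \<xi> powr m" using x p m by (intro powr_mono2) auto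
        then have le: "exp (- (c * norm \<xi> powr m)) \<le> exp (- (c * (t * (real n - r)) powr m))" using c by simp
        have "\<bar>G \<xi>\<bar> \<le> C * exp (- (c * norm \<xi> powr m))" by (rule C) (use x p in auto)
        also have "\<dots> \<le> \<bar>C\<bar> * exp (- (c * norm \<xi> powr m))" by (intro mult_right_mono) auto
        also have "\<dots> \<le> ?A n" by (intro mult_left_mono le) simp
        finally show "\<bar>G \<xi>\<bar> \<le> ?A n" .
      qed
    qed
    \<comment> \<open>Up to a constant factor the sequence is the exponential of \<open>?L n\<close>
      times n^m. The factor tends to b - c t^m / 2 < 0; the polynomial growth of the norm of
      \<open>w\<close> enters only through ln n / n^m.\<close>
    let ?L = "\<lambda>n. (m * d) * (ln (real n) / real n powr m) - c * t powr m / 2 * ((real n - r) / real n) powr m + b"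
    have "(\<lambda>n. ln (real n) / real n powr m) \<longlonglongrightarrow> 0" using m by real_asymp
    moreover have "(\<lambda>n. (real n - r) / real n) \<longlonglongrightarrow> 1" by real_asymp
    then have "(\<lambda>n. ((real n - r) / real n) powr m) \<longlonglongrightarrow> 1 powr m" by (intro tendsto_powr tendsto_const) auto
    ultimately have "?L \<longlonglongrightarrow> (m * d) * 0 - c * t powr m / 2 * 1 powr m + b"
      by (intro tendsto_add tendsto_diff tendsto_mult tendsto_const)
    then have L: "?L \<longlonglongrightarrow> b - c * t powr m / 2" by simp
    have "filterlim (\<lambda>n. real n powr m) at_top sequentially" using m by real_asymp
    from filterlim_tendsto_neg_mult_at_bot[OF L _ this]
    have "filterlim (\<lambda>n. ?L n * real n powr m) at_bot sequentially" using b by simp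
    then have "(\<lambda>n. exp (?L n * real n powr m)) \<longlonglongrightarrow> 0"
      by (rule filterlim_compose[OF exp_at_bot])
    then have "(\<lambda>n. sqrt \<bar>C\<bar> * exp (?L n * real n powr m)) \<longlonglongrightarrow> 0" by (rule tendsto_mult_right_zero)
    moreover have "\<forall>\<^sub>F n in sequentially. sqrt \<bar>C\<bar> * exp (?L n * real n powr m) =
        real n powr (m * DIM('a)) * sqrt (?A n) / S (real n *\<^sub>R e)"
      using eventually_gt_at_top[of "nat \<lceil>r\<rceil>"]
    proof eventually_elim
      case (elim n)
      then have n: "real n > r" "real n > 0" using r by linarith+
      have "(t * (real n - r)) powr m = t powr m * (((real n - r) / real n) powr m * real n powr m)"
        using n t by (simp add: powr_mult powr_divide)
      then have X: "c * (t * (real n - r)) powr m / 2 = c * t powr m / 2 * ((real n - r) / real n) powr m * real n powr m" by simp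
      have 1: "sqrt (?A n) = sqrt \<bar>C\<bar> * exp (- (c * (t * (real n - r)) powr m / 2))"
        using exp_double[of "- (c * (t * (real n - r)) powr m / 2)"] by (simp add: real_sqrt_mult)
      have 2: "real n powr (m * DIM('a)) = exp (m * d * (ln (real n) / real n powr m) * real n powr m)"
        using n by (simp add: powr_def d_def)
      have 3: "1 / S (real n *\<^sub>R e) = exp (b * real n powr m)"
        using e by (simp add: S_def exp_minus divide_inverse)
      have "real n powr (m * DIM('a)) * sqrt (?A n) / S (real n *\<^sub>R e) =
          real n powr (m * DIM('a)) * sqrt (?A n) * (1 / S (real n *\<^sub>R e))" by simp
      also have "\<dots> = sqrt \<bar>C\<bar> * (exp (m * d * (ln (real n) / real n powr m) * real n powr m) *
            exp (- (c * (t * (real n - r)) powr m / 2)) * exp (b * real n powr m))"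
        unfolding 1 2 3 by (simp only: mult_ac)
      also have "\<dots> = sqrt \<bar>C\<bar> * exp (?L n * real n powr m)"
        unfolding X exp_add[symmetric] by (simp add: algebra_simps)
      finally show ?case by simp
    qed
    ultimately show "(\<lambda>n. real n powr (m * DIM('a)) * sqrt (?A n) / S (real n *\<^sub>R e)) \<longlonglongrightarrow> 0"
      by (rule Lim_transform_eventually)
  qed
  show ?thesis
    by (rule wave_packets.admissible_blowup[OF wp adm nc exponential_decay_imp_super_polynomial[OF c m dec] t decay M])
qed


subsection \<open>Riesz potentials\<close>

lemma C_infinity_on_ln:
  fixes f :: "'a::euclidean_space \<Rightarrow> real"
  assumes "open S" "C_infinity_on S f" "\<And>x. x \<in> S \<Longrightarrow> f x > 0"
  shows "C_infinity_on S (\<lambda>x. ln (f x))"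
proof -
  define \<phi> :: "nat \<Rightarrow> real \<Rightarrow> real" where
    "\<phi> k y = (case k of 0 \<Rightarrow> ln y | Suc j \<Rightarrow> (\<Prod>i<j. - 1 - real i) * y powr (- 1 - real j))" for k y
  have "C_infinity_on S (\<lambda>x. \<phi> 0 (f x))"
  proof (rule C_infinity_on_compose_real[where T = "{0<..}" and \<phi> = \<phi>])
    fix k and y :: real assume "y \<in> {0<..}"
    then show "(\<phi> k has_real_derivative \<phi> (Suc k) y) (at y)"
      unfolding \<phi>_def
      by (cases k) (auto intro!: derivative_eq_intros simp: powr_minus_divide algebra_simps)
  qed (use assms in auto)
  then show ?thesis by (simp add: \<phi>_def)
qed

lemma riesz_potential_smooth: "C_infinity_on (- {0}) (riesz_potential s :: 'a::euclidean_space \<Rightarrow> real)"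
proof (cases "s = 0")
  case True
  have "C_infinity_on (- {0}) (\<lambda>\<xi>::'a. - (1 / 2) * ln ((norm (\<xi> - 0))\<^sup>2))"
    by (intro C_infinity_on_mult C_infinity_on_ln C_infinity_on_norm_sq) auto
  then show ?thesis
    using C_infinity_on_cong[of "- {0::'a}" "\<lambda>\<xi>. - (1 / 2) * ln ((norm (\<xi> - 0))\<^sup>2)" "riesz_potential s"] True
    by (auto simp: riesz_potential_def ln_realpow)
next
  case False
  have "C_infinity_on (- {0}) (\<lambda>\<xi>::'a. 1 / s * norm \<xi> powr (- s))"
    by (intro C_infinity_on_mult C_infinity_on_norm_powr) auto
  moreover have "riesz_potential s = (\<lambda>\<xi>::'a. 1 / s * norm \<xi> powr (- s))"
    using False by (simp add: riesz_potential_def fun_eq_iff)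
  ultimately show ?thesis by simp
qed

lemma riesz_potential_radial: "radially_symmetric (riesz_potential s)"
  by (simp add: radially_symmetric_def riesz_potential_def)

lemma riesz_potential_nonconstant: "nonconstant_potential (riesz_potential s :: 'a::euclidean_space \<Rightarrow> real)"
proof -
  obtain e :: 'a where e: "e \<in> Basis" using nonempty_Basis by blast
  have "riesz_potential s e \<noteq> riesz_potential s (2 *\<^sub>R e)"
    using e by (auto simp: riesz_potential_def powr_eq_one_iff_gen)
  then show ?thesis
    unfolding nonconstant_potential_def using e by (intro exI[of _ e] exI[of _ "2 *\<^sub>R e"]) auto
qed

text \<open>The normalisation 1/s makes the radial derivative equal to - \<rho>^(-s - 1) for every
  s, the logarithm included.\<close>

lemma riesz_potential_gradient_le:
  fixes z :: "'a::euclidean_space"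
  assumes z: "z \<noteq> 0" and e: "e \<in> Basis"
  shows "\<bar>e \<bullet> gradient (riesz_potential s) z\<bar> \<le> norm z powr (- s - 1)"
proof -
  define \<phi> where "\<phi> \<rho> = (if s = 0 then - ln \<rho> else 1 / s * \<rho> powr (- s))" for \<rho> :: real
  have "(\<phi> has_real_derivative - (norm z powr (- s - 1))) (at (norm z))"
  proof (cases "s = 0")
    case True
    then show ?thesis
      unfolding \<phi>_def using z by (auto intro!: derivative_eq_intros simp: powr_minus_divide)
  next
    case False
    then show ?thesis
      unfolding \<phi>_def using DERIV_cmult[OF has_real_derivative_powr[of "norm z" "- s"], of "1 / s"] z by simp
  qed
  from GDERIV_DERIV_compose[OF GDERIV_norm[OF z] this]
  have "GDERIV (riesz_potential s) z :> - (norm z powr (- s - 1)) *\<^sub>R sgn z"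
    unfolding \<phi>_def riesz_potential_def .
  then have d: "(riesz_potential s has_derivative (\<lambda>h. h \<bullet> (- (norm z powr (- s - 1)) *\<^sub>R sgn z))) (at z)"
    by (simp add: gderiv_def)
  have "e \<bullet> gradient (riesz_potential s) z = e \<bullet> (- (norm z powr (- s - 1)) *\<^sub>R sgn z)"
    using gradient_inner[OF differentiableI[OF d], of e] pd_eqI[OF d, of e] by simp
  moreover have "\<bar>e \<bullet> sgn z\<bar> \<le> 1" using Cauchy_Schwarz_ineq2[of e "sgn z"] e z by (simp add: norm_sgn)
  ultimately show ?thesis by (simp add: abs_mult mult_left_le)
qed

text \<open>For s < -1 the bound on the gradient grows at infinity, but less than linearly as s >
  -2. For s \<ge> -1 it stays bounded at infinity and may be singular at 0, with the integrable
  exponent s + 1 < d.\<close>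

lemma riesz_gradient_tempered:
  assumes e: "(e::'a::euclidean_space) \<in> Basis" and s: "- 2 < s" "s < real DIM('a) - 2"
  shows "tempered (\<lambda>z. e \<bullet> gradient (riesz_potential s) z)"
proof -
  let ?D = "\<lambda>z. e \<bullet> gradient (riesz_potential s) z"
  note [measurable] = gradient_regular(3)[OF riesz_potential_smooth e, of s]
  note le = riesz_potential_gradient_le[OF _ e, of _ s]
  show ?thesis
  proof (cases "s + 1 \<ge> 0")
    case False
    show ?thesis
    proof (rule tempered_poly_bound[where C = 1 and N = 1])
      fix z :: 'a assume z: "z \<noteq> 0"
      have "norm z powr (- s - 1) \<le> (1 + norm z) powr (- s - 1)" using False by (intro powr_mono2) auto
      also have "\<dots> \<le> (1 + norm z) powr 1" using s(1) by (intro powr_mono) auto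
      finally show "\<bar>?D z\<bar> \<le> 1 * (1 + norm z) ^ 1" using le[OF z] by simp
    qed measurable
  next
    case True
    let ?N = "2 * DIM('a)"
    have "integrable lborel (\<lambda>z. ?D z / (1 + norm z) ^ ?N)"
    proof (rule Bochner_Integration.integrable_bound)
      show "integrable lborel (\<lambda>z::'a. indicator (cball 0 1) z * norm z powr (- (s + 1)) + 1 / (1 + norm z) ^ ?N)"
        using True s by (intro Bochner_Integration.integrable_add integrable_norm_powr_cball integrable_weight_DIM) auto
      show "AE z in lborel. norm (?D z / (1 + norm z) ^ ?N) \<le>
          norm (indicator (cball 0 1) z * norm z powr (- (s + 1)) + 1 / (1 + norm z) ^ ?N)"
        using AE_lborel_singleton[of "0::'a"]
      proof eventually_elim
        case (elim z)
        have D: "\<bar>?D z\<bar> \<le> norm z powr (- (s + 1))" using le[OF elim] by simp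
        have pos: "0 < (1 + norm z) ^ ?N" by (simp add: add_pos_nonneg)
        show ?case
        proof (cases "norm z \<le> 1")
          case True
          have "\<bar>?D z\<bar> / (1 + norm z) ^ ?N \<le> norm z powr (- (s + 1)) / 1"
            using D by (intro frac_le) auto
          moreover have "0 \<le> 1 / (1 + norm z) ^ ?N" by simp
          ultimately have "\<bar>?D z\<bar> / (1 + norm z) ^ ?N \<le> norm z powr (- (s + 1)) + 1 / (1 + norm z) ^ ?N" by linarith
          then show ?thesis using True by (simp add: abs_divide)
        next
          case False
          have "norm z powr (- (s + 1)) \<le> norm z powr 0" using False \<open>s + 1 \<ge> 0\<close> by (intro powr_mono) auto
          then have "\<bar>?D z\<bar> / (1 + norm z) ^ ?N \<le> 1 / (1 + norm z) ^ ?N"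
            using D elim pos by (intro divide_right_mono) auto
          then show ?thesis using False by (simp add: abs_divide)
        qed
      qed
    qed measurable
    then show ?thesis unfolding tempered_def by blast
  qed
qed


subsection \<open>Homogeneous Sobolev norms of the data\<close>

lemma isCont_inv_fourier:
  fixes W :: "'a::euclidean_space \<Rightarrow> complex"
  assumes W: "integrable lborel W"
  shows "isCont (inv_fourier W) x"
  unfolding continuous_at_sequentially
proof (intro allI impI)
  fix z :: "nat \<Rightarrow> 'a" assume z: "z \<longlonglongrightarrow> x"
  note [measurable] = borel_measurable_integrable[OF W, simplified]
  show "(inv_fourier W \<circ> z) \<longlonglongrightarrow> inv_fourier W x"
    unfolding inv_fourier_cis comp_def
  proof (rule integral_dominated_convergence[where w = "\<lambda>\<xi>. norm (W \<xi>)"])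
    have "(\<lambda>i. cis (2 * pi * (\<xi> \<bullet> z i)) * W \<xi>) \<longlonglongrightarrow> cis (2 * pi * (\<xi> \<bullet> x)) * W \<xi>" for \<xi>
      unfolding cis_conv_exp by (intro tendsto_intros z)
    then show "AE \<xi> in lborel. (\<lambda>i. cis (2 * pi * (\<xi> \<bullet> z i)) * W \<xi>) \<longlonglongrightarrow> cis (2 * pi * (\<xi> \<bullet> x)) * W \<xi>" by simp
  qed (use W in \<open>auto simp: norm_mult\<close>)
qed

text \<open>The L^2 bound is one-sided and does not exclude norm 0. Positivity is therefore deduced
  from a nonzero value and the continuity of the inverse transform.\<close>

lemma Lp_norm_inv_fourier:
  fixes W :: "'a::euclidean_space \<Rightarrow> complex"
  assumes W: "integrable lborel W" "integrable lborel (\<lambda>\<xi>. (norm (W \<xi>))\<^sup>2)"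
  shows "Lp_norm 2 (inv_fourier W) \<le> sqrt (\<integral>\<xi>. (norm (W \<xi>))\<^sup>2 \<partial>lborel)"
    and "inv_fourier W x \<noteq> 0 \<Longrightarrow> 0 < Lp_norm 2 (inv_fourier W)"
proof -
  note b = inv_fourier_L2_bound[OF W]
  have eq: "Lp_norm 2 (inv_fourier W) = sqrt (\<integral>x. (norm (inv_fourier W x))\<^sup>2 \<partial>lborel)"
    by (simp add: Lp_norm_def powr_half_sqrt)
  show "Lp_norm 2 (inv_fourier W) \<le> sqrt (\<integral>\<xi>. (norm (W \<xi>))\<^sup>2 \<partial>lborel)"
    unfolding eq by (rule real_sqrt_le_mono[OF b(2)])
  assume x: "inv_fourier W x \<noteq> 0"
  have "0 < (\<integral>x. (norm (inv_fourier W x))\<^sup>2 \<partial>lborel)"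
    by (rule lborel_integral_pos[OF b(1), of x]) (use x isCont_inv_fourier[OF W(1)] in \<open>auto intro!: continuous_intros\<close>)
  then show "0 < Lp_norm 2 (inv_fourier W)" unfolding eq by simp
qed

lemma riesz_symbol_measurable [measurable]: "riesz_symbol b \<in> borel_measurable borel"
  unfolding riesz_symbol_def[abs_def] by measurable

lemma riesz_symbol_nonneg: "0 \<le> riesz_symbol b \<xi>"
  by (simp add: riesz_symbol_def)

lemma isCont_riesz_symbol: "\<xi> \<noteq> 0 \<Longrightarrow> isCont (riesz_symbol b) \<xi>"
  unfolding riesz_symbol_def[abs_def] by (intro continuous_intros) auto

lemma Re_inv_fourier_real:
  assumes "integrable lborel F"
  shows "Re (inv_fourier (\<lambda>\<xi>. of_real (F \<xi>)) x) = (\<integral>\<xi>. F \<xi> * cos (2 * pi * (\<xi> \<bullet> x)) \<partial>lborel)"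
  using ift_Re[OF assms] by (simp add: ift_def)

text \<open>The frequencies of the packet have norm at least |c| - r, and the symbol decreases
  because b < 0. Positivity is read off at x = 0, where the inverse transform is the integral of a
  nonnegative function.\<close>

lemma hom_sobolev_norm_packet:
  fixes c :: "'a::euclidean_space"
  assumes r: "r > 0" and c: "norm c > r" and b: "b < 0"
  shows "hom_sobolev_norm b (rift (bump c r)) \<le> (2 * pi * (norm c - r)) powr b * sqrt (\<integral>\<xi>. bump (0::'a) r \<xi> \<partial>lborel)"
    and "0 < hom_sobolev_norm b (rift (bump c r))"
proof -
  let ?B = "symm (bump c r)" and ?m = "(2 * pi * (norm c - r)) powr b"
  let ?F = "\<lambda>\<xi>. riesz_symbol b \<xi> * ?B \<xi>"
  let ?W = "\<lambda>\<xi>. complex_of_real (?F \<xi>)"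
  note tfB = tf_symm[OF tf_bump[OF r, of c]]
  note [measurable] = tf_measurable[OF tfB] tf_measurable[OF tf_bump[OF r, of c]]
  have B01: "0 \<le> ?B \<xi>" "?B \<xi> \<le> 1" for \<xi>
    using bump_nonneg[of c r] bump_le_1[of c r \<xi>] bump_le_1[of c r "- \<xi>"] by (auto simp: symm_def)
  have F_le: "?F \<xi> \<le> ?m * ?B \<xi>" for \<xi>
  proof (cases "norm \<xi> \<ge> norm c - r")
    case True
    have "riesz_symbol b \<xi> \<le> ?m"
      unfolding riesz_symbol_def using True c b by (intro powr_mono2') auto
    then show ?thesis using B01 by (intro mult_right_mono) auto
  next
    case False
    have "norm (\<xi> - c) \<ge> r" "norm (- \<xi> - c) \<ge> r"
      using False norm_triangle_ineq2[of c \<xi>] norm_triangle_ineq2[of c "- \<xi>"] by (auto simp: norm_minus_commute)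
    then have "bump c r \<xi> = 0" "bump c r (- \<xi>) = 0" by (auto intro: bump_eq_0[OF r])
    then show ?thesis by (simp add: symm_def)
  qed
  have F0: "0 \<le> ?F \<xi>" for \<xi> by (intro mult_nonneg_nonneg riesz_symbol_nonneg B01)
  have iB: "integrable lborel ?B" by (rule tf_integrable[OF tfB])
  have iF: "integrable lborel ?F"
    by (rule Bochner_Integration.integrable_bound[OF integrable_mult_right[OF iB, of ?m]]) (use F_le F0 B01 in \<open>auto simp: abs_mult riesz_symbol_nonneg\<close>)
  have F2: "(?F \<xi>)\<^sup>2 \<le> ?m\<^sup>2 * ?B \<xi>" for \<xi>
  proof -
    have "(?F \<xi>)\<^sup>2 \<le> (?m * ?B \<xi>)\<^sup>2" by (rule power_mono[OF F_le F0])
    also have "\<dots> = ?m\<^sup>2 * (?B \<xi> * ?B \<xi>)" by (simp add: power2_eq_square)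
    also have "\<dots> \<le> ?m\<^sup>2 * ?B \<xi>" using B01[of \<xi>] by (intro mult_left_mono) (auto simp: mult_left_le)
    finally show ?thesis .
  qed
  have iF2: "integrable lborel (\<lambda>\<xi>. (?F \<xi>)\<^sup>2)"
    by (rule Bochner_Integration.integrable_bound[OF integrable_mult_right[OF iB, of "?m\<^sup>2"]]) (use F2 B01 in auto)
  have W: "integrable lborel ?W" "integrable lborel (\<lambda>\<xi>. (norm (?W \<xi>))\<^sup>2)"
  proof -
    show "integrable lborel ?W" by (rule integrable_bounded_linear[OF bounded_linear_of_real iF])
    show "integrable lborel (\<lambda>\<xi>. (norm (?W \<xi>))\<^sup>2)" unfolding norm_of_real power2_abs by (rule iF2)
  qed
  have eq: "hom_sobolev_norm b (rift (bump c r)) = Lp_norm 2 (inv_fourier ?W)"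
    unfolding hom_sobolev_norm_def fourier_rift[OF tf_bump[OF r]] by simp
  have "(\<integral>\<xi>. ?B \<xi> \<partial>lborel) = (\<integral>\<xi>. bump (0::'a) r \<xi> \<partial>lborel)"
  proof -
    have "(\<integral>\<xi>. ?B \<xi> \<partial>lborel) = ((\<integral>\<xi>. bump c r \<xi> \<partial>lborel) + (\<integral>\<xi>. bump c r (- \<xi>) \<partial>lborel)) / 2"
      using tf_integrable[OF tf_bump[OF r, of c]] tf_integrable[OF tf_reflect[OF tf_bump[OF r, of c]]] by (simp add: symm_def)
    also have "\<dots> = (\<integral>\<xi>. bump c r \<xi> \<partial>lborel)"
      by (subst integral_reflect) simp_all
    also have "\<dots> = (\<integral>\<xi>. bump c r (\<xi> + c) \<partial>lborel)" by (rule integral_translate[symmetric]) simp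
    finally show ?thesis by (simp add: bump_def)
  qed
  then have "(\<integral>\<xi>. (?F \<xi>)\<^sup>2 \<partial>lborel) \<le> ?m\<^sup>2 * (\<integral>\<xi>. bump (0::'a) r \<xi> \<partial>lborel)"
    using integral_mono[OF iF2 integrable_mult_right[OF iB, of "?m\<^sup>2"] F2] by simp
  from order_trans[OF Lp_norm_inv_fourier(1)[OF W, unfolded norm_of_real power2_abs] real_sqrt_le_mono[OF this]]
  show "hom_sobolev_norm b (rift (bump c r)) \<le> ?m * sqrt (\<integral>\<xi>. bump (0::'a) r \<xi> \<partial>lborel)"
    unfolding eq by (simp add: real_sqrt_mult)
  have c0: "c \<noteq> 0" using c r by auto
  have "0 < (\<integral>\<xi>. ?F \<xi> \<partial>lborel)"
  proof (rule lborel_integral_pos[OF iF F0, of c])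
    have "isCont ?B c" using tf_continuous[OF tfB] by (simp add: continuous_on_eq_continuous_at)
    then show "isCont ?F c" by (intro continuous_mult isCont_riesz_symbol c0)
    have "bump c r c = 1" using r by (intro bump_eq_1) auto
    then have "?B c > 0" using bump_nonneg[of c r "- c"] by (simp add: symm_def)
    then show "0 < ?F c" using c0 by (simp add: riesz_symbol_def)
  qed
  then have "Re (inv_fourier ?W 0) > 0" unfolding Re_inv_fourier_real[OF iF] by simp
  then have "inv_fourier ?W 0 \<noteq> 0" by auto
  then show "0 < hom_sobolev_norm b (rift (bump c r))" unfolding eq by (rule Lp_norm_inv_fourier(2)[OF W])
qed

text \<open>The inverse transform of the odd symbol is purely imaginary, so taking its imaginary
  part is multiplication by -i, and the inversion formula applies.\<close>

lemma fourier_dipole: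
  assumes r: "r > 0"
  shows "fourier (\<lambda>y. of_real (dipole r p y)) \<xi> = 2 * \<i> * of_real (bump 0 r \<xi> * sin (2 * pi * (\<xi> \<bullet> p)))"
proof -
  let ?F = "\<lambda>\<xi>. -2 * (bump 0 r \<xi> * sin (2 * pi * (\<xi> \<bullet> p)))"
  note tfF = tf_dipole[OF r, of p]
  have cnj: "cnj (ift ?F y) = - ift ?F y" for y
  proof -
    have "cnj (ift ?F y) = ift (\<lambda>\<xi>. ?F (- \<xi>)) y" by (rule ift_reflect[OF tf_measurable[OF tfF], symmetric])
    also have "\<dots> = - ift ?F y" unfolding ift_eq by (simp add: bump_0_even)
    finally show ?thesis .
  qed
  have "Re (ift ?F y) = 0" for y using arg_cong[OF cnj[of y], of Re] by simp
  then have h: "complex_of_real (dipole r p y) = - \<i> * ift ?F y" for y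
    unfolding dipole_eq[OF r] by (simp add: complex_eq_iff)
  have "fourier (\<lambda>y. of_real (dipole r p y)) \<xi> = - \<i> * fourier (ift ?F) \<xi>"
    unfolding h fourier_def by (subst integral_mult_right_zero[symmetric]) (simp add: mult_ac)
  then show ?thesis unfolding fourier_ift[OF tfF] by simp
qed

text \<open>The sine vanishes to first order at the origin and softens the singularity |\<xi>|^b to
  |\<xi>|^(b + 1), whose square is locally integrable by the lower bound on b. Positivity is tested
  at x = p, where the relevant integrand is a nonnegative multiple of the squared sine.\<close>

lemma hom_sobolev_norm_dipole:
  fixes p :: "'a::euclidean_space"
  assumes r: "r > 0" and p: "p \<noteq> 0" and b: "- real DIM('a) / 2 - 1 < b" "b < - 1"
  shows "0 < hom_sobolev_norm b (dipole r p)"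
proof -
  let ?A = "\<lambda>\<xi>. bump 0 r \<xi> * sin (2 * pi * (\<xi> \<bullet> p))"
  let ?F = "\<lambda>\<xi>. riesz_symbol b \<xi> * ?A \<xi>"
  let ?W = "\<lambda>\<xi>. 2 * \<i> * complex_of_real (?F \<xi>)"
  let ?q = "- b - 1" and ?K = "(2 * pi) powr b * (2 * pi * norm p)"
  let ?I = "indicator (cball 0 1) :: 'a \<Rightarrow> real"
  have tfA: "tf ?A" by (intro tf_mult tf_bump r C_infinity_on_trig)
  note [measurable] = tf_measurable[OF tfA] tf_measurable[OF tf_bump[OF r, of "0::'a"]]
  have le: "\<bar>?F \<xi>\<bar> \<le> ?K * norm \<xi> powr (- ?q)" if "\<xi> \<noteq> 0" for \<xi>
  proof -
    have "\<bar>sin (2 * pi * (\<xi> \<bullet> p))\<bar> \<le> \<bar>2 * pi * (\<xi> \<bullet> p)\<bar>" by (rule abs_sin_x_le_abs_x)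
    also have "\<dots> \<le> 2 * pi * (norm \<xi> * norm p)" using Cauchy_Schwarz_ineq2[of \<xi> p] by (simp add: abs_mult)
    finally have "bump 0 r \<xi> * \<bar>sin (2 * pi * (\<xi> \<bullet> p))\<bar> \<le> 1 * (2 * pi * (norm \<xi> * norm p))"
      using bump_le_1[of 0 r \<xi>] by (intro mult_mono) auto
    then have "\<bar>?F \<xi>\<bar> \<le> riesz_symbol b \<xi> * (2 * pi * (norm \<xi> * norm p))"
      using bump_nonneg[of 0 r \<xi>] riesz_symbol_nonneg[of b \<xi>] by (simp add: abs_mult mult_left_mono)
    also have "\<dots> = ?K * (norm \<xi> powr b * norm \<xi>)" by (simp add: riesz_symbol_def powr_mult)
    also have "norm \<xi> powr b * norm \<xi> = norm \<xi> powr (- ?q)" using that by (simp add: powr_add)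
    finally show ?thesis .
  qed
  have far: "\<bar>?F \<xi>\<bar> \<le> \<bar>?A \<xi>\<bar>" if "norm \<xi> \<ge> 1" for \<xi>
  proof -
    have "1 * 1 \<le> 2 * pi * norm \<xi>" using that pi_gt3 by (intro mult_mono) auto
    then have "1 \<le> 2 * pi * norm \<xi>" by simp
    from powr_mono[OF _ this, of b 0] this have "riesz_symbol b \<xi> \<le> 1"
      using b by (simp add: riesz_symbol_def powr_zero_eq_one split: if_splits)
    from mult_right_mono[OF this, of "\<bar>?A \<xi>\<bar>"] show ?thesis using riesz_symbol_nonneg[of b \<xi>] by (simp add: abs_mult)
  qed
  have iF: "integrable lborel ?F"
  proof (rule Bochner_Integration.integrable_bound)
    show "integrable lborel (\<lambda>\<xi>. ?K * (?I \<xi> * norm \<xi> powr (- ?q)) + \<bar>?A \<xi>\<bar>)"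
      using b by (intro Bochner_Integration.integrable_add integrable_mult_right integrable_norm_powr_cball integrable_abs tf_integrable tfA) auto
    show "AE \<xi> in lborel. norm (?F \<xi>) \<le> norm (?K * (?I \<xi> * norm \<xi> powr (- ?q)) + \<bar>?A \<xi>\<bar>)"
      using AE_lborel_singleton[of "0::'a"]
    proof eventually_elim
      case (elim \<xi>)
      have "0 \<le> ?K * norm \<xi> powr (- ?q)" by simp
      with le[OF elim] far[of \<xi>] show ?case by (cases "norm \<xi> \<le> 1") auto
    qed
  qed measurable
  have iF2: "integrable lborel (\<lambda>\<xi>. (?F \<xi>)\<^sup>2)"
  proof (rule Bochner_Integration.integrable_bound)
    have "integrable lborel (\<lambda>\<xi>. ?A \<xi> * ?A \<xi>)"
      by (intro tf_integrable tf_mult tfA tf_smooth)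
    then show "integrable lborel (\<lambda>\<xi>. ?K\<^sup>2 * (?I \<xi> * norm \<xi> powr (- (2 * ?q))) + (?A \<xi>)\<^sup>2)"
      using b unfolding power2_eq_square[of "?A _"]
      by (intro Bochner_Integration.integrable_add integrable_mult_right integrable_norm_powr_cball) auto
    show "AE \<xi> in lborel. norm ((?F \<xi>)\<^sup>2) \<le> norm (?K\<^sup>2 * (?I \<xi> * norm \<xi> powr (- (2 * ?q))) + (?A \<xi>)\<^sup>2)"
      using AE_lborel_singleton[of "0::'a"]
    proof eventually_elim
      case (elim \<xi>)
      show ?case
      proof (cases "norm \<xi> \<le> 1")
        case True
        have "\<bar>?F \<xi>\<bar>\<^sup>2 \<le> (?K * norm \<xi> powr (- ?q))\<^sup>2" by (rule power_mono[OF le[OF elim]]) simp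
        also have "\<dots> = ?K\<^sup>2 * norm \<xi> powr (- (2 * ?q))"
          unfolding power_mult_distrib power2_eq_square[of "norm \<xi> powr _"] powr_add[symmetric] by simp
        finally have "\<bar>?F \<xi>\<bar>\<^sup>2 \<le> ?K\<^sup>2 * norm \<xi> powr (- (2 * ?q)) + (?A \<xi>)\<^sup>2"
          by (rule order_trans) simp
        then show ?thesis using True by simp
      next
        case False
        have "\<bar>?F \<xi>\<bar>\<^sup>2 \<le> \<bar>?A \<xi>\<bar>\<^sup>2" using False by (intro power_mono far) auto
        then show ?thesis using False by simp
      qed
    qed
  qed measurable
  have W: "integrable lborel ?W" "integrable lborel (\<lambda>\<xi>. (norm (?W \<xi>))\<^sup>2)"
  proof -
    show "integrable lborel ?W" by (intro integrable_mult_right integrable_bounded_linear[OF bounded_linear_of_real iF])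
    have "(norm (?W \<xi>))\<^sup>2 = 4 * (?F \<xi>)\<^sup>2" for \<xi> by (simp add: norm_mult power_mult_distrib)
    then show "integrable lborel (\<lambda>\<xi>. (norm (?W \<xi>))\<^sup>2)" using integrable_mult_right[OF iF2, of 4] by simp
  qed
  have eq: "hom_sobolev_norm b (dipole r p) = Lp_norm 2 (inv_fourier ?W)"
    unfolding hom_sobolev_norm_def fourier_dipole[OF r] by (simp add: mult_ac)
  \<comment> \<open>The point \<open>a\<close> at distance \<mu> in the direction of p lies where
    the bump is 1, and 2 pi (a \<bullet> p) lies in (0, pi/2], where the sine is positive.\<close>
  define \<mu> where "\<mu> = min (r / 2) (1 / (4 * norm p))"
  have \<mu>: "0 < \<mu>" "\<mu> \<le> r / 2" "\<mu> * norm p \<le> 1 / 4"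
    using r p mult_right_mono[of \<mu> "1 / (4 * norm p)" "norm p"] by (auto simp: \<mu>_def)
  define a where "a = (\<mu> / norm p) *\<^sub>R p"
  have a: "a \<noteq> 0" "norm a = \<mu>" "a \<bullet> p = \<mu> * norm p"
    using \<mu> p by (auto simp: a_def power2_norm_eq_inner[symmetric] power2_eq_square)
  have "0 < (\<integral>\<xi>. ?F \<xi> * sin (2 * pi * (\<xi> \<bullet> p)) \<partial>lborel)"
  proof (rule lborel_integral_pos[where a = a])
    show "integrable lborel (\<lambda>\<xi>. ?F \<xi> * sin (2 * pi * (\<xi> \<bullet> p)))"
      by (rule Bochner_Integration.integrable_bound[OF iF]) (auto simp: abs_mult mult_left_le)
    show "0 \<le> ?F \<xi> * sin (2 * pi * (\<xi> \<bullet> p))" for \<xi>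
    proof -
      have sq: "?F \<xi> * sin (2 * pi * (\<xi> \<bullet> p)) = riesz_symbol b \<xi> * bump 0 r \<xi> * (sin (2 * pi * (\<xi> \<bullet> p)))\<^sup>2"
        by (simp add: power2_eq_square)
      show ?thesis unfolding sq by (intro mult_nonneg_nonneg riesz_symbol_nonneg bump_nonneg zero_le_power2)
    qed
    have "isCont (bump 0 r) a" using tf_continuous[OF tf_bump[OF r, of "0::'a"]] by (simp add: continuous_on_eq_continuous_at)
    then show "isCont (\<lambda>\<xi>. ?F \<xi> * sin (2 * pi * (\<xi> \<bullet> p))) a"
      by (intro continuous_mult isCont_riesz_symbol a(1) continuous_intros)
    have "bump 0 r a = 1" by (rule bump_eq_1[OF r]) (use \<mu> a in simp)
    moreover have "0 < sin (2 * pi * (a \<bullet> p))"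
    proof (rule sin_gt_zero)
      show "0 < 2 * pi * (a \<bullet> p)" using \<mu> p by (simp add: a)
      have "2 * pi * (a \<bullet> p) \<le> 2 * pi * (1 / 4)" unfolding a(3) using \<mu> by (intro mult_left_mono) auto
      also have "\<dots> < pi" by simp
      finally show "2 * pi * (a \<bullet> p) < pi" .
    qed
    moreover have "riesz_symbol b a > 0" using a(1) by (simp add: riesz_symbol_def)
    ultimately show "0 < ?F a * sin (2 * pi * (a \<bullet> p))" by (auto intro!: mult_pos_pos)
  qed
  moreover have "inv_fourier ?W p = 2 * \<i> * ift ?F p"
    unfolding ift_eq inv_fourier_cis by (subst integral_mult_right_zero[symmetric]) (simp add: mult_ac)
  then have "Re (inv_fourier ?W p) = - 2 * (\<integral>\<xi>. ?F \<xi> * sin (2 * pi * (\<xi> \<bullet> p)) \<partial>lborel)"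
    using ift_Im[OF iF, of p] by simp
  ultimately have "Re (inv_fourier ?W p) < 0" by linarith
  then have "inv_fourier ?W p \<noteq> 0" by auto
  then show ?thesis unfolding eq by (rule Lp_norm_inv_fourier(2)[OF W])
qed


subsection \<open>The Riesz case\<close>

lemma pd_le_Lipschitz:
  fixes f :: "'a::euclidean_space \<Rightarrow> real"
  assumes f: "f differentiable (at x)" and L: "\<And>x y. \<bar>f x - f y\<bar> \<le> L * norm (x - y)"
  shows "\<bar>pd h f x\<bar> \<le> L * norm h"
proof (rule LIMSEQ_le_const2[OF tendsto_rabs[OF difference_quotient_limit[OF f]]], intro exI allI impI)
  fix n :: nat
  have "\<bar>f (x + (1 / real (Suc n)) *\<^sub>R h) - f x\<bar> \<le> L * (1 / real (Suc n) * norm h)"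
    using L[of "x + (1 / real (Suc n)) *\<^sub>R h" x] by (simp del: of_nat_Suc)
  then show "\<bar>(f (x + (1 / real (Suc n)) *\<^sub>R h) - f x) / (1 / real (Suc n))\<bar> \<le> L * norm h"
    by (simp add: abs_mult pos_le_divide_eq mult_ac del: of_nat_Suc)
qed

text \<open>The derivative of f e has rank one, and as |e| = 1 its operator norm is the norm of the
  gradient of f. With both bounds the extended real can be converted to a real number
  safely.\<close>

lemma grad_esssup_scaleR:
  fixes f :: "'a::euclidean_space \<Rightarrow> real"
  assumes f: "C_infinity_on UNIV f" and L: "\<And>x y. \<bar>f x - f y\<bar> \<le> L * norm (x - y)" and e: "norm e = 1"
  shows "0 \<le> grad_esssup (\<lambda>x. f x *\<^sub>R e)" "grad_esssup (\<lambda>x. f x *\<^sub>R e) \<le> ereal L"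
proof -
  have fd: "f differentiable (at x)" for x using C_infinity_onD[OF f] by simp
  define D where "D x = (\<Sum>b\<in>Basis. pd b f x *\<^sub>R b)" for x
  have lin: "linear (frechet_derivative f (at x))" for x by (rule linear_frechet_derivative[OF fd])
  have pdD: "pd h f x = h \<bullet> D x" for h x
  proof -
    have "pd h f x = pd (\<Sum>b\<in>Basis. (h \<bullet> b) *\<^sub>R b) f x" by (simp add: euclidean_representation)
    also have "\<dots> = (\<Sum>b\<in>Basis. (h \<bullet> b) * pd b f x)"
      by (simp add: linear_sum[OF lin] linear_scale[OF lin])
    also have "\<dots> = h \<bullet> D x" by (simp add: D_def inner_sum_right mult.commute)
    finally show ?thesis .
  qed
  have d: "frechet_derivative (\<lambda>x. f x *\<^sub>R e) (at x) = (\<lambda>h. (h \<bullet> D x) *\<^sub>R e)" for x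
  proof -
    have "(f has_derivative (\<lambda>h. h \<bullet> D x)) (at x)"
      using fd[of x] by (simp add: frechet_derivative_works pdD[abs_def])
    then have "((\<lambda>x. f x *\<^sub>R e) has_derivative (\<lambda>h. (h \<bullet> D x) *\<^sub>R e)) (at x)"
      by (rule has_derivative_scaleR_left)
    then show ?thesis by (rule frechet_derivative_at[symmetric])
  qed
  have on: "onorm (\<lambda>h. (h \<bullet> D x) *\<^sub>R e) = norm (D x)" for x
  proof (rule antisym)
    show "onorm (\<lambda>h. (h \<bullet> D x) *\<^sub>R e) \<le> norm (D x)"
      by (rule onorm_le) (use e Cauchy_Schwarz_ineq2 in \<open>simp add: mult.commute\<close>)
    have "bounded_linear (\<lambda>h. (h \<bullet> D x) *\<^sub>R e)"
      by (rule bounded_linear_scaleR_const[OF bounded_linear_inner_left])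
    from onorm[OF this, of "D x"] have "norm (D x) * norm (D x) \<le> onorm (\<lambda>h. (h \<bullet> D x) *\<^sub>R e) * norm (D x)"
      using e by (simp add: power2_norm_eq_inner[symmetric] power2_eq_square)
    then show "norm (D x) \<le> onorm (\<lambda>h. (h \<bullet> D x) *\<^sub>R e)"
      using onorm_pos_le[OF \<open>bounded_linear (\<lambda>h. (h \<bullet> D x) *\<^sub>R e)\<close>] by (cases "D x = 0") auto
  qed
  have "continuous_on UNIV D"
    unfolding D_def by (intro continuous_intros C_infinity_on_continuous[OF C_infinity_on_pd[OF f]])
  note [measurable] = borel_measurable_continuous_onI[OF this]
  have eq: "grad_esssup (\<lambda>x. f x *\<^sub>R e) = esssup lborel (\<lambda>x. ereal (norm (D x)))"
    unfolding grad_esssup_def d on ..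
  have "esssup lborel (\<lambda>x::'a. 0::ereal) \<le> esssup lborel (\<lambda>x. ereal (norm (D x)))"
    by (rule esssup_mono) auto
  then show "0 \<le> grad_esssup (\<lambda>x. f x *\<^sub>R e)"
    unfolding eq by (subst (asm) esssup_const) auto
  have "norm (D x) \<le> L" for x
  proof (cases "D x = 0")
    case True
    obtain b :: 'a where "b \<in> Basis" using nonempty_Basis by blast
    then show ?thesis using L[of b 0] True by simp
  next
    case False
    have "norm (D x) * norm (D x) \<le> L * norm (D x)"
      using pd_le_Lipschitz[OF fd[of x] L, where h = "D x"] by (simp add: pdD power2_norm_eq_inner[symmetric] power2_eq_square)
    then show ?thesis using False by simp
  qed
  then show "grad_esssup (\<lambda>x. f x *\<^sub>R e) \<le> ereal L" unfolding eq by (intro esssup_I) auto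
qed

text \<open>All frequencies of the packet have norm at most 2n. The constant 8 pi is 2 pi from the
  phase, times 2 for the frequencies, times 2 from \<open>ratio_bound\<close>.\<close>

lemma (in wave_packets) v_Lipschitz:
  assumes n: "n \<ge> n0"
  shows "\<bar>v n x - v n y\<bar> \<le> (8 * pi * bump_mass TYPE('a)) * (real n * S (real n *\<^sub>R e)) * norm (x - y)"
proof -
  let ?b = "\<lambda>\<zeta>. bump (0::'a) 1 \<zeta> * S (real n *\<^sub>R e + \<delta> n *\<^sub>R \<zeta>)"
  let ?a = "\<lambda>\<zeta> x. 2 * pi * ((real n *\<^sub>R e + \<delta> n *\<^sub>R \<zeta>) \<bullet> x)"
  let ?S = "S (real n *\<^sub>R e)"
  note [measurable] = bump_S_measurable[OF n]
  note iB = tf_integrable[OF tf_bump[OF zero_less_one, of "0::'a"]]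
  have i: "integrable lborel (\<lambda>\<zeta>. ?b \<zeta> * cos (?a \<zeta> x))" for x
  proof (rule Bochner_Integration.integrable_bound[OF integrable_mult_right[OF iB, of "2 * ?S"]])
    have "norm (?b \<zeta> * cos (?a \<zeta> x)) \<le> norm (2 * ?S * bump (0::'a) 1 \<zeta>)" for \<zeta>
    proof -
      have "\<bar>?b \<zeta>\<bar> * \<bar>cos (?a \<zeta> x)\<bar> \<le> (2 * ?S * bump (0::'a) 1 \<zeta>) * 1"
        by (intro mult_mono bump_S_bound n abs_cos_le_one) (use Sn_pos[OF n] bump_nonneg[of 0 1 \<zeta>] in auto)
      then show ?thesis using Sn_pos[OF n] bump_nonneg[of 0 1 \<zeta>] by (simp add: abs_mult)
    qed
    then show "AE \<zeta> in lborel. norm (?b \<zeta> * cos (?a \<zeta> x)) \<le> norm (2 * ?S * bump (0::'a) 1 \<zeta>)" by simp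
  qed measurable
  have pt: "\<bar>?b \<zeta> * cos (?a \<zeta> x) - ?b \<zeta> * cos (?a \<zeta> y)\<bar> \<le> (8 * pi * (real n * ?S) * norm (x - y)) * bump (0::'a) 1 \<zeta>" for \<zeta>
  proof (cases "norm \<zeta> \<le> 1")
    case True
    have "norm (real n *\<^sub>R e + \<delta> n *\<^sub>R \<zeta>) \<le> real n + \<delta> n * norm \<zeta>"
      using norm_triangle_ineq[of "real n *\<^sub>R e" "\<delta> n *\<^sub>R \<zeta>"] \<delta>[OF n] by simp
    also have "\<delta> n * norm \<zeta> \<le> 1" using \<delta>[OF n] True by (intro mult_le_one) auto
    finally have no: "norm (real n *\<^sub>R e + \<delta> n *\<^sub>R \<zeta>) \<le> 2 * real n" using n n0 by linarith
    have "\<bar>cos (?a \<zeta> x) - cos (?a \<zeta> y)\<bar> \<le> \<bar>?a \<zeta> x - ?a \<zeta> y\<bar>" by (rule cos_diff_le)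
    also have "\<dots> = 2 * pi * \<bar>(real n *\<^sub>R e + \<delta> n *\<^sub>R \<zeta>) \<bullet> (x - y)\<bar>"
      unfolding inner_diff_right right_diff_distrib[symmetric] by (simp add: abs_mult)
    also have "\<dots> \<le> 2 * pi * (2 * real n * norm (x - y))"
      using order_trans[OF Cauchy_Schwarz_ineq2 mult_right_mono[OF no norm_ge_zero]] by (intro mult_left_mono) auto
    finally have c: "\<bar>cos (?a \<zeta> x) - cos (?a \<zeta> y)\<bar> \<le> 4 * pi * real n * norm (x - y)" by simp
    have "\<bar>?b \<zeta>\<bar> * \<bar>cos (?a \<zeta> x) - cos (?a \<zeta> y)\<bar> \<le> (2 * ?S * bump (0::'a) 1 \<zeta>) * (4 * pi * real n * norm (x - y))"
      by (intro mult_mono bump_S_bound n c) (use Sn_pos[OF n] bump_nonneg[of 0 1 \<zeta>] in auto)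
    also have "\<dots> = (8 * pi * (real n * ?S) * norm (x - y)) * bump (0::'a) 1 \<zeta>" by simp
    finally show ?thesis unfolding right_diff_distrib[symmetric] abs_mult .
  qed (simp add: bump_eq_0)
  have "v n x - v n y = (\<integral>\<zeta>. ?b \<zeta> * cos (?a \<zeta> x) - ?b \<zeta> * cos (?a \<zeta> y) \<partial>lborel)"
    unfolding v_eq[OF n] by (rule Bochner_Integration.integral_diff[OF i i, symmetric])
  then have "\<bar>v n x - v n y\<bar> \<le> (\<integral>\<zeta>. \<bar>?b \<zeta> * cos (?a \<zeta> x) - ?b \<zeta> * cos (?a \<zeta> y)\<bar> \<partial>lborel)"
    by (simp only: integral_abs_bound)
  also have "\<dots> \<le> (\<integral>\<zeta>. (8 * pi * (real n * ?S) * norm (x - y)) * bump (0::'a) 1 \<zeta> \<partial>lborel)"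
    by (intro integral_mono integrable_abs Bochner_Integration.integrable_diff i integrable_mult_right[OF iB] pt)
  also have "\<dots> = (8 * pi * bump_mass TYPE('a)) * (real n * ?S) * norm (x - y)" by (simp add: bump_mass_def)
  finally show ?thesis .
qed

theorem riesz_blowup:
  fixes s a M :: real
  assumes s: "- 2 < s" "s < real DIM('a::euclidean_space) - 2" and a: "2 < a" "a < real DIM('a) - s" and M: "M > 0"
  shows "\<exists>(v :: 'a \<Rightarrow> 'a) w f h. C_infinity_on UNIV v \<and> zero_mean_schwartz f \<and> zero_mean_schwartz h \<and>
    grad_esssup v < \<infinity> \<and> fourier_multiplier (riesz_symbol (a / 2)) v w \<and>
    in_Lp (2 * real DIM('a) / (a - 2)) w \<and>
    \<bar>commutator_form (riesz_potential s) v f h\<bar> /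
      ((real_of_ereal (grad_esssup v) + Lp_norm (2 * real DIM('a) / (a - 2)) w) *
       hom_sobolev_norm ((s - real DIM('a)) / 2) f * hom_sobolev_norm ((s - real DIM('a)) / 2) h) \<ge> M"
proof -
  obtain e :: 'a where e: "e \<in> Basis" using nonempty_Basis by blast
  define d where "d = real DIM('a)"
  \<comment> \<open>Chosen such that \<kappa> d / p = (d - s - a) / 4: the spreading of
    \<open>w\<close> consumes half of the available power b + a / 2 = - (d - s - a) / 2.\<close>
  define \<kappa> where "\<kappa> = (d - s - a) / (2 * (a - 2))"
  define p where "p = 2 * d / (a - 2)"
  define b where "b = (s - d) / 2"
  define S where "S = (\<lambda>\<xi>::'a. exp (- (a / 2 * ln (2 * pi * norm \<xi>))))"
  have \<kappa>: "\<kappa> > 0" using a by (simp add: \<kappa>_def d_def)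
  \<comment> \<open>Here s > -2 enters: a - 2 < d - s - 2 < d.\<close>
  have p: "p \<ge> 1" using a s by (simp add: p_def d_def pos_le_divide_eq)
  \<comment> \<open>The first two inequalities restate s > -2 and s < d - 2; they are what the norm
    of the dipole requires.\<close>
  have b: "- real DIM('a) / 2 - 1 < b" "b < - 1" "b < 0" using s by (auto simp: b_def d_def)
  obtain n0 where wp: "wave_packets (riesz_symbol (a / 2)) S \<kappa> e n0"
    using riesz_wave_packets[OF e _ \<kappa>, of "a / 2"] a unfolding S_def by auto
  interpret wave_packets "riesz_symbol (a / 2)" S \<kappa> e n0 by (rule wp)
  have Sn: "S (real n *\<^sub>R e) = (2 * pi * real n) powr (- (a / 2))" if "n > 0" for n
    using that by (simp add: S_def powr_def)
  let ?g = "riesz_potential s :: 'a \<Rightarrow> real"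
  let ?D = "\<lambda>z. e \<bullet> gradient ?g z"
  note D = gradient_regular[OF riesz_potential_smooth[of s] e]
  have Dt: "tempered ?D" by (rule riesz_gradient_tempered[OF e s])
  obtain q where q: "q \<noteq> 0" "?D q - ?D (- q) \<noteq> 0"
    using radial_gradient_dipole[OF riesz_potential_smooth riesz_potential_radial riesz_potential_nonconstant e] by blast
  have cont: "isCont ?D z" if "z \<noteq> 0" for z
    using D(2) that by (simp add: continuous_on_eq_continuous_at off_0)
  have "(\<lambda>j. pairing ?D (rift (bump 0 (real (Suc j)))) (dipole (real (Suc j)) q)) \<longlonglongrightarrow> ?D q - ?D (- q)"
    by (rule pairing_dipole_limit[OF Dt cont cont]) (use q in auto)
  then have "\<forall>\<^sub>F j in sequentially. pairing ?D (rift (bump 0 (real (Suc j)))) (dipole (real (Suc j)) q) \<noteq> 0"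
    by (rule tendsto_imp_eventually_ne[OF _ q(2)])
  then obtain j where j: "pairing ?D (rift (bump 0 (real (Suc j)))) (dipole (real (Suc j)) q) \<noteq> 0"
    unfolding eventually_sequentially by blast
  define r where "r = real (Suc j)"
  have r: "r > 0" by (simp add: r_def)
  define h where "h = dipole r q"
  define f where "f n = rift (bump (real n *\<^sub>R e) r)" for n
  define L where "L = \<bar>bump_mass TYPE('a) / 2 * pairing ?D (rift (bump 0 r)) h\<bar>"
  have L: "L > 0" using j bump_mass_pos[where 'a = 'a] by (simp add: L_def h_def r_def)
  then have L2: "L / 2 < L" "0 < L / 2" by simp_all
  have lim: "(\<lambda>n. \<bar>comm ?D (v n) (f n) h / S (real n *\<^sub>R e)\<bar>) \<longlonglongrightarrow> L"
    unfolding L_def f_def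
    by (intro tendsto_rabs packet_comm_limit Dt D(2) r) (auto simp: h_def intro: dipole_rapid[OF r] dipole_continuous[OF r])
  define H where "H = hom_sobolev_norm b h"
  have H: "H > 0" unfolding H_def h_def by (rule hom_sobolev_norm_dipole[OF r q(1) b(1,2)])
  define B where "B = sqrt (\<integral>\<xi>. bump (0::'a) r \<xi> \<partial>lborel)"
  define A where "A = (\<integral>x. \<bar>rift (bump 0 1) x\<bar> powr p \<partial>(lborel :: 'a measure)) powr (1 / p)"
  define C where "C = 8 * pi * bump_mass TYPE('a)"
  have C: "C > 0" using bump_mass_pos[where 'a = 'a] by (simp add: C_def)
  have B: "B \<ge> 0" unfolding B_def by (intro real_sqrt_ge_zero Bochner_Integration.integral_nonneg bump_nonneg)
  have A: "A \<ge> 0" by (simp add: A_def)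
  \<comment> \<open>The power that is left after spreading: \<kappa> d / p + b + a / 2 = -
    c.\<close>
  define c where "c = (d - s - a) / 4"
  have c: "c > 0" using a by (simp add: c_def d_def)
  define X where "X n = (C + A) * B * H * M * (pi powr b * (2 * pi) powr (a / 2)) * real n powr (- c)" for n :: nat
  have "X \<longlonglongrightarrow> 0"
    unfolding X_def using c by (intro tendsto_mult_right_zero tendsto_neg_powr filterlim_real_sequentially) simp
  note X0 = order_tendstoD(2)[OF this L2(2)]
  have "\<forall>\<^sub>F n in sequentially. n \<ge> n0 \<and> real n > 2 * r \<and> \<bar>comm ?D (v n) (f n) h / S (real n *\<^sub>R e)\<bar> > L / 2 \<and> X n < L / 2"
    using eventually_ge_at_top[of n0] eventually_gt_at_top[of "nat \<lceil>2 * r\<rceil>"] order_tendstoD(1)[OF lim L2(1)] X0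
    by eventually_elim linarith
  then obtain n where n: "n \<ge> n0" and nr: "real n > 2 * r" and big: "\<bar>comm ?D (v n) (f n) h / S (real n *\<^sub>R e)\<bar> > L / 2"
    and small: "X n < L / 2"
    unfolding eventually_sequentially by blast
  let ?S = "S (real n *\<^sub>R e)" and ?v = "\<lambda>x. v n x *\<^sub>R e" and ?w = "\<lambda>x. w n x *\<^sub>R e"
  have n1: "real n \<ge> 1" using n n0 by simp
  have Sp: "?S > 0" by (rule Sn_pos[OF n])
  have vs: "C_infinity_on UNIV (v n)" unfolding v_def by (rule rift_smooth[OF tf_Vh[OF n]])
  note ge = grad_esssup_scaleR[OF vs v_Lipschitz[OF n] norm_e]
  have fin: "grad_esssup ?v < \<infinity>" using ge(2) by (rule le_less_trans) simp
  have G: "0 \<le> real_of_ereal (grad_esssup ?v)" "real_of_ereal (grad_esssup ?v) \<le> C * (real n * ?S)"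
    using ge fin unfolding C_def by (cases "grad_esssup ?v"; simp)+
  \<comment> \<open>The bound on the gradient of \<open>v\<close> is of order n to the power 1 -
    a/2, a negative exponent as a > 2, so the growing bound on the L^p norm of \<open>w\<close>
    absorbs it.\<close>
  have nS: "real n * ?S \<le> real n powr (\<kappa> * d / p)"
  proof -
    have "?S \<le> real n powr (- (a / 2))"
      using n1 a pi_gt3 Sn[of n] by (auto intro!: powr_mono2')
    then have "real n * ?S \<le> real n powr 1 * real n powr (- (a / 2))" using n1 Sp by (intro mult_mono) auto
    also have "\<dots> = real n powr (1 - a / 2)" using powr_add[of "real n" 1 "- (a / 2)"] by simp
    also have "\<dots> \<le> real n powr (\<kappa> * d / p)"
    proof (rule powr_mono[OF _ n1])
      have "0 \<le> \<kappa> * d / p" using \<kappa> p by (intro divide_nonneg_nonneg mult_nonneg_nonneg) (auto simp: d_def)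
      then show "1 - a / 2 \<le> \<kappa> * d / p" using a by linarith
    qed
    finally show ?thesis .
  qed
  let ?P = "Lp_norm p ?w"
  have P: "in_Lp p ?w" "0 < ?P" "?P \<le> real n powr (\<kappa> * d / p) * A"
    using w_Lp[OF n p] by (simp_all add: d_def A_def)
  have GP: "real_of_ereal (grad_esssup ?v) + ?P \<le> (C + A) * real n powr (\<kappa> * d / p)"
    using G(2) P(3) mult_left_mono[OF nS less_imp_le[OF C]] by (simp add: algebra_simps)
  let ?F = "hom_sobolev_norm b (f n)"
  have nc: "norm (real n *\<^sub>R e) > r" using nr r by simp
  note F = hom_sobolev_norm_packet[OF r nc b(3), folded f_def]
  have Fle: "?F \<le> pi powr b * real n powr b * B"
  proof -
    have "(2 * pi * (real n - r)) powr b \<le> (pi * real n) powr b"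
    proof (rule powr_mono2')
      have "pi * real n \<le> pi * (2 * (real n - r))" using nr by (intro mult_left_mono) auto
      then show "pi * real n \<le> 2 * pi * (real n - r)" by simp
    qed (use b n1 in auto)
    also have "\<dots> = pi powr b * real n powr b" by (simp add: powr_mult)
    finally show ?thesis using F(1) mult_right_mono[OF _ B] unfolding B_def by force
  qed
  let ?N = "(real_of_ereal (grad_esssup ?v) + ?P) * ?F * H"
  have N: "?N > 0" using G(1) P(2) F(2) H by (intro mult_pos_pos add_nonneg_pos)
  have NX: "?N * M / ?S \<le> X n"
  proof -
    have "(real_of_ereal (grad_esssup ?v) + ?P) * ?F \<le> ((C + A) * real n powr (\<kappa> * d / p)) * (pi powr b * real n powr b * B)"
      using GP Fle F(2) C A by (intro mult_mono) auto
    note le = mult_right_mono[OF this, of "H * M / ?S"]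
    have HM: "H * M / ?S = H * M * ((2 * pi) powr (a / 2) * real n powr (a / 2))"
      using n1 Sn[of n] by (simp add: powr_minus_divide powr_mult)
    have "?N * M / ?S = (real_of_ereal (grad_esssup ?v) + ?P) * ?F * (H * M / ?S)" by simp
    also have "\<dots> \<le> ((C + A) * real n powr (\<kappa> * d / p)) * (pi powr b * real n powr b * B) * (H * M / ?S)"
      using le H M Sp by simp
    also have "\<dots> = (C + A) * B * H * M * (pi powr b * (2 * pi) powr (a / 2)) *
        (real n powr (\<kappa> * d / p) * real n powr b * real n powr (a / 2))" unfolding HM by (simp only: mult_ac)
    also have "real n powr (\<kappa> * d / p) * real n powr b * real n powr (a / 2) = real n powr (- c)"
    proof -
      have X: "\<kappa> * d / p = (d - s - a) / 4" using a by (simp add: \<kappa>_def p_def d_def field_simps)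
      have "\<kappa> * d / p + b + a / 2 = - c" unfolding X b_def c_def by (simp add: field_simps)
      then show ?thesis by (simp add: powr_add[symmetric])
    qed
    finally show ?thesis by (simp only: X_def)
  qed
  have "?N * M / ?S \<le> \<bar>comm ?D (v n) (f n) h\<bar> / ?S"
  proof -
    have "\<bar>comm ?D (v n) (f n) h\<bar> / ?S = \<bar>comm ?D (v n) (f n) h / ?S\<bar>" using Sp by (simp add: abs_divide)
    then show ?thesis using big small NX by linarith
  qed
  then have "?N * M \<le> \<bar>comm ?D (v n) (f n) h\<bar>" using Sp by (simp add: divide_le_cancel)
  then have "M \<le> \<bar>commutator_form ?g ?v (f n) h\<bar> / ?N"
    using N by (simp add: commutator_form_scaleR pos_le_divide_eq mult.commute)
  moreover have "zero_mean_schwartz (f n)"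
    unfolding f_def by (rule zero_mean_schwartz_rift[OF tf_bump[OF r]], rule bump_eq_0[OF r]) (use nc in simp)
  moreover have "zero_mean_schwartz h" unfolding h_def by (rule zero_mean_schwartz_dipole[OF r])
  ultimately show ?thesis
    using v_smooth[OF n] fin v_multiplier[OF n] P(1) unfolding H_def b_def p_def d_def by blast
qed


theorem corollary2p4:
  shows
   "(\<forall>s a M :: real.
       - 2 < s \<and> s < real DIM('a::euclidean_space) - 2 \<and>
       2 < a \<and> a < real DIM('a) - s \<and> 0 < M \<longrightarrow>
       (\<exists>(v :: 'a \<Rightarrow> 'a) w f h.
          C_infinity_on UNIV v \<and> zero_mean_schwartz f \<and> zero_mean_schwartz h \<and>
          grad_esssup v < \<infinity> \<and>
          fourier_multiplier (riesz_symbol (a / 2)) v w \<and>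
          in_Lp (2 * real DIM('a) / (a - 2)) w \<and>
          \<bar>commutator_form (riesz_potential s) v f h\<bar> /
            ((real_of_ereal (grad_esssup v) + Lp_norm (2 * real DIM('a) / (a - 2)) w) *
             hom_sobolev_norm ((s - real DIM('a)) / 2) f *
             hom_sobolev_norm ((s - real DIM('a)) / 2) h) \<ge> M))
    \<and>
    (\<forall>(g :: 'a \<Rightarrow> real) G.
       admissible g G \<and> nonconstant_potential g \<and> super_polynomial_decay G \<longrightarrow>
       (\<forall>n M t :: real. 0 < n \<and> 0 < M \<and> 0 < t \<longrightarrow>
          (\<exists>(v :: 'a \<Rightarrow> 'a) w f h.
             C_infinity_on UNIV v \<and> zero_mean_schwartz f \<and> zero_mean_schwartz h \<and>
             fourier_multiplier (bessel_symbol n) v w \<and> in_Lp 1 w \<and>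
             \<bar>commutator_form g v f h\<bar> /
               (Lp_norm 1 w * potential_norm (dilate t g) f * potential_norm (dilate t g) h) \<ge> M)))
    \<and>
    (\<forall>(g :: 'a \<Rightarrow> real) G (c :: real) (m :: real).
       admissible g G \<and> nonconstant_potential g \<and> 0 < c \<and> 0 < m \<and> exponential_decay c m G \<longrightarrow>
       (\<forall>t b M :: real. 0 < t \<and> b < c * t powr m / 2 \<and> 0 < M \<longrightarrow>
          (\<exists>(v :: 'a \<Rightarrow> 'a) w f h.
             C_infinity_on UNIV v \<and> zero_mean_schwartz f \<and> zero_mean_schwartz h \<and>
             fourier_multiplier (exp_symbol b m) v w \<and> in_Lp 1 w \<and>
             \<bar>commutator_form g v f h\<bar> /
               (Lp_norm 1 w * potential_norm (dilate t g) f * potential_norm (dilate t g) h) \<ge> M)))"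
proof (intro conjI allI impI; elim conjE)
  fix s a M :: real
  assume "- 2 < s" "s < real DIM('a) - 2" "2 < a" "a < real DIM('a) - s" "0 < M"
  then show "\<exists>(v :: 'a \<Rightarrow> 'a) w f h. C_infinity_on UNIV v \<and> zero_mean_schwartz f \<and> zero_mean_schwartz h \<and>
      grad_esssup v < \<infinity> \<and> fourier_multiplier (riesz_symbol (a / 2)) v w \<and>
      in_Lp (2 * real DIM('a) / (a - 2)) w \<and>
      \<bar>commutator_form (riesz_potential s) v f h\<bar> /
        ((real_of_ereal (grad_esssup v) + Lp_norm (2 * real DIM('a) / (a - 2)) w) *
         hom_sobolev_norm ((s - real DIM('a)) / 2) f * hom_sobolev_norm ((s - real DIM('a)) / 2) h) \<ge> M"
    by (rule riesz_blowup)
qed (rule super_polynomial_blowup exponential_blowup; assumption)+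

end
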